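(* Let $k,n\in\mathbb{N}$ be coprime, let $q=e^{2\pi i k/n}$, let $u,v$ be a pair of unitaries with $uv=qvu$, and let $\mathcal{S}=\mathcal{S}(u,v)$ be the operator system they generate. Then: (1) $\mathrm{UCP}(\mathcal{S})$ is $n$-subhomogeneous. (2) $\partial\,\mathrm{UCP}(\mathcal{S},\mathbb{M}_n)=\mathrm{Abex}(\mathrm{UCP}(\mathcal{S}))$, and this is the set of all restrictions to $\mathcal{S}$ of boundary representations for $\mathcal{S}$. (3) For all $1\le m<n$, the set $\partial\,\mathrm{UCP}(\mathcal{S},\mathbb{M}_m)$ is non-empty, and any $\varphi\in\partial\,\mathrm{UCP}(\mathcal{S},\mathbb{M}_m)$ can be written in one of the following two forms: - $\varphi=\gamma^*\psi\gamma$ for some $\psi\in\partial\,\mathrm{UCP}(\mathcal{S},\mathbb{M}_{m+1})$ and a matrix $\gamma$; - $\varphi=\gamma^*\psi\gamma$ for some $\psi\in\mathrm{Abex}(\mathrm{UCP}(\mathcal{S}))$ and a matrix $\gamma$.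
   Context: An operator system is a unital self-adjoint linear subspace of a unital $C^*$-algebra; $C^*(\mathcal{S})$ is the $C^*$-algebra it generates. $\mathbb{M}_n$ denotes the complex $n\times n$ matrices, $\mathbb{M}_{m,n}$ the complex $m\times n$ matrices. $\mathrm{UCP}(\mathcal{S},\mathbb{M}_n)$ is the set of unital completely positive (UCP) maps $\mathcal{S}\to\mathbb{M}_n$; $\mathrm{UCP}(\mathcal{S})=(\mathrm{UCP}(\mathcal{S},\mathbb{M}_n))_n$. Matrix extreme: $\phi\in \mathrm{UCP}(\mathcal{S},\mathbb{M}_n)$ is matrix extreme if whenever $\phi=\sum_i\gamma_i^*\phi_i\gamma_i$ (finite sum) with $\phi_i\in \mathrm{UCP}(\mathcal{S},\mathbb{M}_{n_i})$, each $\gamma_i\in\mathbb{M}_{n_i,n}$ surjective, and $\sum_i\gamma_i^*\gamma_i=1_n$, then for all $i$, $n_i=n$ and $\phi=u_i^*\phi_iu_i$ for some unitary $u_i\in\mathbb{M}_n$. $\partial\,\mathrm{UCP}(\mathcal{S},\mathbb{M}_n)$ is the set of matrix extreme points at level $n$. $\mathrm{UCP}(\mathcal{S})$ is $N$-subhomogeneous if $N$ is the smallest positive integer with $\partial\,\mathrm{UCP}(\mathcal{S},\mathbb{M}_n)=\emptyset$ for all $n>N$. Absolute matrix extreme: $\phi\in \mathrm{UCP}(\mathcal{S},\mathbb{M}_n)$ is absolute matrix extreme if whenever $\phi=\sum_i\gamma_i^*\phi_i\gamma_i$ (finite sum) with $\phi_i\in \mathrm{UCP}(\mathcal{S},\mathbb{M}_{n_i})$,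 all $\gamma_i\in\mathbb{M}_{n_i,n}$ non-zero, and $\sum_i\gamma_i^*\gamma_i=1_n$, then for each $i$: if $n_i\le n$, then $n_i=n$ and $\phi=u_i^*\phi_iu_i$ for some unitary $u_i\in\mathbb{M}_n$; if $n_i>n$, then $\phi_i=u_i^*(\phi\oplus\rho_i)u_i$ for some $\rho_i\in \mathrm{UCP}(\mathcal{S},\mathbb{M}_{n_i-n})$ and unitary $u_i\in\mathbb{M}_{n_i}$. $\mathrm{Abex}(\mathrm{UCP}(\mathcal{S}))$ is the set of absolute matrix extreme points (over all levels). A UCP map $\phi:\mathcal{S}\to B(\mathcal{H})$ has the unique extension property if it has a unique UCP extension to $C^*(\mathcal{S})$ and this extension is multiplicative. A boundary representation for $\mathcal{S}$ is an irreducible $*$-representation $\pi$ of $C^*(\mathcal{S})$ such that $\pi|_{\mathcal{S}}$ has the unique extension property; finite-dimensional ones are viewed as maps into matrix algebras by choosing an orthonormal basis. *)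

theory Defs
  imports Complex_Main "HOL-Library.FuncSet" "Jordan_Normal_Form.Schur_Decomposition"
begin

section \<open>C*-algebras and Hilbert spaces\<close>

class complex_normed_vector = real_normed_vector +
  fixes scaleC :: "complex \<Rightarrow> 'a \<Rightarrow> 'a"
  assumes scaleC_add_right: "scaleC c (x + y) = scaleC c x + scaleC c y"
    and scaleC_add_left: "scaleC (c + d) x = scaleC c x + scaleC d x"
    and scaleC_scaleC: "scaleC c (scaleC d x) = scaleC (c * d) x"
    and scaleR_scaleC: "scaleR r x = scaleC (complex_of_real r) x"
    and norm_scaleC: "norm (scaleC c x) = cmod c * norm x"

text \<open>Unital C*-algebras; the axiom \<open>norm 1 = 1\<close> of \<^class>\<open>real_normed_algebra_1\<close>
  only excludes the zero algebra.\<close>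

class unital_cstar_algebra = complex_normed_vector + real_normed_algebra_1 + banach +
  fixes star :: "'a \<Rightarrow> 'a"
  assumes mult_scaleC_left: "scaleC c x * y = scaleC c (x * y)"
    and mult_scaleC_right: "x * scaleC c y = scaleC c (x * y)"
    and star_star: "star (star x) = x"
    and star_add: "star (x + y) = star x + star y"
    and star_scaleC: "star (scaleC c x) = scaleC (cnj c) (star x)"
    and star_mult: "star (x * y) = star y * star x"
    and cstar_identity: "norm (star x * x) = norm x ^ 2"

text \<open>The inner product is linear in its first argument, like the product
  \<open>\<bullet>c\<close> of complex vectors.\<close>

class complex_hilbert_space = complex_normed_vector + banach +
  fixes cinner :: "'a \<Rightarrow> 'a \<Rightarrow> complex"
  assumes cinner_add_left: "cinner (x + y) z = cinner x z + cinner y z"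
    and cinner_scaleC_left: "cinner (scaleC c x) y = c * cinner x y"
    and cinner_commute: "cinner x y = cnj (cinner y x)"
    and cinner_norm: "cinner x x = complex_of_real (norm x ^ 2)"

section \<open>Operator systems\<close>

definition operator_system :: "'a::unital_cstar_algebra set \<Rightarrow> bool" where
  "operator_system T \<longleftrightarrow>
     1 \<in> T \<and> (\<forall>x\<in>T. \<forall>y\<in>T. x + y \<in> T) \<and> (\<forall>c. \<forall>x\<in>T. scaleC c x \<in> T) \<and>
     (\<forall>x\<in>T. star x \<in> T)"

definition generated_operator_system :: "'a::unital_cstar_algebra set \<Rightarrow> 'a set" where
  "generated_operator_system X = \<Inter>{T. operator_system T \<and> X \<subseteq> T}"

definition cstar_subalgebra :: "'a::unital_cstar_algebra set \<Rightarrow> bool" where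
  "cstar_subalgebra B \<longleftrightarrow>
     operator_system B \<and> (\<forall>x\<in>B. \<forall>y\<in>B. x * y \<in> B) \<and> closed B"

definition generated_cstar :: "'a::unital_cstar_algebra set \<Rightarrow> 'a set" where
  "generated_cstar S = \<Inter>{B. cstar_subalgebra B \<and> S \<subseteq> B}"

definition unitary_element :: "'a::unital_cstar_algebra \<Rightarrow> bool" where
  "unitary_element u \<longleftrightarrow> star u * u = 1 \<and> u * star u = 1"

text \<open>\<open>X\<close>, read as the \<open>k \<times> k\<close> matrix \<open>(X i j)\<close> with \<open>i, j < k\<close>, is a positive
  element of the C*-algebra of \<open>k \<times> k\<close> matrices over \<open>'a\<close>, i.e. it is of the form
  \<open>Y\<^sup>* Y\<close>.\<close>

definition positive_matrix :: "nat \<Rightarrow> (nat \<Rightarrow> nat \<Rightarrow> 'a::unital_cstar_algebra) \<Rightarrow> bool" where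
  "positive_matrix k X \<longleftrightarrow>
     (\<exists>Y. \<forall>i<k. \<forall>j<k. X i j = (\<Sum>l<k. star (Y l i) * Y l j))"

section \<open>Matrix-valued UCP maps\<close>

text \<open>UCP maps from \<open>S\<close> to the \<open>d \<times> d\<close> matrices, for levels \<open>d \<ge> 1\<close>. They are extensional
  functions, so that equality of maps is equality on \<open>S\<close>. Positivity of the matrix
  \<open>(\<phi> (X i j))\<close> is positivity of its quadratic form on \<open>k\<close>-tuples of vectors; the order
  on \<^typ>\<open>complex\<close> is such that \<open>0 \<le> z\<close> means that \<open>z\<close> is real and nonnegative.\<close>

definition ucp :: "'a::unital_cstar_algebra set \<Rightarrow> nat \<Rightarrow> ('a \<Rightarrow> complex mat) set" where
  "ucp S d = {\<phi> \<in> S \<rightarrow>\<^sub>E carrier_mat d d.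
     0 < d \<and>
     (\<forall>x\<in>S. \<forall>y\<in>S. \<phi> (x + y) = \<phi> x + \<phi> y) \<and>
     (\<forall>c. \<forall>x\<in>S. \<phi> (scaleC c x) = c \<cdot>\<^sub>m \<phi> x) \<and>
     \<phi> 1 = 1\<^sub>m d \<and>
     (\<forall>k X. (\<forall>i<k. \<forall>j<k. X i j \<in> S) \<longrightarrow> positive_matrix k X \<longrightarrow>
        (\<forall>\<xi>. (\<forall>i<k. \<xi> i \<in> carrier_vec d) \<longrightarrow>
           0 \<le> (\<Sum>i<k. \<Sum>j<k. (\<phi> (X i j) *\<^sub>v \<xi> j) \<bullet>c \<xi> i)))}"

definition unitary_mat :: "nat \<Rightarrow> complex mat \<Rightarrow> bool" where
  "unitary_mat d U \<longleftrightarrow>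
     U \<in> carrier_mat d d \<and> mat_adjoint U * U = 1\<^sub>m d \<and> U * mat_adjoint U = 1\<^sub>m d"

definition mat_sum :: "nat \<Rightarrow> nat \<Rightarrow> (nat \<Rightarrow> complex mat) \<Rightarrow> complex mat" where
  "mat_sum n r F = mat n n (\<lambda>(a, b). \<Sum>i<r. F i $$ (a, b))"

text \<open>\<open>\<phi> = \<Sum>i<r. \<gamma>\<^sub>i\<^sup>* \<phi>\<^sub>i \<gamma>\<^sub>i\<close> with \<open>\<Sum>i<r. \<gamma>\<^sub>i\<^sup>* \<gamma>\<^sub>i = 1\<close> and \<open>\<phi>\<^sub>i\<close> of level \<open>m i\<close>.\<close>

definition matrix_convex_combination ::
  "'a::unital_cstar_algebra set \<Rightarrow> nat \<Rightarrow> ('a \<Rightarrow> complex mat) \<Rightarrow> nat \<Rightarrow> (nat \<Rightarrow> nat) \<Rightarrow>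
    (nat \<Rightarrow> 'a \<Rightarrow> complex mat) \<Rightarrow> (nat \<Rightarrow> complex mat) \<Rightarrow> bool" where
  "matrix_convex_combination S n \<phi> r m \<psi> \<gamma> \<longleftrightarrow>
     (\<forall>i<r. \<psi> i \<in> ucp S (m i) \<and> \<gamma> i \<in> carrier_mat (m i) n) \<and>
     mat_sum n r (\<lambda>i. mat_adjoint (\<gamma> i) * \<gamma> i) = 1\<^sub>m n \<and>
     (\<forall>x\<in>S. \<phi> x = mat_sum n r (\<lambda>i. mat_adjoint (\<gamma> i) * \<psi> i x * \<gamma> i))"

definition surjective_mat :: "complex mat \<Rightarrow> bool" where
  "surjective_mat A \<longleftrightarrow> (\<lambda>v. A *\<^sub>v v) ` carrier_vec (dim_col A) = carrier_vec (dim_row A)"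

definition unitarily_equivalent ::
  "'a::unital_cstar_algebra set \<Rightarrow> nat \<Rightarrow> ('a \<Rightarrow> complex mat) \<Rightarrow> ('a \<Rightarrow> complex mat) \<Rightarrow> bool" where
  "unitarily_equivalent S d \<phi> \<psi> \<longleftrightarrow>
     (\<exists>U. unitary_mat d U \<and> (\<forall>x\<in>S. \<phi> x = mat_adjoint U * \<psi> x * U))"

definition matrix_extreme_points ::
  "'a::unital_cstar_algebra set \<Rightarrow> nat \<Rightarrow> ('a \<Rightarrow> complex mat) set" where
  "matrix_extreme_points S n = {\<phi> \<in> ucp S n.
     \<forall>r m \<psi> \<gamma>. matrix_convex_combination S n \<phi> r m \<psi> \<gamma> \<longrightarrow> (\<forall>i<r. surjective_mat (\<gamma> i)) \<longrightarrow>
       (\<forall>i<r. m i = n \<and> unitarily_equivalent S n \<phi> (\<psi> i))}"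

definition subhomogeneous :: "'a::unital_cstar_algebra set \<Rightarrow> nat \<Rightarrow> bool" where
  "subhomogeneous S N \<longleftrightarrow>
     0 < N \<and> (\<forall>n>N. matrix_extreme_points S n = {}) \<and>
     (\<forall>M>0. (\<forall>n>M. matrix_extreme_points S n = {}) \<longrightarrow> N \<le> M)"

definition absolute_matrix_extreme_points ::
  "'a::unital_cstar_algebra set \<Rightarrow> nat \<Rightarrow> ('a \<Rightarrow> complex mat) set" where
  "absolute_matrix_extreme_points S n = {\<phi> \<in> ucp S n.
     \<forall>r m \<psi> \<gamma>. matrix_convex_combination S n \<phi> r m \<psi> \<gamma> \<longrightarrow> (\<forall>i<r. \<gamma> i \<noteq> 0\<^sub>m (m i) n) \<longrightarrow>
       (\<forall>i<r.
          (m i \<le> n \<longrightarrow> m i = n \<and> unitarily_equivalent S n \<phi> (\<psi> i)) \<and>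
          (m i > n \<longrightarrow> (\<exists>\<rho> \<in> ucp S (m i - n).
             unitarily_equivalent S (m i) (\<psi> i) (\<lambda>x. diag_block_mat [\<phi> x, \<rho> x]))))}"

definition Abex :: "'a::unital_cstar_algebra set \<Rightarrow> ('a \<Rightarrow> complex mat) set" where
  "Abex S = (\<Union>d. absolute_matrix_extreme_points S d)"

section \<open>UCP maps into the bounded operators on a Hilbert space\<close>

definition bounded_operator :: "('h::complex_hilbert_space \<Rightarrow> 'h) \<Rightarrow> bool" where
  "bounded_operator T \<longleftrightarrow> bounded_linear T \<and> (\<forall>c x. T (scaleC c x) = scaleC c (T x))"

definition ucp_op ::
  "'a::unital_cstar_algebra set \<Rightarrow> ('a \<Rightarrow> 'h::complex_hilbert_space \<Rightarrow> 'h) set" where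
  "ucp_op S = {\<phi> \<in> S \<rightarrow>\<^sub>E {T. bounded_operator T}.
     (\<forall>x\<in>S. \<forall>y\<in>S. \<phi> (x + y) = (\<lambda>h. \<phi> x h + \<phi> y h)) \<and>
     (\<forall>c. \<forall>x\<in>S. \<phi> (scaleC c x) = (\<lambda>h. scaleC c (\<phi> x h))) \<and>
     \<phi> 1 = id \<and>
     (\<forall>k X. (\<forall>i<k. \<forall>j<k. X i j \<in> S) \<longrightarrow> positive_matrix k X \<longrightarrow>
        (\<forall>\<xi>. 0 \<le> (\<Sum>i<k. \<Sum>j<k. cinner (\<phi> (X i j) (\<xi> j)) (\<xi> i))))}"

section \<open>Boundary representations\<close>

text \<open>\<open>UCP T\<close> is the set of UCP maps on \<open>T\<close> into a fixed algebra of operators with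
  product \<open>mul\<close>.\<close>

definition unique_extension_property ::
  "('a::unital_cstar_algebra set \<Rightarrow> ('a \<Rightarrow> 'b) set) \<Rightarrow> ('b \<Rightarrow> 'b \<Rightarrow> 'b) \<Rightarrow> 'a set \<Rightarrow> ('a \<Rightarrow> 'b) \<Rightarrow> bool"
  where
  "unique_extension_property UCP mul S \<phi> \<longleftrightarrow>
     \<phi> \<in> UCP S \<and>
     (\<exists>\<Phi>. {\<Psi> \<in> UCP (generated_cstar S). restrict \<Psi> S = \<phi>} = {\<Phi>} \<and>
        (\<forall>a\<in>generated_cstar S. \<forall>b\<in>generated_cstar S. \<Phi> (a * b) = mul (\<Phi> a) (\<Phi> b)))"

definition star_representation_op ::
  "'a::unital_cstar_algebra set \<Rightarrow> ('a \<Rightarrow> 'h::complex_hilbert_space \<Rightarrow> 'h) \<Rightarrow> bool" where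
  "star_representation_op B \<pi> \<longleftrightarrow>
     \<pi> \<in> B \<rightarrow>\<^sub>E {T. bounded_operator T} \<and>
     (\<forall>a\<in>B. \<forall>b\<in>B. \<pi> (a + b) = (\<lambda>h. \<pi> a h + \<pi> b h)) \<and>
     (\<forall>c. \<forall>a\<in>B. \<pi> (scaleC c a) = (\<lambda>h. scaleC c (\<pi> a h))) \<and>
     (\<forall>a\<in>B. \<forall>b\<in>B. \<pi> (a * b) = \<pi> a \<circ> \<pi> b) \<and>
     (\<forall>a\<in>B. \<forall>x y. cinner (\<pi> (star a) x) y = cinner x (\<pi> a y)) \<and>
     \<pi> 1 = id"

definition irreducible_op ::
  "'a set \<Rightarrow> ('a \<Rightarrow> 'h::complex_hilbert_space \<Rightarrow> 'h) \<Rightarrow> bool" where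
  "irreducible_op B \<pi> \<longleftrightarrow>
     (UNIV :: 'h set) \<noteq> {0} \<and>
     (\<forall>W. closed W \<longrightarrow> 0 \<in> W \<longrightarrow> (\<forall>x\<in>W. \<forall>y\<in>W. x + y \<in> W) \<longrightarrow>
        (\<forall>c. \<forall>x\<in>W. scaleC c x \<in> W) \<longrightarrow> (\<forall>a\<in>B. \<forall>x\<in>W. \<pi> a x \<in> W) \<longrightarrow>
        W = {0} \<or> W = UNIV)"

definition boundary_representation_op ::
  "'a::unital_cstar_algebra set \<Rightarrow> ('a \<Rightarrow> 'h::complex_hilbert_space \<Rightarrow> 'h) \<Rightarrow> bool" where
  "boundary_representation_op S \<pi> \<longleftrightarrow>
     star_representation_op (generated_cstar S) \<pi> \<and> irreducible_op (generated_cstar S) \<pi> \<and>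
     unique_extension_property ucp_op (\<circ>) S (restrict \<pi> S)"

text \<open>The same notions for representations on \<open>\<complex>\<^sup>d\<close>, viewed as maps into the
  \<open>d \<times> d\<close> matrices. Since the level \<open>d\<close> is a number and not a type, these cannot be
  obtained as instances of the previous ones.\<close>

definition star_representation_mat ::
  "'a::unital_cstar_algebra set \<Rightarrow> nat \<Rightarrow> ('a \<Rightarrow> complex mat) \<Rightarrow> bool" where
  "star_representation_mat B d \<pi> \<longleftrightarrow>
     \<pi> \<in> B \<rightarrow>\<^sub>E carrier_mat d d \<and>
     (\<forall>a\<in>B. \<forall>b\<in>B. \<pi> (a + b) = \<pi> a + \<pi> b) \<and>
     (\<forall>c. \<forall>a\<in>B. \<pi> (scaleC c a) = c \<cdot>\<^sub>m \<pi> a) \<and>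
     (\<forall>a\<in>B. \<forall>b\<in>B. \<pi> (a * b) = \<pi> a * \<pi> b) \<and>
     (\<forall>a\<in>B. \<pi> (star a) = mat_adjoint (\<pi> a)) \<and>
     \<pi> 1 = 1\<^sub>m d"

definition irreducible_mat :: "'a set \<Rightarrow> nat \<Rightarrow> ('a \<Rightarrow> complex mat) \<Rightarrow> bool" where
  "irreducible_mat B d \<pi> \<longleftrightarrow>
     0 < d \<and>
     (\<forall>W. W \<subseteq> carrier_vec d \<longrightarrow> 0\<^sub>v d \<in> W \<longrightarrow> (\<forall>x\<in>W. \<forall>y\<in>W. x + y \<in> W) \<longrightarrow>
        (\<forall>c. \<forall>x\<in>W. c \<cdot>\<^sub>v x \<in> W) \<longrightarrow> (\<forall>a\<in>B. \<forall>x\<in>W. \<pi> a *\<^sub>v x \<in> W) \<longrightarrow>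
        W = {0\<^sub>v d} \<or> W = carrier_vec d)"

definition boundary_representation_mat ::
  "'a::unital_cstar_algebra set \<Rightarrow> nat \<Rightarrow> ('a \<Rightarrow> complex mat) \<Rightarrow> bool" where
  "boundary_representation_mat S d \<pi> \<longleftrightarrow>
     star_representation_mat (generated_cstar S) d \<pi> \<and> irreducible_mat (generated_cstar S) d \<pi> \<and>
     unique_extension_property (\<lambda>T. ucp T d) (*) S (restrict \<pi> S)"

definition orthonormal_basis :: "'h::complex_hilbert_space list \<Rightarrow> bool" where
  "orthonormal_basis es \<longleftrightarrow>
     (\<forall>i<length es. \<forall>j<length es. cinner (es ! i) (es ! j) = (if i = j then 1 else 0)) \<and>
     (\<forall>x. x = (\<Sum>i<length es. scaleC (cinner x (es ! i)) (es ! i)))"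

definition mat_of_op :: "'h::complex_hilbert_space list \<Rightarrow> ('h \<Rightarrow> 'h) \<Rightarrow> complex mat" where
  "mat_of_op es T =
     mat (length es) (length es) (\<lambda>(i, j). cinner (T (es ! j)) (es ! i))"

end

theory Submission
  imports Defs "HOL-Computational_Algebra.Formal_Power_Series" "HOL-Library.Function_Algebras"
    "Jordan_Normal_Form.Spectral_Radius"
begin

text \<open>
  Why the theorem holds. Since \<open>q\<close> is a primitive \<open>n\<close>-th root of unity, \<open>u\<^sup>n\<close> and \<open>v\<^sup>n\<close> are central in the
  C*-algebra \<open>B\<close> generated by \<open>u\<close> and \<open>v\<close>. Where they act as scalars \<open>l\<close> and \<open>\<mu>\<close>, an eigenvector of \<open>u\<close>
  has an orthonormal orbit under \<open>v\<close>, on which \<open>u\<close> and \<open>v\<close> act as a clock and a shift matrix of size \<open>n\<close>,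
  up to unimodular factors. So all irreducible representations have dimension \<open>n\<close>.

  A matrix extreme point \<open>\<phi>\<close> of the state space of \<open>S\<close> cannot be split by central elements. Cutting an
  extension of \<open>\<phi>\<close> to \<open>B\<close> with the positive parts of \<open>c - |u\<^sup>n - l|\<^sup>2 - |v\<^sup>n - \<mu>|\<^sup>2\<close>, finitely many of which
  cover the spectrum, one finds for every \<open>c > 0\<close> an extension that is concentrated near one point
  \<open>(l, \<mu>)\<close>; by compactness there is an extension for which \<open>u\<^sup>n\<close> and \<open>v\<^sup>n\<close> are exactly \<open>l\<close> and \<open>\<mu>\<close>
  (\<open>extreme_point_extension\<close>). Such an extension factors through the clock and shift representation
  \<open>\<pi>\<close> and has a Kraus decomposition \<open>\<Sum> \<gamma>\<^sub>t\<^sup>* \<pi> \<gamma>\<^sub>t\<close> (\<open>kraus_decomposition\<close>), and extremality reduces it to one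
  term: \<open>\<phi> = \<delta>\<^sup>* \<pi> \<delta>\<close> with an isometry \<open>\<delta>\<close> (\<open>extreme_point_is_compression\<close>). Hence there are no extreme points
  above level \<open>n\<close>, those of level \<open>n\<close> are representations, and all others are compressions of one.

  Conversely a unitary of \<open>S\<close> that a representation maps to a unitary forces equality in the Schwarz
  inequality of every summand of a decomposition of that representation (\<open>combination_exchange\<close>), so each
  coefficient intertwines, and by Schur's lemma it is a multiple of an isometry
  (\<open>irrep_absolute_extreme\<close>). This gives absolute extremality, and the same multiplicativity gives the
  unique extension property (\<open>irreducible_boundary\<close>). Below level \<open>n\<close> the compression of \<open>\<pi>\<close> to the first
  \<open>m\<close> basis vectors is extreme (\<open>compression_extreme\<close>).

  The analytic tools, all elementary, are square roots in a C*-algebra by the binomial series, the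
  positivity of \<open>x\<^sup>* x\<close>, and the extension theorem for completely positive matrix-valued maps, deduced
  from the M. Riesz extension theorem for positive functionals.
\<close>

abbreviation (input) adj :: "complex mat => complex mat" where "adj == mat_adjoint"

section \<open>Elementary consequences of the C*-axioms\<close>

lemma star_0 [simp]: "star (0::'a::unital_cstar_algebra) = 0"
 by (metis add_cancel_right_right star_add)

lemma star_1 [simp]: "star (1::'a::unital_cstar_algebra) = 1"
 by (metis mult_1 mult.right_neutral star_mult star_star)

lemma scaleC_minus_one: "scaleC (-1) (x::'a::complex_normed_vector) = - x"
 using scaleR_scaleC[of "-1" x] by simp

lemma star_uminus [simp]: "star (- x) = - star (x::'a::unital_cstar_algebra)"
 by (metis add.right_inverse add_eq_0_iff star_0 star_add)

lemma star_diff [simp]: "star (x - y) = star x - star (y::'a::unital_cstar_algebra)"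
 using star_add[of x "- y"] by simp

lemma star_scaleR [simp]: "star (r *\<^sub>R x) = r *\<^sub>R star (x::'a::unital_cstar_algebra)"
 by (simp add: scaleR_scaleC star_scaleC)

lemma star_sum: "star (sum f I) = (\<Sum>i\<in>I. star (f i :: 'a::unital_cstar_algebra))"
 by (induction I rule: infinite_finite_induct) (auto simp: star_add)

lemma star_power: "star (x ^ k) = star (x::'a::unital_cstar_algebra) ^ k"
 by (induction k) (auto simp: star_mult power_commutes)

lemma norm_star [simp]: "norm (star x) = norm (x::'a::unital_cstar_algebra)"
proof -
 have le: "norm y <= norm (star y)" for y :: 'a
 proof (cases "y = 0")
  case False
  have "norm y * norm y <= norm (star y) * norm y"
   using norm_mult_ineq[of "star y" y] by (simp add: cstar_identity power2_eq_square)
  with False show ?thesis by simp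
 qed simp
 show ?thesis using le[of x] le[of "star x"] by (simp add: star_star)
qed

lemma bounded_linear_star: "bounded_linear (star :: 'a::unital_cstar_algebra => 'a)"
 by (rule bounded_linear_intro[of _ 1]) (auto simp: star_add)

lemma scaleC_zero_left [simp]: "scaleC 0 (x::'a::complex_normed_vector) = 0"
 using scaleR_scaleC[of 0 x] by simp

lemma scaleC_one [simp]: "scaleC 1 (x::'a::complex_normed_vector) = x"
 using scaleR_scaleC[of 1 x] by simp

lemma scaleC_zero_right [simp]: "scaleC c (0::'a::complex_normed_vector) = 0"
 by (metis add_cancel_right_right scaleC_add_right)

lemma scaleC_minus_right [simp]: "scaleC c (- x) = - scaleC c (x::'a::complex_normed_vector)"
 by (metis add.right_inverse add_eq_0_iff scaleC_zero_right scaleC_add_right)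

lemma scaleC_minus_left [simp]: "scaleC (- c) x = - scaleC c (x::'a::complex_normed_vector)"
 by (metis add.right_inverse add_eq_0_iff scaleC_zero_left scaleC_add_left)

lemma scaleC_diff_right: "scaleC c (x - y) = scaleC c x - scaleC c (y::'a::complex_normed_vector)"
 using scaleC_add_right[of c x "- y"] by simp

lemma scaleC_diff_left: "scaleC (c - d) x = scaleC c x - scaleC d (x::'a::complex_normed_vector)"
 using scaleC_add_left[of c "- d" x] by simp

lemma scaleC_sum_right: "scaleC c (sum f I) = (\<Sum>i\<in>I. scaleC c (f i :: 'a::complex_normed_vector))"
 by (induction I rule: infinite_finite_induct) (auto simp: scaleC_add_right)

lemma scaleC_sum_left: "scaleC (sum f I) x = (\<Sum>i\<in>I. scaleC (f i) (x :: 'a::complex_normed_vector))"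
 by (induction I rule: infinite_finite_induct) (auto simp: scaleC_add_left)

lemma norm_power_selfadjoint:
 assumes "star a = (a::'a::unital_cstar_algebra)"
 shows "norm (a * a) = norm a ^ 2"
 using cstar_identity[of a] assms by simp

lemma selfadjoint_square_eq_0:
 assumes "star a = (a::'a::unital_cstar_algebra)" "a * a = 0"
 shows "a = 0"
 using norm_power_selfadjoint[OF assms(1)] assms(2) by simp

lemma cstar_subalgebra_closure_props:
 assumes "cstar_subalgebra B"
 shows "1 : B" "0 : B" "!!x y. x : B ==> y : B ==> x + y : B"
  "!!x y. x : B ==> y : B ==> x - y : B"
  "!!x y. x : B ==> y : B ==> x * y : B" "!!c x. x : B ==> scaleC c x : B"
  "!!c x. x : B ==> c *\<^sub>R x : B" "!!x. x : B ==> star x : B"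
  "!!x. x : B ==> - x : B" "!!x k. x : B ==> x ^ k : B" "closed B"
proof -
 have *: "1 : B" "!!x y. x : B ==> y : B ==> x + y : B"
  "!!x y. x : B ==> y : B ==> x * y : B" "!!c x. x : B ==> scaleC c x : B"
  "!!x. x : B ==> star x : B" "closed B"
  using assms by (auto simp: cstar_subalgebra_def operator_system_def)
 show m: "- x : B" if "x : B" for x using *(4)[OF that, of "-1"] by simp
 show "0 : B" using *(4)[OF *(1), of 0] by simp
 show "x - y : B" if "x : B" "y : B" for x y using *(2)[OF that(1) m[OF that(2)]] by simp
 show "c *\<^sub>R x : B" if "x : B" for c x using *(4)[OF that] by (simp add: scaleR_scaleC)
 show "x ^ k : B" if "x : B" for x k using that by (induction k) (auto intro: *)
qed (use assms in \<open>auto simp: cstar_subalgebra_def operator_system_def\<close>)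

section \<open>Positive elements and square roots\<close>

definition sqrt_coeff :: "nat => real" where
 "sqrt_coeff j = (-1) ^ j * ((1/2) gchoose j)"

lemma sqrt_coeff_0 [simp]: "sqrt_coeff 0 = 1"
 by (simp add: sqrt_coeff_def)

lemma sqrt_coeff_nonpos: "0 < j ==> sqrt_coeff j <= 0"
proof -
 assume "0 < j"
 then obtain i where j: "j = Suc i" by (cases j) auto
 have "sqrt_coeff j = pochhammer (-1/2) j / fact j"
  by (simp add: sqrt_coeff_def gbinomial_pochhammer flip: power_add mult_2)
 also have "pochhammer (-1/2::real) j = (-1/2) * pochhammer (1/2) i"
  by (simp add: j pochhammer_rec)
 also have "... / fact j <= 0"
  using pochhammer_pos[of "1/2::real" i] by (simp add: divide_nonpos_pos)
 finally show ?thesis by simp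
qed

lemma sqrt_coeff_sum_nonneg: "0 <= (\<Sum>j\<le>k. sqrt_coeff j)"
proof -
 have "(\<Sum>j\<le>k. sqrt_coeff j) = (\<Sum>j\<le>k. ((1/2) gchoose j) * (-1) ^ j)"
  by (simp add: sqrt_coeff_def mult.commute)
 also have "... = (-1) ^ k * ((1/2 - 1) gchoose k)"
  by (rule gbinomial_sum_lower_neg)
 also have "... = pochhammer (1/2) k / fact k"
  by (simp add: gbinomial_pochhammer flip: power_add mult_2)
 also have "... \<ge> 0" using pochhammer_pos[of "1/2::real" k] by simp
 finally show ?thesis .
qed

lemma sqrt_coeff_abs_sum: "(\<Sum>j<k. \<bar>sqrt_coeff (Suc j)\<bar>) <= 1"
proof -
 have "(\<Sum>j<k. \<bar>sqrt_coeff (Suc j)\<bar>) = - (\<Sum>j<k. sqrt_coeff (Suc j))"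
  using sqrt_coeff_nonpos by (simp flip: sum_negf)
 also have "... = 1 - (\<Sum>j\<le>k. sqrt_coeff j)"
  by (simp add: sum.lessThan_Suc_shift flip: lessThan_Suc_atMost del: sum.lessThan_Suc)
 finally show ?thesis using sqrt_coeff_sum_nonneg[of k] by simp
qed

lemma sqrt_coeff_summable: "summable (%j. \<bar>sqrt_coeff (Suc j)\<bar>)"
 by (rule summableI_nonneg_bounded[of _ 1]) (use sqrt_coeff_abs_sum in auto)

lemma sqrt_coeff_convolution:
 "(\<Sum>i\<le>k. sqrt_coeff i * sqrt_coeff (k - i)) = (if k = 0 then 1 else if k = 1 then -1 else 0)"
proof -
 have "(\<Sum>i\<le>k. sqrt_coeff i * sqrt_coeff (k - i)) =
    (\<Sum>i\<le>k. (-1) ^ k * (((1/2) gchoose i) * ((1/2) gchoose (k - i))))"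
  by (rule sum.cong) (auto simp: sqrt_coeff_def simp flip: power_add)
 also have "... = (-1) ^ k * (\<Sum>i=0..k. ((1/2) gchoose i) * ((1/2) gchoose (k - i)))"
  by (simp add: sum_distrib_left atMost_atLeast0)
 also have "... = (-1) ^ k * ((1/2 + 1/2) gchoose k)"
  by (subst gbinomial_Vandermonde) simp
 also have "... = (-1) ^ k * of_nat (1 choose k)"
  using binomial_gbinomial[of 1 k, where 'a=real] by simp
 also have "... = (if k = 0 then 1 else if k = 1 then -1 else 0)"
  by (cases k rule: nat.exhaust; cases "k - 1") (auto simp: binomial_eq_0)
 finally show ?thesis .
qed

text \<open>Functional calculus is only needed through two of its features: what commutes with \<open>x\<close>
  commutes with \<open>d\<close>, and \<open>d\<close> lies in every C*-subalgebra containing \<open>x\<close>.\<close>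

definition calculus_of :: "'a::unital_cstar_algebra => 'a => bool" where
 "calculus_of x d \<longleftrightarrow> (ALL y. y * x = x * y --> y * d = d * y) \<and>
   (ALL B. cstar_subalgebra B --> x : B --> d : B)"

lemma calculus_of_refl: "calculus_of x x"
 and calculus_of_trans: "calculus_of x d ==> calculus_of d e ==> calculus_of x e"
 and calculus_of_one: "calculus_of x 1"
 and calculus_of_diff: "calculus_of x d ==> calculus_of x e ==> calculus_of x (d - e)"
 and calculus_of_add: "calculus_of x d ==> calculus_of x e ==> calculus_of x (d + e)"
 and calculus_of_scaleR: "calculus_of x d ==> calculus_of x (r *\<^sub>R d)"
 unfolding calculus_of_def by (simp_all add: ring_distribs cstar_subalgebra_closure_props)

lemma calculus_of_mult: "calculus_of x d ==> calculus_of x e ==> calculus_of x (d * e)"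
proof -
 assume d: "calculus_of x d" and e: "calculus_of x e"
 have "y * (d * e) = d * e * y" if "y * x = x * y" for y
 proof -
  have yd: "y * d = d * y" and ye: "y * e = e * y" using d e that by (auto simp: calculus_of_def)
  have "y * (d * e) = (y * d) * e" by (rule mult.assoc[symmetric])
  also have "... = d * (y * e)" unfolding yd by (rule mult.assoc)
  also have "... = d * e * y" unfolding ye by (rule mult.assoc[symmetric])
  finally show ?thesis .
 qed
 then show ?thesis
  using d e cstar_subalgebra_closure_props(5) unfolding calculus_of_def by blast
qed

lemma calculus_of_comm: "calculus_of x d ==> y * x = x * y ==> y * d = d * y"
 by (auto simp: calculus_of_def)

lemma calculus_of_mem: "calculus_of x d ==> cstar_subalgebra B ==> x : B ==> d : B"
 by (auto simp: calculus_of_def)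

text \<open>The binomial series of \<open>sqrt (1 - x)\<close> converges absolutely on the closed unit ball.\<close>

lemma sqrt_one_minus:
 fixes x :: "'a::unital_cstar_algebra"
 assumes x: "star x = x" "norm x <= 1"
 obtains d where "star d = d" "d * d = 1 - x" "norm (1 - d) <= 1" "calculus_of x d"
proof -
 define f where "f j = sqrt_coeff j *\<^sub>R x ^ j" for j
 have nf: "norm (f (Suc j)) <= \<bar>sqrt_coeff (Suc j)\<bar>" for j
 proof -
  have "norm (x ^ Suc j) <= 1"
   using norm_power_ineq[of x "Suc j"] power_le_one[OF norm_ge_zero x(2), of "Suc j"] by linarith
  then show ?thesis by (simp add: f_def mult_left_le del: power_Suc)
 qed
 have sn1: "summable (%j. norm (f (Suc j)))"
  by (rule summable_comparison_test'[OF sqrt_coeff_summable, of 0]) (use nf in auto)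
 then have sn: "summable (%j. norm (f j))" using summable_Suc_iff by blast
 then have s: "summable f" by (rule summable_norm_cancel)
 define d where "d = suminf f"
 have "norm (\<Sum>j. f (Suc j)) <= (\<Sum>j. \<bar>sqrt_coeff (Suc j)\<bar>)"
  by (rule order_trans[OF summable_norm[OF sn1]]) (rule suminf_le[OF nf sn1 sqrt_coeff_summable])
 also have "... <= 1" by (rule suminf_le_const[OF sqrt_coeff_summable]) (rule sqrt_coeff_abs_sum)
 also have "(\<Sum>j. f (Suc j)) = - (1 - d)"
  using suminf_split_head[OF s] by (simp add: d_def f_def)
 finally have d1: "norm (1 - d) <= 1" by (simp add: norm_minus_commute)
 have "star d = (\<Sum>j. star (f j))"
  unfolding d_def by (rule bounded_linear.suminf[OF bounded_linear_star s])
 also have "... = d" unfolding d_def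
  by (rule arg_cong[of _ _ suminf]) (simp add: f_def fun_eq_iff star_power x)
 finally have d2: "star d = d" .
 have "(%k. \<Sum>i\<le>k. f i * f (k - i)) sums (d * d)"
  unfolding d_def by (rule Cauchy_product_sums[OF sn sn])
 also have "(%k. \<Sum>i\<le>k. f i * f (k - i)) =
   (%k. (if k = 0 then 1 else if k = 1 then -1 else 0) *\<^sub>R x ^ k)"
  by (auto simp: f_def sqrt_coeff_convolution[symmetric] scaleR_sum_left
       simp flip: power_add intro!: ext sum.cong)
 finally have 1: "(%k. (if k = 0 then 1 else if k = 1 then -1 else 0) *\<^sub>R x ^ k) sums (d * d)" .
 have "(%k. (if k = 0 then 1 else if k = 1 then -1 else 0) *\<^sub>R x ^ k) sums
    (\<Sum>k\<in>{0,1}. (if k = 0 then 1 else if k = 1 then -1 else 0) *\<^sub>R x ^ k)"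
  by (rule sums_finite) auto
 then have d3: "d * d = 1 - x" using sums_unique2[OF 1] by simp
 have "calculus_of x d"
  unfolding calculus_of_def
 proof safe
  fix y assume y: "y * x = x * y"
  have p: "y * x ^ j = x ^ j * y" for j
   by (induction j) (simp_all add: mult.assoc[symmetric] y, simp add: mult.assoc)
  have "y * d = (\<Sum>j. y * f j)" unfolding d_def by (rule suminf_mult[OF s, symmetric])
  also have "... = (\<Sum>j. f j * y)" by (simp add: f_def p)
  also have "... = d * y" unfolding d_def by (rule suminf_mult2[OF s, symmetric])
  finally show "y * d = d * y" .
 next
  fix B assume B: "cstar_subalgebra B" "x : B"
  have "(\<Sum>j<k. f j) : B" for k
   by (induction k) (auto simp: f_def B intro!: cstar_subalgebra_closure_props[OF B(1)])
  moreover have "(%k. \<Sum>j<k. f j) \<longlonglongrightarrow> d"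
   unfolding d_def using s by (simp add: summable_LIMSEQ)
  ultimately show "d : B"
   using closed_sequentially[OF cstar_subalgebra_closure_props(11)[OF B(1)], of "%k. \<Sum>j<k. f j"] by blast
 qed
 with d1 d2 d3 show ?thesis using that by blast
qed

definition cpos :: "'a::unital_cstar_algebra => bool" where
 "cpos a \<longleftrightarrow> (EX d. star d = d & a = d * d)"

lemma cpos_selfadjoint: "cpos a ==> star a = a"
 by (auto simp: cpos_def star_mult)

lemma cpos_0 [simp]: "cpos 0" by (auto simp: cpos_def intro!: exI[of _ 0])

lemma cpos_1 [simp]: "cpos 1" by (auto simp: cpos_def intro!: exI[of _ 1])

lemma cpos_scaleR: "0 <= r ==> cpos a ==> cpos (r *\<^sub>R a)"
proof -
 assume r: "0 <= r" and "cpos a"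
 then obtain d where d: "star d = d" "a = d * d" by (auto simp: cpos_def)
 then show ?thesis
  unfolding cpos_def using r by (intro exI[of _ "sqrt r *\<^sub>R d"]) simp
qed

lemma sqrt_of_norm_criterion:
 fixes a :: "'a::unital_cstar_algebra"
 assumes "star a = a" "norm (t *\<^sub>R 1 - a) <= t"
 obtains d where "star d = d" "a = d * d" "calculus_of a d"
proof (cases "t = 0")
 case True
 then have "a = 0" using assms by simp
 then show ?thesis using that[of 0] calculus_of_refl[of 0] by simp
next
 case False
 then have t: "0 < t" using assms(2) norm_ge_zero[of "t *\<^sub>R 1 - a"] by linarith
 let ?x = "1 - (1 / t) *\<^sub>R a"
 have "?x = (1 / t) *\<^sub>R (t *\<^sub>R 1 - a)" using t by (simp add: scaleR_right_diff_distrib)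
 then have "norm ?x <= 1" using assms t by (simp add: divide_simps)
 moreover have "star ?x = ?x" using assms by simp
 ultimately obtain d where d': "star d = d" "d * d = 1 - ?x" "norm (1 - d) <= 1" "calculus_of ?x d"
  by (metis sqrt_one_minus)
 then have d: "star d = d" "d * d = (1 / t) *\<^sub>R a" "calculus_of ?x d" by simp_all
 show ?thesis
 proof (rule that[of "sqrt t *\<^sub>R d"])
  show "a = sqrt t *\<^sub>R d * sqrt t *\<^sub>R d" using d t by simp
  have "calculus_of a ?x"
   by (intro calculus_of_diff calculus_of_one calculus_of_scaleR calculus_of_refl)
  then show "calculus_of a (sqrt t *\<^sub>R d)"
   by (intro calculus_of_scaleR) (rule calculus_of_trans[OF _ d(3)])
 qed (simp add: d)
qed

lemma cpos_norm_criterion: "star a = a ==> norm (t *\<^sub>R 1 - a) <= t ==> cpos a"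
 using sqrt_of_norm_criterion[of a t] unfolding cpos_def by metis

text \<open>With \<open>c = sqrt (1 - b\<^sup>2)\<close>, the element \<open>b + \<i> c\<close> is unitary; this bounds the norm of \<open>c\<close>.\<close>

lemma norm_le_of_sum_squares:
 fixes p r :: "'a::unital_cstar_algebra"
 assumes "star p = p" "star r = r" "p * r = r * p" "p * p + r * r = s *\<^sub>R 1" and s0: "0 <= s"
 shows "norm (p * p) <= s"
proof -
 let ?w = "p + scaleC \<i> r"
 have sw: "star ?w = p - scaleC \<i> r" by (simp add: star_add star_scaleC assms(1,2))
 have "star ?w * ?w = s *\<^sub>R 1"
 proof -
  have "(p - scaleC \<i> r) * (p + scaleC \<i> r) = p * p + scaleC \<i> (p * r) - scaleC \<i> (r * p) + r * r"
   by (simp add: ring_distribs mult_scaleC_left mult_scaleC_right scaleC_scaleC scaleC_diff_right)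
  then show ?thesis using assms(3,4) unfolding sw by simp
 qed
 then have n: "norm ?w ^ 2 = norm (s *\<^sub>R (1::'a))" using cstar_identity[of ?w] by metis
 have "2 *\<^sub>R p = ?w + star ?w" unfolding sw by (simp add: scaleR_2)
 then have "2 * norm p <= 2 * norm ?w"
  using norm_triangle_ineq[of ?w "star ?w"] by (metis abs_numeral mult_2 norm_scaleR norm_star)
 then have "norm p ^ 2 <= norm ?w ^ 2" by (simp add: power_mono)
 then show ?thesis using n s0 by (simp add: norm_power_selfadjoint assms)
qed

lemma cpos_bound_square:
 fixes d :: "'a::unital_cstar_algebra"
 assumes d: "star d = d" and t: "norm (d * d) <= t"
 shows "norm (t *\<^sub>R 1 - d * d) <= t"
proof (cases "t = 0")
 case False
 with t have t0: "0 < t" using norm_ge_zero[of "d * d"] by linarith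
 define x where "x = (1 / t) *\<^sub>R (d * d)"
 have "star x = x" by (simp add: x_def star_mult d)
 moreover have "norm x <= 1" using t t0 by (simp add: x_def divide_simps)
 ultimately obtain c where c: "star c = c" "c * c = 1 - x" "calculus_of x c"
  by (rule sqrt_one_minus)
 define b where "b = (1 / sqrt t) *\<^sub>R d"
 have bb: "b * b = x" using t0 by (simp add: b_def x_def)
 have "b * x = x * b" by (simp add: b_def x_def mult.assoc)
 then have "b * c = c * b" by (rule calculus_of_comm[OF c(3)])
 then have "norm (c * c) <= 1"
  by (intro norm_le_of_sum_squares[of c b]) (auto simp: c bb, simp add: b_def d)
 then have "norm (t *\<^sub>R (1 - x)) <= t" using c t0 by (simp add: mult_left_le)
 then show ?thesis using t0 by (simp add: x_def scaleR_right_diff_distrib)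
qed (use t in auto)

lemma cpos_norm_diff: "cpos a ==> norm a <= t ==> norm (t *\<^sub>R 1 - a) <= t"
 unfolding cpos_def using cpos_bound_square by blast

lemma cpos_sqrt:
 assumes "cpos a"
 obtains d where "star d = d" "a = d * d" "calculus_of a d"
 using sqrt_of_norm_criterion[OF cpos_selfadjoint[OF assms] cpos_norm_diff[OF assms order_refl]]
 by blast

lemma cpos_add:
 assumes "cpos a" "cpos b"
 shows "cpos (a + b)"
proof (rule cpos_norm_criterion)
 have "norm ((norm a + norm b) *\<^sub>R 1 - (a + b)) =
    norm ((norm a *\<^sub>R 1 - a) + (norm b *\<^sub>R 1 - b))"
  by (simp add: algebra_simps)
 also have "... <= norm (norm a *\<^sub>R 1 - a) + norm (norm b *\<^sub>R 1 - b)" by (rule norm_triangle_ineq)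
 also have "... <= norm a + norm b"
  by (intro add_mono cpos_norm_diff assms order_refl)
 finally show "norm ((norm a + norm b) *\<^sub>R 1 - (a + b)) <= norm a + norm b" .
qed (simp add: star_add cpos_selfadjoint assms)

lemma cpos_sum: "(!!i. i : I ==> cpos (f i)) ==> cpos (sum f I)"
 by (induction I rule: infinite_finite_induct) (auto intro: cpos_add)

lemma cpos_scalar_minus: "star a = a ==> norm a <= t ==> cpos (t *\<^sub>R 1 - a)"
 by (rule cpos_norm_criterion[of _ t]) auto

lemma cpos_norm_le:
 assumes a: "cpos a" "cpos (s *\<^sub>R 1 - a)" and s: "0 <= s"
 shows "norm a <= s"
proof -
 obtain p where p: "star p = p" "a = p * p" "calculus_of a p" using a(1) by (rule cpos_sqrt)
 obtain r where r: "star r = r" "s *\<^sub>R 1 - a = r * r" "calculus_of (s *\<^sub>R 1 - a) r"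
  using a(2) by (rule cpos_sqrt)
 have "p * (s *\<^sub>R 1 - a) = (s *\<^sub>R 1 - a) * p" by (simp add: p(2) algebra_simps)
 then have "p * r = r * p" by (rule calculus_of_comm[OF r(3)])
 then show ?thesis
  using norm_le_of_sum_squares[OF p(1) r(1) _ _ s] by (simp add: p(2)[symmetric] r(2)[symmetric])
qed

lemma cpos_antisym:
 assumes "cpos a" "cpos (- a)"
 shows "a = 0"
 using cpos_norm_le[of a 0] assms by simp

lemma abs_exists:
 fixes a :: "'a::unital_cstar_algebra"
 assumes a: "star a = a"
 obtains q where "cpos q" "q * q = a * a" "calculus_of a q"
proof -
 define t where "t = norm a + 1"
 have t: "0 < t" "norm a <= t" by (auto simp: t_def add_nonneg_pos)
 define b where "b = (1 / t) *\<^sub>R a"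
 have b: "star b = b" by (simp add: b_def a)
 have "norm b <= 1" using t by (simp add: b_def divide_simps)
 then have "norm (b * b) <= 1" by (simp add: norm_power_selfadjoint b power_le_one)
 then have "norm (1 - b * b) <= 1" using cpos_bound_square[OF b, of 1] by simp
 then obtain d where d: "star d = d" "d * d = b * b" "norm (1 - d) <= 1" "calculus_of (1 - b * b) d"
  using sqrt_one_minus[of "1 - b * b"] by (auto simp: star_mult b)
 have "cpos d" by (rule cpos_norm_criterion[of _ 1]) (use d in auto)
 then have "cpos (t *\<^sub>R d)" using t by (intro cpos_scaleR) auto
 moreover have "(t *\<^sub>R d) * (t *\<^sub>R d) = a * a" using t by (simp add: d(2)) (simp add: b_def)
 moreover have "calculus_of a (1 - b * b)" unfolding b_def
  by (intro calculus_of_diff calculus_of_one calculus_of_mult calculus_of_scaleR calculus_of_refl)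
 then have "calculus_of a (t *\<^sub>R d)" by (intro calculus_of_scaleR) (rule calculus_of_trans[OF _ d(4)])
 ultimately show ?thesis by (rule that)
qed

text \<open>Positive and negative part. At this stage only the cubes of the two parts are seen to be
  positive: they are squares of \<open>p * sqrt |a|\<close>.\<close>

lemma parts_exist:
 fixes a :: "'a::unital_cstar_algebra"
 assumes a: "star a = a"
 obtains p m where "star p = p" "star m = m" "a = p - m" "p * m = 0" "m * p = 0" "cpos (p + m)"
  "calculus_of a p" "calculus_of a m" "cpos (m * m * m)" "cpos (p * p * p)" "cpos (m * m * m * m * m)"
proof -
 obtain q where q: "cpos q" "q * q = a * a" "calculus_of a q" using abs_exists[OF a] .
 obtain k where k: "star k = k" "q = k * k" "calculus_of q k" using q(1) by (rule cpos_sqrt)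
 have sq: "star q = q" using q(1) by (rule cpos_selfadjoint)
 have aq: "a * q = q * a" using calculus_of_comm[OF q(3)] by simp
 define p where "p = (1/2) *\<^sub>R (q + a)"
 define m where "m = (1/2) *\<^sub>R (q - a)"
 have pm: "p + m = q" "p - m = a"
  by (simp_all add: p_def m_def scaleR_right_distrib scaleR_right_diff_distrib flip: scaleR_add_left)
 have 0: "p * m = 0" "m * p = 0" by (simp_all add: p_def m_def algebra_simps q(2) aq)
 have sp: "star p = p" "star m = m" by (simp_all add: p_def m_def star_add sq a)
 have cp: "calculus_of a p" "calculus_of a m" unfolding p_def m_def
  by (intro calculus_of_scaleR calculus_of_add calculus_of_diff calculus_of_refl q(3))+
 have q_split: "q = p + m" using pm by simp
 have *: "cpos (x * x * x)" if x: "x = p | x = m" for x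
 proof -
  have "x * q = q * x" using x 0 by (auto simp: q_split algebra_simps)
  then have xk: "x * k = k * x" by (rule calculus_of_comm[OF k(3)])
  have "x * x * x = x * q * x" using x 0 by (auto simp: q_split algebra_simps)
  also have "... = (x * k) * (x * k)" by (simp add: k(2) xk[symmetric] mult.assoc)
  finally show ?thesis unfolding cpos_def
   using x sp k(1) xk by (intro exI[of _ "x * k"]) (auto simp: star_mult)
 qed
 have "cpos (m * (m * m * m) * m)"
 proof -
  obtain z where z: "star z = z" "m * m * m = z * z" "calculus_of (m * m * m) z"
   using cpos_sqrt *[of m] by blast
  have mz: "m * z = z * m" by (rule calculus_of_comm[OF z(3)]) (simp add: mult.assoc)
  have "m * (m * m * m) * m = (m * z) * (m * z)"
  proof -
   have "m * (m * m * m) * m = m * (z * z) * m" by (simp only: z(2))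
   then have "m * (m * m * m) * m = (m * z) * (z * m)" by (simp only: mult.assoc)
   then show ?thesis by (simp only: mz)
  qed
  then show ?thesis unfolding cpos_def
   by (intro exI[of _ "m * z"]) (simp add: z(1) sp star_mult mz)
 qed
 then have "cpos (m * m * m * m * m)" by (simp add: mult.assoc)
 moreover have "cpos (p + m)" using pm q(1) by simp
 moreover have "cpos (m * m * m)" "cpos (p * p * p)" using * by auto
 ultimately show ?thesis using sp 0 pm(2)[symmetric] cp by (intro that[of p m])
qed

text \<open>If \<open>y y\<^sup>*\<close> and \<open>- y\<^sup>* y\<close> are positive then \<open>y = 0\<close>. With \<open>D = y y\<^sup>*\<close> and
  \<open>t = norm D\<close>, the element \<open>D (t + D)\<^sup>2 = y (t + y\<^sup>* y)\<^sup>2 y\<^sup>*\<close> has norm at most \<open>t\<^sup>3\<close>, but it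
  dominates \<open>2 t D\<^sup>2\<close>, whose norm is \<open>2 t\<^sup>3\<close>.\<close>

lemma star_mult_eq_0_if_cpos_minus:
 fixes y :: "'a::unital_cstar_algebra"
 assumes D: "cpos (y * star y)" and N: "cpos (- (star y * y))"
 shows "y = 0"
proof -
 let ?D = "y * star y"
 define t where "t = norm y ^ 2"
 have t0: "0 <= t" by (simp add: t_def)
 have nD: "norm ?D = t" using cstar_identity[of "star y"] by (simp add: t_def star_star)
 have nN: "norm (star y * y) = t" by (simp add: t_def cstar_identity)
 have n1: "norm (t *\<^sub>R 1 + star y * y) <= t"
  using cpos_norm_diff[OF N, of t] nN by simp
 have eq: "t\<^sup>2 *\<^sub>R ?D + (2 * t) *\<^sub>R (?D * ?D) + ?D * ?D * ?D =
   y * ((t *\<^sub>R 1 + star y * y) * (t *\<^sub>R 1 + star y * y)) * star y"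
  by (simp add: algebra_simps power2_eq_square scaleR_2 flip: scaleR_scaleR)
 have "norm (t\<^sup>2 *\<^sub>R ?D + (2 * t) *\<^sub>R (?D * ?D) + ?D * ?D * ?D) \<le>
    norm y * (norm (t *\<^sub>R 1 + star y * y) * norm (t *\<^sub>R 1 + star y * y)) * norm (star y)"
  unfolding eq
  by (meson mult_mono mult_nonneg_nonneg norm_ge_zero norm_mult_ineq order_refl order_trans)
 also have "... <= norm y * (t * t) * norm (star y)"
  using n1 t0 by (intro mult_right_mono mult_left_mono mult_mono) auto
 also have "... = t ^ 3" by (simp add: t_def power2_eq_square power3_eq_cube)
 finally have up: "norm (t\<^sup>2 *\<^sub>R ?D + (2 * t) *\<^sub>R (?D * ?D) + ?D * ?D * ?D) <= t ^ 3"
  (is "norm ?X <= _") .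
 obtain d where d: "star d = d" "?D = d * d" using D by (auto simp: cpos_def)
 have D2: "cpos (?D * ?D)" unfolding cpos_def by (intro exI[of _ ?D]) (simp add: star_mult star_star)
 have D3: "cpos (?D * ?D * ?D)" unfolding cpos_def
  by (intro exI[of _ "d * d * d"]) (simp add: d star_mult mult.assoc)
 have sX: "star ?X = ?X" by (simp add: star_add star_mult star_star mult.assoc)
 have "cpos (t ^ 3 *\<^sub>R 1 - ?X)" by (rule cpos_scalar_minus[OF sX up])
 then have "cpos ((t ^ 3 *\<^sub>R 1 - ?X) + (t\<^sup>2 *\<^sub>R ?D + ?D * ?D * ?D))"
  using t0 by (intro cpos_add cpos_scaleR D D3) auto
 then have "cpos (t ^ 3 *\<^sub>R 1 - (2 * t) *\<^sub>R (?D * ?D))" by (simp add: algebra_simps)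
 then have "norm ((2 * t) *\<^sub>R (?D * ?D)) <= t ^ 3"
  using t0 by (intro cpos_norm_le cpos_scaleR D2) auto
 moreover have "norm (?D * ?D) = t\<^sup>2"
  by (subst norm_power_selfadjoint) (auto simp: star_mult star_star nD)
 ultimately have "2 * t ^ 3 <= t ^ 3" using t0 by (simp add: power2_eq_square power3_eq_cube)
 then have "t = 0" using t0 by (metis mult_2 add_le_same_cancel1 zero_less_power not_less order_le_less)
 then show ?thesis by (simp add: t_def)
qed

text \<open>Kaplansky's theorem. The negative part \<open>m\<close> of \<open>x\<^sup>* x\<close> gives \<open>y = x m\<close> with
  \<open>- y\<^sup>* y = m\<^sup>3\<close>, and \<open>y y\<^sup>* + y\<^sup>* y\<close> is a sum of two squares.\<close>

theorem cpos_star_mult: "cpos (star x * (x::'a::unital_cstar_algebra))"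
proof -
 let ?a = "star x * x"
 have a: "star ?a = ?a" by (simp add: star_mult star_star)
 obtain p m where pm: "star p = p" "star m = m" "?a = p - m" "p * m = 0" "m * p = 0" "cpos (p + m)"
  "cpos (m * m * m)"
  using parts_exist[OF a] by metis
 define y where "y = x * m"
 have yy: "star y * y = - (m * m * m)"
 proof -
  have "star y * y = m * ?a * m" by (simp add: y_def star_mult pm(2) mult.assoc)
  also have "... = m * p * m - m * m * m"
   by (simp only: pm(3) ring_distribs)
  finally show ?thesis by (simp only: pm(5)) simp
 qed
 define h k where "h = (1/2) *\<^sub>R (y + star y)" and "k = scaleC (- \<i> / 2) (y - star y)"
 have h: "star h = h" by (simp add: h_def star_add star_star add.commute)
 have "star k = scaleC (\<i> / 2) (star y - y)" by (simp add: k_def star_scaleC star_star)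
 also have "... = k" by (simp add: k_def scaleC_diff_right)
 finally have k: "star k = k" .
 have hh: "4 *\<^sub>R (h * h) = y * y + star y * star y + y * star y + star y * y"
 proof -
  have "4 *\<^sub>R (h * h) = (y + star y) * (y + star y)" by (simp add: h_def)
  then show ?thesis by (simp only: ring_distribs add_ac)
 qed
 have kk: "4 *\<^sub>R (k * k) = y * star y + star y * y - y * y - star y * star y"
 proof -
  have "4 *\<^sub>R (k * k) = - ((y - star y) * (y - star y))"
   by (simp add: k_def mult_scaleC_left mult_scaleC_right scaleC_scaleC scaleR_scaleC)
  also have "... = y * star y + star y * y - y * y - star y * star y"
   by (simp only: ring_distribs) simp
  finally show ?thesis .
 qed
 have "2 *\<^sub>R (2 *\<^sub>R (h * h) + 2 *\<^sub>R (k * k)) = 2 *\<^sub>R (y * star y + star y * y)"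
 proof -
  have "2 *\<^sub>R (2 *\<^sub>R (h * h) + 2 *\<^sub>R (k * k)) = 4 *\<^sub>R (h * h) + 4 *\<^sub>R (k * k)"
   by (simp add: scaleR_add_right)
  also have "... = 2 *\<^sub>R (y * star y + star y * y)"
   by (simp add: hh kk scaleR_2)
  finally show ?thesis .
 qed
 then have "2 *\<^sub>R (h * h) + 2 *\<^sub>R (k * k) = y * star y + star y * y" by simp
 then have "y * star y = 2 *\<^sub>R (h * h) + 2 *\<^sub>R (k * k) + m * m * m" by (simp add: yy)
 moreover have "cpos (h * h)" "cpos (k * k)" using h k by (auto simp: cpos_def)
 ultimately have "cpos (y * star y)" using pm(7) by (auto intro!: cpos_add cpos_scaleR)
 moreover have "cpos (- (star y * y))" using pm(7) by (simp add: yy)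
 ultimately have "y = 0" by (rule star_mult_eq_0_if_cpos_minus)
 then have "(m * m) * (m * m) = 0" using yy by (simp add: mult.assoc)
 then have "m * m = 0" by (intro selfadjoint_square_eq_0[of "m * m"]) (simp_all add: star_mult pm(2))
 then have "m = 0" by (rule selfadjoint_square_eq_0[OF pm(2)])
 then show ?thesis using pm(3,6) by simp
qed

lemma cpos_conj:
 assumes "cpos a"
 shows "cpos (star y * a * y)"
proof -
 obtain d where d: "star d = d" "a = d * d" using assms by (auto simp: cpos_def)
 have "star y * a * y = star (d * y) * (d * y)" by (simp add: d star_mult mult.assoc)
 then show ?thesis by (simp add: cpos_star_mult)
qed

lemma cpos_of_cube:
 fixes z :: "'a::unital_cstar_algebra"
 assumes z: "star z = z" and z3: "cpos (z * z * z)"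
 shows "cpos z"
proof -
 obtain p m where pm: "star p = p" "star m = m" "z = p - m" "p * m = 0" "m * p = 0" "cpos (p + m)"
  "cpos (m * m * m * m * m)"
  using parts_exist[OF z] by metis
 have mz: "m * z = - (m * m)" "z * m = - (m * m)"
  unfolding pm(3) by (simp_all add: ring_distribs pm(4,5))
 have "star m * (z * z * z) * m = (m * z) * z * (z * m)" by (simp add: pm mult.assoc)
 also have "... = - ((m * m) * - z * (m * m))" by (simp add: mz)
 also have "... = m * (m * z) * (m * m)" by (simp add: mult.assoc)
 also have "... = - (m * m * m * m * m)" by (simp add: mz mult.assoc)
 finally have "cpos (- (m * m * m * m * m))" using cpos_conj[OF z3, of m] by simp
 with pm(7) have 0: "m * m * m * m * m = 0" by (rule cpos_antisym)
 have "(m * m * m) * (m * m * m) = 0" using 0 by (metis mult.assoc mult_zero_left)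
 then have "m * m * m = 0" by (intro selfadjoint_square_eq_0[of "m * m * m"]) (simp_all add: star_mult pm(2) mult.assoc)
 then have "(m * m) * (m * m) = 0" by (metis mult.assoc mult_zero_left)
 then have "m * m = 0" by (intro selfadjoint_square_eq_0[of "m * m"]) (simp_all add: star_mult pm(2))
 then have "m = 0" by (rule selfadjoint_square_eq_0[OF pm(2)])
 then show ?thesis using pm(3,6) by simp
qed

lemma positive_parts:
 fixes a :: "'a::unital_cstar_algebra"
 assumes "star a = a"
 obtains p m where "cpos p" "cpos m" "a = p - m" "p * m = 0" "calculus_of a p" "calculus_of a m"
proof -
 obtain p m where pm: "star p = p" "star m = m" "a = p - m" "p * m = 0"
  "calculus_of a p" "calculus_of a m" "cpos (m * m * m)" "cpos (p * p * p)"
  using parts_exist[OF assms] by metis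
 show ?thesis
  by (rule that[OF cpos_of_cube[OF pm(1,8)] cpos_of_cube[OF pm(2,7)] pm(3,4,5,6)])
qed

section \<open>Extension of positive functionals\<close>

instantiation "fun" :: (type, real_vector) real_vector
begin

definition scaleR_fun :: "real => ('a => 'b) => 'a => 'b" where
 "scaleR_fun r f = (%x. r *\<^sub>R f x)"

instance
 by standard (auto simp: scaleR_fun_def scaleR_add_right scaleR_add_left)

end

text \<open>A real-linear map is handled as its graph. Positivity makes a linear relation
  single-valued: \<open>(0, r)\<close> and \<open>(0, - r)\<close> in it force \<open>r = 0\<close>.\<close>

definition positive_linear_relation :: "'v::real_vector set => ('v \<times> real) set => bool" where
 "positive_linear_relation K G \<longleftrightarrow>
   (ALL x r y s. (x, r) : G --> (y, s) : G --> (x + y, r + s) : G) \<and>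
   (ALL x r t. (x, r) : G --> (t *\<^sub>R x, t * r) : G) \<and>
   (ALL x r. (x, r) : G --> x : K --> 0 <= r)"

lemma positive_linear_relationI:
 assumes "!!x r y s. (x, r) : G ==> (y, s) : G ==> (x + y, r + s) : G"
  and "!!x r t. (x, r) : G ==> (t *\<^sub>R x, t * r) : G"
  and "!!x r. (x, r) : G ==> x : K ==> 0 <= r"
 shows "positive_linear_relation K G"
 using assms by (auto simp: positive_linear_relation_def)

lemma positive_linear_relationD:
 assumes "positive_linear_relation K G"
 shows "(x, r) : G ==> (y, s) : G ==> (x + y, r + s) : G"
  and "(x, r) : G ==> (t *\<^sub>R x, t * r) : G"
  and "(x, r) : G ==> x : K ==> 0 <= r"
 using assms by (auto simp: positive_linear_relation_def)

lemma positive_linear_relation_extend: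
 fixes K :: "'v::real_vector set"
 assumes K: "!!x y. x : K ==> y : K ==> x + y : K" "!!t x. 0 <= t ==> x : K ==> t *\<^sub>R x : K"
  and G: "positive_linear_relation K G" "(0, 0) : G"
  and dom: "!!v. EX e r. (e, r) : G & e - v : K"
 obtains s where "positive_linear_relation K {(w + t *\<^sub>R v, r + t * s) | w r t. (w, r) : G}"
proof -
 have Ga: "(x + y, r + s) : G" if "(x, r) : G" "(y, s) : G" for x y r s
  using G that by (auto simp: positive_linear_relation_def)
 have Gs: "(t *\<^sub>R x, t * r) : G" if "(x, r) : G" for x r t
  using G that by (auto simp: positive_linear_relation_def)
 have Gp: "0 <= r" if "(x, r) : G" "x : K" for x r
  using G that by (auto simp: positive_linear_relation_def)
 define U where "U = {r. EX w. (w, r) : G & w - v : K}"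
 have U0: "U ~= {}" using dom[of v] by (auto simp: U_def)
 have cross: "- r' <= r" if "(w, r) : G" "w - v : K" "(w', r') : G" "w' + v : K" for w r w' r'
 proof -
  have "(w - v) + (w' + v) : K" by (intro K(1) that)
  then have "w + w' : K" by simp
  then show ?thesis using Gp[OF Ga[OF that(1,3)]] by simp
 qed
 obtain e' r0' where e': "(e', r0') : G" "e' - (- v) : K" using dom[of "- v"] by blast
 then have bdd: "bdd_below U"
  by (intro bdd_belowI[of _ "- r0'"]) (auto simp: U_def intro: cross)
 define s where "s = Inf U"
 have up: "s <= r" if "(w, r) : G" "w - v : K" for w r
  unfolding s_def by (rule cInf_lower[OF _ bdd]) (use that in \<open>auto simp: U_def\<close>)
 have low: "- r <= s" if "(w, r) : G" "w + v : K" for w r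
  unfolding s_def by (rule cInf_greatest[OF U0]) (use that in \<open>auto simp: U_def intro: cross\<close>)
 have "positive_linear_relation K {(w + t *\<^sub>R v, r + t * s) | w r t. (w, r) : G}"
 proof (rule positive_linear_relationI)
  fix x1 q1 x2 q2
  assume "(x1, q1) : {(w + t *\<^sub>R v, r + t * s) | w r t. (w, r) : G}"
   "(x2, q2) : {(w + t *\<^sub>R v, r + t * s) | w r t. (w, r) : G}"
  then obtain w1 r1 t1 w2 r2 t2 where 1: "x1 = w1 + t1 *\<^sub>R v" "q1 = r1 + t1 * s" "(w1, r1) : G"
   and 2: "x2 = w2 + t2 *\<^sub>R v" "q2 = r2 + t2 * s" "(w2, r2) : G" by blast
  have "x1 + x2 = (w1 + w2) + (t1 + t2) *\<^sub>R v" "q1 + q2 = (r1 + r2) + (t1 + t2) * s"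
   by (simp_all add: 1 2 scaleR_add_left ring_distribs)
  with Ga[OF 1(3) 2(3)] show "(x1 + x2, q1 + q2) : {(w + t *\<^sub>R v, r + t * s) | w r t. (w, r) : G}"
   by blast
 next
  fix x q t assume "(x, q) : {(w + t *\<^sub>R v, r + t * s) | w r t. (w, r) : G}"
  then obtain w1 r1 t1 where 1: "x = w1 + t1 *\<^sub>R v" "q = r1 + t1 * s" "(w1, r1) : G" by blast
  have "t *\<^sub>R x = t *\<^sub>R w1 + (t * t1) *\<^sub>R v" "t * q = t * r1 + (t * t1) * s"
   by (simp_all add: 1 scaleR_add_right ring_distribs)
  with Gs[OF 1(3), of t] show "(t *\<^sub>R x, t * q) : {(w + t *\<^sub>R v, r + t * s) | w r t. (w, r) : G}"
   by blast
 next
  fix x q assume "(x, q) : {(w + t *\<^sub>R v, r + t * s) | w r t. (w, r) : G}" and x: "x : K"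
  then obtain w r t where 1: "x = w + t *\<^sub>R v" "q = r + t * s" and wr: "(w, r) : G" by blast
  have wt: "w + t *\<^sub>R v : K" using x 1 by simp
  have "0 <= r + t * s"
  proof (cases t "0 :: real" rule: linorder_cases)
   case equal
   then show ?thesis using Gp[OF wr] wt by simp
  next
   case greater
   have "(1 / t) *\<^sub>R (w + t *\<^sub>R v) : K" using greater by (intro K wt) auto
   moreover have "(1 / t) *\<^sub>R (w + t *\<^sub>R v) = (1 / t) *\<^sub>R w + v"
    using greater by (simp add: scaleR_add_right)
   ultimately have "- ((1 / t) * r) <= s" using low[OF Gs[OF wr, of "1 / t"]] by simp
   then show ?thesis using greater by (simp add: field_simps)
  next
   case less
   have "(- 1 / t) *\<^sub>R (w + t *\<^sub>R v) : K" using less by (intro K wt) (auto simp: divide_nonpos_neg)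
   moreover have "(- 1 / t) *\<^sub>R (w + t *\<^sub>R v) = (- 1 / t) *\<^sub>R w - v"
    using less by (simp add: scaleR_add_right)
   ultimately have "s <= (- 1 / t) * r" using up[OF Gs[OF wr, of "- 1 / t"]] by simp
   then show ?thesis using less by (simp add: field_simps)
  qed
  then show "0 <= q" using 1 by simp
 qed
 then show ?thesis by (rule that)
qed

text \<open>Zorn's lemma on positive linear relations: a maximal one is total, because it could otherwise be
  extended by one dimension.\<close>

theorem riesz_extension:
 fixes K :: "'v::real_vector set" and f :: "'v => real"
 assumes K: "!!x y. x : K ==> y : K ==> x + y : K" "!!t x. 0 <= t ==> x : K ==> t *\<^sub>R x : K"
  and E: "0 : E" "!!x y. x : E ==> y : E ==> x + y : E" "!!t x. x : E ==> t *\<^sub>R x : E"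
  and f: "!!x y. x : E ==> y : E ==> f (x + y) = f x + f y" "!!t x. x : E ==> f (t *\<^sub>R x) = t * f x"
  and pos: "!!x. x : E ==> x : K ==> 0 <= f x"
  and dom: "!!v. \<exists>e\<in>E. e - v : K"
 obtains F where "linear F" "!!x. x : E ==> F x = f x" "!!x. x : K ==> 0 <= F x"
proof -
 define G0 where "G0 = {(x, f x) | x. x : E}"
 define \<A> where "\<A> = {G. positive_linear_relation K G & G0 <= G}"
 have G0: "G0 : \<A>"
  unfolding \<A>_def positive_linear_relation_def G0_def using E f pos by auto
 have "\<exists>M\<in>\<A>. \<forall>X\<in>\<A>. M <= X --> X = M"
 proof (rule subset_Zorn_nonempty)
  fix \<C> assume ne: "\<C> ~= {}" and ch: "subset.chain \<A> \<C>"
  have sub: "\<C> <= \<A>" using ch by (auto simp: subset_chain_def)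
  have two: "\<exists>G\<in>\<C>. p : G & q : G" if "p : \<Union>\<C>" "q : \<Union>\<C>" for p q
  proof -
   obtain G H where "G : \<C>" "p : G" "H : \<C>" "q : H" using \<open>p : \<Union>\<C>\<close> \<open>q : \<Union>\<C>\<close> by blast
   moreover have "G <= H | H <= G" using ch \<open>G : \<C>\<close> \<open>H : \<C>\<close> by (auto simp: subset_chain_def)
   ultimately show ?thesis by blast
  qed
  have pl: "positive_linear_relation K G" if "G : \<C>" for G using sub that by (auto simp: \<A>_def)
  have "positive_linear_relation K (\<Union>\<C>)"
  proof (rule positive_linear_relationI)
   fix x r y s assume "(x, r) : \<Union>\<C>" "(y, s) : \<Union>\<C>"
   then obtain G where "G : \<C>" "(x, r) : G" "(y, s) : G" using two by blast
   then show "(x + y, r + s) : \<Union>\<C>" using positive_linear_relationD(1)[OF pl] by blast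
  next
   fix x r t assume "(x, r) : \<Union>\<C>"
   then show "(t *\<^sub>R x, t * r) : \<Union>\<C>" using positive_linear_relationD(2)[OF pl] by blast
  next
   fix x r assume "(x, r) : \<Union>\<C>" "x : K"
   then show "0 <= r" using positive_linear_relationD(3)[OF pl] by blast
  qed
  moreover have "G0 <= \<Union>\<C>" using ne sub by (auto simp: \<A>_def)
  ultimately show "\<Union>\<C> \<in> \<A>" by (simp add: \<A>_def)
 qed (use G0 in blast)
 then obtain M where M: "positive_linear_relation K M" "G0 <= M"
  and max: "!!X. X : \<A> ==> M <= X ==> X = M"
  by (auto simp: \<A>_def)
 have Ma: "(x + y, r + s) : M" if "(x, r) : M" "(y, s) : M" for x y r s
  using M that by (auto simp: positive_linear_relation_def)
 have Ms: "(t *\<^sub>R x, t * r) : M" if "(x, r) : M" for x r t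
  using M that by (auto simp: positive_linear_relation_def)
 have Mp: "0 <= r" if "(x, r) : M" "x : K" for x r
  using M that by (auto simp: positive_linear_relation_def)
 have Mf: "(x, f x) : M" if "x : E" for x using M that by (auto simp: G0_def)
 have "f (0 *\<^sub>R 0) = 0 * f 0" by (rule f(2)[OF E(1)])
 then have M0: "(0, 0) : M" using Mf[OF E(1)] by simp
 have K0: "0 : K" using dom[of 0] K(2)[of 0] by fastforce
 have total: "EX r. (v, r) : M" for v
 proof -
  obtain s where s: "positive_linear_relation K {(w + t *\<^sub>R v, r + t * s) | w r t. (w, r) : M}"
   by (rule positive_linear_relation_extend[OF K M(1) M0, of v]) (use dom Mf in blast)+
  have sub: "M <= {(w + t *\<^sub>R v, r + t * s) | w r t. (w, r) : M}"
  proof clarify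
   fix w r assume "(w, r) : M"
   then have "EX r' t. w = w + t *\<^sub>R v & r = r' + t * s & (w, r') : M"
    by (intro exI[of _ r] exI[of _ 0]) simp
   then show "EX wa ra t. (w, r) = (wa + t *\<^sub>R v, ra + t * s) & (wa, ra) : M" by blast
  qed
  then have "{(w + t *\<^sub>R v, r + t * s) | w r t. (w, r) : M} = M"
   using M s by (intro max) (auto simp: \<A>_def)
  moreover have "(0 + 1 *\<^sub>R v, 0 + 1 * s) : {(w + t *\<^sub>R v, r + t * s) | w r t. (w, r) : M}"
   using M0 by blast
  ultimately show ?thesis by auto
 qed
 have unique: "r = s" if "(v, r) : M" "(v, s) : M" for v r s
 proof -
  have "(v + (-1) *\<^sub>R v, r + (-1) * s) : M" "(v + (-1) *\<^sub>R v, s + (-1) * r) : M"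
   by (rule Ma Ms that)+
  then have "(0, r - s) : M" "(0, s - r) : M" by simp_all
  then show ?thesis using Mp[OF _ K0, of "r - s"] Mp[OF _ K0, of "s - r"] by simp
 qed
 define F where "F v = (THE r. (v, r) : M)" for v
 have FM: "(v, F v) : M" for v
  unfolding F_def by (rule theI') (use total unique in blast)
 have Feq: "F v = r" if "(v, r) : M" for v r using FM that unique by blast
 show ?thesis
 proof (rule that)
  show "linear F" by (rule linearI) (auto intro!: Feq Ma Ms FM)
 qed (auto intro: Feq Mf Mp FM)
qed

section \<open>Complex matrices\<close>

lemma mult_mat_vec_carrier' [intro]: "A : carrier_mat n m ==> A *\<^sub>v x : carrier_vec n"
 by (auto intro!: carrier_vecI)

lemma adjoint_carrier [simp]: "A : carrier_mat n m ==> adj A : carrier_mat m n"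
 by (auto simp: mat_adjoint_def intro!: carrier_matI)

lemma adjoint_dim [simp]:
 "dim_row (adj A) = dim_col A" "dim_col (adj A) = dim_row A"
 by (auto simp: mat_adjoint_def)

lemma adjoint_index [simp]:
 fixes A :: "complex mat"
 assumes "i < dim_col A" "j < dim_row A"
 shows "adj A $$ (i, j) = cnj (A $$ (j, i))"
 using assms by (simp add: mat_adjoint_def mat_of_rows_index)

lemma adjoint_adjoint [simp]: "adj (adj A) = (A :: complex mat)"
 by (rule eq_matI) auto

lemma adjoint_one [simp]: "adj (1\<^sub>m n) = (1\<^sub>m n :: complex mat)"
 by (rule eq_matI) auto

lemma adjoint_minus:
 "A : carrier_mat n m ==> B : carrier_mat n m ==>
  adj (A - B) = adj A - adj (B :: complex mat)"
 by (rule eq_matI) auto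

lemma adjoint_smult: "adj (c \<cdot>\<^sub>m A) = cnj c \<cdot>\<^sub>m adj (A :: complex mat)"
 by (rule eq_matI) auto

lemma adjoint_mult:
 fixes A B :: "complex mat"
 assumes "A : carrier_mat n m" "B : carrier_mat m k"
 shows "adj (A * B) = adj B * adj A"
 using assms by (intro eq_matI) (auto simp: scalar_prod_def intro!: sum.cong)

lemma cscalar_commute: "x : carrier_vec n ==> y : carrier_vec n ==> x \<bullet>c y = cnj (y \<bullet>c (x :: complex vec))"
 by (auto simp: scalar_prod_def intro!: sum.cong)

lemma cscalar_simps:
 fixes x y z :: "complex vec"
 shows "x : carrier_vec n ==> y : carrier_vec n ==> z : carrier_vec n ==>
   (x + y) \<bullet>c z = x \<bullet>c z + y \<bullet>c z"
  "x : carrier_vec n ==> y : carrier_vec n ==> z : carrier_vec n ==>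
   z \<bullet>c (x + y) = z \<bullet>c x + z \<bullet>c y"
  "x : carrier_vec n ==> z : carrier_vec n ==> (c \<cdot>\<^sub>v x) \<bullet>c z = c * (x \<bullet>c z)"
  "x : carrier_vec n ==> z : carrier_vec n ==> z \<bullet>c (c \<cdot>\<^sub>v x) = cnj c * (z \<bullet>c x)"
  "x : carrier_vec n ==> y : carrier_vec n ==> z : carrier_vec n ==>
   (x - y) \<bullet>c z = x \<bullet>c z - y \<bullet>c z"
  "x : carrier_vec n ==> y : carrier_vec n ==> z : carrier_vec n ==>
   z \<bullet>c (x - y) = z \<bullet>c x - z \<bullet>c y"
 by (simp_all add: scalar_prod_def sum.distrib sum_distrib_left sum_subtractf ring_distribs mult_ac)

lemma cscalar_self: "x \<bullet>c x = complex_of_real (\<Sum>i<dim_vec x. (cmod (x $ i))\<^sup>2)"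
 by (auto simp: scalar_prod_def atLeast0LessThan complex_norm_square[symmetric] simp del: of_real_power
   intro!: sum.cong)

lemma cscalar_self_Re: "x \<bullet>c x = complex_of_real (Re (x \<bullet>c x))" "0 <= Re (x \<bullet>c x)"
 by (auto simp: cscalar_self sum_nonneg)

lemma cscalar_unit:
 "i < n ==> x : carrier_vec n ==> x \<bullet>c unit_vec n i = (x $ i :: complex)"
 by (auto simp: scalar_prod_def unit_vec_def if_distrib[of cnj] sum.delta' cong: if_cong)
   (subst sum.remove[of _ i]; auto)

lemma cscalar_ext:
 fixes x y :: "complex vec"
 assumes "x : carrier_vec n" "y : carrier_vec n" "!!z. z : carrier_vec n ==> x \<bullet>c z = y \<bullet>c z"
 shows "x = y"
proof (rule eq_vecI)
 fix i assume "i < dim_vec y"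
 then have "i < n" using assms by auto
 then show "x $ i = y $ i" using assms(3)[of "unit_vec n i"] by (simp add: cscalar_unit assms)
qed (use assms in auto)

lemma form_expand:
 fixes A :: "complex mat"
 assumes "A : carrier_mat n m" "x : carrier_vec m" "y : carrier_vec n"
 shows "(A *\<^sub>v x) \<bullet>c y = (\<Sum>i<n. \<Sum>j<m. A $$ (i, j) * x $ j * cnj (y $ i))"
 using assms by (auto simp: scalar_prod_def atLeast0LessThan sum_distrib_right intro!: sum.cong)

lemma form_adjoint:
 fixes A :: "complex mat"
 assumes "A : carrier_mat n m" "x : carrier_vec m" "y : carrier_vec n"
 shows "x \<bullet>c (adj A *\<^sub>v y) = (A *\<^sub>v x) \<bullet>c y"
proof -
 have "x \<bullet>c (adj A *\<^sub>v y) = cnj ((adj A *\<^sub>v y) \<bullet>c x)"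
  by (rule cscalar_commute[of _ m]) (use assms in \<open>auto intro: mult_mat_vec_carrier' adjoint_carrier\<close>)
 also have "(adj A *\<^sub>v y) \<bullet>c x = (\<Sum>i<m. \<Sum>j<n. adj A $$ (i, j) * y $ j * cnj (x $ i))"
  by (rule form_expand) (use assms in auto)
 also have "cnj ... = (\<Sum>i<m. \<Sum>j<n. A $$ (j, i) * x $ i * cnj (y $ j))"
  using assms by (auto intro!: sum.cong)
 also have "... = (A *\<^sub>v x) \<bullet>c y" unfolding form_expand[OF assms] by (rule sum.swap)
 finally show ?thesis .
qed

lemma form_adjoint':
 fixes A :: "complex mat"
 assumes "A : carrier_mat n m" "x : carrier_vec m" "y : carrier_vec n"
 shows "(adj A *\<^sub>v y) \<bullet>c x = y \<bullet>c (A *\<^sub>v x)"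
 using form_adjoint[of "adj A" m n y x] assms by simp

lemma form_unit:
 fixes A :: "complex mat"
 assumes "A : carrier_mat n m" "i < n" "j < m"
 shows "(A *\<^sub>v unit_vec m j) \<bullet>c unit_vec n i = A $$ (i, j)"
proof -
 have "(A *\<^sub>v unit_vec m j) $ i = A $$ (i, j)" using assms by simp
 then show ?thesis using assms by (subst cscalar_unit) auto
qed

lemma mat_eq_formI:
 fixes A B :: "complex mat"
 assumes "A : carrier_mat n m" "B : carrier_mat n m"
  "!!x y. x : carrier_vec m ==> y : carrier_vec n ==> (A *\<^sub>v x) \<bullet>c y = (B *\<^sub>v x) \<bullet>c y"
 shows "A = B"
proof (rule eq_matI)
 fix i j assume "i < dim_row B" "j < dim_col B"
 then have ij: "i < n" "j < m" using assms by auto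
 show "A $$ (i, j) = B $$ (i, j)"
  using assms(3)[of "unit_vec m j" "unit_vec n i"] form_unit[OF assms(1) ij] form_unit[OF assms(2) ij]
  by simp
qed (use assms in auto)

lemma mat_eq_vecI:
 fixes A B :: "complex mat"
 assumes "A : carrier_mat n m" "B : carrier_mat n m"
  "!!x. x : carrier_vec m ==> A *\<^sub>v x = B *\<^sub>v x"
 shows "A = B"
 by (rule mat_eq_formI[OF assms(1,2)]) (simp add: assms(3))

lemma mat_sum_carrier [simp]: "mat_sum n r F : carrier_mat n n"
 by (simp add: mat_sum_def)

lemma mat_sum_form:
 assumes "!!i. i < r ==> F i : carrier_mat n n" "x : carrier_vec n" "y : carrier_vec n"
 shows "(mat_sum n r F *\<^sub>v x) \<bullet>c y = (\<Sum>i<r. (F i *\<^sub>v x) \<bullet>c y)"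
proof -
 have "(mat_sum n r F *\<^sub>v x) \<bullet>c y = (\<Sum>a<n. \<Sum>b<n. (\<Sum>i<r. F i $$ (a, b)) * x $ b * cnj (y $ a))"
  by (subst form_expand[of _ n n]) (use assms in \<open>auto simp: mat_sum_def intro!: sum.cong\<close>)
 also have "... = (\<Sum>a<n. \<Sum>i<r. \<Sum>b<n. F i $$ (a, b) * x $ b * cnj (y $ a))"
  by (simp add: sum_distrib_right) (rule sum.cong[OF refl], rule sum.swap)
 also have "... = (\<Sum>i<r. \<Sum>a<n. \<Sum>b<n. F i $$ (a, b) * x $ b * cnj (y $ a))" by (rule sum.swap)
 also have "... = (\<Sum>i<r. (F i *\<^sub>v x) \<bullet>c y)"
  by (intro sum.cong) (use assms form_expand[of _ n n x y] in auto)
 finally show ?thesis .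
qed

lemma conj_form:
 fixes A g :: "complex mat"
 assumes "g : carrier_mat m n" "A : carrier_mat m m" "x : carrier_vec n" "y : carrier_vec n"
 shows "((adj g * A * g) *\<^sub>v x) \<bullet>c y = (A *\<^sub>v (g *\<^sub>v x)) \<bullet>c (g *\<^sub>v y)"
proof -
 have g': "adj g : carrier_mat n m" using assms by simp
 have "(adj g * A * g) *\<^sub>v x = (adj g * A) *\<^sub>v (g *\<^sub>v x)"
  by (rule assoc_mult_mat_vec[OF mult_carrier_mat[OF g' assms(2)] assms(1,3)])
 also have "... = adj g *\<^sub>v (A *\<^sub>v (g *\<^sub>v x))"
  by (rule assoc_mult_mat_vec[OF g' assms(2)]) (use assms in auto)
 finally have "(adj g * A * g) *\<^sub>v x = adj g *\<^sub>v (A *\<^sub>v (g *\<^sub>v x))" .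
 then show ?thesis using assms
  by (simp add: form_adjoint'[of _ m n] mult_mat_vec_carrier'[of _ m m])
qed

lemma gram_form:
 fixes g :: "complex mat"
 assumes "g : carrier_mat m n" "x : carrier_vec n" "y : carrier_vec n"
 shows "((adj g * g) *\<^sub>v x) \<bullet>c y = (g *\<^sub>v x) \<bullet>c (g *\<^sub>v y)"
 using assms by (simp add: form_adjoint'[of _ m n] assoc_mult_mat_vec[of _ n m])

definition tr :: "complex mat => complex" where
 "tr A = (\<Sum>i<dim_row A. A $$ (i, i))"

lemma tr_mult_commute:
 assumes "A : carrier_mat n m" "B : carrier_mat m n"
 shows "tr (A * B) = tr (B * A)"
proof -
 have "tr (A * B) = (\<Sum>i<n. \<Sum>j<m. A $$ (i, j) * B $$ (j, i))"
  using assms by (auto simp: tr_def scalar_prod_def atLeast0LessThan intro!: sum.cong)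
 also have "... = (\<Sum>j<m. \<Sum>i<n. A $$ (i, j) * B $$ (j, i))" by (rule sum.swap)
 also have "... = tr (B * A)"
  using assms by (auto simp: tr_def scalar_prod_def atLeast0LessThan mult.commute intro!: sum.cong)
 finally show ?thesis .
qed

section \<open>Factorisation of positive semidefinite matrices\<close>

text \<open>Cholesky's elimination step. The dual vectors \<open>h\<close> express that the rows \<open>g\<close> of the factor
  are linearly independent.\<close>

lemma psd_factor:
 fixes G :: "'i => 'i => complex"
 assumes I: "finite I" and psd: "!!x. 0 <= (\<Sum>i\<in>I. \<Sum>j\<in>I. cnj (x i) * G i j * x j)"
 shows "EX (r::nat) g h. (\<forall>i\<in>I. \<forall>j\<in>I. G i j = (\<Sum>t<r. cnj (g t i) * g t j)) \<and>
  (ALL t<r. ALL s<r. (\<Sum>i\<in>I. g t i * h s i) = (if t = s then 1 else 0))"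
 using psd
proof (induction "card {j\<in>I. G j j ~= 0}" arbitrary: G rule: less_induct)
 case (less G)
 define Q where "Q x = (\<Sum>i\<in>I. \<Sum>j\<in>I. cnj (x i) * G i j * x j)" for x
 have Qpos: "0 <= Q x" for x using less.prems by (simp add: Q_def)
 have expand: "Q (%k. x k + (if k = j then b else 0)) =
   Q x + cnj b * (\<Sum>k\<in>I. G j k * x k) + b * (\<Sum>i\<in>I. cnj (x i) * G i j) + cnj b * b * G j j"
  if "j : I" for x j b
 proof -
  have "Q (%k. x k + (if k = j then b else 0)) =
   (\<Sum>i\<in>I. \<Sum>k\<in>I. cnj (x i) * G i k * x k + (if i = j then cnj b * G j k * x k else 0) +
     (if k = j then cnj (x i) * G i j * b else 0) + (if i = j & k = j then cnj b * G j j * b else 0))"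
   unfolding Q_def by (intro sum.cong) (auto simp: algebra_simps)
  also have "... = Q x + (\<Sum>i\<in>I. \<Sum>k\<in>I. if i = j then cnj b * G j k * x k else 0) +
    (\<Sum>i\<in>I. \<Sum>k\<in>I. if k = j then cnj (x i) * G i j * b else 0) +
    (\<Sum>i\<in>I. \<Sum>k\<in>I. if i = j & k = j then cnj b * G j j * b else 0)"
   by (simp add: sum.distrib Q_def)
  also have "(\<Sum>i\<in>I. \<Sum>k\<in>I. if i = j then cnj b * G j k * x k else 0) = cnj b * (\<Sum>k\<in>I. G j k * x k)"
   by (subst sum.swap) (simp add: I that sum_distrib_left mult.assoc)
  also have "(\<Sum>i\<in>I. \<Sum>k\<in>I. if k = j then cnj (x i) * G i j * b else 0) = b * (\<Sum>i\<in>I. cnj (x i) * G i j)"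
   by (simp add: I that sum_distrib_left mult_ac)
  also have "(\<Sum>i\<in>I. \<Sum>k\<in>I. if i = j & k = j then cnj b * G j j * b else 0) = cnj b * b * G j j"
  proof -
   have "(\<Sum>i\<in>I. \<Sum>k\<in>I. if i = j & k = j then cnj b * G j j * b else 0) =
     (\<Sum>i\<in>I. if i = j then \<Sum>k\<in>I. if k = j then cnj b * G j j * b else 0 else 0)"
    by (intro sum.cong) auto
   then show ?thesis using I that by (simp add: mult_ac)
  qed
  finally show ?thesis .
 qed
 have two: "Q (%k. (if k = i then a else 0) + (if k = j then b else 0)) =
   cnj a * a * G i i + cnj b * a * G j i + b * cnj a * G i j + cnj b * b * G j j"
  if "i : I" "j : I" for i j a b
 proof -
  have "Q (%k. if k = i then a else 0) = cnj a * a * G i i"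
   using expand[OF that(1), of "%_. 0" a] by (simp add: Q_def)
  moreover have "(\<Sum>k\<in>I. G j k * (if k = i then a else 0)) = G j i * a"
   using I that by (simp add: if_distrib cong: if_cong)
  moreover have "(\<Sum>k\<in>I. cnj (if k = i then a else 0) * G k j) = cnj a * G i j"
   using I that by (simp add: if_distrib if_distribR cong: if_cong)
  ultimately show ?thesis unfolding expand[OF that(2)] by (simp add: algebra_simps)
 qed
 have diag: "0 <= G j j" if "j : I" for j
  using Qpos[of "%k. (if k = j then 1 else 0) + (if k = j then 0 else 0)"] two[OF that that, of 1 0] by simp
 have imd: "Im (G j j) = 0" if "j : I" for j using diag[OF that] by (simp add: less_eq_complex_def)
 have herm: "G i j = cnj (G j i)" if ij: "i : I" "j : I" for i j
 proof -
  have "Im (G j i + G i j) = 0"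
   using Qpos[of "%k. (if k = i then 1 else 0) + (if k = j then 1 else 0)"]
   unfolding two[OF ij] by (simp add: less_eq_complex_def imd ij)
  moreover have "Re (G i j) = Re (G j i)"
   using Qpos[of "%k. (if k = i then 1 else 0) + (if k = j then \<i> else 0)"]
   unfolding two[OF ij] by (simp add: less_eq_complex_def imd ij)
  ultimately show ?thesis by (simp add: complex_eq_iff)
 qed
 have null: "G i j = 0" "G j i = 0" if ij: "i : I" "j : I" and 0: "G j j = 0" for i j
 proof -
  show *: "G j i = 0"
  proof (rule ccontr)
   assume "G j i ~= 0"
   then have p: "0 < (cmod (G j i))\<^sup>2" by simp
   define t where "t = (Re (G i i) + 1) / (2 * (cmod (G j i))\<^sup>2)"
   have sq: "G j i * cnj (G j i) = complex_of_real ((cmod (G j i))\<^sup>2)"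
    by (simp only: complex_norm_square)
   have tp: "2 * t * (cmod (G j i))\<^sup>2 = Re (G i i) + 1" using p by (simp add: t_def)
   have "Q (%k. (if k = i then 1 else 0) + (if k = j then - of_real t * G j i else 0)) =
     G i i - of_real t * (cnj (G j i) * G j i) - of_real t * (G j i * cnj (G j i))"
    unfolding two[OF ij] 0 using herm[OF ij] by simp
   also have "... = G i i - of_real (2 * t * (cmod (G j i))\<^sup>2)"
    by (simp add: sq mult.commute[of "cnj _"] mult_ac)
   also have "... = G i i - of_real (Re (G i i) + 1)" by (simp only: tp)
   finally have eq: "Q (%k. (if k = i then 1 else 0) + (if k = j then - of_real t * G j i else 0)) =
    G i i - of_real (Re (G i i) + 1)" .
   show False
    using Qpos[of "%k. (if k = i then 1 else 0) + (if k = j then - of_real t * G j i else 0)"]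
    unfolding eq by (simp add: less_eq_complex_def)
  qed
  then show "G i j = 0" using herm[OF ij] by simp
 qed
 show ?case
 proof (cases "\<exists>j\<in>I. G j j ~= 0")
  case False
  then have "G i j = 0" if "i : I" "j : I" for i j using null(1)[OF that] that by blast
  then show ?thesis by (intro exI[of _ 0]) simp
 next
  case True
  then obtain j where j: "j : I" "G j j ~= 0" by blast
  define p where "p = Re (G j j)"
  have Gp: "G j j = of_real p" using imd[OF j(1)] by (simp add: p_def complex_eq_iff)
  have "0 <= p" using diag[OF j(1)] unfolding Gp by (simp add: less_eq_complex_def)
  moreover have "p ~= 0" using j(2) unfolding Gp by simp
  ultimately have p: "0 < p" by simp
  define G' where "G' i k = G i k - G i j * G j k / G j j" for i k
  have "0 <= (\<Sum>i\<in>I. \<Sum>k\<in>I. cnj (x i) * G' i k * x k)" for x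
  proof -
   define a where "a = (\<Sum>k\<in>I. G j k * x k)"
   have ca: "(\<Sum>i\<in>I. cnj (x i) * G i j) = cnj a"
    unfolding a_def using herm[OF _ j(1)] by (auto simp: mult.commute intro!: sum.cong)
   have "Q (%k. x k + (if k = j then - a / G j j else 0)) = Q x - cnj a * a / G j j"
    unfolding expand[OF j(1)] ca a_def[symmetric] using j(2) by (simp add: Gp field_simps)
   also have "... = Q x - (\<Sum>i\<in>I. cnj (x i) * G i j) * (\<Sum>k\<in>I. G j k * x k) / G j j"
    by (simp only: ca a_def[symmetric])
   also have "... = (\<Sum>i\<in>I. \<Sum>k\<in>I. cnj (x i) * G' i k * x k)"
    unfolding Q_def G'_def sum_product sum_divide_distrib sum_subtractf[symmetric]
    by (intro sum.cong) (auto simp: algebra_simps)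
   finally show ?thesis using Qpos by metis
  qed
  moreover have "{k\<in>I. G' k k ~= 0} \<subset> {k\<in>I. G k k ~= 0}"
  proof
   show "{k\<in>I. G' k k ~= 0} <= {k\<in>I. G k k ~= 0}"
   proof clarify
    fix k assume k: "k : I" "G' k k ~= 0" "G k k = 0"
    then show False using null(2)[OF j(1) k(1,3)] by (simp add: G'_def)
   qed
   have "j : {k\<in>I. G k k ~= 0}" "G' j j = 0" using j by (simp_all add: G'_def)
   then show "{k\<in>I. G' k k ~= 0} ~= {k\<in>I. G k k ~= 0}" by blast
  qed
  then have "card {k\<in>I. G' k k ~= 0} < card {k\<in>I. G k k ~= 0}" using I by (intro psubset_card_mono) auto
  ultimately obtain r :: nat and g h where g: "\<forall>i\<in>I. \<forall>k\<in>I. G' i k = (\<Sum>t<r. cnj (g t i) * g t k)"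
   and h: "ALL t<r. ALL s<r. (\<Sum>i\<in>I. g t i * h s i) = (if t = s then 1 else 0)"
   using less.hyps[of G'] by blast
  have gj: "g t j = 0" if "t < r" for t
  proof -
   have "(\<Sum>t<r. cnj (g t j) * g t j) = G' j j" using g j(1) by simp
   also have "... = 0" using j(2) by (simp add: G'_def)
   finally have "(\<Sum>t<r. cnj (g t j) * g t j) = 0" .
   moreover have "(\<Sum>t<r. cnj (g t j) * g t j) = complex_of_real (\<Sum>t<r. (cmod (g t j))\<^sup>2)"
    unfolding of_real_sum complex_norm_square by (simp add: mult.commute)
   ultimately have "complex_of_real (\<Sum>t<r. (cmod (g t j))\<^sup>2) = 0" by simp
   then have "(\<Sum>t<r. (cmod (g t j))\<^sup>2) = 0" using of_real_eq_0_iff by blast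
   then show ?thesis using that by (simp add: sum_nonneg_eq_0_iff)
  qed
  define q where "q = complex_of_real (sqrt p)"
  have q: "q ~= 0" "cnj q = q" "q * q = G j j" using p by (auto simp: q_def Gp simp flip: of_real_mult)
  define gr where "gr i = G j i / q" for i
  define g' where "g' t = (if t < r then g t else gr)" for t
  define h' where "h' s = (if s < r then (%i. h s i - (if i = j then (\<Sum>i\<in>I. gr i * h s i) / q else 0))
    else (%i. if i = j then 1 / q else 0))" for s
  have grj: "gr j = q" using q by (simp add: gr_def flip: q(3))
  have "G i k = (\<Sum>t<Suc r. cnj (g' t i) * g' t k)" if ik: "i : I" "k : I" for i k
  proof -
   have "(\<Sum>t<Suc r. cnj (g' t i) * g' t k) = G' i k + cnj (gr i) * gr k"
    using g ik by (simp add: g'_def)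
   also have "cnj (gr i) * gr k = G i j * G j k / G j j"
    using herm[OF ik(1) j(1)] by (simp add: gr_def q(2) flip: q(3))
   finally show ?thesis by (simp add: G'_def)
  qed
  moreover have "(\<Sum>i\<in>I. g' t i * h' s i) = (if t = s then 1 else 0)" if ts: "t < Suc r" "s < Suc r" for t s
  proof (cases "s < r")
   case True
   have "(\<Sum>i\<in>I. g' t i * h' s i) = (\<Sum>i\<in>I. g' t i * h s i) -
     g' t j * ((\<Sum>i\<in>I. gr i * h s i) / q)"
   proof -
    have "(\<Sum>i\<in>I. g' t i * h' s i) = (\<Sum>i\<in>I. g' t i * h s i -
      (if i = j then g' t j * ((\<Sum>i\<in>I. gr i * h s i) / q) else 0))"
     using True by (intro sum.cong) (auto simp: h'_def right_diff_distrib)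
    then show ?thesis using I j(1) by (simp add: sum_subtractf)
   qed
   also have "... = (if t = s then 1 else 0)"
    using True ts h by (cases "t < r") (auto simp: g'_def gj grj q)
   finally show ?thesis .
  next
   case False
   then have s: "s = r" using ts by simp
   have "(\<Sum>i\<in>I. g' t i * h' s i) = g' t j / q"
    using I j(1) by (simp add: s h'_def if_distrib cong: if_cong)
   also have "... = (if t = s then 1 else 0)"
    using ts by (cases "t < r") (auto simp: g'_def s gj grj q)
   finally show ?thesis .
  qed
  ultimately show ?thesis
   by (intro exI[of _ "Suc r"] exI[of _ g'] exI[of _ h'] conjI ballI allI impI)
 qed
qed

lemma psd_factor_mat:
 fixes G :: "complex mat"
 assumes G: "G : carrier_mat n n" and psd: "!!x. x : carrier_vec n ==> 0 <= (G *\<^sub>v x) \<bullet>c x"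
 obtains r c e where "c : carrier_mat r n" "e : carrier_mat n r" "adj c * c = G" "c * e = 1\<^sub>m r"
proof -
 have "0 <= (\<Sum>i\<in>{..<n}. \<Sum>j\<in>{..<n}. cnj (x i) * G $$ (i, j) * x j)" for x
 proof -
  have "(G *\<^sub>v vec n x) \<bullet>c vec n x = (\<Sum>i<n. \<Sum>j<n. cnj (x i) * G $$ (i, j) * x j)"
   unfolding form_expand[OF G vec_carrier vec_carrier]
   by (intro sum.cong refl) (simp add: mult_ac)
  then show ?thesis using psd[of "vec n x"] by simp
 qed
 then have "EX (r::nat) g h. (\<forall>i\<in>{..<n}. \<forall>j\<in>{..<n}. G $$ (i, j) = (\<Sum>t<r. cnj (g t i) * g t j)) \<and>
  (ALL t<r. ALL s<r. (\<Sum>i<n. g t i * h s i) = (if t = s then 1 else 0))"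
  by (rule psd_factor[OF finite_lessThan])
 then obtain r :: nat and g h where
  gh: "\<forall>i\<in>{..<n}. \<forall>j\<in>{..<n}. G $$ (i, j) = (\<Sum>t<r. cnj (g t i) * g t j)"
   "ALL t<r. ALL s<r. (\<Sum>i<n. g t i * h s i) = (if t = s then 1 else 0)"
  by blast
 have g: "G $$ (i, j) = (\<Sum>t<r. cnj (g t i) * g t j)" if "i < n" "j < n" for i j using gh(1) that by simp
 have h: "(\<Sum>i<n. g t i * h s i) = (if t = s then 1 else 0)" if "t < r" "s < r" for t s
  using gh(2) that by simp
 show ?thesis
 proof (rule that)
  let ?c = "mat r n (%(t, i). g t i)" and ?e = "mat n r (%(i, s). h s i)"
  show "?c : carrier_mat r n" "?e : carrier_mat n r" by auto
  show "adj ?c * ?c = G"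
   using G by (intro eq_matI) (auto simp: scalar_prod_def g atLeast0LessThan)
  show "?c * ?e = 1\<^sub>m r"
   by (intro eq_matI) (auto simp: scalar_prod_def h atLeast0LessThan)
 qed
qed

lemma isometry_completion:
 fixes V :: "complex mat"
 assumes V: "V : carrier_mat n d" and iso: "adj V * V = 1\<^sub>m d"
 obtains r c where "c : carrier_mat r n" "n = d + r" "c * adj c = 1\<^sub>m r" "c * V = 0\<^sub>m r d"
  "adj c * c + V * adj V = 1\<^sub>m n"
proof -
 define P where "P = V * adj V"
 define Q where "Q = 1\<^sub>m n - P"
 have P: "P : carrier_mat n n" using V by (auto simp: P_def)
 have Q: "Q : carrier_mat n n" using P by (auto simp: Q_def)
 have V': "adj V : carrier_mat d n" using V by simp
 have PV: "P * V = V" unfolding P_def assoc_mult_mat[OF V V' V] iso using V by simp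
 have "P * P = (P * V) * adj V"
  using assoc_mult_mat[OF P V V'] by (simp add: P_def)
 then have PP: "P * P = P" by (simp add: PV) (simp add: P_def)
 have sP: "adj P = P" by (simp add: P_def adjoint_mult[OF V V'])
 have QV: "Q * V = 0\<^sub>m n d"
  unfolding Q_def minus_mult_distrib_mat[OF one_carrier_mat P V] PV using V by simp
 have sQ: "adj Q = Q" unfolding Q_def adjoint_minus[OF one_carrier_mat P] sP by simp
 have QP: "Q * P = 0\<^sub>m n n"
  unfolding Q_def minus_mult_distrib_mat[OF one_carrier_mat P P] PP using P by simp
 have "Q * (1\<^sub>m n - P) = Q * 1\<^sub>m n - Q * P" by (rule mult_minus_distrib_mat[OF Q one_carrier_mat P])
 also have "... = Q" unfolding QP using Q by (intro eq_matI) auto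
 finally have QQ: "Q * Q = Q" unfolding Q_def[symmetric] .
 have "0 <= (Q *\<^sub>v x) \<bullet>c x" if "x : carrier_vec n" for x
 proof -
  have "(Q *\<^sub>v x) \<bullet>c x = ((adj Q * Q) *\<^sub>v x) \<bullet>c x" by (simp add: sQ QQ)
  also have "... = (Q *\<^sub>v x) \<bullet>c (Q *\<^sub>v x)" by (rule gram_form[OF Q that that])
  finally show ?thesis by (metis conjugate_square_ge_0_vec)
 qed
 then obtain r c e where c: "c : carrier_mat r n" "e : carrier_mat n r" "adj c * c = Q" "c * e = 1\<^sub>m r"
  using psd_factor_mat[OF Q] by metis
 have c': "adj c : carrier_mat n r" and e': "adj e : carrier_mat r n" using c by auto
 have ec: "adj e * adj c = 1\<^sub>m r"
  using adjoint_mult[OF c(1,2)] c(4) by simp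
 have cQ: "c * X = adj e * (Q * X)" if X: "X : carrier_mat n k" for X k
 proof -
  have cX: "c * X : carrier_mat r k" using c X by simp
  have "Q * X = adj c * (c * X)" unfolding c(3)[symmetric] by (rule assoc_mult_mat[OF c' c(1) X])
  then have "adj e * (Q * X) = (adj e * adj c) * (c * X)"
   using assoc_mult_mat[OF e' c' cX] by simp
  then show ?thesis by (simp only: ec left_mult_one_mat[OF cX])
 qed
 have cV: "c * V = 0\<^sub>m r d" unfolding cQ[OF V] QV by (rule right_mult_zero_mat[OF e'])
 have ceQ: "c = adj e * Q" using cQ[OF one_carrier_mat] c Q e' by simp
 have cQc: "c * Q = c" using cQ[OF Q] by (simp add: QQ flip: ceQ)
 have cc1: "c * adj c : carrier_mat r r" using c(1) c' by simp
 have "c * adj c = c * adj c * (c * e)" by (simp only: c(4) right_mult_one_mat[OF cc1])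
 also have "... = c * adj c * c * e" by (rule assoc_mult_mat[OF cc1 c(1,2), symmetric])
 also have "c * adj c * c = c * Q" unfolding assoc_mult_mat[OF c(1) c' c(1)] c(3) ..
 finally have cc: "c * adj c = 1\<^sub>m r" by (simp add: cQc c(4))
 have sum: "adj c * c + V * adj V = 1\<^sub>m n"
  unfolding c(3) P_def[symmetric] Q_def using P by (intro eq_matI) auto
 have "tr (1\<^sub>m n) = tr (adj c * c) + tr (V * adj V)"
  unfolding sum[symmetric] using c(1) c' V V' by (simp add: tr_def sum.distrib)
 also have "tr (adj c * c) = tr (1\<^sub>m r)" using tr_mult_commute[OF c' c(1)] cc by simp
 also have "tr (V * adj V) = tr (1\<^sub>m d)" using tr_mult_commute[OF V V'] iso by simp
 finally have "complex_of_nat n = of_nat (d + r)" by (simp add: tr_def)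
 then have "n = d + r" using of_nat_eq_iff by blast
 with c cc cV sum show ?thesis by (intro that)
qed

section \<open>Completely positive maps on the whole algebra\<close>

definition cp_map :: "nat => ('a::unital_cstar_algebra => complex mat) => bool" where
 "cp_map d \<Phi> \<longleftrightarrow>
   (ALL x. \<Phi> x : carrier_mat d d) & (ALL x y. \<Phi> (x + y) = \<Phi> x + \<Phi> y) \<and>
   (ALL c x. \<Phi> (scaleC c x) = c \<cdot>\<^sub>m \<Phi> x) \<and>
   (ALL k a \<xi>. (ALL i<k. \<xi> i : carrier_vec d) -->
    0 <= (\<Sum>i<(k::nat). \<Sum>j<k. (\<Phi> (star (a i) * a j) *\<^sub>v \<xi> j) \<bullet>c \<xi> i))"

lemma smult_mat_vec_form:
 fixes A :: "complex mat"
 assumes "A : carrier_mat n m" "x : carrier_vec m" "y : carrier_vec n"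
 shows "((c \<cdot>\<^sub>m A) *\<^sub>v x) \<bullet>c y = c * ((A *\<^sub>v x) \<bullet>c y)"
 using assms form_expand[OF assms] form_expand[of "c \<cdot>\<^sub>m A" n m x y]
 by (simp add: sum_distrib_left mult.assoc)

lemma add_mat_vec_form:
 fixes A :: "complex mat"
 assumes "A : carrier_mat n m" "B : carrier_mat n m" "x : carrier_vec m" "y : carrier_vec n"
 shows "((A + B) *\<^sub>v x) \<bullet>c y = (A *\<^sub>v x) \<bullet>c y + (B *\<^sub>v x) \<bullet>c y"
 using assms form_expand[of A n m x y] form_expand[of B n m x y] form_expand[of "A + B" n m x y]
 by (simp add: sum.distrib ring_distribs)

lemma zero_mat_mult_vec: "\<xi> : carrier_vec m ==> 0\<^sub>m n m *\<^sub>v \<xi> = 0\<^sub>v n"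
 by (intro eq_vecI) auto

lemma mat_eq_quadI:
 fixes A B :: "complex mat"
 assumes A: "A : carrier_mat n n" and B: "B : carrier_mat n n"
  and eq: "!!x. x : carrier_vec n ==> (A *\<^sub>v x) \<bullet>c x = (B *\<^sub>v x) \<bullet>c x"
 shows "A = B"
proof (rule mat_eq_formI[OF A B])
 fix x y :: "complex vec" assume x: "x : carrier_vec n" and y: "y : carrier_vec n"
 have ex: "(M *\<^sub>v (x + c \<cdot>\<^sub>v y)) \<bullet>c (x + c \<cdot>\<^sub>v y) = (M *\<^sub>v x) \<bullet>c x + cnj c * ((M *\<^sub>v x) \<bullet>c y) +
   c * ((M *\<^sub>v y) \<bullet>c x) + c * cnj c * ((M *\<^sub>v y) \<bullet>c y)" if M: "M : carrier_mat n n" for M c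
 proof -
  have "M *\<^sub>v (x + c \<cdot>\<^sub>v y) = M *\<^sub>v x + c \<cdot>\<^sub>v (M *\<^sub>v y)"
   using M x y by (simp add: mult_add_distrib_mat_vec[of M n n] mult_mat_vec[of M n n])
  moreover have "M *\<^sub>v x : carrier_vec n" "M *\<^sub>v y : carrier_vec n" using M by auto
  ultimately show ?thesis using x y
   by (simp add: cscalar_simps[of _ n] algebra_simps)
 qed
 have 1: "(A *\<^sub>v x) \<bullet>c y + (A *\<^sub>v y) \<bullet>c x = (B *\<^sub>v x) \<bullet>c y + (B *\<^sub>v y) \<bullet>c x"
  using eq[of "x + 1 \<cdot>\<^sub>v y"] ex[OF A, of 1] ex[OF B, of 1] eq[OF x] eq[OF y] x y by simp
 have "- \<i> * ((A *\<^sub>v x) \<bullet>c y) + \<i> * ((A *\<^sub>v y) \<bullet>c x) = - \<i> * ((B *\<^sub>v x) \<bullet>c y) + \<i> * ((B *\<^sub>v y) \<bullet>c x)"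
  using eq[of "x + \<i> \<cdot>\<^sub>v y"] ex[OF A, of \<i>] ex[OF B, of \<i>] eq[OF x] eq[OF y] x y by simp
 then have "\<i> * (- ((A *\<^sub>v x) \<bullet>c y) + (A *\<^sub>v y) \<bullet>c x) = \<i> * (- ((B *\<^sub>v x) \<bullet>c y) + (B *\<^sub>v y) \<bullet>c x)"
  by (simp only: ring_distribs) simp
 then have 2: "- ((A *\<^sub>v x) \<bullet>c y) + (A *\<^sub>v y) \<bullet>c x = - ((B *\<^sub>v x) \<bullet>c y) + (B *\<^sub>v y) \<bullet>c x"
  by (simp only: mult_cancel_left) simp
 have "2 * ((A *\<^sub>v x) \<bullet>c y) = 2 * ((B *\<^sub>v x) \<bullet>c y)"
  using arg_cong2[OF 1 2, of "(-)"] by simp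
 then show "(A *\<^sub>v x) \<bullet>c y = (B *\<^sub>v x) \<bullet>c y" by simp
qed

lemma operator_systemD:
 assumes "operator_system S"
 shows "1 : S" "0 : S" "!!x y. x : S ==> y : S ==> x + y : S"
  "!!x y. x : S ==> y : S ==> x - y : S"
  "!!c x. x : S ==> scaleC c x : S" "!!c x. x : S ==> c *\<^sub>R x : S"
  "!!x. x : S ==> star x : S" "!!x. x : S ==> - x : S"
proof -
 have *: "1 : S" "!!x y. x : S ==> y : S ==> x + y : S" "!!c x. x : S ==> scaleC c x : S"
  "!!x. x : S ==> star x : S"
  using assms by (auto simp: operator_system_def)
 show m: "- x : S" if "x : S" for x using *(3)[OF that, of "-1"] by simp
 show "0 : S" using *(3)[OF *(1), of 0] by simp
 show "x - y : S" if "x : S" "y : S" for x y using *(2)[OF that(1) m[OF that(2)]] by simp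
 show "c *\<^sub>R x : S" if "x : S" for c x using *(3)[OF that] by (simp add: scaleR_scaleC)
qed (use assms in \<open>auto simp: operator_system_def\<close>)

lemma operator_system_UNIV [simp]: "operator_system UNIV"
 by (simp add: operator_system_def)

text \<open>Positivity on self-adjoint elements forces compatibility with the involution.\<close>

lemma star_preserving_of_pos:
 fixes \<phi> :: "'a::unital_cstar_algebra => complex mat"
 assumes S: "operator_system S" and car: "!!x. x : S ==> \<phi> x : carrier_mat d d"
  and add: "!!x y. x : S ==> y : S ==> \<phi> (x + y) = \<phi> x + \<phi> y"
  and scale: "!!c x. x : S ==> \<phi> (scaleC c x) = c \<cdot>\<^sub>m \<phi> x"
  and pos: "!!a \<xi>. a : S ==> cpos a ==> \<xi> : carrier_vec d ==> 0 <= (\<phi> a *\<^sub>v \<xi>) \<bullet>c \<xi>"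
  and x: "x : S"
 shows "\<phi> (star x) = adj (\<phi> x)"
proof (rule mat_eq_quadI[of _ d])
 note SD = operator_systemD[OF S]
 show c1: "\<phi> (star x) : carrier_mat d d" "adj (\<phi> x) : carrier_mat d d"
  using car x SD by auto
 fix \<xi> :: "complex vec" assume xi: "\<xi> : carrier_vec d"
 define f where "f a = (\<phi> a *\<^sub>v \<xi>) \<bullet>c \<xi>" for a
 have fadd: "f (a + b) = f a + f b" if "a : S" "b : S" for a b
  using that xi car by (simp add: f_def add add_mat_vec_form[of _ d d])
 have fsc: "f (scaleC c a) = c * f a" if "a : S" for a c
  using that xi car by (simp add: f_def scale smult_mat_vec_form[of _ d d])
 have real: "Im (f h) = 0" if h: "h : S" "star h = h" for h
 proof -
  have "cpos (norm h *\<^sub>R 1 - (- h))" by (rule cpos_scalar_minus) (use h in auto)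
  then have "0 <= f (norm h *\<^sub>R 1 - (- h))" unfolding f_def using SD h xi by (intro pos) auto
  moreover have "0 <= f (norm h *\<^sub>R 1)" unfolding f_def using SD xi by (intro pos cpos_scaleR) auto
  moreover have "f (norm h *\<^sub>R 1 - (- h)) = f (norm h *\<^sub>R 1) + f h"
   using fadd[of "norm h *\<^sub>R 1" h] SD h by simp
  ultimately show ?thesis by (simp add: less_eq_complex_def)
 qed
 define h where "h = (1/2) *\<^sub>R (x + star x)"
 define k where "k = scaleC (- \<i> / 2) (x - star x)"
 have hS: "h : S" "k : S" using SD x by (auto simp: h_def k_def)
 have sh: "star h = h" by (simp add: h_def star_add star_star add.commute)
 have sk: "star k = k"
  by (simp add: k_def star_scaleC star_star scaleC_diff_right)
 have ik: "scaleC \<i> k = (1/2) *\<^sub>R (x - star x)"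
  by (simp add: k_def scaleC_scaleC scaleR_scaleC)
 have hk: "x = h + scaleC \<i> k" "star x = h - scaleC \<i> k"
  unfolding ik h_def
  by (simp_all add: scaleR_right_distrib scaleR_right_diff_distrib flip: scaleR_add_left)
 have fdiff: "f (a - b) = f a - f b" if "a : S" "b : S" for a b
  using fadd[of a "- b"] fsc[of b "-1"] SD that by simp
 have "f (star x) = f h - \<i> * f k" unfolding hk(2) using hS SD by (simp add: fdiff fsc)
 moreover have "f x = f h + \<i> * f k" by (subst hk(1)) (use hS SD in \<open>simp add: fadd fsc\<close>)
 ultimately have "f (star x) = cnj (f x)" using real[OF hS(1) sh] real[OF hS(2) sk] by (simp add: complex_eq_iff)
 also have "... = (adj (\<phi> x) *\<^sub>v \<xi>) \<bullet>c \<xi>"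
  using form_adjoint'[of "\<phi> x" d d \<xi> \<xi>] car[OF x] xi cscalar_commute[of \<xi> d "\<phi> x *\<^sub>v \<xi>"]
   mult_mat_vec_carrier'[OF car[OF x]] by (simp add: f_def)
 finally show "(\<phi> (star x) *\<^sub>v \<xi>) \<bullet>c \<xi> = (adj (\<phi> x) *\<^sub>v \<xi>) \<bullet>c \<xi>" by (simp add: f_def)
qed

context
 fixes d :: nat and \<Phi> :: "'a::unital_cstar_algebra => complex mat"
 assumes cp: "cp_map d \<Phi>"
begin

lemma cp_carrier [simp]: "\<Phi> x : carrier_mat d d"
 and cp_add: "\<Phi> (x + y) = \<Phi> x + \<Phi> y"
 and cp_scaleC: "\<Phi> (scaleC c x) = c \<cdot>\<^sub>m \<Phi> x"
 using cp by (simp_all add: cp_map_def)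

lemma cp_pos:
 fixes k :: nat
 assumes "!!i. i < k ==> \<xi> i : carrier_vec d"
 shows "0 <= (\<Sum>i<k. \<Sum>j<k. (\<Phi> (star (a i) * a j) *\<^sub>v \<xi> j) \<bullet>c \<xi> i)"
proof -
 have "ALL k a \<xi>. (ALL i<k. \<xi> i : carrier_vec d) -->
    0 <= (\<Sum>i<(k::nat). \<Sum>j<k. (\<Phi> (star (a i) * a j) *\<^sub>v \<xi> j) \<bullet>c \<xi> i)"
  using cp unfolding cp_map_def by (elim conjE)
 from this[rule_format, of k \<xi> a] assms show ?thesis by simp
qed

lemma cp_dim [simp]: "dim_row (\<Phi> x) = d" "dim_col (\<Phi> x) = d"
 using carrier_matD[OF cp_carrier[of x]] by auto

lemma cp_vec [simp]: "\<Phi> x *\<^sub>v \<xi> : carrier_vec d"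
 using mult_mat_vec_carrier'[OF cp_carrier] .

lemma cp_form_add:
 "\<xi> : carrier_vec d ==> \<eta> : carrier_vec d ==>
  (\<Phi> (x + y) *\<^sub>v \<xi>) \<bullet>c \<eta> = (\<Phi> x *\<^sub>v \<xi>) \<bullet>c \<eta> + (\<Phi> y *\<^sub>v \<xi>) \<bullet>c \<eta>"
 by (simp add: cp_add add_mat_vec_form[of _ d d])

lemma cp_form_scaleC:
 "\<xi> : carrier_vec d ==> \<eta> : carrier_vec d ==>
  (\<Phi> (scaleC c x) *\<^sub>v \<xi>) \<bullet>c \<eta> = c * ((\<Phi> x *\<^sub>v \<xi>) \<bullet>c \<eta>)"
 by (simp add: cp_scaleC smult_mat_vec_form[of _ d d])

lemma cp_form_scaleR:
 "\<xi> : carrier_vec d ==> \<eta> : carrier_vec d ==>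
  (\<Phi> (r *\<^sub>R x) *\<^sub>v \<xi>) \<bullet>c \<eta> = of_real r * ((\<Phi> x *\<^sub>v \<xi>) \<bullet>c \<eta>)"
 by (simp add: scaleR_scaleC cp_form_scaleC)

lemma cp_form_diff:
 "\<xi> : carrier_vec d ==> \<eta> : carrier_vec d ==>
  (\<Phi> (x - y) *\<^sub>v \<xi>) \<bullet>c \<eta> = (\<Phi> x *\<^sub>v \<xi>) \<bullet>c \<eta> - (\<Phi> y *\<^sub>v \<xi>) \<bullet>c \<eta>"
 using cp_form_add[of \<xi> \<eta> x "- y"] cp_form_scaleC[of \<xi> \<eta> "-1" y] by simp

lemma cp_form_minus:
 "\<xi> : carrier_vec d ==> \<eta> : carrier_vec d ==> (\<Phi> (- x) *\<^sub>v \<xi>) \<bullet>c \<eta> = - ((\<Phi> x *\<^sub>v \<xi>) \<bullet>c \<eta>)"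
 using cp_form_scaleC[of \<xi> \<eta> "-1" x] by simp

lemma cp_zero: "\<Phi> 0 = 0\<^sub>m d d"
 using cp_scaleC[of 0 0] by (intro eq_matI) (auto, metis cp_dim index_smult_mat(1) mult_zero_left)

lemma cp_form_sum:
 "\<xi> : carrier_vec d ==> \<eta> : carrier_vec d ==>
  (\<Phi> (sum f I) *\<^sub>v \<xi>) \<bullet>c \<eta> = (\<Sum>i\<in>I. (\<Phi> (f i) *\<^sub>v \<xi>) \<bullet>c \<eta>)"
proof (induction I rule: infinite_finite_induct)
 case (insert x F)
 then show ?case by (simp add: cp_form_add)
qed (simp_all add: cp_zero zero_mat_mult_vec)

lemma cp_index_sum: "i < d ==> j < d ==> \<Phi> (sum f I) $$ (i, j) = (\<Sum>t\<in>I. \<Phi> (f t) $$ (i, j))"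
 using cp_form_sum[of "unit_vec d j" "unit_vec d i" f I] by (simp add: form_unit[of _ d d])

lemma cp_pos1: "\<xi> : carrier_vec d ==> 0 <= (\<Phi> (star a * a) *\<^sub>v \<xi>) \<bullet>c \<xi>"
 using cp_pos[of 1 "%_. \<xi>" "%_. a"] by simp

lemma cp_pos_cpos: "cpos a ==> \<xi> : carrier_vec d ==> 0 <= (\<Phi> a *\<^sub>v \<xi>) \<bullet>c \<xi>"
 using cp_pos1 by (metis cpos_def)

lemma cp_star: "\<Phi> (star x) = adj (\<Phi> x)"
 by (rule star_preserving_of_pos[of UNIV _ d]) (auto simp: cp_add cp_scaleC intro: cp_pos_cpos)

lemma cp_form_star:
 "\<xi> : carrier_vec d ==> \<eta> : carrier_vec d ==> (\<Phi> (star x) *\<^sub>v \<xi>) \<bullet>c \<eta> = cnj ((\<Phi> x *\<^sub>v \<eta>) \<bullet>c \<xi>)"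
 using cscalar_commute[of \<xi> d "\<Phi> x *\<^sub>v \<eta>"] by (simp add: cp_star form_adjoint'[of _ d d])

text \<open>In the Stinespring space the quantity \<open>q\<close> is the squared distance of \<open>a \<otimes> \<alpha>\<close> and
  \<open>1 \<otimes> \<beta>\<close>. If it vanishes then these vectors may be exchanged to the right of any \<open>c\<close>.\<close>

lemma cp_distance_nonneg:
 assumes \<alpha>: "\<alpha> : carrier_vec d" and \<beta>: "\<beta> : carrier_vec d"
 shows "0 <= (\<Phi> (star a * a) *\<^sub>v \<alpha>) \<bullet>c \<alpha> - (\<Phi> a *\<^sub>v \<alpha>) \<bullet>c \<beta> - cnj ((\<Phi> a *\<^sub>v \<alpha>) \<bullet>c \<beta>) + (\<Phi> 1 *\<^sub>v \<beta>) \<bullet>c \<beta>"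
proof -
 let ?a = "%i::nat. if i = 0 then a else - 1" and ?x = "%i::nat. if i = 0 then \<alpha> else \<beta>"
 have "0 <= (\<Sum>i<2. \<Sum>j<2. (\<Phi> (star (?a i) * ?a j) *\<^sub>v ?x j) \<bullet>c ?x i)"
  by (rule cp_pos) (use assms in auto)
 also have "... = (\<Phi> (star a * a) *\<^sub>v \<alpha>) \<bullet>c \<alpha> - (\<Phi> a *\<^sub>v \<alpha>) \<bullet>c \<beta> - cnj ((\<Phi> a *\<^sub>v \<alpha>) \<bullet>c \<beta>) + (\<Phi> 1 *\<^sub>v \<beta>) \<bullet>c \<beta>"
  using \<alpha> \<beta> cp_form_star[OF \<beta> \<beta>, of 1]
  by (simp add: numeral_2_eq_2 cp_form_minus cp_form_star)
 finally show ?thesis .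
qed

lemma cp_exchange:
 assumes \<alpha>: "\<alpha> : carrier_vec d" and \<beta>: "\<beta> : carrier_vec d"
  and q: "(\<Phi> (star a * a) *\<^sub>v \<alpha>) \<bullet>c \<alpha> - (\<Phi> a *\<^sub>v \<alpha>) \<bullet>c \<beta> - cnj ((\<Phi> a *\<^sub>v \<alpha>) \<bullet>c \<beta>) + (\<Phi> 1 *\<^sub>v \<beta>) \<bullet>c \<beta> = 0"
 shows "\<Phi> (c * a) *\<^sub>v \<alpha> = \<Phi> c *\<^sub>v \<beta>"
proof (rule cscalar_ext[of _ d])
 fix \<gamma> :: "complex vec" assume \<gamma>: "\<gamma> : carrier_vec d"
 define z where "z = (\<Phi> (c * a) *\<^sub>v \<alpha>) \<bullet>c \<gamma> - (\<Phi> c *\<^sub>v \<beta>) \<bullet>c \<gamma>"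
 define r where "r = Re ((\<Phi> (c * star c) *\<^sub>v \<gamma>) \<bullet>c \<gamma>)"
 have r: "(\<Phi> (c * star c) *\<^sub>v \<gamma>) \<bullet>c \<gamma> = of_real r" "0 <= r"
  using cp_pos1[OF \<gamma>, of "star c"] by (auto simp: r_def star_star less_eq_complex_def complex_eq_iff)
 have ineq: "0 <= complex_of_real (- (2 * s * (cmod z)\<^sup>2) + s * s * (cmod z)\<^sup>2 * r)" for s :: real
 proof -
  define t where "t = - of_real s * z"
  let ?a = "%i::nat. if i = 0 then a else if i = 1 then - 1 else scaleC t (star c)"
  let ?x = "%i::nat. if i = 0 then \<alpha> else if i = 1 then \<beta> else \<gamma>"
  have "0 <= (\<Sum>i<3. \<Sum>j<3. (\<Phi> (star (?a i) * ?a j) *\<^sub>v ?x j) \<bullet>c ?x i)"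
   by (rule cp_pos) (use \<alpha> \<beta> \<gamma> in auto)
  also have "... = ((\<Phi> (star a * a) *\<^sub>v \<alpha>) \<bullet>c \<alpha> - (\<Phi> a *\<^sub>v \<alpha>) \<bullet>c \<beta> - cnj ((\<Phi> a *\<^sub>v \<alpha>) \<bullet>c \<beta>) + (\<Phi> 1 *\<^sub>v \<beta>) \<bullet>c \<beta>) +
    cnj t * z + t * cnj z + t * cnj t * of_real r"
   using cp_form_star[OF \<gamma> \<alpha>, of "c * a"] cp_form_star[OF \<gamma> \<beta>, of c]
    cp_form_star[OF \<beta> \<beta>, of 1]
   by (simp add: numeral_3_eq_3 cp_form_minus cp_form_star \<alpha> \<beta> \<gamma> mult_scaleC_left mult_scaleC_right
     cp_form_scaleC star_scaleC star_star star_mult r(1) z_def)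
    (simp add: algebra_simps)
  also have "... = cnj t * z + t * cnj z + t * cnj t * of_real r" by (simp add: q)
  also have "... = complex_of_real (- (2 * s * (cmod z)\<^sup>2) + s * s * (cmod z)\<^sup>2 * r)"
   unfolding of_real_add of_real_minus of_real_mult complex_norm_square by (simp add: t_def algebra_simps)
  finally show ?thesis .
 qed
 have "(cmod z)\<^sup>2 = 0"
 proof (rule ccontr)
  assume "(cmod z)\<^sup>2 ~= 0"
  then have A: "0 < (cmod z)\<^sup>2" by simp
  define s where "s = 1 / (r + 1)"
  have s: "0 < s" "s * r <= 1" using r(2) by (auto simp: s_def divide_simps)
  have "0 <= - (2 * s * (cmod z)\<^sup>2) + s * s * (cmod z)\<^sup>2 * r"
   using ineq[of s] unfolding less_eq_complex_def by (simp only: Re_complex_of_real zero_complex.sel)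
  also have "... = (s * (cmod z)\<^sup>2) * (s * r - 2)" by (simp add: algebra_simps)
  also have "... < 0" using s A by (intro mult_pos_neg) auto
  finally show False by simp
 qed
 then show "(\<Phi> (c * a) *\<^sub>v \<alpha>) \<bullet>c \<gamma> = (\<Phi> c *\<^sub>v \<beta>) \<bullet>c \<gamma>" by (simp add: z_def)
qed simp_all

lemma cp_null:
 assumes "\<alpha> : carrier_vec d" "(\<Phi> (star a * a) *\<^sub>v \<alpha>) \<bullet>c \<alpha> = 0"
 shows "\<Phi> (c * a) *\<^sub>v \<alpha> = 0\<^sub>v d"
proof -
 have z: "\<Phi> x *\<^sub>v 0\<^sub>v d = 0\<^sub>v d" for x by (intro eq_vecI) auto
 have "(\<Phi> a *\<^sub>v \<alpha>) \<bullet>c 0\<^sub>v d = 0" by simp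
 then show ?thesis using cp_exchange[OF assms(1) zero_carrier_vec, of a c] assms(2) z by simp
qed

lemma cp_bound:
 assumes "\<Phi> 1 = 1\<^sub>m d" "\<xi> : carrier_vec d"
 shows "Re ((\<Phi> a *\<^sub>v \<xi>) \<bullet>c (\<Phi> a *\<^sub>v \<xi>)) <= (norm a)\<^sup>2 * Re (\<xi> \<bullet>c \<xi>)"
proof -
 let ?b = "\<Phi> a *\<^sub>v \<xi>"
 have "cpos ((norm a)\<^sup>2 *\<^sub>R 1 - star a * a)"
  by (rule cpos_scalar_minus) (auto simp: star_mult star_star cstar_identity)
 from cp_pos_cpos[OF this assms(2)]
 have "0 <= of_real ((norm a)\<^sup>2) * (\<xi> \<bullet>c \<xi>) - (\<Phi> (star a * a) *\<^sub>v \<xi>) \<bullet>c \<xi>"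
  using assms by (simp add: cp_form_diff cp_form_scaleR del: of_real_power)
 then have "Re ((\<Phi> (star a * a) *\<^sub>v \<xi>) \<bullet>c \<xi>) <= (norm a)\<^sup>2 * Re (\<xi> \<bullet>c \<xi>)"
  by (simp add: less_eq_complex_def del: of_real_power)
 moreover have "Re (?b \<bullet>c ?b) <= Re ((\<Phi> (star a * a) *\<^sub>v \<xi>) \<bullet>c \<xi>)"
  using cp_distance_nonneg[OF assms(2) cp_vec, of a a \<xi>] assms(1) by (simp add: less_eq_complex_def)
 ultimately show ?thesis by linarith
qed

lemma cp_index_bound:
 assumes "\<Phi> 1 = 1\<^sub>m d" "i < d" "j < d"
 shows "cmod (\<Phi> a $$ (i, j)) <= norm a"
proof -
 have "(cmod (\<Phi> a $$ (i, j)))\<^sup>2 = (cmod ((\<Phi> a *\<^sub>v unit_vec d j) $ i))\<^sup>2" using assms by simp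
 also have "... <= (\<Sum>i<d. (cmod ((\<Phi> a *\<^sub>v unit_vec d j) $ i))\<^sup>2)"
  by (rule member_le_sum) (use assms in auto)
 also have "... = Re ((\<Phi> a *\<^sub>v unit_vec d j) \<bullet>c (\<Phi> a *\<^sub>v unit_vec d j))" by (simp add: cscalar_self)
 also have "... <= (norm a)\<^sup>2 * Re (unit_vec d j \<bullet>c unit_vec d j)" by (rule cp_bound) (use assms in auto)
 also have "unit_vec d j \<bullet>c unit_vec d j = (1::complex)" using assms(3) by (subst cscalar_unit) auto
 finally show ?thesis by (simp add: power2_le_iff_abs_le)
qed

end

section \<open>Extension of UCP maps to the whole algebra\<close>

text \<open>The cone of positive \<open>m \<times> m\<close> arrays over the algebra, as sums of Gram arrays of rows.
  Any number of rows is admitted, which makes closure under addition immediate.\<close>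

definition gram :: "(nat => 'a::unital_cstar_algebra) list => nat => nat => 'a" where
 "gram ys p q = (\<Sum>y\<leftarrow>ys. star (y p) * y q)"

definition gram_cone :: "nat => (nat => nat => 'a::unital_cstar_algebra) set" where
 "gram_cone m = {X. EX ys. ALL p<m. ALL q<m. X p q = gram ys p q}"

definition hermitian_part :: "(nat => nat => 'a::unital_cstar_algebra) => nat => nat => 'a" where
 "hermitian_part X p q = X p q + star (X q p)"

lemma gram_coneI: "(!!p q. p < m ==> q < m ==> X p q = gram ys p q) ==> X : gram_cone m"
 by (auto simp: gram_cone_def)

lemma gram_cone_row: "(!!p q. p < m ==> q < m ==> X p q = star (y p) * y q) ==> X : gram_cone m"
 by (rule gram_coneI[of _ _ "[y]"]) (simp add: gram_def)

lemma gram_cone_zero: "(!!p q. p < m ==> q < m ==> X p q = 0) ==> X : gram_cone m"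
 by (rule gram_coneI[of _ _ "[]"]) (simp add: gram_def)

lemma gram_cone_add:
 assumes "X : gram_cone m" "Y : gram_cone m"
 shows "(%p q. X p q + Y p q) : gram_cone m"
proof -
 obtain xs ys where "ALL p<m. ALL q<m. X p q = gram xs p q" "ALL p<m. ALL q<m. Y p q = gram ys p q"
  using assms by (auto simp: gram_cone_def)
 then show ?thesis by (intro gram_coneI[of _ _ "xs @ ys"]) (simp add: gram_def)
qed

lemma gram_cone_sum:
 "(!!i. i : I ==> X i : gram_cone m) ==> (%p q. \<Sum>i\<in>I. X i p q) : gram_cone m"
 by (induction I rule: infinite_finite_induct) (auto intro: gram_cone_zero gram_cone_add)

lemma gram_cone_scaleR:
 assumes "0 <= t" "X : gram_cone m"
 shows "(%p q. t *\<^sub>R X p q) : gram_cone m"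
proof -
 obtain ys where ys: "ALL p<m. ALL q<m. X p q = gram ys p q" using assms by (auto simp: gram_cone_def)
 have "t *\<^sub>R gram ys p q = gram (map (%y p. sqrt t *\<^sub>R y p) ys) p q" for p q
  using assms(1) by (induction ys) (auto simp: gram_def scaleR_add_right)
 with ys show ?thesis by (intro gram_coneI[of _ _ "map (%y p. sqrt t *\<^sub>R y p) ys"]) simp
qed

lemma gram_cone_cong:
 "X : gram_cone m ==> (!!p q. p < m ==> q < m ==> X p q = Y p q) ==> Y : gram_cone m"
 by (auto simp: gram_cone_def)

text \<open>Order unit: completing squares, the rows \<open>e\<^sub>i - e\<^sub>j H\<^sub>i\<^sub>j / 2\<close> have Gram sum \<open>- H\<close> up to a
  diagonal array.\<close>

lemma gram_cone_order_unit:
 fixes H :: "nat => nat => 'a::unital_cstar_algebra"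
 assumes H: "!!p q. p < m ==> q < m ==> star (H q p) = H p q"
 obtains t where "(%p q. (if p = q then t *\<^sub>R 1 else 0) - H p q) : gram_cone m"
proof -
 define y where "y i j p = (if p = i then 1 else 0) - (if p = j then (1/2) *\<^sub>R H i j else 0)" for i j p
 define R where "R p = of_nat m *\<^sub>R 1 + (1/4) *\<^sub>R (\<Sum>i<m. star (H i p) * H i p)" for p
 have R: "star (R p) = R p" for p
  by (simp add: R_def star_add star_sum star_mult star_star)
 define t where "t = (\<Sum>p<m. norm (R p))"
 have "EX e. star e = e & t *\<^sub>R 1 - R p = e * e" if "p < m" for p
 proof -
  have "norm (R p) <= t" unfolding t_def by (rule member_le_sum) (use that in auto)
  then show ?thesis using cpos_scalar_minus[OF R] unfolding cpos_def by blast
 qed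
 then obtain e where e: "!!p. p < m ==> star (e p) = e p & t *\<^sub>R 1 - R p = e p * e p" by metis
 have rows: "(%p q. \<Sum>i<m. \<Sum>j<m. star (y i j p) * y i j q) : gram_cone m"
  by (intro gram_cone_sum gram_cone_row[where y = "y _ _"]) simp
 have diag: "(%p q. \<Sum>i<m. star (if p = i then e i else 0) * (if q = i then e i else 0)) : gram_cone m"
  by (intro gram_cone_sum, rule_tac y = "%p. if p = i then e i else 0" in gram_cone_row) simp
 have "(\<Sum>i<m. \<Sum>j<m. star (y i j p) * y i j q) + (\<Sum>i<m. star (if p = i then e i else 0) * (if q = i then e i else 0))
   = (if p = q then t *\<^sub>R 1 else 0) - H p q" if pq: "p < m" "q < m" for p q
 proof -
  have "star (y i j p) * y i j q = (if i = p then if p = q then 1 else 0 else 0)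
    - (if i = p then if j = q then (1/2) *\<^sub>R H i j else 0 else 0)
    - (if i = q then if j = p then (1/2) *\<^sub>R star (H i j) else 0 else 0)
    + (if j = p then if p = q then (1/4) *\<^sub>R (star (H i j) * H i j) else 0 else 0)" for i j
   by (auto simp: y_def algebra_simps)
  then have "(\<Sum>i<m. \<Sum>j<m. star (y i j p) * y i j q) =
    (\<Sum>i<m. \<Sum>j<m. if i = p then if p = q then 1 else 0 else 0)
    - (\<Sum>i<m. \<Sum>j<m. if i = p then if j = q then (1/2) *\<^sub>R H i j else 0 else 0)
    - (\<Sum>i<m. \<Sum>j<m. if i = q then if j = p then (1/2) *\<^sub>R star (H i j) else 0 else 0)
    + (\<Sum>i<m. \<Sum>j<m. if j = p then if p = q then (1/4) *\<^sub>R (star (H i j) * H i j) else 0 else 0)"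
   by (simp only: sum.distrib sum_subtractf)
  also have "(\<Sum>i<m. \<Sum>j<m. if i = p then if p = q then 1 else (0::'a) else 0) = (if p = q then of_nat m *\<^sub>R 1 else 0)"
   by (subst sum.swap) (use pq in \<open>simp add: scaleR_conv_of_real\<close>)
  also have "(\<Sum>i<m. \<Sum>j<m. if i = p then if j = q then (1/2) *\<^sub>R H i j else 0 else 0) = (1/2) *\<^sub>R H p q"
  proof -
   have "(\<Sum>i<m. \<Sum>j<m. if i = p then if j = q then (1/2) *\<^sub>R H i j else 0 else 0) =
     (\<Sum>i<m. if i = p then \<Sum>j<m. if j = q then (1/2) *\<^sub>R H i j else 0 else 0)"
    by (intro sum.cong) auto
   then show ?thesis using pq by simp
  qed
  also have "(\<Sum>i<m. \<Sum>j<m. if i = q then if j = p then (1/2) *\<^sub>R star (H i j) else 0 else 0) = (1/2) *\<^sub>R H p q"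
  proof -
   have "(\<Sum>i<m. \<Sum>j<m. if i = q then if j = p then (1/2) *\<^sub>R star (H i j) else 0 else 0) =
     (\<Sum>i<m. if i = q then \<Sum>j<m. if j = p then (1/2) *\<^sub>R star (H i j) else 0 else 0)"
    by (intro sum.cong) auto
   then show ?thesis using pq H by simp
  qed
  also have "(\<Sum>i<m. \<Sum>j<m. if j = p then if p = q then (1/4) *\<^sub>R (star (H i j) * H i j) else 0 else 0)
    = (if p = q then (1/4) *\<^sub>R (\<Sum>i<m. star (H i p) * H i p) else 0)"
   using pq by (simp add: scaleR_sum_right)
  finally have s1: "(\<Sum>i<m. \<Sum>j<m. star (y i j p) * y i j q) = (if p = q then R p else 0) - H p q"
   by (simp add: R_def algebra_simps flip: scaleR_add_left)
  have "(\<Sum>i<m. star (if p = i then e i else 0) * (if q = i then e i else 0)) =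
    (\<Sum>i<m. if i = p then if p = q then star (e i) * e i else 0 else 0)"
   by (intro sum.cong) auto
  also have "... = (if p = q then t *\<^sub>R 1 - R p else 0)" using pq e by auto
  finally show ?thesis unfolding s1 by auto
 qed
 then show ?thesis by (intro that gram_cone_cong[OF gram_cone_add[OF rows diag]])
qed

lemma cp_map_gram_cone:
 assumes "cp_map m \<Phi>" "X : gram_cone m"
 shows "0 <= (\<Sum>p<m. \<Sum>q<m. \<Phi> (X p q) $$ (p, q))"
proof -
 note cp = assms(1)
 obtain ys where ys: "!!p q. p < m ==> q < m ==> X p q = gram ys p q"
  using assms by (auto simp: gram_cone_def)
 have "0 <= (\<Sum>p<m. \<Sum>q<m. \<Phi> (gram ys p q) $$ (p, q))"
 proof (induction ys)
  case Nil
  then show ?case by (simp add: gram_def cp_zero[OF cp])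
 next
  case (Cons y ys)
  have "(\<Sum>p<m. \<Sum>q<m. \<Phi> (gram (y # ys) p q) $$ (p, q)) =
    (\<Sum>p<m. \<Sum>q<m. (\<Phi> (star (y p) * y q) *\<^sub>v unit_vec m q) \<bullet>c unit_vec m p) +
    (\<Sum>p<m. \<Sum>q<m. \<Phi> (gram ys p q) $$ (p, q))"
   unfolding sum.distrib[symmetric]
   by (intro sum.cong refl)
    (simp add: gram_def cp_add[OF cp] form_unit[OF cp_carrier[OF cp]] cp_dim[OF cp])
  also have "... \<ge> 0" using Cons.IH by (intro add_nonneg_nonneg cp_pos[OF cp]) auto
  finally show ?case .
 qed
 then show ?thesis using ys by simp
qed

lemma ucpD:
 assumes "\<phi> : ucp S d"
 shows "0 < d" "\<phi> : extensional S" "!!x. x : S ==> \<phi> x : carrier_mat d d"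
  "!!x y. x : S ==> y : S ==> \<phi> (x + y) = \<phi> x + \<phi> y"
  "!!c x. x : S ==> \<phi> (scaleC c x) = c \<cdot>\<^sub>m \<phi> x" "\<phi> 1 = 1\<^sub>m d"
 using assms by (auto simp: ucp_def PiE_def)

lemma ucp_pos:
 assumes "\<phi> : ucp S d" "!!i j. i < k ==> j < k ==> X i j : S" "positive_matrix k X"
  "!!i. i < k ==> \<xi> i : carrier_vec d"
 shows "0 <= (\<Sum>i<k. \<Sum>j<k. (\<phi> (X i j) *\<^sub>v \<xi> j) \<bullet>c \<xi> i)"
proof -
 have "ALL k X. (ALL i<k. ALL j<k. X i j : S) --> positive_matrix k X -->
    (ALL \<xi>. (ALL i<k. \<xi> i : carrier_vec d) -->
      0 <= (\<Sum>i<k. \<Sum>j<k. (\<phi> (X i j) *\<^sub>v \<xi> j) \<bullet>c \<xi> i))"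
  using assms(1) unfolding ucp_def mem_Collect_eq by (elim conjE)
 from this[rule_format, of k X \<xi>] assms show ?thesis by simp
qed

lemma ucp_star:
 assumes S: "operator_system S" and \<phi>: "\<phi> : ucp S d" and x: "x : S"
 shows "\<phi> (star x) = adj (\<phi> x)"
proof (rule star_preserving_of_pos[OF S _ _ _ _ x, of \<phi> d])
 fix a and \<xi> :: "complex vec" assume a: "a : S" "cpos a" and xi: "\<xi> : carrier_vec d"
 obtain b where b: "star b = b" "a = b * b" using a(2) by (auto simp: cpos_def)
 have "positive_matrix 1 (%_ _. a)"
  unfolding positive_matrix_def by (rule exI[of _ "%_ _. b"]) (simp add: b)
 from ucp_pos[OF \<phi> _ this, of "%_. \<xi>"] a xi show "0 <= (\<phi> a *\<^sub>v \<xi>) \<bullet>c \<xi>" by simp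
qed (use ucpD[OF \<phi>] in auto)

text \<open>The real functional \<open>X \<mapsto> Re (\<Sum> \<phi>(X\<^sub>p\<^sub>q)\<^sub>p\<^sub>q)\<close> on arrays is extended. Enlarging the cone by the
  multiples of \<open>- e\<close> makes the extension kill \<open>e\<close>.\<close>

lemma cp_extension_core:
 fixes S :: "'a::unital_cstar_algebra set" and e :: 'a
 assumes S: "operator_system S" and e: "star e = e"
  and car: "!!x. x : S ==> \<phi> x : carrier_mat m m"
  and add: "!!x y. x : S ==> y : S ==> \<phi> (x + y) = \<phi> x + \<phi> y"
  and scale: "!!c x. x : S ==> \<phi> (scaleC c x) = c \<cdot>\<^sub>m \<phi> x"
  and core: "!!X s. (!!p q. p < m ==> q < m ==> X p q : S) ==> 0 <= s ==>
    (%p q. hermitian_part X p q + (if p = q then s *\<^sub>R e else 0)) : gram_cone m ==>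
    0 <= Re (\<Sum>p<m. \<Sum>q<m. \<phi> (X p q) $$ (p, q))"
 obtains \<Phi> where "cp_map m \<Phi>" "!!x. x : S ==> \<Phi> x = \<phi> x" "Re (\<Sum>p<m. \<Phi> e $$ (p, p)) <= 0"
proof -
 note SD = operator_systemD[OF S]
 define K where "K = {X. \<exists>s\<ge>0. (%p q. hermitian_part X p q + (if p = q then s *\<^sub>R e else 0)) : gram_cone m}"
 define E where "E = {X. ALL p<m. ALL q<m. X p q : S}"
 define f where "f X = Re (\<Sum>p<m. \<Sum>q<m. \<phi> (X p q) $$ (p, q))" for X
 have KI: "X : K" if "0 <= s" "(%p q. hermitian_part X p q + (if p = q then s *\<^sub>R e else 0)) : gram_cone m" for X s
  using that by (auto simp: K_def)
 have "EX F. linear F & (\<forall>X\<in>E. F X = f X) & (\<forall>X\<in>K. 0 <= F X)"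
 proof (rule riesz_extension[of K E f])
  fix X Y assume "X : K" "Y : K"
  then obtain s t where s: "s \<ge> 0" "(%p q. hermitian_part X p q + (if p = q then s *\<^sub>R e else 0)) : gram_cone m"
   and t: "t \<ge> 0" "(%p q. hermitian_part Y p q + (if p = q then t *\<^sub>R e else 0)) : gram_cone m"
   by (auto simp: K_def)
  show "X + Y : K"
   by (rule KI[of "s + t"], use s t in simp, rule gram_cone_cong[OF gram_cone_add[OF s(2) t(2)]])
     (simp add: hermitian_part_def star_add scaleR_add_left algebra_simps)
 next
  fix c :: real and X assume c: "0 <= c" and "X : K"
  then obtain s where s: "s \<ge> 0" "(%p q. hermitian_part X p q + (if p = q then s *\<^sub>R e else 0)) : gram_cone m"
   by (auto simp: K_def)
  show "c *\<^sub>R X : K"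
   by (rule KI[of "c * s"], use s c in simp, rule gram_cone_cong[OF gram_cone_scaleR[OF c s(2)]])
     (simp add: hermitian_part_def scaleR_fun_def scaleR_add_right)
 next
  show "0 : E" using SD by (simp add: E_def)
 next
  fix X Y assume XY: "X : E" "Y : E"
  then show "X + Y : E" using SD by (simp add: E_def)
  have "\<phi> (X p q + Y p q) $$ (p, q) = \<phi> (X p q) $$ (p, q) + \<phi> (Y p q) $$ (p, q)" if "p < m" "q < m" for p q
   using XY that car[of "X p q"] car[of "Y p q"] by (simp add: E_def add)
  then show "f (X + Y) = f X + f Y" by (simp add: f_def sum.distrib)
 next
  fix c :: real and X assume X: "X : E"
  then show "c *\<^sub>R X : E" using SD by (simp add: E_def scaleR_fun_def)
  have "\<phi> (c *\<^sub>R X p q) $$ (p, q) = of_real c * \<phi> (X p q) $$ (p, q)" if "p < m" "q < m" for p q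
   using X that car[of "X p q"] by (simp add: E_def scaleR_scaleC scale)
  then show "f (c *\<^sub>R X) = c * f X"
   by (simp add: f_def scaleR_fun_def sum_distrib_left)
 next
  fix X assume "X : E" "X : K"
  then show "0 <= f X" using core by (auto simp: E_def K_def f_def)
 next
  fix V :: "nat => nat => 'a"
  obtain t where t: "(%p q. (if p = q then t *\<^sub>R 1 else 0) - hermitian_part V p q) : gram_cone m"
   by (rule gram_cone_order_unit[of m "hermitian_part V"])
     (auto simp: hermitian_part_def star_add star_star add.commute)
  let ?T = "%p q. if p = q then (t / 2) *\<^sub>R (1::'a) else 0"
  have "?T : E" using SD by (auto simp: E_def)
  moreover have "?T - V : K"
   by (rule KI[of 0], simp, rule gram_cone_cong[OF t])
     (auto simp: hermitian_part_def star_add simp flip: scaleR_add_left)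
  ultimately show "\<exists>T\<in>E. T - V : K" by blast
 next
  fix F assume "linear F" "!!X. X : E ==> F X = f X" "!!X. X : K ==> 0 <= F X"
  then show ?thesis by blast
 qed
 then obtain F where F: "linear F" "!!X. X : E ==> F X = f X" "!!X. X : K ==> 0 <= F X"
  by blast
 have Fadd: "F (X + Y) = F X + F Y" and Fsc: "F (r *\<^sub>R X) = r * F X" for X Y r
  using F(1) by (auto simp: linear_add linear_scale)
 have Fneg: "F (- X) = - F X" for X using Fsc[of "-1" X] by simp
 define U where "U a p q = (%i j. if i = p & j = q then a else 0)" for a :: 'a and p q :: nat
 define \<Phi> where "\<Phi> a = mat m m (%(p, q). Complex (F (U a p q)) (- F (U (scaleC \<i> a) p q)))" for a
 have Uadd: "U (a + b) p q = U a p q + U b p q" and Usc: "U (r *\<^sub>R a) p q = r *\<^sub>R U a p q" for a b p q r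
  by (auto simp: U_def fun_eq_iff scaleR_fun_def)
 have Fdiff: "F (X - Y) = F X - F Y" for X Y using Fadd[of X "- Y"] Fneg[of Y] by simp
 have Udiff: "U (a - b) p q = U a p q - U b p q" for a b p q by (auto simp: U_def fun_eq_iff)
 have car': "\<Phi> a : carrier_mat m m" and dim': "dim_row (\<Phi> a) = m" "dim_col (\<Phi> a) = m" for a
  by (simp_all add: \<Phi>_def)
 have add': "\<Phi> (a + b) = \<Phi> a + \<Phi> b" for a b
  by (rule eq_matI) (auto simp: \<Phi>_def Uadd Fadd scaleC_add_right complex_eq_iff)
 have scale': "\<Phi> (scaleC c a) = c \<cdot>\<^sub>m \<Phi> a" for c a
 proof -
  have 1: "scaleC c a = Re c *\<^sub>R a + Im c *\<^sub>R scaleC \<i> a"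
   unfolding scaleR_scaleC scaleC_scaleC scaleC_add_left[symmetric]
   by (rule arg_cong[of _ _ "%z. scaleC z a"]) (simp add: complex_eq_iff)
  have 2: "scaleC \<i> (scaleC c a) = Re c *\<^sub>R scaleC \<i> a + (- Im c) *\<^sub>R a"
   unfolding scaleR_scaleC scaleC_scaleC scaleC_add_left[symmetric]
   by (rule arg_cong[of _ _ "%z. scaleC z a"]) (simp add: complex_eq_iff)
  show ?thesis
   by (rule eq_matI) (auto simp: \<Phi>_def 1 2[unfolded 1] Uadd Udiff Usc Fadd Fdiff Fsc complex_eq_iff)
 qed
 have agree: "\<Phi> x = \<phi> x" if x: "x : S" for x
 proof -
  have fU: "F (U y p q) = Re (\<phi> y $$ (p, q))" if y: "y : S" and pq: "p < m" "q < m" for y p q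
  proof -
   have 0: "\<phi> 0 $$ (i, j) = 0" if "i < m" "j < m" for i j
    using scale[OF SD(2), of 0] car[OF SD(2)] that
    by (metis carrier_matD index_smult_mat(1) mult_zero_left scaleC_zero_left)
   have row: "(\<Sum>j<m. \<phi> (U y p q i j) $$ (i, j)) =
     (if i = p then \<Sum>j<m. if j = q then \<phi> y $$ (i, j) else 0 else 0)" if i: "i < m" for i
   proof (cases "i = p")
    case True
    then show ?thesis unfolding True if_P[OF refl]
     by (intro sum.cong[OF refl]) (use i True in \<open>simp add: U_def 0\<close>)
   qed (use i in \<open>simp add: U_def 0\<close>)
   have "(\<Sum>i<m. \<Sum>j<m. \<phi> (U y p q i j) $$ (i, j)) =
     (\<Sum>i<m. if i = p then \<Sum>j<m. if j = q then \<phi> y $$ (i, j) else 0 else 0)"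
    by (rule sum.cong[OF refl]) (use row in simp)
   then have "f (U y p q) = Re (\<phi> y $$ (p, q))" using pq by (simp add: f_def)
   moreover have "F (U y p q) = f (U y p q)" using y SD by (intro F) (auto simp: E_def U_def)
   ultimately show ?thesis by simp
  qed
  show ?thesis
   by (rule eq_matI)
    (use x SD car[OF x] in \<open>auto simp: \<Phi>_def fU scale complex_eq_iff\<close>)
 qed
 have total: "(\<Sum>p<m. \<Sum>q<m. \<Phi> (W p q) $$ (p, q)) = Complex (F W) (- F (%p q. scaleC \<i> (W p q)))"
  if W: "!!i j. \<not> (i < m & j < m) ==> W i j = 0" for W
 proof -
  have FW: "F V = (\<Sum>p<m. \<Sum>q<m. F (U (V p q) p q))" if V: "!!i j. \<not> (i < m & j < m) ==> V i j = 0" for V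
  proof -
   have app: "sum g I i j = (\<Sum>a\<in>I. g a i j)" for g :: "nat => nat => nat => 'a" and I i j
    by (induction I rule: infinite_finite_induct) auto
   have "V = (\<Sum>p<m. \<Sum>q<m. U (V p q) p q)"
   proof (intro ext)
    fix i j
    have "(\<Sum>p<m. \<Sum>q<m. U (V p q) p q) i j = (\<Sum>p<m. if p = i then \<Sum>q<m. if q = j then V p q else 0 else 0)"
     unfolding app by (intro sum.cong refl) (auto simp: U_def intro!: sum.cong sum.neutral)
    then show "V i j = (\<Sum>p<m. \<Sum>q<m. U (V p q) p q) i j" using V[of i j] by auto
   qed
   then have "F V = F (\<Sum>p<m. \<Sum>q<m. U (V p q) p q)" by simp
   then show ?thesis by (simp add: linear_sum[OF F(1)])
  qed
  have "(\<Sum>p<m. \<Sum>q<m. \<Phi> (W p q) $$ (p, q)) =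
    Complex (\<Sum>p<m. \<Sum>q<m. F (U (W p q) p q)) (- (\<Sum>p<m. \<Sum>q<m. F (U (scaleC \<i> (W p q)) p q)))"
   by (simp add: complex_eq_iff \<Phi>_def sum_negf)
  then show ?thesis using FW[OF W] FW[of "%p q. scaleC \<i> (W p q)"] W by simp
 qed
 have pos: "0 <= (\<Sum>i<k. \<Sum>j<k. (\<Phi> (star (a i) * a j) *\<^sub>v \<xi> j) \<bullet>c \<xi> i)"
  if xi: "!!i. i < k ==> \<xi> i : carrier_vec m" for k :: nat and a \<xi>
 proof -
  define z where "z q = (\<Sum>j<k. scaleC (\<xi> j $ q) (a j))" for q
  define W where "W p q = (if p < m & q < m then star (z p) * z q else 0)" for p q
  have \<Phi>sum: "\<Phi> (sum g I) $$ (p, q) = (\<Sum>i\<in>I. \<Phi> (g i) $$ (p, q))" if "p < m" "q < m"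
   for g :: "nat => 'a" and I p q
  proof (induction I rule: infinite_finite_induct)
   case (insert x I)
   then show ?case using that by (simp add: add' dim')
  qed (use that scale'[of 0 0] car'[of 0] in \<open>auto, (metis carrier_matD index_smult_mat(1) mult_zero_left)+\<close>)
  have "(\<Sum>i<k. \<Sum>j<k. (\<Phi> (star (a i) * a j) *\<^sub>v \<xi> j) \<bullet>c \<xi> i) =
    (\<Sum>i<k. \<Sum>j<k. \<Sum>p<m. \<Sum>q<m. \<Phi> (star (a i) * a j) $$ (p, q) * \<xi> j $ q * cnj (\<xi> i $ p))"
   by (intro sum.cong refl form_expand car') (use xi in auto)
  also have "... = (\<Sum>p<m. \<Sum>q<m. \<Sum>i<k. \<Sum>j<k. \<Phi> (star (a i) * a j) $$ (p, q) * \<xi> j $ q * cnj (\<xi> i $ p))"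
  proof -
   have "(\<Sum>i<k. \<Sum>j<k. \<Sum>p<m. \<Sum>q<m. h i j p q) = (\<Sum>p<m. \<Sum>q<m. \<Sum>i<k. \<Sum>j<k. h i j p q)"
    for h :: "nat => nat => nat => nat => complex"
   proof -
    have "(\<Sum>i<k. \<Sum>j<k. \<Sum>p<m. \<Sum>q<m. h i j p q) = (\<Sum>i<k. \<Sum>p<m. \<Sum>j<k. \<Sum>q<m. h i j p q)"
     by (rule sum.cong[OF refl], rule sum.swap)
    also have "... = (\<Sum>p<m. \<Sum>i<k. \<Sum>j<k. \<Sum>q<m. h i j p q)" by (rule sum.swap)
    also have "... = (\<Sum>p<m. \<Sum>i<k. \<Sum>q<m. \<Sum>j<k. h i j p q)"
     by (rule sum.cong[OF refl], rule sum.cong[OF refl], rule sum.swap)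
    also have "... = (\<Sum>p<m. \<Sum>q<m. \<Sum>i<k. \<Sum>j<k. h i j p q)"
     by (rule sum.cong[OF refl], rule sum.swap)
    finally show ?thesis .
   qed
   then show ?thesis .
  qed
  also have "... = (\<Sum>p<m. \<Sum>q<m. \<Phi> (W p q) $$ (p, q))"
  proof (intro sum.cong refl)
   fix p q assume pq: "p : {..<m}" "q : {..<m}"
   have "star (z p) * z q = (\<Sum>i<k. \<Sum>j<k. scaleC (\<xi> j $ q * cnj (\<xi> i $ p)) (star (a i) * a j))"
    by (simp add: z_def star_sum sum_product star_scaleC mult_scaleC_left mult_scaleC_right scaleC_scaleC mult.commute)
   then have "\<Phi> (W p q) $$ (p, q) = (\<Sum>i<k. \<Sum>j<k. \<Phi> (scaleC (\<xi> j $ q * cnj (\<xi> i $ p)) (star (a i) * a j)) $$ (p, q))"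
    using pq by (simp add: W_def \<Phi>sum)
   also have "... = (\<Sum>i<k. \<Sum>j<k. \<Phi> (star (a i) * a j) $$ (p, q) * \<xi> j $ q * cnj (\<xi> i $ p))"
    using pq by (intro sum.cong refl) (simp add: scale' dim' mult_ac)
   finally show "(\<Sum>i<k. \<Sum>j<k. \<Phi> (star (a i) * a j) $$ (p, q) * \<xi> j $ q * cnj (\<xi> i $ p)) = \<Phi> (W p q) $$ (p, q)" ..
  qed
  also have "... = Complex (F W) (- F (%p q. scaleC \<i> (W p q)))" by (rule total) (auto simp: W_def)
  finally have eq: "(\<Sum>i<k. \<Sum>j<k. (\<Phi> (star (a i) * a j) *\<^sub>v \<xi> j) \<bullet>c \<xi> i) = Complex (F W) (- F (%p q. scaleC \<i> (W p q)))" .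
  have sW: "star (W q p) = W p q" for p q by (auto simp: W_def star_mult star_star)
  have Wc: "W : gram_cone m" by (rule gram_cone_row[of _ _ z]) (simp add: W_def)
  have "W : K"
   by (rule KI[of 0], simp, rule gram_cone_cong[OF gram_cone_add[OF Wc Wc]])
     (simp add: hermitian_part_def sW)
  then have "0 <= F W" by (rule F)
  moreover have "F (%p q. scaleC \<i> (W p q)) = 0"
  proof -
   let ?V = "%p q. scaleC \<i> (W p q)"
   have h: "hermitian_part ?V = (%p q. 0)" by (simp add: hermitian_part_def star_scaleC sW fun_eq_iff)
   have "?V : K" by (rule KI[of 0]) (auto simp: h intro: gram_cone_zero)
   moreover have h': "hermitian_part (- ?V) = (%p q. 0)" by (simp add: hermitian_part_def star_scaleC sW fun_eq_iff)
   have "- ?V : K" by (rule KI[of 0]) (auto simp: h' intro: gram_cone_zero)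
   ultimately show ?thesis using F(3)[of ?V] F(3)[of "- ?V"] Fneg[of ?V] by linarith
  qed
  ultimately show ?thesis unfolding eq by (simp add: less_eq_complex_def)
 qed
 have "cp_map m \<Phi>" unfolding cp_map_def using car' add' scale' pos by blast
 moreover have "Re (\<Sum>p<m. \<Phi> e $$ (p, p)) <= 0"
 proof -
  let ?V = "%p q. if p = q & p < m then - e else 0"
  have "?V : K"
   by (rule KI[of 2], simp, rule gram_cone_zero) (auto simp: hermitian_part_def e scaleR_2)
  then have "0 <= F ?V" by (rule F)
  also have "F ?V = Re (\<Sum>p<m. \<Sum>q<m. \<Phi> (?V p q) $$ (p, q))" by (subst total) auto
  also have "(\<Sum>p<m. \<Sum>q<m. \<Phi> (?V p q) $$ (p, q)) = (\<Sum>p<m. - \<Phi> e $$ (p, p))"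
  proof (intro sum.cong refl)
   fix p assume "p : {..<m}"
   then have p: "p < m" by simp
   have 0: "\<Phi> 0 $$ (p, q) = 0" if "q < m" for q
    using scale'[of 0 0] car'[of 0] p that by (metis carrier_matD index_smult_mat(1) mult_zero_left scaleC_zero_left)
   have ne: "\<Phi> (- e) $$ (p, p) = - \<Phi> e $$ (p, p)" using scale'[of "-1" e] car'[of e] p by simp
   have "(\<Sum>q<m. \<Phi> (?V p q) $$ (p, q)) = (\<Sum>q<m. if q = p then \<Phi> (- e) $$ (p, q) else 0)"
    using p by (intro sum.cong) (auto simp: 0)
   then show "(\<Sum>q<m. \<Phi> (?V p q) $$ (p, q)) = - \<Phi> e $$ (p, p)" using p ne by simp
  qed
  finally show ?thesis by (simp add: sum_negf)
 qed
 ultimately show ?thesis using that agree by blast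
qed

lemma Re_sum_hermitian_part:
 assumes S: "operator_system S" and star: "!!x. x : S ==> \<phi> (star x) = adj (\<phi> x)"
  and car: "!!x. x : S ==> \<phi> x : carrier_mat m m"
  and add: "!!x y. x : S ==> y : S ==> \<phi> (x + y) = \<phi> x + \<phi> y"
  and X: "!!p q. p < m ==> q < m ==> X p q : S"
 shows "Re (\<Sum>p<m. \<Sum>q<m. \<phi> (hermitian_part X p q) $$ (p, q)) = 2 * Re (\<Sum>p<m. \<Sum>q<m. \<phi> (X p q) $$ (p, q))"
proof -
 have "(\<Sum>p<m. \<Sum>q<m. \<phi> (hermitian_part X p q) $$ (p, q)) =
   (\<Sum>p<m. \<Sum>q<m. \<phi> (X p q) $$ (p, q)) + (\<Sum>p<m. \<Sum>q<m. cnj (\<phi> (X q p) $$ (q, p)))"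
  unfolding sum.distrib[symmetric]
 proof (intro sum.cong refl)
  fix p q assume "p : {..<m}" "q : {..<m}"
  then have pq: "p < m" "q < m" by auto
  show "\<phi> (hermitian_part X p q) $$ (p, q) = \<phi> (X p q) $$ (p, q) + cnj (\<phi> (X q p) $$ (q, p))"
   using X[OF pq] X[OF pq(2,1)] car[OF X[OF pq]] car[OF X[OF pq(2,1)]] operator_systemD[OF S] pq
   by (simp add: hermitian_part_def add star)
 qed
 also have "(\<Sum>p<m. \<Sum>q<m. cnj (\<phi> (X q p) $$ (q, p))) = cnj (\<Sum>p<m. \<Sum>q<m. \<phi> (X p q) $$ (p, q))"
  by (subst sum.swap) simp
 finally show ?thesis by simp
qed

text \<open>A map into the matrices is the same as a functional on arrays, and complete positivity is positivity
  of the functional on the Gram cone.\<close>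

theorem ucp_extension:
 assumes S: "operator_system S" and \<phi>: "\<phi> : ucp S m"
 obtains \<Phi> where "cp_map m \<Phi>" "!!x. x : S ==> \<Phi> x = \<phi> x"
proof -
 note D = ucpD[OF \<phi>] and SD = operator_systemD[OF S]
 have "0 <= Re (\<Sum>p<m. \<Sum>q<m. \<phi> (X p q) $$ (p, q))"
  if X: "!!p q. p < m ==> q < m ==> X p q : S"
   and C: "(%p q. hermitian_part X p q + (if p = q then s *\<^sub>R 0 else 0)) : gram_cone m" for X and s :: real
 proof -
  obtain ys where ys: "!!p q. p < m ==> q < m ==> hermitian_part X p q = gram ys p q"
  proof -
   have "hermitian_part X : gram_cone m" by (rule gram_cone_cong[OF C]) simp
   then show ?thesis using that by (auto simp: gram_cone_def)
  qed
  define k where "k = m + length ys"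
  define X' where "X' i j = (if i < m & j < m then hermitian_part X i j else 0)" for i j
  define Y where "Y l i = (if l < length ys & i < m then (ys ! l) i else 0)" for l i
  have hS: "hermitian_part X p q : S" if "p < m" "q < m" for p q
   using that X SD by (simp add: hermitian_part_def)
  have "X' i j = (\<Sum>l<k. star (Y l i) * Y l j)" for i j
  proof -
   have "(\<Sum>l<k. star (Y l i) * Y l j) = (\<Sum>l<length ys. star (Y l i) * Y l j)"
    by (rule sum.mono_neutral_right) (auto simp: k_def Y_def)
   also have "... = X' i j"
    by (auto simp: X'_def Y_def ys gram_def sum_list_sum_nth atLeast0LessThan intro!: sum.cong)
   finally show ?thesis ..
  qed
  then have pm: "positive_matrix k X'" unfolding positive_matrix_def by blast
  have cX: "\<phi> (X' i j) : carrier_mat m m" for i j using hS SD D(3) by (simp add: X'_def)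
  note z = scalar_prod_right_zero[OF mult_mat_vec_carrier'[OF cX]]
  have "0 <= (\<Sum>i<k. \<Sum>j<k. (\<phi> (X' i j) *\<^sub>v (if j < m then unit_vec m j else 0\<^sub>v m)) \<bullet>c (if i < m then unit_vec m i else 0\<^sub>v m))"
   by (rule ucp_pos[OF \<phi> _ pm]) (use hS SD in \<open>auto simp: X'_def\<close>)
  also have "... = (\<Sum>i<m. \<Sum>j<k. (\<phi> (X' i j) *\<^sub>v (if j < m then unit_vec m j else 0\<^sub>v m)) \<bullet>c (if i < m then unit_vec m i else 0\<^sub>v m))"
   by (rule sum.mono_neutral_right) (auto simp: k_def z)
  also have "... = (\<Sum>i<m. \<Sum>j<m. (\<phi> (X' i j) *\<^sub>v (if j < m then unit_vec m j else 0\<^sub>v m)) \<bullet>c (if i < m then unit_vec m i else 0\<^sub>v m))"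
  proof (rule sum.cong[OF refl], rule sum.mono_neutral_right, goal_cases)
   case (3 i)
   then have i: "i : {..<m}" by simp
   show ?case
   proof
   fix j assume j: "j : {..<k} - {..<m}"
   have c: "\<phi> (X' i j) : carrier_mat m m" using j SD D by (simp add: X'_def)
   have "\<phi> (X' i j) *\<^sub>v 0\<^sub>v m = 0\<^sub>v m" using c by (intro eq_vecI) auto
   then show "(\<phi> (X' i j) *\<^sub>v (if j < m then unit_vec m j else 0\<^sub>v m)) \<bullet>c (if i < m then unit_vec m i else 0\<^sub>v m) = 0"
    using i j by simp
   qed
  qed (auto simp: k_def)
  also have "... = (\<Sum>p<m. \<Sum>q<m. \<phi> (hermitian_part X p q) $$ (p, q))"
  proof (intro sum.cong refl)
   fix i j assume "i : {..<m}" "j : {..<m}"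
   then have ij: "i < m" "j < m" by auto
   show "(\<phi> (X' i j) *\<^sub>v (if j < m then unit_vec m j else 0\<^sub>v m)) \<bullet>c (if i < m then unit_vec m i else 0\<^sub>v m) =
     \<phi> (hermitian_part X i j) $$ (i, j)"
    using ij form_unit[OF D(3)[OF hS[OF ij]] ij] by (simp add: X'_def)
  qed
  finally have "0 <= Re (\<Sum>p<m. \<Sum>q<m. \<phi> (hermitian_part X p q) $$ (p, q))" by (simp add: less_eq_complex_def)
  also have "... = 2 * Re (\<Sum>p<m. \<Sum>q<m. \<phi> (X p q) $$ (p, q))"
   by (rule Re_sum_hermitian_part[OF S]) (use ucp_star[OF S \<phi>] D X in auto)
  finally show ?thesis by simp
 qed
 note core = this
 show ?thesis
 proof (rule cp_extension_core[OF S star_0, of \<phi> m])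
  fix X and s :: real assume "!!p q. p < m ==> q < m ==> X p q : S"
   "(%p q. hermitian_part X p q + (if p = q then s *\<^sub>R 0 else 0)) : gram_cone m"
  then show "0 <= Re (\<Sum>p<m. \<Sum>q<m. \<phi> (X p q) $$ (p, q))" by (rule core)
 next
  fix \<Phi> assume "cp_map m \<Phi>" "!!x. x : S ==> \<Phi> x = \<phi> x"
  then show thesis by (rule that)
 qed (use D in auto)
qed

theorem ucp_extension_vanishing:
 assumes S: "operator_system S" and \<phi>: "\<phi> : ucp S m" and e: "cpos e"
  and small: "!!\<epsilon>. 0 < \<epsilon> ==> EX \<Phi>. cp_map m \<Phi> & (\<forall>x\<in>S. \<Phi> x = \<phi> x) & Re (\<Sum>p<m. \<Phi> e $$ (p, p)) <= \<epsilon>"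
 obtains \<Phi> where "cp_map m \<Phi>" "!!x. x : S ==> \<Phi> x = \<phi> x" "!!p. p < m ==> \<Phi> e $$ (p, p) = 0"
proof -
 note D = ucpD[OF \<phi>] and SD = operator_systemD[OF S]
 have core: "0 <= Re (\<Sum>p<m. \<Sum>q<m. \<phi> (X p q) $$ (p, q))"
  if X: "!!p q. p < m ==> q < m ==> X p q : S" and s: "0 <= s"
   and C: "(%p q. hermitian_part X p q + (if p = q then s *\<^sub>R e else 0)) : gram_cone m" for X s
 proof -
  have herm: "Re (\<Sum>p<m. \<Sum>q<m. \<phi> (hermitian_part X p q) $$ (p, q)) = 2 * Re (\<Sum>p<m. \<Sum>q<m. \<phi> (X p q) $$ (p, q))"
   by (rule Re_sum_hermitian_part[OF S]) (use ucp_star[OF S \<phi>] D X in auto)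
  have bound: "- (s * \<epsilon>) <= 2 * Re (\<Sum>p<m. \<Sum>q<m. \<phi> (X p q) $$ (p, q))" if eps: "0 < \<epsilon>" for \<epsilon>
  proof -
   obtain \<Phi> where cp: "cp_map m \<Phi>" and ext: "!!x. x : S ==> \<Phi> x = \<phi> x"
    and le: "Re (\<Sum>p<m. \<Phi> e $$ (p, p)) <= \<epsilon>" using small[OF eps] by blast
   have "0 <= (\<Sum>p<m. \<Sum>q<m. \<Phi> (hermitian_part X p q + (if p = q then s *\<^sub>R e else 0)) $$ (p, q))"
    by (rule cp_map_gram_cone[OF cp C])
   also have "... = (\<Sum>p<m. \<Sum>q<m. \<phi> (hermitian_part X p q) $$ (p, q) + (if q = p then of_real s * \<Phi> e $$ (p, q) else 0))"
   proof (intro sum.cong refl)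
    fix p q assume "p : {..<m}" "q : {..<m}"
    then have pq: "p < m" "q < m" by auto
    have "hermitian_part X p q : S" using pq X SD by (simp add: hermitian_part_def)
    then show "\<Phi> (hermitian_part X p q + (if p = q then s *\<^sub>R e else 0)) $$ (p, q) =
      \<phi> (hermitian_part X p q) $$ (p, q) + (if q = p then of_real s * \<Phi> e $$ (p, q) else 0)"
     using pq cp_dim[OF cp] by (auto simp: cp_add[OF cp] ext scaleR_scaleC cp_scaleC[OF cp] cp_zero[OF cp])
   qed
   also have "... = (\<Sum>p<m. \<Sum>q<m. \<phi> (hermitian_part X p q) $$ (p, q)) + of_real s * (\<Sum>p<m. \<Phi> e $$ (p, p))"
    by (simp add: sum.distrib sum_distrib_left)
   finally have "0 <= Re (\<Sum>p<m. \<Sum>q<m. \<phi> (hermitian_part X p q) $$ (p, q)) + s * Re (\<Sum>p<m. \<Phi> e $$ (p, p))"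
    unfolding less_eq_complex_def by simp
   moreover have "s * Re (\<Sum>p<m. \<Phi> e $$ (p, p)) <= s * \<epsilon>" by (rule mult_left_mono[OF le s])
   ultimately show ?thesis
    using herm by linarith
  qed
  show ?thesis
  proof (rule ccontr)
   assume neg: "\<not> ?thesis"
   define \<delta> where "\<delta> = - Re (\<Sum>p<m. \<Sum>q<m. \<phi> (X p q) $$ (p, q))"
   have \<delta>: "0 < \<delta>" using neg by (simp add: \<delta>_def)
   have "s * (\<delta> / (s + 1)) <= \<delta>" using \<delta> s by (simp add: divide_simps algebra_simps)
   moreover have "- (s * (\<delta> / (s + 1))) <= 2 * - \<delta>"
   proof -
    have "0 < \<delta> / (s + 1)" using \<delta> s by simp
    from bound[OF this] show ?thesis unfolding \<delta>_def by (simp only: minus_minus)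
   qed
   ultimately show False using \<delta> by linarith
  qed
 qed
 obtain \<Phi> where \<Phi>: "cp_map m \<Phi>" "!!x. x : S ==> \<Phi> x = \<phi> x" "Re (\<Sum>p<m. \<Phi> e $$ (p, p)) <= 0"
 proof (rule cp_extension_core[OF S cpos_selfadjoint[OF e], of \<phi> m])
  fix X s assume "!!p q. p < m ==> q < m ==> X p q : S" "0 <= s"
   "(%p q. hermitian_part X p q + (if p = q then s *\<^sub>R e else 0)) : gram_cone m"
  then show "0 <= Re (\<Sum>p<m. \<Sum>q<m. \<phi> (X p q) $$ (p, q))" by (rule core)
 qed (use D in auto)
 have d: "0 <= \<Phi> e $$ (p, p)" if "p < m" for p
  using cp_pos_cpos[OF \<Phi>(1) e, of "unit_vec m p"] form_unit[OF cp_carrier[OF \<Phi>(1)] that that] by simp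
 have "0 <= (\<Sum>p<m. \<Phi> e $$ (p, p))" using d by (intro sum_nonneg) auto
 then have "(\<Sum>p<m. \<Phi> e $$ (p, p)) = 0" using \<Phi>(3) unfolding less_eq_complex_def by (auto simp: complex_eq_iff)
 then have "\<Phi> e $$ (p, p) = 0" if "p < m" for p
  using sum_nonneg_0[of "{..<m}" "%p. \<Phi> e $$ (p, p)"] d that by auto
 then show ?thesis using that \<Phi> by blast
qed

section \<open>Compressions and summands of completely positive maps\<close>

lemma cp_map_restrict_ucp:
 assumes \<Phi>: "cp_map d \<Phi>" "\<Phi> 1 = 1\<^sub>m d" and d: "0 < d" and S: "operator_system S"
 shows "restrict \<Phi> S : ucp S d"
proof -
 note SD = operator_systemD[OF S]
 have "0 <= (\<Sum>i<k. \<Sum>j<k. (restrict \<Phi> S (X i j) *\<^sub>v \<xi> j) \<bullet>c \<xi> i)"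
  if X: "ALL i<k. ALL j<k. X i j : S" and pm: "positive_matrix k X" and xi: "ALL i<k. \<xi> i : carrier_vec d"
  for k X and \<xi> :: "nat => complex vec"
 proof -
  obtain Y where Y: "!!i j. i < k ==> j < k ==> X i j = (\<Sum>l<k. star (Y l i) * Y l j)"
   using pm by (auto simp: positive_matrix_def)
  have "(\<Sum>i<k. \<Sum>j<k. (restrict \<Phi> S (X i j) *\<^sub>v \<xi> j) \<bullet>c \<xi> i) =
    (\<Sum>i<k. \<Sum>j<k. \<Sum>l<k. (\<Phi> (star (Y l i) * Y l j) *\<^sub>v \<xi> j) \<bullet>c \<xi> i)"
  proof (intro sum.cong refl)
   fix i j assume "i : {..<k}" "j : {..<k}"
   then have ij: "i < k" "j < k" by auto
   have "restrict \<Phi> S (X i j) = \<Phi> (X i j)" using X ij by simp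
   then show "(restrict \<Phi> S (X i j) *\<^sub>v \<xi> j) \<bullet>c \<xi> i = (\<Sum>l<k. (\<Phi> (star (Y l i) * Y l j) *\<^sub>v \<xi> j) \<bullet>c \<xi> i)"
    using Y[OF ij] xi ij by (simp add: cp_form_sum[OF \<Phi>(1)])
  qed
  also have "... = (\<Sum>i<k. \<Sum>l<k. \<Sum>j<k. (\<Phi> (star (Y l i) * Y l j) *\<^sub>v \<xi> j) \<bullet>c \<xi> i)"
   by (rule sum.cong[OF refl], rule sum.swap)
  also have "... = (\<Sum>l<k. \<Sum>i<k. \<Sum>j<k. (\<Phi> (star (Y l i) * Y l j) *\<^sub>v \<xi> j) \<bullet>c \<xi> i)"
   by (rule sum.swap)
  also have "... \<ge> 0" by (intro sum_nonneg cp_pos[OF \<Phi>(1)]) (use xi in auto)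
  finally show ?thesis .
 qed
 then show ?thesis
  unfolding ucp_def using d \<Phi>(2) SD cp_carrier[OF \<Phi>(1)] cp_add[OF \<Phi>(1)] cp_scaleC[OF \<Phi>(1)] by auto
qed

lemma conj_carrier:
 "A : carrier_mat m m ==> g : carrier_mat m n ==> adj g * A * g : carrier_mat n n"
 by (rule mult_carrier_mat[OF mult_carrier_mat[OF adjoint_carrier]])

lemma cp_map_conj:
 assumes \<Phi>: "cp_map d \<Phi>" and g: "g : carrier_mat d n"
 shows "cp_map n (%x. adj g * \<Phi> x * g)"
proof -
 note c = cp_carrier[OF \<Phi>] and form = conj_form[OF g cp_carrier[OF \<Phi>]]
 have gv: "g *\<^sub>v x : carrier_vec d" for x using g by auto
 have car: "adj g * \<Phi> x * g : carrier_mat n n" for x by (rule conj_carrier[OF c g])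
 show ?thesis
  unfolding cp_map_def
 proof (intro conjI allI impI)
  fix x y show "adj g * \<Phi> (x + y) * g = adj g * \<Phi> x * g + adj g * \<Phi> y * g"
   by (rule mat_eq_formI[OF car add_carrier_mat[OF car]])
    (simp add: form add_mat_vec_form[OF car car] cp_form_add[OF \<Phi> gv gv])
 next
  fix t x show "adj g * \<Phi> (scaleC t x) * g = t \<cdot>\<^sub>m (adj g * \<Phi> x * g)"
   by (rule mat_eq_formI[OF car smult_carrier_mat[OF car]])
    (simp add: form smult_mat_vec_form[OF car] cp_form_scaleC[OF \<Phi> gv gv])
 next
  fix k :: nat and a and \<xi> :: "nat => complex vec" assume "ALL i<k. \<xi> i : carrier_vec n"
  then have "(\<Sum>i<k. \<Sum>j<k. (adj g * \<Phi> (star (a i) * a j) * g *\<^sub>v \<xi> j) \<bullet>c \<xi> i) =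
    (\<Sum>i<k. \<Sum>j<k. (\<Phi> (star (a i) * a j) *\<^sub>v (g *\<^sub>v \<xi> j)) \<bullet>c (g *\<^sub>v \<xi> i))"
   by (intro sum.cong refl form) auto
  also have "... \<ge> 0" by (rule cp_pos[OF \<Phi>]) (rule gv)
  finally show "0 <= (\<Sum>i<k. \<Sum>j<k. (adj g * \<Phi> (star (a i) * a j) * g *\<^sub>v \<xi> j) \<bullet>c \<xi> i)" .
 qed (rule car)
qed

lemma cp_map_compose_conj:
 assumes \<Phi>: "cp_map d \<Phi>"
 shows "cp_map d (%x. \<Phi> (star b * x * b))"
 unfolding cp_map_def
proof (intro conjI allI impI)
 fix k :: nat and a and \<xi> :: "nat => complex vec" assume "ALL i<k. \<xi> i : carrier_vec d"
 then show "0 <= (\<Sum>i<k. \<Sum>j<k. (\<Phi> (star b * (star (a i) * a j) * b) *\<^sub>v \<xi> j) \<bullet>c \<xi> i)"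
  using cp_pos[OF \<Phi>, of k \<xi> "%i. a i * b"] by (simp add: star_mult mult.assoc)
qed (simp_all add: cp_carrier[OF \<Phi>] cp_add[OF \<Phi>] cp_scaleC[OF \<Phi>] ring_distribs
   mult_scaleC_left mult_scaleC_right flip: cp_add[OF \<Phi>] cp_scaleC[OF \<Phi>])

lemma cp_map_mat_sum:
 assumes \<Phi>: "!!t. t < r ==> cp_map d (\<Phi> t)"
 shows "cp_map d (%x. mat_sum d r (%t. \<Phi> t x))"
proof -
 note c = cp_carrier[OF \<Phi>]
 note form = mat_sum_form[OF c]
 show ?thesis
  unfolding cp_map_def
 proof (intro conjI allI impI)
  fix x y show "mat_sum d r (%t. \<Phi> t (x + y)) = mat_sum d r (%t. \<Phi> t x) + mat_sum d r (%t. \<Phi> t y)"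
   by (rule mat_eq_formI[of _ d d])
    (simp_all add: form add_mat_vec_form[of _ d d] cp_form_add[OF \<Phi>] sum.distrib)
 next
  fix k x show "mat_sum d r (%t. \<Phi> t (scaleC k x)) = k \<cdot>\<^sub>m mat_sum d r (%t. \<Phi> t x)"
   by (rule mat_eq_formI[of _ d d])
    (simp_all add: form smult_mat_vec_form[of _ d d] cp_form_scaleC[OF \<Phi>] sum_distrib_left)
 next
  fix k :: nat and a and \<xi> :: "nat => complex vec" assume xi: "ALL i<k. \<xi> i : carrier_vec d"
  then have "(\<Sum>i<k. \<Sum>j<k. (mat_sum d r (%t. \<Phi> t (star (a i) * a j)) *\<^sub>v \<xi> j) \<bullet>c \<xi> i) =
    (\<Sum>i<k. \<Sum>j<k. \<Sum>t<r. (\<Phi> t (star (a i) * a j) *\<^sub>v \<xi> j) \<bullet>c \<xi> i)"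
   by (intro sum.cong refl form) auto
  also have "... = (\<Sum>i<k. \<Sum>t<r. \<Sum>j<k. (\<Phi> t (star (a i) * a j) *\<^sub>v \<xi> j) \<bullet>c \<xi> i)"
   by (rule sum.cong[OF refl], rule sum.swap)
  also have "... = (\<Sum>t<r. \<Sum>i<k. \<Sum>j<k. (\<Phi> t (star (a i) * a j) *\<^sub>v \<xi> j) \<bullet>c \<xi> i)"
   by (rule sum.swap)
  also have "... \<ge> 0" by (intro sum_nonneg cp_pos[OF \<Phi>]) (use xi in auto)
  finally show "0 <= (\<Sum>i<k. \<Sum>j<k. (mat_sum d r (%t. \<Phi> t (star (a i) * a j)) *\<^sub>v \<xi> j) \<bullet>c \<xi> i)" .
 qed simp
qed

text \<open>A completely positive map vanishes on the kernel of \<open>\<Phi> 1\<close>, so compressing it to the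
  support of \<open>\<Phi> 1\<close> loses nothing and makes it unital.\<close>

lemma cp_map_normalise:
 assumes \<Phi>: "cp_map d \<Phi>"
 obtains r c e \<Psi> where "c : carrier_mat r d" "e : carrier_mat d r" "c * e = 1\<^sub>m r"
  "adj c * c = \<Phi> 1" "cp_map r \<Psi>" "\<Psi> 1 = 1\<^sub>m r" "!!x. \<Phi> x = adj c * \<Psi> x * c"
proof -
 note C = cp_carrier[OF \<Phi>]
 obtain r c e where c: "c : carrier_mat r d" and e: "e : carrier_mat d r"
  and cc: "adj c * c = \<Phi> 1" and ce: "c * e = 1\<^sub>m r"
  using psd_factor_mat[OF C, of 1] cp_pos_cpos[OF \<Phi> cpos_1] by metis
 define \<Psi> where "\<Psi> x = adj e * \<Phi> x * e" for x
 have cp: "cp_map r \<Psi>" unfolding \<Psi>_def by (rule cp_map_conj[OF \<Phi> e])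
 have "\<Psi> 1 = 1\<^sub>m r"
 proof (rule mat_eq_formI[OF cp_carrier[OF cp] one_carrier_mat])
  fix x y :: "complex vec" assume x: "x : carrier_vec r" and y: "y : carrier_vec r"
  have cev: "c *\<^sub>v (e *\<^sub>v z) = z" if "z : carrier_vec r" for z
   using assoc_mult_mat_vec[OF c e that] ce that by simp
  have ev: "e *\<^sub>v z : carrier_vec d" for z using e by auto
  have "(\<Psi> 1 *\<^sub>v x) \<bullet>c y = (\<Phi> 1 *\<^sub>v (e *\<^sub>v x)) \<bullet>c (e *\<^sub>v y)"
   unfolding \<Psi>_def by (rule conj_form[OF e C x y])
  also have "... = x \<bullet>c y"
   unfolding cc[symmetric] gram_form[OF c ev ev] cev[OF x] cev[OF y] ..
  finally show "(\<Psi> 1 *\<^sub>v x) \<bullet>c y = (1\<^sub>m r *\<^sub>v x) \<bullet>c y" using x by simp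
 qed
 moreover have "\<Phi> x = adj c * \<Psi> x * c" for x
 proof (rule mat_eq_formI[OF C conj_carrier[OF cp_carrier[OF cp] c]])
  fix \<xi> \<eta> :: "complex vec" assume xi: "\<xi> : carrier_vec d" and eta: "\<eta> : carrier_vec d"
  define P where "P z = e *\<^sub>v (c *\<^sub>v z)" for z
  have P: "P z : carrier_vec d" for z using e by (auto simp: P_def)
  have cv: "c *\<^sub>v z : carrier_vec r" for z using c by auto
  have null: "\<Phi> y *\<^sub>v z = \<Phi> y *\<^sub>v P z" if z: "z : carrier_vec d" for y z
  proof -
   have "c *\<^sub>v P z = c *\<^sub>v z"
    unfolding P_def using assoc_mult_mat_vec[OF c e cv, of z] ce cv[of z] by simp
   then have "c *\<^sub>v (z - P z) = 0\<^sub>v r"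
    using mult_minus_distrib_mat_vec[OF c z P] cv[of z] by simp
   then have "(\<Phi> (star 1 * 1) *\<^sub>v (z - P z)) \<bullet>c (z - P z) = 0"
    using gram_form[OF c, of "z - P z" "z - P z"] z P[of z] cc by simp
   then have "\<Phi> (y * 1) *\<^sub>v (z - P z) = 0\<^sub>v d"
    by (rule cp_null[OF \<Phi>, rotated]) (use z P[of z] in simp)
   then have "\<Phi> y *\<^sub>v z - \<Phi> y *\<^sub>v P z = 0\<^sub>v d"
    using mult_minus_distrib_mat_vec[OF C z P] by simp
   then have *: "(\<Phi> y *\<^sub>v z - \<Phi> y *\<^sub>v P z) $ i = 0" if "i < d" for i using that by simp
   show ?thesis
   proof (rule eq_vecI)
    fix i assume "i < dim_vec (\<Phi> y *\<^sub>v P z)"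
    then have "i < d" using cp_dim[OF \<Phi>] by simp
    then show "(\<Phi> y *\<^sub>v z) $ i = (\<Phi> y *\<^sub>v P z) $ i" using *[of i] cp_dim[OF \<Phi>] by simp
   qed (simp add: cp_dim[OF \<Phi>])
  qed
  have "(\<Phi> x *\<^sub>v \<xi>) \<bullet>c \<eta> = (\<Phi> x *\<^sub>v P \<xi>) \<bullet>c \<eta>" by (simp add: null[OF xi])
  also have "... = cnj ((\<Phi> (star x) *\<^sub>v \<eta>) \<bullet>c P \<xi>)"
   using cp_form_star[OF \<Phi> P eta, of "star x"] by (simp add: star_star)
  also have "... = cnj ((\<Phi> (star x) *\<^sub>v P \<eta>) \<bullet>c P \<xi>)" by (simp add: null[OF eta])
  also have "... = (\<Phi> x *\<^sub>v P \<xi>) \<bullet>c P \<eta>"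
   using cp_form_star[OF \<Phi> P P, of "star x"] by (simp add: star_star)
  also have "... = (\<Psi> x *\<^sub>v (c *\<^sub>v \<xi>)) \<bullet>c (c *\<^sub>v \<eta>)"
   unfolding \<Psi>_def P_def by (rule conj_form[OF e C cv cv, symmetric])
  also have "... = ((adj c * \<Psi> x * c) *\<^sub>v \<xi>) \<bullet>c \<eta>"
   by (rule conj_form[OF c cp_carrier[OF cp] xi eta, symmetric])
  finally show "(\<Phi> x *\<^sub>v \<xi>) \<bullet>c \<eta> = ((adj c * \<Psi> x * c) *\<^sub>v \<xi>) \<bullet>c \<eta>" .
 qed
 ultimately show ?thesis using that c e ce cc cp by blast
qed

lemma surjective_mat_right_inverse:
 fixes c e :: "complex mat"
 assumes "c : carrier_mat r n" "e : carrier_mat n r" "c * e = 1\<^sub>m r"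
 shows "surjective_mat c"
 unfolding surjective_mat_def
proof (intro equalityI subsetI)
 fix v :: "complex vec" assume "v : carrier_vec (dim_row c)"
 then have v: "v : carrier_vec r" using assms by simp
 have "v = c *\<^sub>v (e *\<^sub>v v)" using assoc_mult_mat_vec[OF assms(1,2) v] assms(3) v by simp
 moreover have "e *\<^sub>v v : carrier_vec (dim_col c)" using assms by auto
 ultimately show "v : (%v. c *\<^sub>v v) ` carrier_vec (dim_col c)" by blast
qed (use assms in auto)

lemma mat_sum_one: "F 0 : carrier_mat n n ==> mat_sum n (Suc 0) F = F 0"
 by (rule eq_matI) (auto simp: mat_sum_def)

lemma mat_sum_two: "F 0 : carrier_mat n n ==> F 1 : carrier_mat n n ==> mat_sum n (Suc (Suc 0)) F = F 0 + F 1"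
 by (rule eq_matI) (auto simp: mat_sum_def)

text \<open>The two normalised summands form a matrix convex combination with surjective coefficients, to which
  extremality applies; equality of levels makes the coefficient invertible.\<close>

theorem matrix_extreme_summand:
 assumes S: "operator_system S" and \<phi>: "\<phi> : matrix_extreme_points S d"
  and \<Phi>: "cp_map d \<Phi>1" "cp_map d \<Phi>2"
  and sum: "!!x. x : S ==> \<phi> x = \<Phi>1 x + \<Phi>2 x" and nz: "\<Phi>1 1 ~= 0\<^sub>m d d"
 obtains g h where "g : carrier_mat d d" "h : carrier_mat d d" "g * h = 1\<^sub>m d" "h * g = 1\<^sub>m d"
  "!!x. x : S ==> \<Phi>1 x = adj g * \<phi> x * g"
proof -
 have ucp: "\<phi> : ucp S d" using \<phi> by (simp add: matrix_extreme_points_def)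
 note D = ucpD[OF ucp] and SD = operator_systemD[OF S]
 obtain r1 c1 e1 \<Psi>1 where 1: "c1 : carrier_mat r1 d" "e1 : carrier_mat d r1" "c1 * e1 = 1\<^sub>m r1"
  "adj c1 * c1 = \<Phi>1 1" "cp_map r1 \<Psi>1" "\<Psi>1 1 = 1\<^sub>m r1" "!!x. \<Phi>1 x = adj c1 * \<Psi>1 x * c1"
  by (rule cp_map_normalise[OF \<Phi>(1)], rule that)
 obtain r2 c2 e2 \<Psi>2 where 2: "c2 : carrier_mat r2 d" "e2 : carrier_mat d r2" "c2 * e2 = 1\<^sub>m r2"
  "adj c2 * c2 = \<Phi>2 1" "cp_map r2 \<Psi>2" "\<Psi>2 1 = 1\<^sub>m r2" "!!x. \<Phi>2 x = adj c2 * \<Psi>2 x * c2"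
  by (rule cp_map_normalise[OF \<Phi>(2)], rule that)
 have r1: "0 < r1"
 proof (rule ccontr)
  assume "\<not> 0 < r1"
  then have "adj c1 * c1 = 0\<^sub>m d d" using 1(1) by (intro eq_matI) (auto simp: scalar_prod_def)
  with 1(4) nz show False by simp
 qed
 \<comment> \<open>If the second summand vanishes it has no level, and is dropped.\<close>
 define r where "r = (if r2 = 0 then Suc 0 else Suc (Suc 0))"
 define m where "m i = (if i = 0 then r1 else r2)" for i :: nat
 define \<psi> where "\<psi> i = (if i = 0 then restrict \<Psi>1 S else restrict \<Psi>2 S)" for i :: nat
 define \<gamma> where "\<gamma> i = (if i = 0 then c1 else c2)" for i :: nat
 have ms: "mat_sum d r F = F 0 + F 1"
  if "F 0 : carrier_mat d d" "F 1 : carrier_mat d d" "r2 = 0 ==> F 1 = 0\<^sub>m d d" for F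
  using that mat_sum_one[of F d] mat_sum_two[of F d] by (auto simp: r_def)
 have z: "adj c2 * X = 0\<^sub>m d d" if "r2 = 0" "X : carrier_mat 0 d" for X
  using that 2(1) by (intro eq_matI) (auto simp: scalar_prod_def)
 have cg: "adj c * c : carrier_mat d d" if "c : carrier_mat k d" for c k
  by (rule mult_carrier_mat[OF adjoint_carrier[OF that] that])
 have "matrix_convex_combination S d \<phi> r m \<psi> \<gamma>"
  unfolding matrix_convex_combination_def
 proof (intro conjI allI impI ballI)
  fix i assume i: "i < r"
  show "\<psi> i : ucp S (m i)"
   using i r1 cp_map_restrict_ucp[OF 1(5,6) r1 S] cp_map_restrict_ucp[OF 2(5,6) _ S]
   by (auto simp: \<psi>_def m_def r_def split: if_splits)
  show "\<gamma> i : carrier_mat (m i) d" using 1(1) 2(1) by (simp add: \<gamma>_def m_def)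
 next
  have "mat_sum d r (%i. adj (\<gamma> i) * \<gamma> i) = adj c1 * c1 + adj c2 * c2"
   by (subst ms) (use cg[OF 1(1)] cg[OF 2(1)] z[of c2] 2(1) in \<open>auto simp: \<gamma>_def\<close>)
  also have "... = \<phi> 1" by (simp add: 1(4) 2(4) sum SD)
  finally show "mat_sum d r (%i. adj (\<gamma> i) * \<gamma> i) = 1\<^sub>m d" by (simp add: D)
 next
  fix x assume x: "x : S"
  have "mat_sum d r (%i. adj (\<gamma> i) * \<psi> i x * \<gamma> i) = adj c1 * \<Psi>1 x * c1 + adj c2 * \<Psi>2 x * c2"
  proof (subst ms, goal_cases)
   case 3
   have "adj c2 * (\<Psi>2 x * c2) = 0\<^sub>m d d"
   proof (rule z)
    show "\<Psi>2 x * c2 : carrier_mat 0 d"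
     using mult_carrier_mat[OF cp_carrier[OF 2(5), of x] 2(1)] 3 by metis
   qed (use 3 in simp)
   then show ?case using x assoc_mult_mat[OF adjoint_carrier[OF 2(1)] cp_carrier[OF 2(5)] 2(1)]
    by (simp add: \<gamma>_def \<psi>_def)
  qed (use x conj_carrier[OF cp_carrier[OF 1(5)] 1(1)] conj_carrier[OF cp_carrier[OF 2(5)] 2(1)]
   in \<open>auto simp: \<gamma>_def \<psi>_def\<close>)
  then show "\<phi> x = mat_sum d r (%i. adj (\<gamma> i) * \<psi> i x * \<gamma> i)"
   by (simp add: sum[OF x] 1(7)[of x] 2(7)[of x])
 qed
 moreover have "ALL i<r. surjective_mat (\<gamma> i)"
  using surjective_mat_right_inverse[OF 1(1-3)] surjective_mat_right_inverse[OF 2(1-3)] by (simp add: \<gamma>_def)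
 ultimately have "ALL i<r. m i = d & unitarily_equivalent S d \<phi> (\<psi> i)"
  using \<phi> unfolding matrix_extreme_points_def by blast
 then have "m 0 = d & unitarily_equivalent S d \<phi> (\<psi> 0)" by (simp add: r_def)
 then obtain U where r1d: "r1 = d" and U: "unitary_mat d U" and eqU: "!!x. x : S ==> \<phi> x = adj U * \<Psi>1 x * U"
  by (auto simp: unitarily_equivalent_def m_def \<psi>_def)
 have Uc: "U : carrier_mat d d" and UU: "U * adj U = 1\<^sub>m d" and UU': "adj U * U = 1\<^sub>m d"
  using U by (auto simp: unitary_mat_def)
 have c1: "c1 : carrier_mat d d" and e1: "e1 : carrier_mat d d" and ce: "c1 * e1 = 1\<^sub>m d" using 1 r1d by auto
 have U': "adj U : carrier_mat d d" using Uc by simp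
 define g where "g = adj U * c1"
 define h where "h = e1 * U"
 have g: "g : carrier_mat d d" and h: "h : carrier_mat d d" using c1 e1 Uc by (auto simp: g_def h_def)
 have "g * h = adj U * (c1 * e1) * U"
  using c1 e1 Uc U' by (simp add: g_def h_def assoc_mult_mat[of _ d d _ d _ d])
 then have gh: "g * h = 1\<^sub>m d" by (simp only: ce right_mult_one_mat[OF U'] UU')
 then have hg: "h * g = 1\<^sub>m d" by (rule mat_mult_left_right_inverse[OF g h])
 have "\<Phi>1 x = adj g * \<phi> x * g" if x: "x : S" for x
 proof (rule mat_eq_formI[OF cp_carrier[OF \<Phi>(1)] conj_carrier[OF D(3)[OF x] g]])
  fix \<xi> \<eta> :: "complex vec" assume xi: "\<xi> : carrier_vec d" and eta: "\<eta> : carrier_vec d"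
  have C: "\<Psi>1 x : carrier_mat d d" using cp_carrier[OF 1(5)] r1d by simp
  have gv: "g *\<^sub>v z : carrier_vec d" for z using g by auto
  have Ug: "U *\<^sub>v (g *\<^sub>v z) = c1 *\<^sub>v z" if z: "z : carrier_vec d" for z
  proof -
   have "U * g = c1" unfolding g_def using assoc_mult_mat[OF Uc U' c1] UU c1 by simp
   then show ?thesis using assoc_mult_mat_vec[OF Uc g z] by simp
  qed
  have "((adj g * \<phi> x * g) *\<^sub>v \<xi>) \<bullet>c \<eta> = (\<phi> x *\<^sub>v (g *\<^sub>v \<xi>)) \<bullet>c (g *\<^sub>v \<eta>)"
   by (rule conj_form[OF g D(3)[OF x] xi eta])
  also have "... = (\<Psi>1 x *\<^sub>v (c1 *\<^sub>v \<xi>)) \<bullet>c (c1 *\<^sub>v \<eta>)"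
   unfolding eqU[OF x] conj_form[OF Uc C gv gv] Ug[OF xi] Ug[OF eta] ..
  also have "... = (\<Phi>1 x *\<^sub>v \<xi>) \<bullet>c \<eta>" unfolding 1(7)[of x] by (rule conj_form[OF c1 C xi eta, symmetric])
  finally show "(\<Phi>1 x *\<^sub>v \<xi>) \<bullet>c \<eta> = ((adj g * \<phi> x * g) *\<^sub>v \<xi>) \<bullet>c \<eta>" ..
 qed
 with g h gh hg show ?thesis using that by blast
qed

section \<open>Averages over roots of unity\<close>

definition primitive_root :: "nat => complex => bool" where
 "primitive_root N z \<longleftrightarrow> 0 < N & z ^ N = 1 & (ALL j. 0 < j & j < N --> z ^ j ~= 1)"

lemma primitive_rootD:
 assumes "primitive_root N z"
 shows "0 < N" "z ^ N = 1" "!!j. 0 < j ==> j < N ==> z ^ j ~= 1" "cmod z = 1" "cnj z * z = 1" "z * cnj z = 1" "z ~= 0"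
proof -
 show *: "0 < N" "z ^ N = 1" "!!j. 0 < j ==> j < N ==> z ^ j ~= 1"
  using assms by (auto simp: primitive_root_def)
 have "cmod z ^ N = 1" using *(2) by (metis norm_one norm_power)
 then show n: "cmod z = 1" using *(1) by (metis norm_ge_zero power_eq_1_iff power_eq_imp_eq_base power_one zero_le_one)
 show "z * cnj z = 1" using complex_norm_square[of z] n by simp
 then show "cnj z * z = 1" by (simp add: mult.commute)
 show "z ~= 0" using n by auto
qed

lemma primitive_root_exists:
 assumes "0 < n" "coprime k n"
 shows "primitive_root n (exp (2 * complex_of_real pi * \<i> * of_nat k / of_nat n))"
proof -
 let ?q = "exp (2 * complex_of_real pi * \<i> * of_nat k / of_nat n)"
 have qj: "?q ^ j = exp (2 * of_real pi * \<i> * (of_nat (k * j) / of_nat n))" for j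
  by (simp add: exp_of_nat_mult[symmetric] field_simps)
 have iff: "?q ^ j = 1 \<longleftrightarrow> n dvd k * j" for j
 proof
  assume "n dvd k * j"
  then obtain t where "k * j = n * t" by auto
  then have "(of_nat (k * j) / of_nat n :: complex) = of_nat t" using assms(1) by (simp add: field_simps flip: of_nat_mult)
  then have "?q ^ j = exp (of_nat t * (2 * of_real pi * \<i>))" unfolding qj by (simp add: mult_ac)
  then show "?q ^ j = 1" by (simp add: exp_of_nat_mult)
 next
  assume "?q ^ j = 1"
  then have "exp (2 * of_real pi * \<i> * (of_nat (k * j) / of_nat n)) = (1 :: complex)" by (simp only: qj)
  then have "Re (exp (2 * of_real pi * \<i> * (of_nat (k * j) / of_nat n))) = 1" by simp
  moreover have "2 * of_real pi * \<i> * (of_nat (k * j) / of_nat n) = \<i> * of_real (2 * pi * (real (k * j) / real n))"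
   by (simp add: mult_ac)
  ultimately have "cos (2 * pi * (real (k * j) / real n)) = 1"
   by (simp only: cis_conv_exp[symmetric] cis.sel)
  then obtain t :: int where "2 * pi * (real (k * j) / real n) = real_of_int t * 2 * pi"
   unfolding cos_one_2pi_int by blast
  then have "2 * pi * (real (k * j) / real n) = 2 * pi * of_int t" by (simp only: mult_ac)
  then have "real (k * j) / real n = of_int t" by (simp only: mult_cancel_left) simp
  then have "real (k * j) = of_int t * real n" using assms(1) by (simp add: field_simps)
  then have "of_int (int (k * j)) = (of_int (t * int n) :: real)" by simp
  then have "int (k * j) = t * int n" by (simp only: of_int_eq_iff)
  then have "int n dvd int (k * j)" by simp
  then show "n dvd k * j" by (simp only: int_dvd_int_iff)
 qed
 show ?thesis
  unfolding primitive_root_def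
 proof (intro conjI allI impI)
  show "?q ^ n = 1" by (simp only: iff) simp
  fix j assume j: "0 < j & j < n"
  show "?q ^ j ~= 1"
  proof
   assume "?q ^ j = 1"
   then have "n dvd j" using assms(2) by (simp only: iff coprime_commute coprime_dvd_mult_right_iff)
   with j show False by (simp add: nat_dvd_not_less)
  qed
 qed (rule assms)
qed

lemma primitive_root_orthogonality:
 assumes z: "primitive_root N z" and ab: "a < N" "b < N"
 shows "(\<Sum>j<N. (z ^ j) ^ a * (cnj (z ^ j)) ^ b) = (if a = b then of_nat N else 0)"
proof -
 note D = primitive_rootD[OF z]
 have e: "(z ^ j) ^ a * (cnj (z ^ j)) ^ b = (z ^ a * cnj z ^ b) ^ j" for j
  by (simp add: power_mult_distrib mult.commute flip: power_mult)
 have N1: "(z ^ a * cnj z ^ b) ^ N = 1"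
 proof -
  have "(z ^ a * cnj z ^ b) ^ N = (z ^ N) ^ a * (cnj (z ^ N)) ^ b"
   by (simp add: power_mult_distrib mult.commute flip: power_mult)
  then show ?thesis by (simp add: D(2))
 qed
 have cz: "cnj z ^ i * z ^ i = 1" "z ^ i * cnj z ^ i = 1" for i using D(5,6) by (simp_all flip: power_mult_distrib)
 show ?thesis
 proof (cases "a = b")
  case True
  then show ?thesis unfolding e by (simp add: cz)
 next
  case False
  have ne: "z ^ a * cnj z ^ b ~= 1"
  proof (cases "b < a")
   case True
   have "z ^ a * cnj z ^ b = z ^ (a - b) * (z ^ b * cnj z ^ b)" using True by (simp flip: power_add mult.assoc)
   then show ?thesis using D(3)[of "a - b"] True ab by (simp add: cz)
  next
   case F: False
   have "cnj (z ^ a * cnj z ^ b) = (cnj z ^ a * z ^ a) * z ^ (b - a)" using F by (simp add: mult.assoc flip: power_add)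
   then have "cnj (z ^ a * cnj z ^ b) ~= 1" using D(3)[of "b - a"] F False ab by (simp add: cz)
   then show ?thesis by (metis complex_cnj_one)
  qed
  have "(\<Sum>j<N. (z ^ a * cnj z ^ b) ^ j) = 0"
   using geometric_sum[OF ne, of N] N1 by simp
  then show ?thesis using False unfolding e by simp
 qed
qed

text \<open>The average of \<open>(w / z)\<^sup>a\<close> over \<open>a < N\<close>. If \<open>w\<^sup>N = 1\<close> and \<open>z\<close> is an \<open>N\<close>-th root of unity, this
  is the eigenprojection of \<open>w\<close> at \<open>z\<close>; for general unitary \<open>w\<close> it is a Fejer-type localisation.\<close>

definition root_average :: "nat => 'a::unital_cstar_algebra => complex => 'a" where
 "root_average N w z = scaleC (1 / of_nat N) (\<Sum>a<N. scaleC (cnj z ^ a) (w ^ a))"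

lemma root_average_eigen:
 assumes z: "cnj z * z = 1" "z ^ N = 1"
 shows "w * root_average N w z - scaleC z (root_average N w z) = scaleC (z / of_nat N) (w ^ N - 1)"
proof -
 have tel: "w * (\<Sum>a<M. scaleC (cnj z ^ a) (w ^ a)) - scaleC z (\<Sum>a<M. scaleC (cnj z ^ a) (w ^ a)) =
   scaleC (z * cnj z ^ M) (w ^ M) - scaleC z 1" for M
 proof (induction M)
  case (Suc M)
  have "z * cnj z ^ Suc M = cnj z ^ M" using z(1) by (simp add: mult.assoc[symmetric] mult.commute[of z])
  moreover have "w * scaleC (cnj z ^ M) (w ^ M) = scaleC (cnj z ^ M) (w ^ Suc M)"
   by (simp add: mult_scaleC_right)
  ultimately have "w * scaleC (cnj z ^ M) (w ^ M) = scaleC (z * cnj z ^ Suc M) (w ^ Suc M)" by (simp only:)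
  moreover have "w * (\<Sum>a<Suc M. scaleC (cnj z ^ a) (w ^ a)) - scaleC z (\<Sum>a<Suc M. scaleC (cnj z ^ a) (w ^ a)) =
    (w * (\<Sum>a<M. scaleC (cnj z ^ a) (w ^ a)) - scaleC z (\<Sum>a<M. scaleC (cnj z ^ a) (w ^ a))) +
    (w * scaleC (cnj z ^ M) (w ^ M) - scaleC (z * cnj z ^ M) (w ^ M))"
   by (simp add: distrib_left scaleC_add_right scaleC_scaleC)
  ultimately show ?case unfolding Suc by simp
 qed simp
 have "cnj z ^ N = 1" using z(2) by (metis complex_cnj_one complex_cnj_power)
 then have "w * (\<Sum>a<N. scaleC (cnj z ^ a) (w ^ a)) - scaleC z (\<Sum>a<N. scaleC (cnj z ^ a) (w ^ a)) = scaleC z (w ^ N - 1)"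
  by (simp add: tel scaleC_diff_right)
 from arg_cong[OF this, of "scaleC (1 / of_nat N)"] show ?thesis
  by (simp add: root_average_def mult_scaleC_right scaleC_diff_right scaleC_scaleC mult.commute)
qed

lemma star_root_average:
 "star (root_average N w z) = scaleC (1 / of_nat N) (\<Sum>a<N. scaleC (z ^ a) (star w ^ a))"
 by (simp add: root_average_def star_scaleC star_sum star_power)

lemma root_average_sum_squares:
 assumes z: "primitive_root N z" and w: "star w * w = 1"
 shows "(\<Sum>j<N. star (root_average N w (z ^ j)) * root_average N w (z ^ j)) = 1"
proof -
 have N: "0 < N" using primitive_rootD[OF z] by simp
 have ww: "star w ^ a * w ^ a = 1" for a
 proof (induction a)
  case (Suc a)
  have "star w ^ Suc a * w ^ Suc a = star w ^ a * (star w * w) * w ^ a" by (simp only: power_Suc2[of "star w"] power_Suc[of w] mult.assoc)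
  then show ?case by (simp add: w Suc)
 qed simp
 have "star (root_average N w (z ^ j)) * root_average N w (z ^ j) =
   scaleC (1 / of_nat N * (1 / of_nat N)) (\<Sum>a<N. \<Sum>b<N. scaleC ((z ^ j) ^ a * cnj (z ^ j) ^ b) (star w ^ a * w ^ b))" for j
  unfolding star_root_average unfolding root_average_def
  by (simp only: sum_product mult_scaleC_left mult_scaleC_right scaleC_scaleC) (simp only: mult.commute)
 then have "(\<Sum>j<N. star (root_average N w (z ^ j)) * root_average N w (z ^ j)) =
   scaleC (1 / of_nat N * (1 / of_nat N)) (\<Sum>j<N. \<Sum>a<N. \<Sum>b<N. scaleC ((z ^ j) ^ a * cnj (z ^ j) ^ b) (star w ^ a * w ^ b))"
  by (simp only: scaleC_sum_right)
 also have "(\<Sum>j<N. \<Sum>a<N. \<Sum>b<N. scaleC ((z ^ j) ^ a * cnj (z ^ j) ^ b) (star w ^ a * w ^ b)) =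
   (\<Sum>a<N. \<Sum>j<N. \<Sum>b<N. scaleC ((z ^ j) ^ a * cnj (z ^ j) ^ b) (star w ^ a * w ^ b))"
  by (rule sum.swap)
 also have "... = (\<Sum>a<N. \<Sum>b<N. \<Sum>j<N. scaleC ((z ^ j) ^ a * cnj (z ^ j) ^ b) (star w ^ a * w ^ b))"
  by (rule sum.cong[OF refl], rule sum.swap)
 also have "... = (\<Sum>a<N. \<Sum>b<N. if b = a then scaleC (of_nat N) 1 else 0)"
 proof (intro sum.cong refl)
  fix a b assume "a : {..<N}" "b : {..<N}"
  then show "(\<Sum>j<N. scaleC ((z ^ j) ^ a * cnj (z ^ j) ^ b) (star w ^ a * w ^ b)) = (if b = a then scaleC (of_nat N) 1 else 0)"
   using primitive_root_orthogonality[OF z, of a b] by (auto simp: ww simp flip: scaleC_sum_left)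
 qed
 also have "... = (\<Sum>a<N. scaleC (of_nat N) 1)" by (intro sum.cong refl) simp
 also have "... = scaleC (\<Sum>a<N. of_nat N) 1" by (rule scaleC_sum_left[symmetric])
 also have "... = scaleC (of_nat N * of_nat N) 1" by simp
 finally show ?thesis using N by (simp add: scaleC_scaleC)
qed

lemma root_average_sum:
 assumes z: "primitive_root N z"
 shows "(\<Sum>j<N. root_average N w (z ^ j)) = 1"
proof -
 have N: "0 < N" using primitive_rootD[OF z] by simp
 have "(\<Sum>j<N. root_average N w (z ^ j)) = scaleC (1 / of_nat N) (\<Sum>j<N. \<Sum>a<N. scaleC (cnj (z ^ j) ^ a) (w ^ a))"
  by (simp add: root_average_def scaleC_sum_right)
 also have "(\<Sum>j<N. \<Sum>a<N. scaleC (cnj (z ^ j) ^ a) (w ^ a)) = (\<Sum>a<N. \<Sum>j<N. scaleC (cnj (z ^ j) ^ a) (w ^ a))"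
  by (rule sum.swap)
 also have "... = (\<Sum>a<N. if a = 0 then scaleC (of_nat N) 1 else 0)"
 proof (intro sum.cong refl)
  fix a assume "a : {..<N}"
  then show "(\<Sum>j<N. scaleC (cnj (z ^ j) ^ a) (w ^ a)) = (if a = 0 then scaleC (of_nat N) 1 else 0)"
   using primitive_root_orthogonality[OF z, of 0 a] N by (auto simp flip: scaleC_sum_left)
 qed
 finally show ?thesis using N by (simp add: scaleC_scaleC)
qed

lemma norm_unitary: "star w * w = 1 ==> norm (w :: 'a::unital_cstar_algebra) = 1"
 using cstar_identity[of w] by (simp add: power2_eq_1_iff) (smt (verit) norm_ge_zero)

lemma norm_power_unitary_le: "star w * w = 1 ==> norm ((w :: 'a::unital_cstar_algebra) ^ k) <= 1"
 using norm_power_ineq[of w k] norm_unitary[of w] by simp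

lemma norm_root_average_le:
 fixes w :: "'a::unital_cstar_algebra"
 assumes w: "star w * w = 1" and z: "cmod z = 1" and N: "0 < N"
 shows "norm (root_average N w z) <= 1"
proof -
 have "norm (\<Sum>a<N. scaleC (cnj z ^ a) (w ^ a)) <= (\<Sum>a<N. 1)"
  using norm_power_unitary_le[OF w] by (intro sum_norm_le) (simp add: norm_scaleC norm_power z)
 then show ?thesis using N by (simp add: root_average_def norm_scaleC norm_divide divide_simps)
qed

section \<open>Localisation in the joint spectrum of two commuting unitaries\<close>

text \<open>The point \<open>(\<lambda>, \<mu>)\<close> belongs to the joint spectrum iff this element is not invertible.\<close>

definition gap :: "'a::unital_cstar_algebra => 'a => complex => complex => 'a" where
 "gap w1 w2 l m = star (w1 - scaleC l 1) * (w1 - scaleC l 1) + star (w2 - scaleC m 1) * (w2 - scaleC m 1)"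

lemma cpos_gap: "cpos (gap w1 w2 l m)"
 unfolding gap_def by (intro cpos_add cpos_star_mult)

lemma gap_commute:
 fixes y :: "'a::unital_cstar_algebra"
 assumes y: "y * w1 = w1 * y" "y * star w1 = star w1 * y" "y * w2 = w2 * y" "y * star w2 = star w2 * y"
 shows "y * gap w1 w2 l \<mu> = gap w1 w2 l \<mu> * y"
proof -
 have mul: "y * (a * b) = a * b * y" if "y * a = a * y" "y * b = b * y" for a b
 proof -
  have "y * (a * b) = (y * a) * b" by (rule mult.assoc[symmetric])
  also have "... = a * (y * b)" unfolding that(1) by (rule mult.assoc)
  also have "... = a * b * y" unfolding that(2) by (rule mult.assoc[symmetric])
  finally show ?thesis .
 qed
 have "y * (w1 - scaleC l 1) = (w1 - scaleC l 1) * y" "y * star (w1 - scaleC l 1) = star (w1 - scaleC l 1) * y"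
  "y * (w2 - scaleC \<mu> 1) = (w2 - scaleC \<mu> 1) * y" "y * star (w2 - scaleC \<mu> 1) = star (w2 - scaleC \<mu> 1) * y"
  using y by (simp_all add: ring_distribs star_scaleC mult_scaleC_left mult_scaleC_right)
 then show ?thesis unfolding gap_def distrib_left distrib_right by (simp only: mul)
qed

lemma root_average_gap_bound:
 fixes w :: "'a::unital_cstar_algebra"
 assumes w: "star w * w = 1" and z: "primitive_root N z" and zj: "x = z ^ j"
 shows "cpos ((4 / (real N)\<^sup>2) *\<^sub>R 1 - star (root_average N w x) * (star (w - scaleC x 1) * (w - scaleC x 1)) * root_average N w x)"
proof -
 note D = primitive_rootD[OF z]
 have x1: "x ^ N = 1" "cnj x * x = 1" "cmod x = 1"
  using D(2,4,5) by (simp_all add: zj norm_power flip: power_mult power_mult_distrib)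
   (simp add: mult.commute[of j] power_mult)
 let ?y = "(w - scaleC x 1) * root_average N w x"
 have "?y = scaleC (x / of_nat N) (w ^ N - 1)"
  using root_average_eigen[OF x1(2,1), of w] by (simp add: left_diff_distrib mult_scaleC_left)
 then have "norm ?y = norm (w ^ N - 1) / real N" by (simp add: norm_scaleC norm_divide x1)
 also have "... <= 2 / real N"
  using norm_triangle_ineq4[of "w ^ N" 1] norm_power_unitary_le[OF w, of N] by (intro divide_right_mono) auto
 finally have "norm ?y ^ 2 <= (2 / real N) ^ 2" by (intro power_mono) auto
 then have "norm (star ?y * ?y) <= 4 / (real N)\<^sup>2" by (simp add: cstar_identity power_divide)
 then have "cpos ((4 / (real N)\<^sup>2) *\<^sub>R 1 - star ?y * ?y)"
  by (intro cpos_scalar_minus) (auto simp: star_mult star_star)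
 then show ?thesis by (simp add: star_mult mult.assoc)
qed

text \<open>Localisation: the positive parts of \<open>c - gap\<close> at finitely many points of the torus have a
  sum bounded below. This follows by averaging \<open>c - gap\<close> against the partition of unity given by
  products of root averages, whose mean gap is \<open>8 / N\<close>.\<close>

theorem positive_parts_cover:
 fixes w1 w2 :: "'a::unital_cstar_algebra"
 assumes w1: "star w1 * w1 = 1" "w1 * star w1 = 1" and w2: "star w2 * w2 = 1" "w2 * star w2 = 1"
  and comm: "w1 * w2 = w2 * w1" "w1 * star w2 = star w2 * w1"
  and c: "0 < c"
 obtains X :: "(complex \<times> complex) set" and p m :: "complex \<times> complex => 'a" and \<delta> :: real
 where "finite X" "0 < \<delta>" "!!l \<mu>. (l, \<mu>) : X ==> cmod l = 1 & cmod \<mu> = 1"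
  "!!x. cpos (p x)" "!!x. cpos (m x)" "!!l \<mu>. c *\<^sub>R 1 - gap w1 w2 l \<mu> = p (l, \<mu>) - m (l, \<mu>)"
  "!!x. p x * m x = 0"
  "!!l \<mu>. calculus_of (gap w1 w2 l \<mu>) (p (l, \<mu>))"  "!!l \<mu>. calculus_of (gap w1 w2 l \<mu>) (m (l, \<mu>))"
  "cpos ((\<Sum>x\<in>X. p x) - \<delta> *\<^sub>R 1)"
proof -
 have "EX p m. cpos p & cpos m & c *\<^sub>R 1 - gap w1 w2 (fst x) (snd x) = p - m & p * m = 0 \<and>
   calculus_of (gap w1 w2 (fst x) (snd x)) p & calculus_of (gap w1 w2 (fst x) (snd x)) m" for x
 proof -
  have s: "star (c *\<^sub>R 1 - gap w1 w2 (fst x) (snd x)) = c *\<^sub>R 1 - gap w1 w2 (fst x) (snd x)"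
   using cpos_selfadjoint[OF cpos_gap] by simp
  have k: "calculus_of (gap w1 w2 (fst x) (snd x)) (c *\<^sub>R 1 - gap w1 w2 (fst x) (snd x))"
   by (intro calculus_of_diff calculus_of_scaleR calculus_of_one calculus_of_refl)
  show ?thesis
  proof (rule positive_parts[OF s])
   fix p m assume "cpos p" "cpos m" "c *\<^sub>R 1 - gap w1 w2 (fst x) (snd x) = p - m" "p * m = 0"
    "calculus_of (c *\<^sub>R 1 - gap w1 w2 (fst x) (snd x)) p" "calculus_of (c *\<^sub>R 1 - gap w1 w2 (fst x) (snd x)) m"
   with calculus_of_trans[OF k] show ?thesis by blast
  qed
 qed
 then obtain p m where pm: "!!x. cpos (p x)" "!!x. cpos (m x)"
  "!!x. c *\<^sub>R 1 - gap w1 w2 (fst x) (snd x) = p x - m x" "!!x. p x * m x = 0"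
  "!!x. calculus_of (gap w1 w2 (fst x) (snd x)) (p x)" "!!x. calculus_of (gap w1 w2 (fst x) (snd x)) (m x)"
  by metis
 obtain N :: nat where N: "8 / c < real N" using reals_Archimedean2 by blast
 have N0: "0 < N" using N c by (intro gr0I) (auto simp: divide_less_0_iff)
 define z where "z = exp (2 * complex_of_real pi * \<i> * of_nat 1 / of_nat N)"
 have z: "primitive_root N z" unfolding z_def by (rule primitive_root_exists[OF N0]) simp
 note zD = primitive_rootD[OF z]
 define r where "r i = root_average N w1 (z ^ i)" for i
 define s where "s j = root_average N w2 (z ^ j)" for j
 have zn: "cmod (z ^ i) = 1" for i using zD by (simp add: norm_power)
 have cw: "star w1 * w2 = w2 * star w1" "star w1 * star w2 = star w2 * star w1"
  using arg_cong[OF comm(1), of star] arg_cong[OF comm(2), of star] by (simp_all add: star_mult star_star)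
 have pow: "y * v ^ a = v ^ a * y" if "y * v = v * y" for y v :: 'a and a
  by (induction a) (use that in \<open>simp_all add: mult.assoc[symmetric]\<close>, simp add: mult.assoc that)
 have avg: "y * root_average N v t = root_average N v t * y" if "y * v = v * y" for y v :: 'a and t
  using pow[OF that] by (simp add: root_average_def sum_distrib_left sum_distrib_right mult_scaleC_left mult_scaleC_right)
 have rs: "r i * s j = s j * r i" for i j
  unfolding r_def s_def by (rule avg) (rule avg[symmetric], rule comm(1)[symmetric, THEN sym, symmetric])
 have rp: "(r i * s j) * p x = p x * (r i * s j)" for i j x
 proof (rule calculus_of_comm[OF pm(5)], rule gap_commute)
  have r1: "v * r i = r i * v" if "v * w1 = w1 * v" for v unfolding r_def by (rule avg[OF that])
  have s1: "v * s j = s j * v" if "v * w2 = w2 * v" for v unfolding s_def by (rule avg[OF that])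
  have both: "r i * s j * v = v * (r i * s j)" if "v * w1 = w1 * v" "v * w2 = w2 * v" for v
  proof -
   have "r i * s j * v = r i * (v * s j)" using s1[OF that(2)] by (simp add: mult.assoc)
   also have "... = v * (r i * s j)" using r1[OF that(1)] by (simp add: mult.assoc[symmetric])
   finally show ?thesis .
  qed
  show "r i * s j * w1 = w1 * (r i * s j)" by (rule both) (simp_all add: comm)
  show "r i * s j * w2 = w2 * (r i * s j)" by (rule both) (simp_all add: comm)
  show "r i * s j * star w1 = star w1 * (r i * s j)" by (rule both) (simp_all add: cw w1)
  show "r i * s j * star w2 = star w2 * (r i * s j)" by (rule both) (simp_all add: comm w2)
 qed
 define R where "R i j = r i * s j" for i j
 define pt where "pt i j = (z ^ i, z ^ j)" for i j
 have one: "(\<Sum>i<N. \<Sum>j<N. star (R i j) * R i j) = 1"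
 proof -
  have "(\<Sum>i<N. \<Sum>j<N. star (R i j) * R i j) = (\<Sum>j<N. \<Sum>i<N. star (s j) * (star (r i) * r i) * s j)"
   by (subst sum.swap) (simp add: R_def star_mult mult.assoc)
  also have "... = (\<Sum>j<N. star (s j) * (\<Sum>i<N. star (r i) * r i) * s j)"
   by (simp add: sum_distrib_left sum_distrib_right)
  also have "... = 1" unfolding r_def root_average_sum_squares[OF z w1(1)] s_def
   by (simp add: root_average_sum_squares[OF z w2(1)])
  finally show ?thesis .
 qed
 have bound: "cpos (p (pt i j) + (4 / (real N)\<^sup>2) *\<^sub>R (star (s j) * s j) + (4 / (real N)\<^sup>2) *\<^sub>R (star (r i) * r i) - c *\<^sub>R (star (R i j) * R i j))" for i j
 proof -
  let ?x = "pt i j" and ?k = "4 / (real N)\<^sup>2"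
  let ?g1 = "star (w1 - scaleC (z ^ i) 1) * (w1 - scaleC (z ^ i) 1)"
  let ?g2 = "star (w2 - scaleC (z ^ j) 1) * (w2 - scaleC (z ^ j) 1)"
  have gap: "gap w1 w2 (fst ?x) (snd ?x) = ?g1 + ?g2" by (simp add: gap_def pt_def)
  have A: "cpos (star (s j) * (?k *\<^sub>R 1 - star (r i) * ?g1 * r i) * s j)"
   unfolding r_def by (intro cpos_conj root_average_gap_bound[OF w1(1) z refl])
  have B: "cpos (star (r i) * (?k *\<^sub>R 1 - star (s j) * ?g2 * s j) * r i)"
   unfolding s_def by (intro cpos_conj root_average_gap_bound[OF w2(1) z refl])
  have C: "cpos (star (R i j) * m ?x * R i j)" by (rule cpos_conj[OF pm(2)])
  obtain d where d: "star d = d" "p ?x = d * d" "calculus_of (p ?x) d" using pm(1) by (rule cpos_sqrt)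
  have "norm (R i j) <= 1 * 1"
   unfolding R_def r_def s_def
   by (intro order_trans[OF norm_mult_ineq] mult_mono norm_root_average_le w1 w2 zn N0) auto
  then have "norm (star (R i j) * R i j) <= 1" by (simp add: cstar_identity power_le_one)
  then have "cpos (star d * (1 *\<^sub>R 1 - star (R i j) * R i j) * d)"
   by (intro cpos_conj cpos_scalar_minus) (auto simp: star_mult star_star)
  moreover have "star d * (star (R i j) * R i j) * d = star (R i j) * p ?x * R i j"
  proof -
   have Rd: "R i j * d = d * R i j" by (rule calculus_of_comm[OF d(3)]) (simp add: R_def rp)
   have "star (R i j) * (d * d) * R i j = (star (R i j) * d) * (d * R i j)" by (simp add: mult.assoc)
   also have "star (R i j) * d = d * star (R i j)" using arg_cong[OF Rd, of star] by (simp add: star_mult d(1))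
   finally show ?thesis by (simp add: d(1) Rd[symmetric] d(2)[symmetric] mult.assoc)
  qed
  ultimately have D: "cpos (p ?x - star (R i j) * p ?x * R i j)" by (simp add: ring_distribs d(1) d(2)[symmetric] mult.assoc)
  have "cpos (star (s j) * (?k *\<^sub>R 1 - star (r i) * ?g1 * r i) * s j + star (r i) * (?k *\<^sub>R 1 - star (s j) * ?g2 * s j) * r i
    + star (R i j) * m ?x * R i j + (p ?x - star (R i j) * p ?x * R i j))"
   by (intro cpos_add A B C D)
  also have "star (r i) * (?k *\<^sub>R 1 - star (s j) * ?g2 * s j) * r i = ?k *\<^sub>R (star (r i) * r i) - star (R i j) * ?g2 * R i j"
  proof -
   have "star (r i) * (star (s j) * ?g2 * s j) * r i = (star (r i) * star (s j)) * ?g2 * (s j * r i)" by (simp only: mult.assoc)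
   also have "... = star (R i j) * ?g2 * R i j"
    using arg_cong[OF rs[of i j], of star] by (simp add: R_def star_mult rs)
   finally show ?thesis by (simp add: right_diff_distrib left_diff_distrib)
  qed
  also have "star (s j) * (?k *\<^sub>R 1 - star (r i) * ?g1 * r i) * s j = ?k *\<^sub>R (star (s j) * s j) - star (R i j) * ?g1 * R i j"
   by (simp add: right_diff_distrib left_diff_distrib R_def star_mult mult.assoc)
  also have "?k *\<^sub>R (star (s j) * s j) - star (R i j) * ?g1 * R i j + (?k *\<^sub>R (star (r i) * r i) - star (R i j) * ?g2 * R i j) +
    star (R i j) * m ?x * R i j + (p ?x - star (R i j) * p ?x * R i j) =
    p ?x + ?k *\<^sub>R (star (s j) * s j) + ?k *\<^sub>R (star (r i) * r i) - star (R i j) * (?g1 + ?g2 + (p ?x - m ?x)) * R i j"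
   by (simp add: distrib_left distrib_right left_diff_distrib right_diff_distrib)
  also have "?g1 + ?g2 + (p ?x - m ?x) = c *\<^sub>R 1" unfolding gap[symmetric] pm(3)[symmetric] by simp
  finally show ?thesis by simp
 qed
 have "cpos (\<Sum>i<N. \<Sum>j<N. p (pt i j) + (4 / (real N)\<^sup>2) *\<^sub>R (star (s j) * s j) + (4 / (real N)\<^sup>2) *\<^sub>R (star (r i) * r i) - c *\<^sub>R (star (R i j) * R i j))"
  by (intro cpos_sum bound)
 also have "(\<Sum>i<N. \<Sum>j<N. p (pt i j) + (4 / (real N)\<^sup>2) *\<^sub>R (star (s j) * s j) + (4 / (real N)\<^sup>2) *\<^sub>R (star (r i) * r i) - c *\<^sub>R (star (R i j) * R i j)) =
   (\<Sum>i<N. \<Sum>j<N. p (pt i j)) + (8 / real N) *\<^sub>R 1 - c *\<^sub>R 1"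
 proof -
  have oN: "of_nat N = real N *\<^sub>R (1::'a)" by (metis of_real_def of_real_of_nat_eq)
  have 1: "(\<Sum>i<N. \<Sum>j<N. (4 / (real N)\<^sup>2) *\<^sub>R (star (s j) * s j)) = (4 / real N) *\<^sub>R 1"
   using root_average_sum_squares[OF z w2(1)] N0
   by (simp add: s_def sum_constant_scaleR oN power2_eq_square flip: scaleR_sum_right)
  have 2: "(\<Sum>i<N. \<Sum>j<N. (4 / (real N)\<^sup>2) *\<^sub>R (star (r i) * r i)) = (4 / real N) *\<^sub>R 1"
   using root_average_sum_squares[OF z w1(1)] N0
   by (subst sum.swap) (simp add: r_def sum_constant_scaleR oN power2_eq_square flip: scaleR_sum_right)
  have 3: "(\<Sum>i<N. \<Sum>j<N. c *\<^sub>R (star (R i j) * R i j)) = c *\<^sub>R 1"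
   by (simp only: scaleR_sum_right[symmetric] one)
  show ?thesis unfolding sum.distrib sum_subtractf 1 2 3 by (simp flip: scaleR_add_left)
 qed
 also have "(\<Sum>i<N. \<Sum>j<N. p (pt i j)) = (\<Sum>x\<in>(%(i, j). pt i j) ` ({..<N} \<times> {..<N}). p x)"
 proof -
  have inj: "inj_on (%(i, j). pt i j) ({..<N} \<times> {..<N})"
  proof (rule inj_onI, clarsimp simp: pt_def)
   have *: "i = i'" if "z ^ i = z ^ i'" "i < N" "i' < N" for i i'
   proof (rule ccontr)
    assume "i ~= i'"
    then show False
     using primitive_root_orthogonality[OF z that(2,3)] that(1) N0 zD(5,6)
     by (simp flip: power_mult) (simp add: mult.commute[of _ i] mult.commute[of _ i'] power_mult that(1) flip: power_mult_distrib)
   qed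
   fix i j i' j' assume "i < N" "j < N" "i' < N" "j' < N" "z ^ i = z ^ i'" "z ^ j = z ^ j'"
   then show "i = i' & j = j'" using * by blast
  qed
  show ?thesis by (subst sum.reindex[OF inj]) (simp add: sum.cartesian_product case_prod_unfold)
 qed
 finally have fin: "cpos ((\<Sum>x\<in>(%(i, j). pt i j) ` ({..<N} \<times> {..<N}). p x) - (c - 8 / real N) *\<^sub>R 1)"
  by (simp add: algebra_simps)
 have "0 < c - 8 / real N" using N N0 c by (simp add: field_simps)
 then show ?thesis
 proof (rule that[rotated])
  show "c *\<^sub>R 1 - gap w1 w2 l \<mu> = p (l, \<mu>) - m (l, \<mu>)" for l \<mu> using pm(3)[of "(l, \<mu>)"] by simp
  show "calculus_of (gap w1 w2 l \<mu>) (p (l, \<mu>))" "calculus_of (gap w1 w2 l \<mu>) (m (l, \<mu>))" for l \<mu>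
   using pm(5)[of "(l, \<mu>)"] pm(6)[of "(l, \<mu>)"] by simp_all
  show "cpos ((\<Sum>x\<in>(%(i, j). pt i j) ` ({..<N} \<times> {..<N}). p x) - (c - 8 / real N) *\<^sub>R 1)" by (rule fin)
 qed (use pm zn in \<open>auto simp: pt_def\<close>)
qed

section \<open>Generated operator systems and C*-algebras\<close>

lemma generated_operator_system:
 shows operator_system_generated: "operator_system (generated_operator_system X)"
  and generated_operator_system_incl: "X <= generated_operator_system X"
  and generated_operator_system_least: "operator_system T ==> X <= T ==> generated_operator_system X <= T"
 unfolding generated_operator_system_def operator_system_def by blast+

lemma generated_cstar:
 shows cstar_subalgebra_generated: "cstar_subalgebra (generated_cstar X)"
  and generated_cstar_incl: "X <= generated_cstar X"
  and generated_cstar_least: "cstar_subalgebra T ==> X <= T ==> generated_cstar X <= T"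
proof -
 have "closed (generated_cstar X)"
  unfolding generated_cstar_def by (rule closed_Inter) (auto simp: cstar_subalgebra_def)
 then show "cstar_subalgebra (generated_cstar X)"
  unfolding generated_cstar_def cstar_subalgebra_def operator_system_def by blast
qed (auto simp: generated_cstar_def)

locale rotation_pair =
 fixes u v :: "'a::unital_cstar_algebra" and q :: complex and n :: nat
 assumes q: "primitive_root n q"
  and u: "star u * u = 1" "u * star u = 1" and v: "star v * v = 1" "v * star v = 1"
  and uv: "u * v = scaleC q (v * u)"
begin

abbreviation (input) S :: "'a set" where "S \<equiv> generated_operator_system {u, v}"
abbreviation (input) B :: "'a set" where "B \<equiv> generated_cstar S"

lemmas q_simps = primitive_rootD[OF q]

lemma S_os: "operator_system S" by (rule operator_system_generated)
lemma B_alg: "cstar_subalgebra B" by (rule cstar_subalgebra_generated)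
lemma B_os: "operator_system B" using B_alg by (simp add: cstar_subalgebra_def)
lemma uv_S: "u : S" "v : S" using generated_operator_system_incl[of "{u, v}"] by auto
lemma S_B: "S <= B" by (rule generated_cstar_incl)
lemma uv_B: "u : B" "v : B" using uv_S S_B by auto
lemmas B_props = cstar_subalgebra_closure_props[OF B_alg]
lemmas S_props = operator_systemD[OF S_os]

lemma B_least: "cstar_subalgebra T ==> u : T ==> v : T ==> B <= T"
 by (intro generated_cstar_least generated_operator_system_least) (auto simp: cstar_subalgebra_def)

lemma S_least: "operator_system T ==> u : T ==> v : T ==> S <= T"
 by (intro generated_operator_system_least) auto

lemma u_vpow: "u * v ^ j = scaleC (q ^ j) (v ^ j * u)"
proof (induction j)
 case (Suc j)
 have "u * v ^ Suc j = (u * v ^ j) * v" by (simp only: power_Suc2 mult.assoc)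
 also have "... = scaleC (q ^ j) (v ^ j * (u * v))" unfolding Suc by (simp add: mult_scaleC_left mult.assoc)
 also have "... = scaleC (q ^ Suc j) (v ^ Suc j * u)"
  unfolding uv by (simp add: mult_scaleC_right scaleC_scaleC mult.assoc[symmetric] power_commutes mult.commute)
 finally show ?case .
qed simp

lemma upow_v: "u ^ j * v = scaleC (q ^ j) (v * u ^ j)"
proof (induction j)
 case (Suc j)
 have "u ^ Suc j * v = u * (u ^ j * v)" by (simp only: power_Suc mult.assoc)
 also have "... = scaleC (q ^ j) ((u * v) * u ^ j)" unfolding Suc by (simp only: mult_scaleC_right mult.assoc)
 also have "... = scaleC (q ^ Suc j) (v * u ^ Suc j)"
  unfolding uv by (simp add: mult_scaleC_left scaleC_scaleC mult.assoc mult.commute)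
 finally show ?case .
qed simp

lemma unitary_power: "star w * w = 1 ==> star (w ^ k) * w ^ k = 1"
proof (induction k)
 case (Suc k)
 have "star (w ^ Suc k) * w ^ Suc k = star (w ^ k) * (star w * w) * w ^ k"
  by (simp only: power_Suc star_mult mult.assoc)
 then show ?case using Suc by simp
qed simp

lemma unitary_power': "w * star w = 1 ==> w ^ k * star (w ^ k) = 1"
 using unitary_power[of "star w" k] by (simp add: star_star star_power)

lemma commutes_star_unitary:
 fixes y w :: 'a
 assumes "star w * w = 1" "w * star w = 1" "y * w = w * y"
 shows "y * star w = star w * y"
proof -
 have "y * star w = (star w * w) * y * star w" by (simp add: assms)
 also have "... = star w * (y * w) * star w" by (simp only: assms(3) mult.assoc)
 also have "... = star w * y * (w * star w)" by (simp only: mult.assoc)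
 finally show ?thesis by (simp add: assms)
qed

lemma un_comm: "u ^ n * u = u * u ^ n" "u ^ n * v = v * u ^ n"
 and vn_comm: "v ^ n * v = v * v ^ n" "v ^ n * u = u * v ^ n"
 using upow_v[of n] u_vpow[of n] by (simp_all add: q_simps power_commutes)

lemma unvn_comm: "u ^ n * v ^ n = v ^ n * u ^ n"
 by (rule power_commuting_commutes) (simp add: vn_comm)

abbreviation gp :: "complex => complex => 'a" where "gp l m \<equiv> gap (u ^ n) (v ^ n) l m"

lemma commutes_B:
 assumes "z * u = u * z" "z * v = v * z" and b: "b : B"
 shows "z * b = b * z"
proof -
 let ?T = "{b. z * b = b * z & z * star b = star b * z}"
 have mul: "z * (a * b) = a * b * z" if "z * a = a * z" "z * b = b * z" for a b
 proof -
  have "z * (a * b) = (z * a) * b" by (rule mult.assoc[symmetric])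
  also have "... = a * (z * b)" unfolding that(1) by (rule mult.assoc)
  also have "... = a * b * z" unfolding that(2) by (rule mult.assoc[symmetric])
  finally show ?thesis .
 qed
 have "closed ?T"
  by (intro closed_Collect_conj closed_Collect_eq continuous_intros
    bounded_linear.continuous_on[OF bounded_linear_star])
 then have "cstar_subalgebra ?T"
  unfolding cstar_subalgebra_def operator_system_def
  by (auto simp: ring_distribs star_add star_scaleC star_mult star_star mult_scaleC_left mult_scaleC_right mul)
 moreover have "u : ?T" "v : ?T" using assms u v by (auto intro: commutes_star_unitary)
 ultimately show ?thesis using B_least b by blast
qed

lemma gap_commutes_B: "b : B ==> gp l m * b = b * gp l m"
proof (rule commutes_B)
 have *: "y * gp l m = gp l m * y" if "y * u ^ n = u ^ n * y" "y * v ^ n = v ^ n * y" for y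
  by (rule gap_commute) (use that unitary_power[OF u(1)] unitary_power'[OF u(2)] unitary_power[OF v(1)] unitary_power'[OF v(2)]
   in \<open>auto intro: commutes_star_unitary\<close>)
 show "gp l m * u = u * gp l m" "gp l m * v = v * gp l m"
  by (rule *[symmetric]; simp add: un_comm vn_comm)+
qed

lemma gap_in_B: "gp l m : B"
 unfolding gap_def using uv_B by (intro B_props) auto

lemma cover:
 assumes "0 < c"
 obtains X :: "(complex \<times> complex) set" and p m :: "complex \<times> complex => 'a" and \<delta> :: real
 where "finite X" "0 < \<delta>" "!!l \<mu>. (l, \<mu>) : X ==> cmod l = 1 & cmod \<mu> = 1"
  "!!x. cpos (p x)" "!!x. cpos (m x)" "!!l \<mu>. c *\<^sub>R 1 - gp l \<mu> = p (l, \<mu>) - m (l, \<mu>)"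
  "!!x. p x * m x = 0"
  "!!l \<mu>. calculus_of (gp l \<mu>) (p (l, \<mu>))"  "!!l \<mu>. calculus_of (gp l \<mu>) (m (l, \<mu>))"
  "cpos ((\<Sum>x\<in>X. p x) - \<delta> *\<^sub>R 1)"
proof (rule positive_parts_cover[OF unitary_power[OF u(1)] unitary_power'[OF u(2)] unitary_power[OF v(1)]
   unitary_power'[OF v(2)] unvn_comm _ assms])
 show "u ^ n * star (v ^ n) = star (v ^ n) * u ^ n"
  by (rule commutes_star_unitary[OF unitary_power[OF v(1)] unitary_power'[OF v(2)] unvn_comm])
qed (rule that)

lemma localise:
 assumes \<Phi>: "cp_map d \<Phi>" "\<Phi> 1 = 1\<^sub>m d" "0 < d" and c: "0 < c"
 obtains l \<mu> g k where "cmod l = 1" "cmod \<mu> = 1" "star g = g" "star k = k" "g * g + k * k = 1"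
  "!!b. b : B ==> b * g = g * b" "!!b. b : B ==> b * k = k * b" "\<Phi> (g * g) ~= 0\<^sub>m d d"
  "cpos (g * (c *\<^sub>R 1 - gp l \<mu>) * g)"
proof -
 obtain X p m \<delta> where X: "finite X" "0 < \<delta>" "!!l \<mu>. (l, \<mu>) : X ==> cmod l = 1 & cmod \<mu> = 1"
  and pm: "!!x. cpos (p x)" "!!x. cpos (m x)" "!!l \<mu>. c *\<^sub>R 1 - gp l \<mu> = p (l, \<mu>) - m (l, \<mu>)"
  "!!x. p x * m x = 0" "!!l \<mu>. calculus_of (gp l \<mu>) (p (l, \<mu>))"
  and lower: "cpos ((\<Sum>x\<in>X. p x) - \<delta> *\<^sub>R 1)"
  by (rule cover[OF c], rule that)
 have "\<exists>x\<in>X. \<Phi> (p x) ~= 0\<^sub>m d d"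
 proof (rule ccontr)
  assume "\<not> ?thesis"
  then have z: "\<Phi> (p x) = 0\<^sub>m d d" if "x : X" for x using that by blast
  let ?e = "unit_vec d 0 :: complex vec"
  have "0 <= (\<Phi> ((\<Sum>x\<in>X. p x) - \<delta> *\<^sub>R 1) *\<^sub>v ?e) \<bullet>c ?e" by (rule cp_pos_cpos[OF \<Phi>(1) lower]) simp
  also have "... = (\<Sum>x\<in>X. (\<Phi> (p x) *\<^sub>v ?e) \<bullet>c ?e) - of_real \<delta> * (?e \<bullet>c ?e)"
   by (simp add: cp_form_diff[OF \<Phi>(1)] cp_form_scaleR[OF \<Phi>(1)] cp_form_sum[OF \<Phi>(1)] \<Phi>(2))
  also have "(\<Sum>x\<in>X. (\<Phi> (p x) *\<^sub>v ?e) \<bullet>c ?e) = 0"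
   by (rule sum.neutral) (simp add: z zero_mat_mult_vec)
  also have "?e \<bullet>c ?e = 1" using \<Phi>(3) by (subst cscalar_unit) auto
  finally show False using X(2) by (simp add: less_eq_complex_def)
 qed
 then obtain l \<mu> where x: "(l, \<mu>) : X" "\<Phi> (p (l, \<mu>)) ~= 0\<^sub>m d d" by auto
 define P M where "P = p (l, \<mu>)" and "M = m (l, \<mu>)"
 define t where "t = 1 / (norm P + 1)"
 have t: "0 < t" by (simp add: t_def add_nonneg_pos)
 have nP: "norm (t *\<^sub>R P) <= 1" by (simp add: t_def divide_simps add_nonneg_pos)
 have cP: "cpos P" "cpos M" "c *\<^sub>R 1 - gp l \<mu> = P - M" "P * M = 0" "calculus_of (gp l \<mu>) P"
  using pm by (simp_all add: P_def M_def)
 have ctP: "cpos (t *\<^sub>R P)" using t cP by (intro cpos_scaleR) auto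
 obtain g where g: "star g = g" "t *\<^sub>R P = g * g" "calculus_of (t *\<^sub>R P) g" using ctP by (rule cpos_sqrt)
 have "cpos (1 *\<^sub>R 1 - t *\<^sub>R P)" by (rule cpos_scalar_minus[OF cpos_selfadjoint[OF ctP] nP])
 then obtain k where k: "star k = k" "1 *\<^sub>R 1 - t *\<^sub>R P = k * k" "calculus_of (1 *\<^sub>R 1 - t *\<^sub>R P) k" by (rule cpos_sqrt)
 have "calculus_of (gp l \<mu>) (t *\<^sub>R P)" by (intro calculus_of_scaleR cP)
 then have cg: "calculus_of (gp l \<mu>) g" by (rule calculus_of_trans[OF _ g(3)])
 have "calculus_of (gp l \<mu>) (1 *\<^sub>R 1 - t *\<^sub>R P)" by (intro calculus_of_scaleR calculus_of_diff calculus_of_one cP)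
 then have ck: "calculus_of (gp l \<mu>) k" by (rule calculus_of_trans[OF _ k(3)])
 have MP: "M * P = 0"
  using arg_cong[OF cP(4), of star] cpos_selfadjoint[OF cP(1)] cpos_selfadjoint[OF cP(2)] by (simp add: star_mult)
 have "M * g = g * M" by (rule calculus_of_comm[OF g(3)]) (simp add: MP cP(4))
 from this[symmetric] have "g * M * g = M * (g * g)" by (simp only:) (simp only: mult.assoc)
 then have gM: "g * M * g = 0" by (simp add: g(2)[symmetric] MP)
 have "P * g = g * P" by (rule calculus_of_comm[OF g(3)]) simp
 from this[symmetric] have "g * P * g = P * (g * g)" by (simp only:) (simp only: mult.assoc)
 then have gP: "g * P * g = t *\<^sub>R (P * P)" by (simp add: g(2)[symmetric])
 have "cpos (P * P)" unfolding cpos_def using cpos_selfadjoint[OF cP(1)] by blast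
 then have "cpos (t *\<^sub>R (P * P))" using t by (intro cpos_scaleR) auto
 then have "cpos (g * (c *\<^sub>R 1 - gp l \<mu>) * g)"
  unfolding cP(3) using gM gP by (simp add: right_diff_distrib left_diff_distrib)
 moreover have "\<Phi> (g * g) ~= 0\<^sub>m d d"
 proof
  assume "\<Phi> (g * g) = 0\<^sub>m d d"
  then have "of_real t \<cdot>\<^sub>m \<Phi> P = 0\<^sub>m d d" by (simp add: g(2)[symmetric] scaleR_scaleC cp_scaleC[OF \<Phi>(1)])
  then have "(of_real t \<cdot>\<^sub>m \<Phi> P) $$ (i, j) = 0" if "i < d" "j < d" for i j using that by simp
  then have "\<Phi> P $$ (i, j) = 0" if "i < d" "j < d" for i j using that t cp_dim[OF \<Phi>(1)] by simp
  then have "\<Phi> P = 0\<^sub>m d d" using cp_dim[OF \<Phi>(1)] by (intro eq_matI) auto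
  with x(2) show False by (simp add: P_def)
 qed
 moreover have "g * g + k * k = 1" by (simp add: g(2)[symmetric] k(2)[symmetric])
 moreover have "b * g = g * b" "b * k = k * b" if "b : B" for b
  using calculus_of_comm[OF cg, of b] calculus_of_comm[OF ck, of b] gap_commutes_B[OF that] by simp_all
 ultimately show ?thesis using that[of l \<mu> g k] X(3)[OF x(1)] g(1) k(1) by blast
qed

lemma bounded_real_subseq:
 fixes x :: "nat => real"
 assumes "!!k. \<bar>x k\<bar> <= 1"
 obtains r :: "nat => nat" and l where "strict_mono r" "(%k. x (r k)) \<longlonglongrightarrow> l"
proof -
 obtain r :: "nat => nat" where r: "strict_mono r" "monoseq (%k. x (r k))" using seq_monosub[of x] by blast
 have "Bseq (%k. x (r k))" by (rule BseqI'[of _ 1]) (use assms in simp)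
 then have "convergent (%k. x (r k))" using r by (intro Bseq_monoseq_convergent)
 then show ?thesis using that r by (auto simp: convergent_def)
qed

lemma unit_circle_subseq:
 assumes "!!k. cmod (z k) = 1"
 obtains r :: "nat => nat" and l where "strict_mono r" "(%k. z (r k)) \<longlonglongrightarrow> l" "cmod l = 1"
proof -
 have "\<bar>Re (z k)\<bar> <= 1" "\<bar>Im (z k)\<bar> <= 1" for k using abs_Re_le_cmod[of "z k"] abs_Im_le_cmod[of "z k"] assms by auto
 then obtain r :: "nat => nat" and a where r: "strict_mono r" "(%k. Re (z (r k))) \<longlonglongrightarrow> a"
  by (metis bounded_real_subseq[of "%k. Re (z k)"])
 obtain s :: "nat => nat" and b where s: "strict_mono s" "(%k. Im (z (r (s k)))) \<longlonglongrightarrow> b"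
  by (rule bounded_real_subseq[of "%k. Im (z (r k))"]) (use \<open>!!k. \<bar>Im (z k)\<bar> <= 1\<close> in auto)
 have "(%k. Re (z (r (s k)))) \<longlonglongrightarrow> a" using LIMSEQ_subseq_LIMSEQ[OF r(2) s(1)] by (simp add: o_def)
 then have lim: "(%k. z (r (s k))) \<longlonglongrightarrow> Complex a b" using s(2) by (simp add: tendsto_complex_iff)
 have "(%k. cmod (z (r (s k)))) \<longlonglongrightarrow> cmod (Complex a b)" by (rule tendsto_norm[OF lim])
 then have "cmod (Complex a b) = 1" using assms LIMSEQ_unique[OF tendsto_const] by fastforce
 moreover have "strict_mono (%k. r (s k))" using r(1) s(1) by (simp add: strict_mono_def)
 ultimately show ?thesis using that lim by blast
qed

lemma gap_Lipschitz:
 fixes w1 w2 :: 'a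
 assumes w: "star w1 * w1 = 1" "star w2 * w2 = 1" and l: "cmod l = 1" "cmod l' = 1" "cmod m = 1" "cmod m' = 1"
 shows "norm (gap w1 w2 l m - gap w1 w2 l' m') <= 2 * cmod (l' - l) + 2 * cmod (m' - m)"
proof -
 have e: "star (w - scaleC t 1) * (w - scaleC t 1) = 2 *\<^sub>R 1 - scaleC t (star w) - scaleC (cnj t) w"
  if "star w * w = 1" "cmod t = 1" for w :: 'a and t
 proof -
  have "cnj t * t = 1" using complex_norm_square[of t] that(2) by (simp add: mult.commute)
  then show ?thesis using that(1)
   by (simp add: star_scaleC ring_distribs mult_scaleC_left mult_scaleC_right scaleC_scaleC scaleC_diff_right scaleR_2 mult.commute)
 qed
 have b: "norm (scaleC (l' - l) (star w) + scaleC (cnj (l' - l)) w) <= 2 * cmod (l' - l)" if "star w * w = 1" for w :: 'a and l l'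
 proof -
  have "norm (scaleC (l' - l) (star w) + scaleC (cnj (l' - l)) w) \<le>
    norm (scaleC (l' - l) (star w)) + norm (scaleC (cnj (l' - l)) w)" by (rule norm_triangle_ineq)
  also have "... = 2 * cmod (l' - l)"
   by (simp add: norm_scaleC norm_unitary[OF that] flip: complex_cnj_diff)
  finally show ?thesis .
 qed
 have eq: "gap w1 w2 l m - gap w1 w2 l' m' = (scaleC (l' - l) (star w1) + scaleC (cnj (l' - l)) w1) +
   (scaleC (m' - m) (star w2) + scaleC (cnj (m' - m)) w2)"
  unfolding gap_def e[OF w(1) l(1)] e[OF w(1) l(2)] e[OF w(2) l(3)] e[OF w(2) l(4)]
  by (simp add: scaleC_diff_left)
 show ?thesis unfolding eq
  using norm_triangle_ineq[of "scaleC (l' - l) (star w1) + scaleC (cnj (l' - l)) w1"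
    "scaleC (m' - m) (star w2) + scaleC (cnj (m' - m)) w2"] b[OF w(1), of l' l] b[OF w(2), of m' m] by linarith
qed

text \<open>A matrix extreme point has, for every \<open>c\<close>, an extension concentrated where the gap is at most
  \<open>c\<close>: localising any extension gives a summand, which by extremality is again the given map.\<close>

lemma extreme_local_extension:
 assumes T: "operator_system T" "T <= B" and \<phi>: "\<phi> : matrix_extreme_points T d" and c: "0 < c"
 obtains l \<mu> \<Phi> where "cmod l = 1" "cmod \<mu> = 1" "cp_map d \<Phi>" "!!x. x : T ==> \<Phi> x = \<phi> x"
  "Re (\<Sum>p<d. \<Phi> (gp l \<mu>) $$ (p, p)) <= c * real d"
proof -
 have ucp: "\<phi> : ucp T d" using \<phi> by (simp add: matrix_extreme_points_def)
 note D = ucpD[OF ucp] and TD = operator_systemD[OF T(1)]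
 obtain \<Phi> where \<Phi>: "cp_map d \<Phi>" "!!x. x : T ==> \<Phi> x = \<phi> x" by (rule ucp_extension[OF T(1) ucp], rule that)
 have \<Phi>1: "\<Phi> 1 = 1\<^sub>m d" using \<Phi>(2)[OF TD(1)] D by simp
 obtain l \<mu> g k where lm: "cmod l = 1" "cmod \<mu> = 1" and gk: "star g = g" "star k = k" "g * g + k * k = 1"
  "!!b. b : B ==> b * g = g * b" "!!b. b : B ==> b * k = k * b" "\<Phi> (g * g) ~= 0\<^sub>m d d"
  "cpos (g * (c *\<^sub>R 1 - gp l \<mu>) * g)"
  by (rule localise[OF \<Phi>(1) \<Phi>1 D(1) c], rule that)
 define \<Phi>1 \<Phi>2 where "\<Phi>1 x = \<Phi> (star g * x * g)" and "\<Phi>2 x = \<Phi> (star k * x * k)" for x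
 have cp: "cp_map d \<Phi>1" "cp_map d \<Phi>2" unfolding \<Phi>1_def \<Phi>2_def by (rule cp_map_compose_conj[OF \<Phi>(1)])+
 have sum: "\<phi> x = \<Phi>1 x + \<Phi>2 x" if x: "x : T" for x
 proof -
  have xB: "x : B" using x T by blast
  have "g * x * g + k * x * k = x * (g * g + k * k)"
   unfolding gk(4)[OF xB, symmetric] gk(5)[OF xB, symmetric] by (simp add: distrib_left mult.assoc)
  then show ?thesis using \<Phi>(2)[OF x] by (simp add: \<Phi>1_def \<Phi>2_def gk flip: cp_add[OF \<Phi>(1)])
 qed
 have nz: "\<Phi>1 1 ~= 0\<^sub>m d d" using gk by (simp add: \<Phi>1_def)
 obtain a h where ah: "a : carrier_mat d d" "h : carrier_mat d d" "a * h = 1\<^sub>m d" "h * a = 1\<^sub>m d"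
  "!!x. x : T ==> \<Phi>1 x = adj a * \<phi> x * a"
  by (rule matrix_extreme_summand[OF T(1) \<phi> cp sum nz], assumption, rule that)
 define \<Psi> where "\<Psi> x = adj h * \<Phi>1 x * h" for x
 have cp\<Psi>: "cp_map d \<Psi>" unfolding \<Psi>_def by (rule cp_map_conj[OF cp(1) ah(2)])
 have agree: "\<Psi> x = \<phi> x" if x: "x : T" for x
 proof (rule mat_eq_formI[OF cp_carrier[OF cp\<Psi>] D(3)[OF x]])
  fix \<xi> \<eta> :: "complex vec" assume xi: "\<xi> : carrier_vec d" and eta: "\<eta> : carrier_vec d"
  have hv: "h *\<^sub>v z : carrier_vec d" for z using ah(2) by auto
  have ahv: "a *\<^sub>v (h *\<^sub>v z) = z" if "z : carrier_vec d" for z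
   using assoc_mult_mat_vec[OF ah(1,2) that] ah(3) that by simp
  have "(\<Psi> x *\<^sub>v \<xi>) \<bullet>c \<eta> = (\<Phi>1 x *\<^sub>v (h *\<^sub>v \<xi>)) \<bullet>c (h *\<^sub>v \<eta>)"
   unfolding \<Psi>_def by (rule conj_form[OF ah(2) cp_carrier[OF cp(1)] xi eta])
  also have "... = (\<phi> x *\<^sub>v (a *\<^sub>v (h *\<^sub>v \<xi>))) \<bullet>c (a *\<^sub>v (h *\<^sub>v \<eta>))"
   unfolding ah(5)[OF x] by (rule conj_form[OF ah(1) D(3)[OF x] hv hv])
  finally show "(\<Psi> x *\<^sub>v \<xi>) \<bullet>c \<eta> = (\<phi> x *\<^sub>v \<xi>) \<bullet>c \<eta>" by (simp only: ahv[OF xi] ahv[OF eta])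
 qed
 have \<Psi>1: "\<Psi> 1 = 1\<^sub>m d" using agree[OF TD(1)] D by simp
 have diag: "Re (\<Psi> (gp l \<mu>) $$ (p, p)) <= c" if p: "p < d" for p
 proof -
  let ?e = "unit_vec d p :: complex vec"
  have he: "h *\<^sub>v ?e : carrier_vec d" using ah(2) by auto
  have "0 <= (\<Phi> (g * (c *\<^sub>R 1 - gp l \<mu>) * g) *\<^sub>v (h *\<^sub>v ?e)) \<bullet>c (h *\<^sub>v ?e)" by (rule cp_pos_cpos[OF \<Phi>(1) gk(7) he])
  also have "... = (\<Phi>1 (c *\<^sub>R 1 - gp l \<mu>) *\<^sub>v (h *\<^sub>v ?e)) \<bullet>c (h *\<^sub>v ?e)" by (simp only: \<Phi>1_def gk(1))
  also have "... = (\<Psi> (c *\<^sub>R 1 - gp l \<mu>) *\<^sub>v ?e) \<bullet>c ?e"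
   unfolding \<Psi>_def by (rule conj_form[OF ah(2) cp_carrier[OF cp(1)] unit_vec_carrier unit_vec_carrier, symmetric])
  also have "... = of_real c * (?e \<bullet>c ?e) - \<Psi> (gp l \<mu>) $$ (p, p)"
   using form_unit[OF cp_carrier[OF cp\<Psi>, of "gp l \<mu>"] p p]
   by (simp add: cp_form_diff[OF cp\<Psi>] cp_form_scaleR[OF cp\<Psi>] \<Psi>1)
  also have "?e \<bullet>c ?e = 1" using p by (subst cscalar_unit) auto
  finally show ?thesis by (simp add: less_eq_complex_def)
 qed
 have "Re (\<Sum>p<d. \<Psi> (gp l \<mu>) $$ (p, p)) <= (\<Sum>p<d. c)"
  unfolding Re_sum by (rule sum_mono) (use diag in auto)
 then show ?thesis using that[OF lm cp\<Psi> agree] by (simp add: mult.commute)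
qed

text \<open>The torus is compact, so the centres of concentration for \<open>c \<longlonglongrightarrow> 0\<close> accumulate at a point \<open>(l, \<mu>)\<close>; extensions
  with arbitrarily small mass of the gap at this point yield one with mass zero.\<close>

theorem extreme_point_extension:
 assumes T: "operator_system T" "T <= B" and \<phi>: "\<phi> : matrix_extreme_points T d"
 obtains l \<mu> \<Phi> where "cmod l = 1" "cmod \<mu> = 1" "cp_map d \<Phi>" "!!x. x : T ==> \<Phi> x = \<phi> x"
  "!!p. p < d ==> \<Phi> (gp l \<mu>) $$ (p, p) = 0"
proof -
 have ucp: "\<phi> : ucp T d" using \<phi> by (simp add: matrix_extreme_points_def)
 note D = ucpD[OF ucp] and TD = operator_systemD[OF T(1)]
 define P where "P k y \<longleftrightarrow> (case y of (l, \<mu>, \<Phi>) => cmod l = 1 & cmod \<mu> = 1 & cp_map d \<Phi> & (\<forall>x\<in>T. \<Phi> x = \<phi> x) \<and>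
   Re (\<Sum>p<d. \<Phi> (gp l \<mu>) $$ (p, p)) <= 1 / real (Suc k) * real d)" for k y
 have "EX y. P k y" for k
 proof (rule extreme_local_extension[OF T \<phi>, of "1 / real (Suc k)"])
  fix l \<mu> \<Phi> assume "cmod l = 1" "cmod \<mu> = 1" "cp_map d \<Phi>" "!!x. x : T ==> \<Phi> x = \<phi> x"
   "Re (\<Sum>p<d. \<Phi> (gp l \<mu>) $$ (p, p)) <= 1 / real (Suc k) * real d"
  then have "P k (l, \<mu>, \<Phi>)" by (simp add: P_def)
  then show ?thesis by blast
 qed simp
 then have "ALL k. EX y. P k y" by blast
 from choice[OF this] obtain y where y: "!!k. P k (y k)" by blast
 define l \<mu> \<Phi> where "l k = fst (y k)" and "\<mu> k = fst (snd (y k))" and "\<Phi> k = snd (snd (y k))" for k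
 have "P k (l k, \<mu> k, \<Phi> k)" for k using y[of k] by (simp add: l_def \<mu>_def \<Phi>_def)
 then have seq: "!!k. cmod (l k) = 1" "!!k. cmod (\<mu> k) = 1" "!!k. cp_map d (\<Phi> k)"
  "!!k x. x : T ==> \<Phi> k x = \<phi> x" "!!k. Re (\<Sum>p<d. \<Phi> k (gp (l k) (\<mu> k)) $$ (p, p)) <= 1 / real (Suc k) * real d"
  unfolding P_def prod.case by blast+
 obtain r :: "nat => nat" and l0 where r: "strict_mono r" "(%k. l (r k)) \<longlonglongrightarrow> l0" "cmod l0 = 1"
  by (rule unit_circle_subseq[OF seq(1)])
 obtain s :: "nat => nat" and \<mu>0 where s: "strict_mono s" "(%k. \<mu> (r (s k))) \<longlonglongrightarrow> \<mu>0" "cmod \<mu>0 = 1"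
  by (rule unit_circle_subseq[of "%k. \<mu> (r k)"]) (use seq in auto)
 define t where "t k = r (s k)" for k
 have t: "strict_mono t" using r(1) s(1) by (simp add: t_def strict_mono_def)
 have lt: "(%k. l (t k)) \<longlonglongrightarrow> l0" using LIMSEQ_subseq_LIMSEQ[OF r(2) s(1)] by (simp add: o_def t_def)
 have mt: "(%k. \<mu> (t k)) \<longlonglongrightarrow> \<mu>0" using s(2) by (simp add: t_def)
 have small: "EX \<Phi>. cp_map d \<Phi> & (\<forall>x\<in>T. \<Phi> x = \<phi> x) & Re (\<Sum>p<d. \<Phi> (gp l0 \<mu>0) $$ (p, p)) <= \<epsilon>" if \<epsilon>: "0 < \<epsilon>" for \<epsilon>
 proof -
  define \<kappa> where "\<kappa> k = 1 / real (Suc k) + (2 * cmod (l (t k) - l0) + 2 * cmod (\<mu> (t k) - \<mu>0))" for k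
  have "\<kappa> \<longlonglongrightarrow> 0 + (2 * cmod (l0 - l0) + 2 * cmod (\<mu>0 - \<mu>0))"
   unfolding \<kappa>_def by (intro tendsto_intros lt mt LIMSEQ_Suc[OF lim_1_over_n])
  then have "\<kappa> \<longlonglongrightarrow> 0" by simp
  moreover have "0 < \<epsilon> / real d" using \<epsilon> D(1) by simp
  ultimately have "eventually (%k. \<kappa> k < \<epsilon> / real d) sequentially" by (rule order_tendstoD(2))
  then obtain k where k: "\<kappa> k < \<epsilon> / real d" by (auto simp: eventually_sequentially)
  note cp = seq(3)[of "t k"]
  have 1: "\<Phi> (t k) 1 = 1\<^sub>m d" using seq(4)[OF TD(1)] D by simp
  have "Re (\<Phi> (t k) (gp l0 \<mu>0) $$ (p, p)) <= Re (\<Phi> (t k) (gp (l (t k)) (\<mu> (t k))) $$ (p, p)) +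
    (2 * cmod (l (t k) - l0) + 2 * cmod (\<mu> (t k) - \<mu>0))" if p: "p < d" for p
  proof -
   let ?\<Delta> = "gp l0 \<mu>0 - gp (l (t k)) (\<mu> (t k))"
   have "\<Phi> (t k) (gp l0 \<mu>0) = \<Phi> (t k) (gp (l (t k)) (\<mu> (t k))) + \<Phi> (t k) ?\<Delta>"
    by (simp flip: cp_add[OF cp])
   then have "\<Phi> (t k) (gp l0 \<mu>0) $$ (p, p) = \<Phi> (t k) (gp (l (t k)) (\<mu> (t k))) $$ (p, p) + \<Phi> (t k) ?\<Delta> $$ (p, p)"
    using p cp_dim[OF cp] by simp
   moreover have "Re (\<Phi> (t k) ?\<Delta> $$ (p, p)) <= norm ?\<Delta>"
    using complex_Re_le_cmod cp_index_bound[OF cp 1 p p] order_trans by blast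
   moreover have "norm ?\<Delta> <= 2 * cmod (l (t k) - l0) + 2 * cmod (\<mu> (t k) - \<mu>0)"
    by (rule gap_Lipschitz) (use unitary_power[OF u(1)] unitary_power[OF v(1)] r(3) s(3) seq in auto)
   ultimately show ?thesis by simp
  qed
  then have "(\<Sum>p<d. Re (\<Phi> (t k) (gp l0 \<mu>0) $$ (p, p))) <= (\<Sum>p<d. Re (\<Phi> (t k) (gp (l (t k)) (\<mu> (t k))) $$ (p, p)) +
    (2 * cmod (l (t k) - l0) + 2 * cmod (\<mu> (t k) - \<mu>0)))" by (intro sum_mono) auto
  also have "... <= 1 / real (Suc (t k)) * real d + real d * (2 * cmod (l (t k) - l0) + 2 * cmod (\<mu> (t k) - \<mu>0))"
   using seq(5)[of "t k"] by (simp add: sum.distrib)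
  also have "... <= real d * \<kappa> k"
  proof -
   have "1 / real (Suc (t k)) <= 1 / real (Suc k)" using seq_suble[OF t, of k] by (simp add: frac_le)
   then have "1 / real (Suc (t k)) * real d <= 1 / real (Suc k) * real d" by (rule mult_right_mono) simp
   then show ?thesis by (simp add: \<kappa>_def ring_distribs mult.commute)
  qed
  also have "... <= \<epsilon>" using k D(1) by (simp add: pos_less_divide_eq mult.commute)
  finally show ?thesis using cp seq(4) by (intro exI[of _ "\<Phi> (t k)"]) auto
 qed
 obtain \<Phi>' where "cp_map d \<Phi>'" "!!x. x : T ==> \<Phi>' x = \<phi> x" "!!p. p < d ==> \<Phi>' (gp l0 \<mu>0) $$ (p, p) = 0"
  by (rule ucp_extension_vanishing[OF T(1) ucp cpos_gap[of "u ^ n" "v ^ n" l0 \<mu>0] small], assumption, rule that)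
 then show ?thesis using that r(3) s(3) by blast
qed

lemma vanishing_gap:
 assumes \<Phi>: "cp_map d \<Phi>" and z: "!!p. p < d ==> \<Phi> (gp l \<mu>) $$ (p, p) = 0"
 shows "\<Phi> (c * (u ^ n - scaleC l 1)) = 0\<^sub>m d d" "\<Phi> (c * (v ^ n - scaleC \<mu> 1)) = 0\<^sub>m d d"
proof -
 let ?a = "u ^ n - scaleC l 1" and ?b = "v ^ n - scaleC \<mu> 1"
 have *: "\<Phi> (c * ?a) *\<^sub>v unit_vec d p = 0\<^sub>v d & \<Phi> (c * ?b) *\<^sub>v unit_vec d p = 0\<^sub>v d" if p: "p < d" for p
 proof -
  let ?e = "unit_vec d p :: complex vec"
  have e: "?e : carrier_vec d" by simp
  have "(\<Phi> (star ?a * ?a) *\<^sub>v ?e) \<bullet>c ?e + (\<Phi> (star ?b * ?b) *\<^sub>v ?e) \<bullet>c ?e = (\<Phi> (gp l \<mu>) *\<^sub>v ?e) \<bullet>c ?e"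
   unfolding gap_def by (rule cp_form_add[OF \<Phi> e e, symmetric])
  also have "... = 0" using z[OF p] form_unit[OF cp_carrier[OF \<Phi>] p p] by simp
  finally have "(\<Phi> (star ?a * ?a) *\<^sub>v ?e) \<bullet>c ?e = 0" "(\<Phi> (star ?b * ?b) *\<^sub>v ?e) \<bullet>c ?e = 0"
   using cp_pos1[OF \<Phi> e, of ?a] cp_pos1[OF \<Phi> e, of ?b] by (auto simp: add_nonneg_eq_0_iff)
  then show ?thesis using cp_null[OF \<Phi> e] by blast
 qed
 have zero: "A = 0\<^sub>m d d" if A: "A : carrier_mat d d" and "!!p. p < d ==> A *\<^sub>v unit_vec d p = 0\<^sub>v d" for A :: "complex mat"
 proof (rule eq_matI)
  fix i j assume "i < dim_row (0\<^sub>m d d :: complex mat)" "j < dim_col (0\<^sub>m d d :: complex mat)"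
  then show "A $$ (i, j) = 0\<^sub>m d d $$ (i, j)" using that(2)[of j] form_unit[OF A, of i j] by simp
 qed (use A in auto)
 show "\<Phi> (c * ?a) = 0\<^sub>m d d" "\<Phi> (c * ?b) = 0\<^sub>m d d" using * by (auto intro!: zero cp_carrier[OF \<Phi>])
qed

end

section \<open>Multiplicative domains and the standard representation\<close>

lemma cp_mult_of_isometry:
 assumes \<Phi>: "cp_map d \<Phi>" "\<Phi> 1 = 1\<^sub>m d" and w: "star w * w = 1"
  and iso: "adj (\<Phi> w) * \<Phi> w = 1\<^sub>m d"
 shows "\<Phi> (c * w) = \<Phi> c * \<Phi> w"
proof (rule mat_eq_vecI[of _ d d])
 note C = cp_carrier[OF \<Phi>(1)]
 fix x :: "complex vec" assume x: "x : carrier_vec d"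
 let ?b = "\<Phi> w *\<^sub>v x"
 have b: "?b : carrier_vec d" by (rule cp_vec[OF \<Phi>(1)])
 have bb: "?b \<bullet>c ?b = x \<bullet>c x" using gram_form[OF C[of w] x x] iso x by simp
 moreover have "cnj (x \<bullet>c x) = x \<bullet>c x" using cscalar_commute[OF x x] by simp
 ultimately have "\<Phi> (c * w) *\<^sub>v x = \<Phi> c *\<^sub>v ?b"
  using x b by (intro cp_exchange[OF \<Phi>(1) x b]) (simp add: w \<Phi>(2))
 then show "\<Phi> (c * w) *\<^sub>v x = (\<Phi> c * \<Phi> w) *\<^sub>v x" using assoc_mult_mat_vec[OF C C x] by simp
qed (rule cp_carrier[OF \<Phi>(1)] mult_carrier_mat[OF cp_carrier[OF \<Phi>(1)] cp_carrier[OF \<Phi>(1)]])+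

lemma cp_entry_continuous:
 assumes \<Phi>: "cp_map d \<Phi>" "\<Phi> 1 = 1\<^sub>m d" and ij: "i < d" "j < d"
 shows "bounded_linear (%x. \<Phi> x $$ (i, j))"
proof (rule bounded_linear_intro[of _ 1])
 show "\<Phi> (x + y) $$ (i, j) = \<Phi> x $$ (i, j) + \<Phi> y $$ (i, j)" for x y
  using ij by (simp add: cp_add[OF \<Phi>(1)] cp_dim[OF \<Phi>(1)])
 show "\<Phi> (r *\<^sub>R x) $$ (i, j) = r *\<^sub>R \<Phi> x $$ (i, j)" for r x
  using ij by (simp add: scaleR_scaleC cp_scaleC[OF \<Phi>(1)] cp_dim[OF \<Phi>(1)] scaleR_conv_of_real)
 show "norm (\<Phi> x $$ (i, j)) <= norm x * 1" for x using cp_index_bound[OF \<Phi> ij] by simp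
qed

lemma closed_mat_eq:
 fixes F G :: "'x::topological_space => complex mat"
 assumes car: "!!b. F b : carrier_mat d d" "!!b. G b : carrier_mat d d"
  and cont: "!!i j. i < d ==> j < d ==> continuous_on UNIV (%b. F b $$ (i, j))"
   "!!i j. i < d ==> j < d ==> continuous_on UNIV (%b. G b $$ (i, j))"
 shows "closed {b. F b = G b}"
proof -
 have dims: "dim_row (F b) = d" "dim_col (F b) = d" "dim_row (G b) = d" "dim_col (G b) = d" for b
  using car[of b] by auto
 have "{b. F b = G b} = (\<Inter>i\<in>{..<d}. \<Inter>j\<in>{..<d}. {b. F b $$ (i, j) = G b $$ (i, j)})"
 proof (intro equalityI subsetI)
  fix b assume b: "b : (\<Inter>i\<in>{..<d}. \<Inter>j\<in>{..<d}. {b. F b $$ (i, j) = G b $$ (i, j)})"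
  have "F b = G b" by (rule eq_matI) (use b dims in auto)
  then show "b : {b. F b = G b}" by simp
 qed auto
 moreover have "closed {b. F b $$ (i, j) = G b $$ (i, j)}" if "i < d" "j < d" for i j
  by (rule closed_Collect_eq[OF cont(1)[OF that] cont(2)[OF that]])
 ultimately show ?thesis by (auto intro!: closed_INT)
qed

lemma closed_cp_eq:
 assumes \<Phi>: "cp_map d \<Phi>" "\<Phi> 1 = 1\<^sub>m d" and car: "!!b. F b : carrier_mat d d"
  and F: "!!i j. i < d ==> j < d ==> continuous_on UNIV (%b. F b $$ (i, j))" and h: "bounded_linear h"
 shows "closed {b. \<Phi> (h b) = F b}"
 by (rule closed_mat_eq[OF cp_carrier[OF \<Phi>(1)] car _ F])
  (rule bounded_linear.continuous_on[OF bounded_linear_compose[OF cp_entry_continuous[OF \<Phi>] h] continuous_on_id])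

lemma continuous_mult_entry:
 fixes F G :: "'a::topological_space => complex mat"
 assumes "!!b. F b : carrier_mat d d" "!!b. G b : carrier_mat d d"
  and "!!i j. i < d ==> j < d ==> continuous_on UNIV (%b. F b $$ (i, j))"
  and "!!i j. i < d ==> j < d ==> continuous_on UNIV (%b. G b $$ (i, j))" and ij: "i < d" "j < d"
 shows "continuous_on UNIV (%b. (F b * G b) $$ (i, j))"
proof -
 have "(F b * G b) $$ (i, j) = (\<Sum>k<d. F b $$ (i, k) * G b $$ (k, j))" for b
  using assms(1)[of b] assms(2)[of b] ij by (simp add: scalar_prod_def atLeast0LessThan)
 then show ?thesis using assms by (auto intro!: continuous_intros)
qed

context rotation_pair
begin

text \<open>Equality in the Schwarz inequality makes the map multiplicative against \<open>u\<close> and \<open>v\<close>; the elements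
  against which it is multiplicative on both sides form a C*-algebra.\<close>

theorem multiplicative_domain:
 assumes \<Phi>: "cp_map d \<Phi>" "\<Phi> 1 = 1\<^sub>m d"
  and U: "unitary_mat d (\<Phi> u)" and V: "unitary_mat d (\<Phi> v)" and b: "b : B"
 shows "\<Phi> (c * b) = \<Phi> c * \<Phi> b" "\<Phi> (b * c) = \<Phi> b * \<Phi> c"
proof -
 note C = cp_carrier[OF \<Phi>(1)] and st = cp_star[OF \<Phi>(1)]
 let ?T = "{b. ALL c. \<Phi> (c * b) = \<Phi> c * \<Phi> b & \<Phi> (b * c) = \<Phi> b * \<Phi> c}"
 have adj: "\<Phi> (star b * c) = \<Phi> (star b) * \<Phi> c" if "!!c. \<Phi> (c * b) = \<Phi> c * \<Phi> b" for b c
  using arg_cong[OF that[of "star c"], of adj] adjoint_mult[OF C C, of "star c" b]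
  by (simp add: st[symmetric] star_mult star_star)
 have adj': "\<Phi> (c * star b) = \<Phi> c * \<Phi> (star b)" if "!!c. \<Phi> (b * c) = \<Phi> b * \<Phi> c" for b c
  using arg_cong[OF that[of "star c"], of adj] adjoint_mult[OF C C, of b "star c"]
  by (simp add: st[symmetric] star_mult star_star)
 have gen: "w : ?T" if w: "star w * w = 1" "w * star w = 1" and W: "unitary_mat d (\<Phi> w)" for w
 proof -
  have 1: "\<Phi> (c * w) = \<Phi> c * \<Phi> w" for c
   by (rule cp_mult_of_isometry[OF \<Phi> w(1)]) (use W in \<open>simp add: unitary_mat_def\<close>)
  have "\<Phi> (c * star w) = \<Phi> c * \<Phi> (star w)" for c
   by (rule cp_mult_of_isometry[OF \<Phi>]) (use W w in \<open>simp_all add: unitary_mat_def st star_star\<close>)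
  then have "\<Phi> (w * c) = \<Phi> w * \<Phi> c" for c using adj[of "star w" c] by (simp add: star_star)
  with 1 show ?thesis by simp
 qed
 have "cstar_subalgebra ?T"
  unfolding cstar_subalgebra_def operator_system_def
 proof (intro conjI ballI allI)
  show "1 : ?T" by (simp add: \<Phi>(2) left_mult_one_mat[OF C] right_mult_one_mat[OF C])
 next
  fix x y assume "x : ?T" "y : ?T"
  then show "x + y : ?T"
   by (simp add: ring_distribs cp_add[OF \<Phi>(1)] add_mult_distrib_mat[OF C C C] mult_add_distrib_mat[OF C C C])
 next
  fix x y assume x: "x : ?T" and y: "y : ?T"
  have "\<Phi> (c * (x * y)) = \<Phi> c * \<Phi> (x * y)" for c
   using x y assoc_mult_mat[OF C C C, of c x y] by (simp flip: mult.assoc)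
  moreover have "\<Phi> (x * y * c) = \<Phi> (x * y) * \<Phi> c" for c
   using x y assoc_mult_mat[OF C C C, of x y c] by (simp add: mult.assoc)
  ultimately show "x * y : ?T" by blast
 next
  fix t x assume "x : ?T"
  then show "scaleC t x : ?T"
   by (simp add: mult_scaleC_left mult_scaleC_right cp_scaleC[OF \<Phi>(1)]
     mult_smult_assoc_mat[OF C C] mult_smult_distrib[OF C C])
 next
  fix x assume "x : ?T"
  then show "star x : ?T" using adj[of x] adj'[of x] by blast
 next
  have ent: "continuous_on UNIV (%b. \<Phi> b $$ (i, j))" if "i < d" "j < d" for i j
   using bounded_linear.continuous_on[OF cp_entry_continuous[OF \<Phi> that] continuous_on_id] by simp
  have "closed {b. \<Phi> (c * b) = \<Phi> c * \<Phi> b}" for c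
  proof (rule closed_cp_eq[OF \<Phi> mult_carrier_mat[OF C C] _ bounded_linear_mult_right])
   fix i j assume "i < d" "j < d"
   then show "continuous_on UNIV (%b. (\<Phi> c * \<Phi> b) $$ (i, j))"
    by (intro continuous_mult_entry[OF C C] ent continuous_on_const)
  qed
  moreover have "closed {b. \<Phi> (b * c) = \<Phi> b * \<Phi> c}" for c
  proof (rule closed_cp_eq[OF \<Phi> mult_carrier_mat[OF C C] _ bounded_linear_mult_left])
   fix i j assume "i < d" "j < d"
   then show "continuous_on UNIV (%b. (\<Phi> b * \<Phi> c) $$ (i, j))"
    by (intro continuous_mult_entry[OF C C] ent continuous_on_const)
  qed
  ultimately show "closed ?T" by (intro closed_Collect_all closed_Collect_conj)
 qed
 then have "b : ?T" using B_least[of ?T] gen[OF u U] gen[OF v V] b by blast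
 then show "\<Phi> (c * b) = \<Phi> c * \<Phi> b" "\<Phi> (b * c) = \<Phi> b * \<Phi> c" by blast+
qed

definition shift_mat :: "complex mat" where
 "shift_mat = mat n n (%(i, j). if i = Suc j mod n then 1 else 0)"

definition clock_mat :: "complex mat" where
 "clock_mat = mat n n (%(i, j). if i = j then q ^ j else 0)"

lemma qpow_inj: "i < n ==> j < n ==> q ^ i = q ^ j ==> i = j"
proof (induction i j rule: linorder_wlog)
 case (le i j)
 have "q ^ j = q ^ i * q ^ (j - i)" using le(1) by (metis le_add_diff_inverse power_add)
 then have "q ^ (j - i) = 1" using le q_simps(7) by simp
 then show ?case using q_simps(3)[of "j - i"] le by (cases "i = j") auto
qed simp

lemma qq: "q ^ j * cnj q ^ j = 1" "cnj q ^ j * q ^ j = 1"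
 by (simp_all only: power_mult_distrib[symmetric] q_simps(5,6) power_one)

lemma Suc_mod_inj: "i < n ==> j < n ==> Suc i mod n = Suc j mod n ==> i = j"
 by (cases "Suc i = n"; cases "Suc j = n") auto

lemma shift_carrier [simp]: "shift_mat : carrier_mat n n" "dim_row shift_mat = n" "dim_col shift_mat = n"
 and clock_carrier [simp]: "clock_mat : carrier_mat n n" "dim_row clock_mat = n" "dim_col clock_mat = n"
 by (simp_all add: shift_mat_def clock_mat_def)

lemma B_sum: "(!!i. i : I ==> f i : B) ==> sum f I : B"
 by (induction I rule: infinite_finite_induct) (auto intro: B_props)

lemma root_average_B: "w : B ==> root_average N w z : B"
 unfolding root_average_def by (intro B_props B_sum)

lemma shift_unitary: "unitary_mat n shift_mat"
proof -
 have "adj shift_mat * shift_mat = 1\<^sub>m n"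
 proof (rule eq_matI)
  fix i j assume "i < dim_row (1\<^sub>m n :: complex mat)" "j < dim_col (1\<^sub>m n :: complex mat)"
  then have ij: "i < n" "j < n" by auto
  have "(adj shift_mat * shift_mat) $$ (i, j) = (\<Sum>k<n. cnj (shift_mat $$ (k, i)) * shift_mat $$ (k, j))"
   using ij shift_carrier by (simp add: scalar_prod_def atLeast0LessThan)
  also have "... = (\<Sum>k<n. if k = Suc i mod n then if k = Suc j mod n then 1 else 0 else 0)"
   by (rule sum.cong[OF refl]) (use ij in \<open>simp add: shift_mat_def\<close>)
  also have "... = (if Suc i mod n = Suc j mod n then 1 else 0)" using ij by simp
  also have "... = (if i = j then 1 else 0)" using Suc_mod_inj[OF ij] by auto
  finally show "(adj shift_mat * shift_mat) $$ (i, j) = 1\<^sub>m n $$ (i, j)" using ij by simp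
 qed (auto simp: shift_mat_def)
 moreover have "shift_mat : carrier_mat n n" by (simp add: shift_mat_def)
 ultimately show ?thesis unfolding unitary_mat_def using mat_mult_left_right_inverse[of "adj shift_mat" n shift_mat] by simp
qed

lemma clock_unitary: "unitary_mat n clock_mat"
proof -
 have "adj clock_mat * clock_mat = 1\<^sub>m n"
 proof (rule eq_matI)
  fix i j assume "i < dim_row (1\<^sub>m n :: complex mat)" "j < dim_col (1\<^sub>m n :: complex mat)"
  then have ij: "i < n" "j < n" by auto
  have "(adj clock_mat * clock_mat) $$ (i, j) = (\<Sum>k<n. cnj (clock_mat $$ (k, i)) * clock_mat $$ (k, j))"
   using ij clock_carrier by (simp add: scalar_prod_def atLeast0LessThan)
  also have "... = (\<Sum>k<n. if k = i then if i = j then 1 else 0 else 0)"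
   by (rule sum.cong[OF refl]) (use ij in \<open>simp add: clock_mat_def qq\<close>)
  finally show "(adj clock_mat * clock_mat) $$ (i, j) = 1\<^sub>m n $$ (i, j)" using ij by simp
 qed (auto simp: clock_mat_def)
 moreover have "clock_mat : carrier_mat n n" by (simp add: clock_mat_def)
 ultimately show ?thesis unfolding unitary_mat_def using mat_mult_left_right_inverse[of "adj clock_mat" n clock_mat] by simp
qed

text \<open>A cut down of the map by \<open>z = v\<^sup>n\<^sup>-\<^sup>j P\<^sub>j\<close>, with \<open>P\<^sub>j\<close> an eigenprojection of \<open>u\<close> of nonzero mass, is a
  vector state at an eigenvector of \<open>u\<close> for the eigenvalue \<open>1\<close>.\<close>

lemma eigenstate_exists:
 assumes \<Phi>: "cp_map d \<Phi>" "\<Phi> 1 = 1\<^sub>m d" "0 < d"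
  and van: "!!c. \<Phi> (c * (u ^ n - 1)) = 0\<^sub>m d d" "!!c. \<Phi> (c * (v ^ n - 1)) = 0\<^sub>m d d"
 obtains \<Psi> where "cp_map 1 \<Psi>" "\<Psi> 1 = 1\<^sub>m 1" "!!c. \<Psi> (c * (u - 1)) = 0\<^sub>m 1 1" "!!c. \<Psi> (c * (v ^ n - 1)) = 0\<^sub>m 1 1"
proof -
 note C = cp_carrier[OF \<Phi>(1)]
 define P where "P j = root_average n u (q ^ j)" for j
 have "EX j<n. EX p<d. \<Phi> (star (P j) * P j) $$ (p, p) ~= 0"
 proof (rule ccontr)
  assume "\<not> ?thesis"
  then have z: "\<Phi> (star (P j) * P j) $$ (0, 0) = 0" if "j < n" for j using that \<Phi>(3) by blast
  have "\<Phi> (\<Sum>j<n. star (P j) * P j) $$ (0, 0) = 0"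
   using \<Phi>(3) by (simp add: cp_index_sum[OF \<Phi>(1)] z)
  then show False using root_average_sum_squares[OF q u(1)] \<Phi>(2,3) by (simp add: P_def)
 qed
 then obtain j p where j: "j < n" and p: "p < d" and nz: "\<Phi> (star (P j) * P j) $$ (p, p) ~= 0" by blast
 define z where "z = v ^ (n - j) * P j"
 have zz: "star z * z = star (P j) * P j"
 proof -
  have "star z * z = star (P j) * (star (v ^ (n - j)) * v ^ (n - j)) * P j" by (simp only: z_def star_mult mult.assoc)
  then show ?thesis by (simp add: unitary_power[OF v(1)])
 qed
 have "(q ^ j) ^ n = (q ^ n) ^ j" by (simp only: power_mult[symmetric] mult.commute)
 then have qj: "cnj (q ^ j) * q ^ j = 1" "(q ^ j) ^ n = 1" by (simp_all add: qq q_simps(2))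
 have uz: "(u - 1) * z = scaleC (1 / of_nat n) (v ^ (n - j) * (u ^ n - 1))"
 proof -
  have "u * z = (u * v ^ (n - j)) * P j" by (simp add: z_def mult.assoc)
  also have "... = scaleC (q ^ (n - j)) (v ^ (n - j) * (u * P j))" by (simp add: u_vpow mult_scaleC_left mult.assoc)
  also have "u * P j = scaleC (q ^ j) (P j) + scaleC (q ^ j / of_nat n) (u ^ n - 1)"
   using root_average_eigen[OF qj, of u] by (simp add: P_def diff_eq_eq add.commute)
  also have "scaleC (q ^ (n - j)) (v ^ (n - j) * (scaleC (q ^ j) (P j) + scaleC (q ^ j / of_nat n) (u ^ n - 1))) =
    scaleC (q ^ (n - j) * q ^ j) z + scaleC (q ^ (n - j) * q ^ j / of_nat n) (v ^ (n - j) * (u ^ n - 1))"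
   by (simp add: distrib_left mult_scaleC_right scaleC_add_right scaleC_scaleC z_def)
  also have "q ^ (n - j) * q ^ j = q ^ (n - j + j)" by (rule power_add[symmetric])
  also have "... = 1" using j q_simps(2) by simp
  finally show ?thesis by (simp add: left_diff_distrib)
 qed
 have vz: "(v ^ n - 1) * z = z * (v ^ n - 1)"
 proof -
  have "z : B" unfolding z_def P_def by (intro B_props root_average_B uv_B)
  then have "v ^ n * z = z * v ^ n" by (rule commutes_B[OF vn_comm(2,1)])
  then show ?thesis by (simp add: ring_distribs)
 qed
 define t where "t = Re (\<Phi> (star z * z) $$ (p, p))"
 have "0 <= \<Phi> (star z * z) $$ (p, p)"
  using cp_pos1[OF \<Phi>(1), of "unit_vec d p" z] form_unit[OF C p p] by simp
 then have t: "\<Phi> (star z * z) $$ (p, p) = of_real t" "0 < t"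
  using nz by (auto simp: t_def zz less_eq_complex_def complex_eq_iff)
 define g where "g = mat d 1 (%(i, _). if i = p then complex_of_real (1 / sqrt t) else 0)"
 have g: "g : carrier_mat d 1" by (simp add: g_def)
 define \<Psi> where "\<Psi> x = adj g * \<Phi> (star z * x * z) * g" for x
 have cp: "cp_map 1 \<Psi>" unfolding \<Psi>_def by (rule cp_map_conj[OF cp_map_compose_conj[OF \<Phi>(1)] g])
 have ent: "\<Psi> x $$ (0, 0) = \<Phi> (star z * x * z) $$ (p, p) / of_real t" for x
 proof -
  have ge: "g *\<^sub>v unit_vec 1 0 = complex_of_real (1 / sqrt t) \<cdot>\<^sub>v unit_vec d p"
   using p by (intro eq_vecI) (auto simp: g_def scalar_prod_def)
  have "\<Psi> x $$ (0, 0) = (\<Psi> x *\<^sub>v unit_vec 1 0) \<bullet>c unit_vec 1 0" using form_unit[OF cp_carrier[OF cp], of 0 0 x] by simp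
  also have "... = (\<Phi> (star z * x * z) *\<^sub>v (g *\<^sub>v unit_vec 1 0)) \<bullet>c (g *\<^sub>v unit_vec 1 0)"
   unfolding \<Psi>_def by (rule conj_form[OF g C]) simp_all
  also have "... = complex_of_real (1 / sqrt t) * complex_of_real (1 / sqrt t) * \<Phi> (star z * x * z) $$ (p, p)"
   unfolding ge mult_mat_vec[OF C unit_vec_carrier]
   by (simp add: cscalar_simps[of _ d] cp_vec[OF \<Phi>(1)] form_unit[OF C p p])
  also have "complex_of_real (1 / sqrt t) * complex_of_real (1 / sqrt t) = complex_of_real (1 / sqrt t * (1 / sqrt t))"
   by (rule of_real_mult[symmetric])
  also have "1 / sqrt t * (1 / sqrt t) = 1 / t" using t(2) by simp
  finally show ?thesis by simp
 qed
 have ext1: "A = A'" if "A : carrier_mat 1 1" "A' : carrier_mat 1 1" "A $$ (0, 0) = A' $$ (0, 0)" for A A' :: "complex mat"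
  using that by (intro eq_matI) auto
 have null: "\<Phi> (star z * (c * (u - 1)) * z) = 0\<^sub>m d d" "\<Phi> (star z * (c * (v ^ n - 1)) * z) = 0\<^sub>m d d" for c
 proof -
  have "star z * (c * (u - 1)) * z = scaleC (1 / of_nat n) (star z * c * v ^ (n - j)) * (u ^ n - 1)"
   using uz by (simp add: mult.assoc mult_scaleC_left mult_scaleC_right)
  then show "\<Phi> (star z * (c * (u - 1)) * z) = 0\<^sub>m d d" by (simp only: van)
  have "star z * (c * (v ^ n - 1)) * z = star z * c * z * (v ^ n - 1)" using vz by (simp add: mult.assoc)
  then show "\<Phi> (star z * (c * (v ^ n - 1)) * z) = 0\<^sub>m d d" by (simp only: van)
 qed
 show ?thesis
 proof (rule that[OF cp])
  show "\<Psi> 1 = 1\<^sub>m 1" by (rule ext1[OF cp_carrier[OF cp]]) (use t in \<open>auto simp: ent\<close>)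
  have z0: "\<Psi> x = 0\<^sub>m 1 1" if "\<Phi> (star z * x * z) = 0\<^sub>m d d" for x
  proof (rule ext1[OF cp_carrier[OF cp]])
   show "\<Psi> x $$ (0, 0) = 0\<^sub>m 1 1 $$ (0, 0)" unfolding ent that using p by simp
  qed simp
  show "\<Psi> (c * (u - 1)) = 0\<^sub>m 1 1" for c by (rule z0[OF null(1)])
  show "\<Psi> (c * (v ^ n - 1)) = 0\<^sub>m 1 1" for c by (rule z0[OF null(2)])
 qed
qed


text \<open>In the GNS space of the eigenstate the orbit of the cyclic vector under \<open>v\<close> is an orthonormal
  basis; the representation is read off from its matrix coefficients.\<close>

theorem standard_representation_exists:
 assumes \<Phi>: "cp_map d \<Phi>" "\<Phi> 1 = 1\<^sub>m d" "0 < d"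
  and van: "!!c. \<Phi> (c * (u ^ n - 1)) = 0\<^sub>m d d" "!!c. \<Phi> (c * (v ^ n - 1)) = 0\<^sub>m d d"
 obtains \<pi> where "cp_map n \<pi>" "\<pi> 1 = 1\<^sub>m n" "\<pi> u = clock_mat" "\<pi> v = shift_mat"
proof -
 obtain \<Psi> where \<Psi>: "cp_map 1 \<Psi>" "\<Psi> 1 = 1\<^sub>m 1" "!!c. \<Psi> (c * (u - 1)) = 0\<^sub>m 1 1" "!!c. \<Psi> (c * (v ^ n - 1)) = 0\<^sub>m 1 1"
  by (rule eigenstate_exists[OF \<Phi> van], rule that)
 note C = cp_carrier[OF \<Psi>(1)] and dim = cp_dim[OF \<Psi>(1)]
 define f where "f x = \<Psi> x $$ (0, 0)" for x
 have fadd: "f (x + y) = f x + f y" for x y by (simp add: f_def cp_add[OF \<Psi>(1)] dim)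
 have fsc: "f (scaleC t x) = t * f x" for t x by (simp add: f_def cp_scaleC[OF \<Psi>(1)] dim)
 have fdiff: "f (x - y) = f x - f y" for x y using fadd[of x "- y"] fsc[of "-1" y] by simp
 have f0: "f 0 = 0" using fsc[of 0 0] by simp
 have fsum: "f (sum g I) = (\<Sum>i\<in>I. f (g i))" for g :: "nat => 'a" and I
  by (induction I rule: infinite_finite_induct) (auto simp: fadd f0)
 have fstar: "f (star x) = cnj (f x)" for x by (simp add: f_def cp_star[OF \<Psi>(1)] dim)
 have fpos: "0 <= f (star x * x)" for x
  using cp_pos1[OF \<Psi>(1), of "unit_vec 1 0" x] form_unit[OF C, of 0 0 "star x * x"] by (simp add: f_def)
 have f1: "f 1 = 1" by (simp add: f_def \<Psi>(2))
 have fu: "f (c * u) = f c" for c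
  using fdiff[of "c * u" c] \<Psi>(3)[of c] by (simp add: f_def right_diff_distrib)
 have fv: "f (c * v ^ n) = f c" for c
  using fdiff[of "c * v ^ n" c] \<Psi>(4)[of c] by (simp add: f_def right_diff_distrib)
 have fu': "f (star u * c) = f c" for c
  using fstar[of "star c * u"] fu[of "star c"] fstar[of "star c"] by (simp add: star_mult star_star)
 have orth: "f (star (v ^ j) * v ^ l) = (if j = l then 1 else 0)" if jl: "j < n" "l < n" for j l
 proof (cases "j = l")
  case True
  then show ?thesis by (simp add: unitary_power[OF v(1)] f1)
 next
  case False
  have vu: "v ^ l * u = scaleC (cnj q ^ l) (u * v ^ l)" for l
   by (simp add: u_vpow scaleC_scaleC qq)
  have "star u * (star (v ^ j) * v ^ l) * u = star (v ^ j * u) * (v ^ l * u)" by (simp add: star_mult mult.assoc)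
  also have "... = scaleC (q ^ j * cnj q ^ l) (star (v ^ j) * (star u * u) * v ^ l)"
   unfolding vu by (simp add: star_scaleC star_mult mult_scaleC_left mult_scaleC_right scaleC_scaleC mult.assoc
     mult.commute[of "cnj q ^ l"])
  finally have "f (star (v ^ j) * v ^ l) = q ^ j * cnj q ^ l * f (star (v ^ j) * v ^ l)"
   using fu[of "star u * (star (v ^ j) * v ^ l)"] fu'[of "star (v ^ j) * v ^ l"] by (simp add: u fsc)
  moreover have "q ^ j * cnj q ^ l ~= 1"
  proof
   assume "q ^ j * cnj q ^ l = 1"
   then have "q ^ j * (cnj q ^ l * q ^ l) = q ^ l" by (simp flip: mult.assoc)
   then show False using qpow_inj[OF jl] False by (simp add: qq)
  qed
  ultimately have "f (star (v ^ j) * v ^ l) = 0" using mult_cancel_right1[of "f (star (v ^ j) * v ^ l)"] by metis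
  then show ?thesis using False by simp
 qed
 define \<pi> where "\<pi> b = mat n n (%(j, l). f (star (v ^ j) * b * v ^ l))" for b
 have car: "\<pi> b : carrier_mat n n" for b by (simp add: \<pi>_def)
 have "cp_map n \<pi>"
  unfolding cp_map_def
 proof (intro conjI allI impI)
  fix k :: nat and a :: "nat => 'a" and \<xi> :: "nat => complex vec" assume xi: "ALL i<k. \<xi> i : carrier_vec n"
  define y where "y = (\<Sum>i<k. \<Sum>l<n. scaleC (\<xi> i $ l) (a i * v ^ l))"
  have "star y * y = (\<Sum>i<k. \<Sum>i'<k. \<Sum>j<n. \<Sum>l<n. scaleC (\<xi> i' $ l * cnj (\<xi> i $ j)) (star (v ^ j) * (star (a i) * a i') * v ^ l))"
   by (simp add: y_def star_sum sum_product star_scaleC star_mult mult_scaleC_left mult_scaleC_right scaleC_scaleC mult.assoc)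
  then have "f (star y * y) = (\<Sum>i<k. \<Sum>i'<k. \<Sum>j<n. \<Sum>l<n. \<pi> (star (a i) * a i') $$ (j, l) * \<xi> i' $ l * cnj (\<xi> i $ j))"
   by (simp add: fsum fsc \<pi>_def mult_ac)
  also have "... = (\<Sum>i<k. \<Sum>i'<k. (\<pi> (star (a i) * a i') *\<^sub>v \<xi> i') \<bullet>c \<xi> i)"
   by (intro sum.cong refl form_expand[symmetric] car) (use xi in auto)
  finally show "0 <= (\<Sum>i<k. \<Sum>j<k. (\<pi> (star (a i) * a j) *\<^sub>v \<xi> j) \<bullet>c \<xi> i)" using fpos[of y] by simp
 qed (auto simp: \<pi>_def distrib_left distrib_right fadd fsc mult_scaleC_left mult_scaleC_right intro!: eq_matI)
 moreover have "\<pi> 1 = 1\<^sub>m n" by (rule eq_matI) (auto simp: \<pi>_def orth)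
 moreover have "\<pi> u = clock_mat"
 proof (rule eq_matI)
  fix i j assume "i < dim_row clock_mat" "j < dim_col clock_mat"
  then have ij: "i < n" "j < n" by (auto simp: clock_mat_def)
  have "star (v ^ i) * u * v ^ j = scaleC (q ^ j) (star (v ^ i) * v ^ j * u)"
   by (simp add: mult.assoc u_vpow mult_scaleC_right)
  then show "\<pi> u $$ (i, j) = clock_mat $$ (i, j)" using ij by (simp add: \<pi>_def clock_mat_def fsc fu orth)
 qed (auto simp: \<pi>_def clock_mat_def)
 moreover have "\<pi> v = shift_mat"
 proof (rule eq_matI)
  fix i j assume "i < dim_row shift_mat" "j < dim_col shift_mat"
  then have ij: "i < n" "j < n" by (auto simp: shift_mat_def)
  have "f (star (v ^ i) * v * v ^ j) = (if i = Suc j mod n then 1 else 0)"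
  proof (cases "Suc j = n")
   case True
   then have "star (v ^ i) * v * v ^ j = star (v ^ i) * v ^ n" by (simp add: mult.assoc flip: power_Suc)
   then show ?thesis using orth[OF ij(1), of 0] True q_simps(1) by (simp add: fv)
  next
   case False
   then show ?thesis using orth[OF ij(1), of "Suc j"] ij by (simp add: mult.assoc)
  qed
  then show "\<pi> v $$ (i, j) = shift_mat $$ (i, j)" using ij by (simp add: \<pi>_def shift_mat_def)
 qed (auto simp: \<pi>_def shift_mat_def)
 ultimately show ?thesis by (rule that)
qed

end

lemma bounded_linear_scaleC:
 assumes "bounded_linear f"
 shows "bounded_linear (%b. scaleC (f b) (y::'a::unital_cstar_algebra))"
proof (rule bounded_linear_compose[OF _ assms])
 show "bounded_linear (%t. scaleC t y)"
  by (rule bounded_linear_intro[of _ "norm y"])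
   (simp_all add: scaleC_add_left norm_scaleC scaleR_scaleC scaleC_scaleC scaleR_conv_of_real)
qed

lemma mat_sum_index: "i < n ==> j < n ==> mat_sum n r F $$ (i, j) = (\<Sum>t<r. F t $$ (i, j))"
 by (simp add: mat_sum_def)

lemma conj_index:
 fixes A g :: "complex mat"
 assumes A: "A : carrier_mat m m" and g: "g : carrier_mat m n" and ij: "i < n" "j < n"
 shows "(adj g * A * g) $$ (i, j) = (\<Sum>a<m. \<Sum>b<m. cnj (g $$ (a, i)) * A $$ (a, b) * g $$ (b, j))"
proof -
 have "(adj g * A * g) $$ (i, j) = (\<Sum>b<m. (\<Sum>a<m. cnj (g $$ (a, i)) * A $$ (a, b)) * g $$ (b, j))"
  using A g ij by (simp add: scalar_prod_def atLeast0LessThan)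
 then show ?thesis by (simp add: sum_distrib_right) (rule sum.swap)
qed

context rotation_pair
begin

text \<open>The reference representation is irreducible: a matrix commuting with the clock matrix is diagonal
  because the \<open>q\<^sup>j\<close> are distinct, and commuting with the shift makes its diagonal constant.\<close>

lemma clock_shift_commutant:
 assumes A: "A : carrier_mat n n" and c: "A * clock_mat = clock_mat * A" and s: "A * shift_mat = shift_mat * A"
 shows "A = A $$ (0, 0) \<cdot>\<^sub>m 1\<^sub>m n"
proof (rule eq_matI)
 fix i j assume "i < dim_row (A $$ (0, 0) \<cdot>\<^sub>m 1\<^sub>m n)" "j < dim_col (A $$ (0, 0) \<cdot>\<^sub>m 1\<^sub>m n)"
 then have ij: "i < n" "j < n" by auto
 have off: "A $$ (i, j) = 0" if "i < n" "j < n" "i ~= j" for i j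
 proof -
  have "(A * clock_mat) $$ (i, j) = (\<Sum>k<n. A $$ (i, k) * (if k = j then q ^ j else 0))"
   using A that by (simp add: clock_mat_def scalar_prod_def atLeast0LessThan)
  also have "... = A $$ (i, j) * q ^ j" using that by (simp add: mult_delta_left mult_delta_right)
  finally have 1: "(A * clock_mat) $$ (i, j) = A $$ (i, j) * q ^ j" .
  have "(clock_mat * A) $$ (i, j) = (\<Sum>k<n. (if i = k then q ^ k else 0) * A $$ (k, j))"
   using A that by (simp add: clock_mat_def scalar_prod_def atLeast0LessThan)
  also have "... = q ^ i * A $$ (i, j)" using that by (simp add: mult_delta_left mult_delta_right)
  finally have 2: "(clock_mat * A) $$ (i, j) = q ^ i * A $$ (i, j)" .
  have "A $$ (i, j) * q ^ j = q ^ i * A $$ (i, j)" by (rule trans[OF sym[OF 1[unfolded c]] 2])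
  then have "A $$ (i, j) * (q ^ j - q ^ i) = 0" by (simp add: algebra_simps)
  then have "A $$ (i, j) = 0 | q ^ i = q ^ j" by auto
  then show ?thesis using qpow_inj[of i j] that by blast
 qed
 have diag: "A $$ (j, j) = A $$ (0, 0)" if "j < n" for j
  using that
 proof (induction j)
  case (Suc j)
  have "(A * shift_mat) $$ (Suc j, j) = (\<Sum>k<n. A $$ (Suc j, k) * (if k = Suc j then 1 else 0))"
   using A Suc by (simp add: shift_mat_def scalar_prod_def atLeast0LessThan)
  also have "... = A $$ (Suc j, Suc j)" using Suc by (simp add: mult_delta_left mult_delta_right)
  finally have 1: "(A * shift_mat) $$ (Suc j, j) = A $$ (Suc j, Suc j)" .
  have "(shift_mat * A) $$ (Suc j, j) = (\<Sum>k<n. (if Suc j = Suc k mod n then 1 else 0) * A $$ (k, j))"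
   using A Suc by (simp add: shift_mat_def scalar_prod_def atLeast0LessThan)
  also have "... = (\<Sum>k<n. if k = j then A $$ (k, j) else 0)"
  proof (rule sum.cong[OF refl])
   fix k assume "k : {..<n}"
   then have k: "k < n" by simp
   have sj: "Suc j mod n = Suc j" by (rule mod_less[OF Suc.prems])
   have eq: "Suc j = Suc k mod n \<longleftrightarrow> k = j"
   proof
    assume a: "Suc j = Suc k mod n"
    show "k = j" by (rule Suc_mod_inj[OF k Suc_lessD[OF Suc.prems] trans[OF a[symmetric] sj[symmetric]]])
   next
    assume "k = j"
    then show "Suc j = Suc k mod n" by (simp only: sj)
   qed
   show "(if Suc j = Suc k mod n then 1 else 0) * A $$ (k, j) = (if k = j then A $$ (k, j) else 0)"
    unfolding eq by simp
  qed
  also have "... = A $$ (j, j)" using Suc.prems by simp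
  finally have 2: "(shift_mat * A) $$ (Suc j, j) = A $$ (j, j)" .
  have "A $$ (Suc j, Suc j) = A $$ (j, j)" by (rule trans[OF sym[OF 1[unfolded s]] 2])
  also have "... = A $$ (0, 0)" by (rule Suc.IH[OF Suc_lessD[OF Suc.prems]])
  finally show ?case .
 qed simp
 show "A $$ (i, j) = (A $$ (0, 0) \<cdot>\<^sub>m 1\<^sub>m n) $$ (i, j)" using ij off[OF ij] diag[OF ij(1)] by auto
qed (use A in auto)


text \<open>If \<open>u\<^sup>n\<close> and \<open>v\<^sup>n\<close> act as \<open>1\<close>, then modulo the null space \<open>N\<close> of the map the elements
  \<open>v\<^sup>j P v\<^sup>-\<^sup>l\<close>, with \<open>P\<close> the eigenprojection of \<open>u\<close> at \<open>1\<close>, are matrix units, so that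
  \<open>b = \<Sum>\<^sub>j\<^sub>l \<pi>(b)\<^sub>j\<^sub>l v\<^sup>j P v\<^sup>-\<^sup>l\<close>: the map factors through \<open>\<pi>\<close>, and as a completely positive map on
  matrices it has a Kraus decomposition.\<close>

theorem kraus_decomposition:
 assumes \<Phi>: "cp_map d \<Phi>" and \<Phi>1: "\<Phi> 1 = 1\<^sub>m d"
  and van: "!!c. \<Phi> (c * (u ^ n - 1)) = 0\<^sub>m d d" "!!c. \<Phi> (c * (v ^ n - 1)) = 0\<^sub>m d d"
  and \<pi>: "cp_map n \<pi>" "\<pi> 1 = 1\<^sub>m n" "\<pi> u = clock_mat" "\<pi> v = shift_mat"
 obtains r :: nat and \<gamma> where "!!t. t < r ==> \<gamma> t : carrier_mat n d"
  "!!b. b : B ==> \<Phi> b = mat_sum d r (%t. adj (\<gamma> t) * \<pi> b * \<gamma> t)"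
proof -
 note C = cp_carrier[OF \<Phi>] and Cp = cp_carrier[OF \<pi>(1)] and dimp = cp_dim[OF \<pi>(1)]
 note mult = multiplicative_domain(1)[OF \<pi>(1,2), unfolded \<pi>(3,4), OF clock_unitary shift_unitary]
 define P where "P = root_average n u 1"
 have PB: "P : B" unfolding P_def by (intro root_average_B uv_B)
 define N where "N = {x. ALL c. \<forall>z\<in>B. \<Phi> (c * x * z) = 0\<^sub>m d d}"
 have N_add: "x + y : N" if "x : N" "y : N" for x y
  using that by (simp add: N_def distrib_left distrib_right cp_add[OF \<Phi>])
 have N_sc: "scaleC t x : N" if "x : N" for t x
  using that by (simp add: N_def mult_scaleC_left mult_scaleC_right cp_scaleC[OF \<Phi>])
 have N_diff: "x - y : N" if "x : N" "y : N" for x y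
  using N_add[OF that(1) N_sc[OF that(2), of "-1"]] by (simp add: scaleC_minus_left)
 have N_left: "a * x : N" if "x : N" for a x
 proof -
  have "c * (a * x) * z = (c * a) * x * z" for c z by (simp only: mult.assoc)
  with that show ?thesis unfolding N_def by simp
 qed
 have N_right: "x * y : N" if "x : N" "y : B" for x y
 proof -
  have "c * (x * y) * z = c * x * (y * z)" for c z by (simp only: mult.assoc)
  with that B_props(5)[OF that(2)] show ?thesis unfolding N_def by simp
 qed
 have N_0: "0 : N" by (simp add: N_def cp_zero[OF \<Phi>])
 have N_sum: "sum f I : N" if "!!i. i : I ==> f i : N" for f :: "nat => 'a" and I
  using that
 proof (induction I rule: infinite_finite_induct)
  case (insert i I)
  have "f i + sum f I : N" by (rule N_add) (use insert in blast)+
  then show ?case by (simp only: sum.insert[OF insert(1,2)])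
 qed (simp_all add: N_0)
 have central: "z - 1 : N" if z: "!!b. b : B ==> z * b = b * z" "!!c. \<Phi> (c * (z - 1)) = 0\<^sub>m d d" for z
 proof -
  have "c * (z - 1) * b = (c * b) * (z - 1)" if "b : B" for b c
   using z(1)[OF that] by (simp add: ring_distribs mult.assoc)
  then show ?thesis unfolding N_def using z(2) by simp
 qed
 have uN: "u ^ n - 1 : N" and vN: "v ^ n - 1 : N"
  by (rule central[OF commutes_B[OF un_comm] van(1)], assumption) (rule central[OF commutes_B[OF vn_comm(2,1)] van(2)])
 have "u * P - P = scaleC (1 / of_nat n) (u ^ n - 1)" using root_average_eigen[of 1 n u] by (simp add: P_def)
 then have uP: "u * P - P : N" by (simp add: N_sc uN)
 define D where "D b l = b * v ^ l * P - (\<Sum>j<n. scaleC (\<pi> b $$ (j, l)) (v ^ j * P))" for b l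
 define T where "T = {b. b : B & (ALL l<n. D b l : N) & (ALL l<n. D (star b) l : N)}"
 have Du: "D u l : N" if l: "l < n" for l
 proof -
  have "(\<Sum>j<n. scaleC (\<pi> u $$ (j, l)) (v ^ j * P)) = (\<Sum>j<n. if j = l then scaleC (q ^ l) (v ^ l * P) else 0)"
   by (rule sum.cong[OF refl]) (use l in \<open>auto simp: \<pi>(3) clock_mat_def\<close>)
  also have "... = scaleC (q ^ l) (v ^ l * P)" using l by simp
  finally have "D u l = scaleC (q ^ l) (v ^ l * (u * P - P))"
   by (simp add: D_def u_vpow mult_scaleC_left mult.assoc right_diff_distrib scaleC_diff_right)
  then show ?thesis by (simp add: N_sc N_left uP)
 qed
 have Dv: "D v l : N" if l: "l < n" for l
 proof -
  have "(\<Sum>j<n. scaleC (\<pi> v $$ (j, l)) (v ^ j * P)) = (\<Sum>j<n. if j = Suc l mod n then v ^ (Suc l mod n) * P else 0)"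
   by (rule sum.cong[OF refl]) (use l in \<open>auto simp: \<pi>(4) shift_mat_def\<close>)
  also have "... = v ^ (Suc l mod n) * P" using q_simps(1) by simp
  finally have D: "D v l = v ^ Suc l * P - v ^ (Suc l mod n) * P" by (simp add: D_def)
  show ?thesis
  proof (cases "Suc l = n")
   case True
   then have "D v l = (v ^ n - 1) * P" by (simp only: D) (simp add: left_diff_distrib)
   then show ?thesis by (simp add: N_right vN PB)
  next
   case False
   then have "D v l = 0" using l by (simp only: D) simp
   then show ?thesis by (simp add: N_0)
  qed
 qed
 have Dunit: "D (star w) l : N"
  if w: "star w * w = 1" and W: "unitary_mat n (\<pi> w)" and Dw: "!!l. l < n ==> D w l : N" and l: "l < n" for w l
 proof -
  let ?c = "%l'. \<pi> (star w) $$ (l', l)"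
  let ?Y = "\<Sum>l'<n. scaleC (?c l') (v ^ l' * P)"
  have one: "\<pi> w * \<pi> (star w) = 1\<^sub>m n" using W by (simp add: unitary_mat_def cp_star[OF \<pi>(1)])
  have ent: "(\<Sum>l'<n. \<pi> w $$ (j, l') * ?c l') = (if j = l then 1 else 0)" if "j < n" for j
   using arg_cong[OF one, of "%A. A $$ (j, l)"] that l dimp[of w] dimp[of "star w"]
   by (simp add: scalar_prod_def atLeast0LessThan)
  have "(\<Sum>l'<n. scaleC (?c l') (\<Sum>j<n. scaleC (\<pi> w $$ (j, l')) (v ^ j * P))) =
    (\<Sum>l'<n. \<Sum>j<n. scaleC (\<pi> w $$ (j, l') * ?c l') (v ^ j * P))"
   by (simp add: scaleC_sum_right scaleC_scaleC mult.commute)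
  also have "... = (\<Sum>j<n. scaleC (\<Sum>l'<n. \<pi> w $$ (j, l') * ?c l') (v ^ j * P))"
   by (subst sum.swap) (simp add: scaleC_sum_left)
  also have "... = (\<Sum>j<n. if j = l then v ^ l * P else 0)"
   by (rule sum.cong[OF refl]) (simp add: ent)
  also have "... = v ^ l * P" using l by simp
  finally have "(\<Sum>l'<n. scaleC (?c l') (D w l')) = w * ?Y - v ^ l * P"
   by (simp add: D_def scaleC_diff_right sum_subtractf sum_distrib_left mult_scaleC_right mult.assoc)
  then have "star w * (\<Sum>l'<n. scaleC (?c l') (D w l')) = ?Y - star w * v ^ l * P"
   by (simp only: right_diff_distrib mult.assoc[symmetric] w mult_1_left)
  then have eq: "D (star w) l = scaleC (-1) (star w * (\<Sum>l'<n. scaleC (?c l') (D w l')))"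
   by (simp only: D_def scaleC_minus_one minus_diff_eq)
  show ?thesis unfolding eq by (intro N_sc N_left N_sum Dw) simp
 qed
 have D_add: "D (a + b) l = D a l + D b l" if "l < n" for a b l
  using that by (simp add: D_def cp_add[OF \<pi>(1)] dimp distrib_right scaleC_add_left sum.distrib)
 have D_sc: "D (scaleC t a) l = scaleC t (D a l)" if "l < n" for t a l
  using that by (simp add: D_def cp_scaleC[OF \<pi>(1)] dimp mult_scaleC_left scaleC_diff_right scaleC_sum_right scaleC_scaleC)
 have D_mult: "D (a * b) l = a * D b l + (\<Sum>j<n. scaleC (\<pi> b $$ (j, l)) (D a j))" if "l < n" "b : B" for a b l
 proof -
  have "(\<Sum>k<n. scaleC (\<pi> (a * b) $$ (k, l)) (v ^ k * P)) =
    (\<Sum>k<n. \<Sum>j<n. scaleC (\<pi> b $$ (j, l)) (scaleC (\<pi> a $$ (k, j)) (v ^ k * P)))"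
   using that(1) dimp[of a] dimp[of b]
   by (simp add: mult[OF that(2)] scalar_prod_def atLeast0LessThan scaleC_sum_left scaleC_scaleC mult.commute)
  also have "... = (\<Sum>j<n. \<Sum>k<n. scaleC (\<pi> b $$ (j, l)) (scaleC (\<pi> a $$ (k, j)) (v ^ k * P)))" by (rule sum.swap)
  also have "... = (\<Sum>j<n. scaleC (\<pi> b $$ (j, l)) (\<Sum>k<n. scaleC (\<pi> a $$ (k, j)) (v ^ k * P)))"
   by (simp add: scaleC_sum_right)
  finally show ?thesis
   by (simp add: D_def right_diff_distrib sum_distrib_left mult_scaleC_right mult.assoc scaleC_diff_right sum_subtractf)
 qed
 have D_lin: "bounded_linear (%b. D b l)" if "l < n" for l
  unfolding D_def mult.assoc
  by (rule bounded_linear_sub[OF bounded_linear_mult_left bounded_linear_sum])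
   (rule bounded_linear_scaleC[OF cp_entry_continuous[OF \<pi>(1,2)]], use that in simp_all)
 have "closed {b. D b l : N}" if l: "l < n" for l
 proof -
  have "closed {b. \<Phi> (c * D b l * z) = 0\<^sub>m d d}" for c z
  proof -
   have "bounded_linear (%b. c * D b l * z)"
    by (rule bounded_linear_compose[OF bounded_linear_mult_left bounded_linear_compose[OF bounded_linear_mult_right D_lin[OF l]]])
   then show ?thesis by (intro closed_cp_eq[OF \<Phi> \<Phi>1]) (simp_all add: continuous_on_const)
  qed
  moreover have "{b. D b l : N} = (\<Inter>c. \<Inter>z\<in>B. {b. \<Phi> (c * D b l * z) = 0\<^sub>m d d})" unfolding N_def by blast
  ultimately show ?thesis by (auto intro!: closed_INT)
 qed
 then have cl: "closed (\<Inter>l\<in>{..<n}. {b. D b l : N})" by (auto intro!: closed_INT)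
 have "T = B \<inter> (\<Inter>l\<in>{..<n}. {b. D b l : N}) \<inter> star -` (\<Inter>l\<in>{..<n}. {b. D b l : N})"
  by (auto simp: T_def)
 then have Tcl: "closed T"
  using closed_Int[OF closed_Int[OF B_props(11) cl] closed_vimage[OF cl bounded_linear.continuous_on[OF bounded_linear_star continuous_on_id]]]
  by (simp only:)
 have T1: "1 : T"
 proof -
  have "(\<Sum>j<n. scaleC (\<pi> 1 $$ (j, l)) (v ^ j * P)) = (\<Sum>j<n. if j = l then v ^ l * P else 0)" if "l < n" for l
   by (rule sum.cong[OF refl]) (use that in \<open>auto simp: \<pi>(2)\<close>)
  then have "D 1 l = 0" if "l < n" for l using that by (simp add: D_def)
  then show ?thesis by (simp add: T_def B_props(1) N_0)
 qed
 have Tmult: "a * b : T" if "a : T" "b : T" for a b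
 proof -
  have ab: "a : B" "b : B" "star a : B" "star b : B"
   and n: "!!l. l < n ==> D a l : N" "!!l. l < n ==> D b l : N" "!!l. l < n ==> D (star a) l : N" "!!l. l < n ==> D (star b) l : N"
   using that B_props(8) unfolding T_def by blast+
  have "D (a * b) l : N" if "l < n" for l
   unfolding D_mult[OF that ab(2)] by (intro N_add N_left N_sum N_sc n that) simp
  moreover have "D (star (a * b)) l : N" if "l < n" for l
   unfolding star_mult D_mult[OF that ab(3)] by (intro N_add N_left N_sum N_sc n that) simp
  ultimately show ?thesis unfolding T_def using B_props(5)[OF ab(1,2)] by blast
 qed
 have Tadd: "a + b : T" if "a : T" "b : T" for a b
  using that B_props(3)[of a b] by (simp add: T_def star_add D_add N_add)
 have Tsc: "scaleC t a : T" if "a : T" for t a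
  using that B_props(6)[of a t] by (simp add: T_def star_scaleC D_sc N_sc)
 have Tstar: "star a : T" if "a : T" for a
  using that B_props(8)[of a] by (simp add: T_def star_star)
 have T: "cstar_subalgebra T"
  unfolding cstar_subalgebra_def operator_system_def
  by (intro conjI ballI allI) (rule T1 Tadd Tsc Tstar Tmult Tcl; assumption)+
 have U: "unitary_mat n (\<pi> u)" "unitary_mat n (\<pi> v)" by (simp_all add: \<pi>(3,4) clock_unitary shift_unitary)
 have "u : T" "v : T"
  unfolding T_def using uv_B Du Dv Dunit[OF u(1) U(1) Du] Dunit[OF v(1) U(2) Dv] by simp_all
 with B_least[OF T] have "B <= T" by blast
 then have DN: "D b l : N" if "b : B" "l < n" for b l using that unfolding T_def by blast
 have PP: "star P * P - P : N"
 proof -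
  have eq: "star u * P - P = scaleC (-1) (star u * (u * P - P))"
   by (simp only: scaleC_minus_one right_diff_distrib u mult.assoc[symmetric] mult_1_left minus_diff_eq)
  have s1: "star u * P - P : N" unfolding eq by (intro N_sc N_left uP)
  have su: "star u ^ a * P - P : N" for a
  proof (induction a)
   case (Suc a)
   have eq: "star u ^ Suc a * P - P = star u * (star u ^ a * P - P) + (star u * P - P)"
    by (simp add: right_diff_distrib mult.assoc)
   show ?case unfolding eq by (intro N_add N_left Suc s1)
  qed (simp add: N_0)
  have "star P * P - P = scaleC (1 / of_nat n) (\<Sum>a<n. star u ^ a * P - P)"
  proof -
   have "(\<Sum>a<n. P) = scaleC (of_nat n) P" using scaleC_sum_left[of "%_. 1" "{..<n}" P] by simp
   then have "scaleC (1 / of_nat n) (\<Sum>a<n. P) = P" using q_simps(1) by (simp add: scaleC_scaleC)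
   then show ?thesis
    by (simp add: P_def star_root_average sum_subtractf scaleC_diff_right mult_scaleC_left sum_distrib_right)
  qed
  then show ?thesis by (simp add: N_sc N_sum su)
 qed
 have conjP: "v ^ l * P * star (v ^ l) = root_average n u (q ^ l)" for l
 proof -
  have uv': "u ^ a * v ^ l = scaleC ((q ^ l) ^ a) (v ^ l * u ^ a)" for a
  proof (induction a)
   case (Suc a)
   have "u ^ Suc a * v ^ l = u * (u ^ a * v ^ l)" by (simp only: power_Suc mult.assoc)
   also have "... = scaleC ((q ^ l) ^ a) (u * v ^ l * u ^ a)" unfolding Suc by (simp only: mult_scaleC_right mult.assoc)
   also have "... = scaleC ((q ^ l) ^ a * q ^ l) (v ^ l * (u * u ^ a))"
    by (simp only: u_vpow mult_scaleC_left scaleC_scaleC mult.assoc)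
   also have "... = scaleC ((q ^ l) ^ Suc a) (v ^ l * u ^ Suc a)" by (simp only: power_Suc2[of "q ^ l"] power_Suc[of u])
   finally show ?case .
  qed simp
  have ql: "cnj (q ^ l) ^ a * (q ^ l) ^ a = 1" for a
   by (simp only: power_mult_distrib[symmetric] complex_cnj_power q_simps(5) power_one)
  have "v ^ l * u ^ a * star (v ^ l) = scaleC (cnj (q ^ l) ^ a) (u ^ a)" for a
  proof -
   have "v ^ l * u ^ a = scaleC (cnj (q ^ l) ^ a) (u ^ a * v ^ l)" by (simp only: uv' scaleC_scaleC ql scaleC_one)
   then show ?thesis by (simp only: mult_scaleC_left mult.assoc unitary_power'[OF v(2)] mult_1_right)
  qed
  then show ?thesis
   by (simp add: P_def root_average_def mult_scaleC_left mult_scaleC_right sum_distrib_left sum_distrib_right)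
 qed
 define E where "E j l = v ^ j * (star P * P) * star (v ^ l)" for j l
 have exp: "\<Phi> b $$ (s, r) = (\<Sum>j<n. \<Sum>l<n. \<pi> b $$ (j, l) * \<Phi> (E j l) $$ (s, r))"
  if b: "b : B" and sr: "s < d" "r < d" for b s r
 proof -
  let ?F = "%x. \<Phi> x $$ (s, r)"
  have Fdiff: "?F (x - y) = ?F x - ?F y" for x y
  proof -
   have "?F x = ?F (x - y) + ?F y" using cp_add[OF \<Phi>, of "x - y" y] sr cp_dim[OF \<Phi>] by simp
   then show ?thesis by simp
  qed
  have Fsc: "?F (scaleC t x) = t * ?F x" for t x using sr by (simp add: cp_scaleC[OF \<Phi>] cp_dim[OF \<Phi>])
  have FN: "?F (x * z) = 0" if "x : N" "z : B" for x z
  proof -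
   have "\<Phi> (1 * x * z) = 0\<^sub>m d d" using that unfolding N_def by blast
   then show ?thesis using sr by simp
  qed
  have vB: "star (v ^ l) : B" for l by (intro B_props uv_B)
  have 1: "?F (b * v ^ l * P * star (v ^ l)) = (\<Sum>j<n. \<pi> b $$ (j, l) * ?F (v ^ j * P * star (v ^ l)))" if "l < n" for l
  proof -
   have "0 = ?F (D b l * star (v ^ l))" using FN[OF DN[OF b that] vB] by simp
   also have "... = ?F (b * v ^ l * P * star (v ^ l)) - (\<Sum>j<n. \<pi> b $$ (j, l) * ?F (v ^ j * P * star (v ^ l)))"
    by (simp add: D_def left_diff_distrib sum_distrib_right mult_scaleC_left Fdiff cp_index_sum[OF \<Phi> sr] Fsc)
   finally show ?thesis by simp
  qed
  have 2: "?F (v ^ j * P * star (v ^ l)) = ?F (E j l)" for j l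
   using FN[OF N_left[OF PP, of "v ^ j"] vB[of l]] by (simp add: E_def left_diff_distrib right_diff_distrib Fdiff)
  have "b = b * (\<Sum>l<n. v ^ l * P * star (v ^ l))" by (simp add: conjP root_average_sum[OF q])
  also have "... = (\<Sum>l<n. b * v ^ l * P * star (v ^ l))" by (simp add: sum_distrib_left mult.assoc)
  finally have "?F b = (\<Sum>l<n. ?F (b * v ^ l * P * star (v ^ l)))"
   using cp_index_sum[OF \<Phi> sr, of "%l. b * v ^ l * P * star (v ^ l)" "{..<n}"] by simp
  also have "... = (\<Sum>l<n. \<Sum>j<n. \<pi> b $$ (j, l) * ?F (E j l))" by (rule sum.cong[OF refl]) (simp add: 1 2)
  also have "... = (\<Sum>j<n. \<Sum>l<n. \<pi> b $$ (j, l) * ?F (E j l))" by (rule sum.swap)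
  finally show ?thesis .
 qed
 let ?I = "{..<n} \<times> {..<d}"
 let ?G = "%(j, s) (l, r). \<Phi> (E j l) $$ (s, r)"
 have psd: "0 <= (\<Sum>i\<in>?I. \<Sum>j\<in>?I. cnj (x i) * ?G i j * x j)" for x
 proof -
  let ?\<xi> = "%l. vec d (%r. x (l, r))"
  let ?a = "%l. P * star (v ^ l)"
  have aa: "star (?a j) * ?a l = E j l" for j l by (simp add: E_def star_mult star_star mult.assoc)
  have "(\<Sum>i\<in>?I. \<Sum>j\<in>?I. cnj (x i) * ?G i j * x j) =
    (\<Sum>j<n. \<Sum>s<d. \<Sum>l<n. \<Sum>r<d. cnj (x (j, s)) * \<Phi> (E j l) $$ (s, r) * x (l, r))"
   by (simp add: sum.cartesian_product')
  also have "... = (\<Sum>j<n. \<Sum>l<n. \<Sum>s<d. \<Sum>r<d. cnj (x (j, s)) * \<Phi> (E j l) $$ (s, r) * x (l, r))"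
   by (rule sum.cong[OF refl], rule sum.swap)
  also have "... = (\<Sum>j<n. \<Sum>l<n. (\<Phi> (E j l) *\<^sub>v ?\<xi> l) \<bullet>c ?\<xi> j)"
   by (intro sum.cong refl) (simp add: form_expand[OF C] mult_ac)
  also have "... = (\<Sum>j<n. \<Sum>l<n. (\<Phi> (star (?a j) * ?a l) *\<^sub>v ?\<xi> l) \<bullet>c ?\<xi> j)" unfolding aa ..
  also have "0 <= ..." by (rule cp_pos[OF \<Phi>]) simp
  finally show ?thesis .
 qed
 obtain r :: nat and g h where g: "\<forall>i\<in>?I. \<forall>j\<in>?I. ?G i j = (\<Sum>t<r. cnj (g t i) * g t j)"
  using psd_factor[of ?I ?G, OF _ psd] by auto
 show ?thesis
 proof (rule that[of r "%t. mat n d (g t)"])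
  show "mat n d (g t) : carrier_mat n d" for t by simp
  fix b assume b: "b : B"
  show "\<Phi> b = mat_sum d r (%t. adj (mat n d (g t)) * \<pi> b * mat n d (g t))"
  proof (rule eq_matI)
   fix s s' assume "s < dim_row (mat_sum d r (%t. adj (mat n d (g t)) * \<pi> b * mat n d (g t)))"
    "s' < dim_col (mat_sum d r (%t. adj (mat n d (g t)) * \<pi> b * mat n d (g t)))"
   then have s: "s < d" "s' < d" by (auto simp: mat_sum_def)
   have "\<Phi> b $$ (s, s') = (\<Sum>j<n. \<Sum>l<n. \<pi> b $$ (j, l) * (\<Sum>t<r. cnj (g t (j, s)) * g t (l, s')))"
    unfolding exp[OF b s] using g s by (intro sum.cong refl) auto
   also have "... = (\<Sum>j<n. \<Sum>l<n. \<Sum>t<r. cnj (g t (j, s)) * \<pi> b $$ (j, l) * g t (l, s'))"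
    by (simp add: sum_distrib_left mult_ac)
   also have "... = (\<Sum>j<n. \<Sum>t<r. \<Sum>l<n. cnj (g t (j, s)) * \<pi> b $$ (j, l) * g t (l, s'))"
    by (rule sum.cong[OF refl], rule sum.swap)
   also have "... = (\<Sum>t<r. \<Sum>j<n. \<Sum>l<n. cnj (g t (j, s)) * \<pi> b $$ (j, l) * g t (l, s'))" by (rule sum.swap)
   also have "... = mat_sum d r (%t. adj (mat n d (g t)) * \<pi> b * mat n d (g t)) $$ (s, s')"
   proof -
    have "(adj (mat n d (g t)) * \<pi> b * mat n d (g t)) $$ (s, s') =
      (\<Sum>j<n. \<Sum>l<n. cnj (mat n d (g t) $$ (j, s)) * \<pi> b $$ (j, l) * mat n d (g t) $$ (l, s'))" for t
     by (rule conj_index[OF Cp _ s]) simp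
    also have "(\<Sum>j<n. \<Sum>l<n. cnj (mat n d (g t) $$ (j, s)) * \<pi> b $$ (j, l) * mat n d (g t) $$ (l, s')) =
      (\<Sum>j<n. \<Sum>l<n. cnj (g t (j, s)) * \<pi> b $$ (j, l) * g t (l, s'))" for t
     using s by (intro sum.cong refl) simp
    finally show ?thesis by (simp only: mat_sum_index[OF s])
   qed
   finally show "\<Phi> b $$ (s, s') = mat_sum d r (%t. adj (mat n d (g t)) * \<pi> b * mat n d (g t)) $$ (s, s')" .
  qed (auto simp: mat_sum_def cp_dim[OF \<Phi>])
 qed
qed

end

section \<open>Matrix extreme points are compressions of the standard representations\<close>

lemma unimodular_root:
 assumes "cmod l = 1" "0 < (n::nat)"
 obtains z where "z ^ n = l" "cmod z = 1"
proof
 have l: "l = cis (Arg l)" using rcis_cmod_Arg[of l] assms(1) by (simp add: rcis_def)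
 show "cis (Arg l / n) ^ n = l" using assms(2) by (subst (2) l) (simp add: DeMoivre)
qed simp

lemma isometry_dim:
 fixes V :: "complex mat"
 assumes "V : carrier_mat n d" "adj V * V = 1\<^sub>m d"
 shows "d <= n"
 by (rule isometry_completion[OF assms]) simp

context rotation_pair
begin

definition standard_rep :: "('a => complex mat) => bool" where
 "standard_rep \<pi> \<longleftrightarrow> cp_map n \<pi> & \<pi> 1 = 1\<^sub>m n \<and>
   (EX l m. cmod l = 1 & cmod m = 1 & \<pi> u = l \<cdot>\<^sub>m clock_mat & \<pi> v = m \<cdot>\<^sub>m shift_mat)"

text \<open>Dividing \<open>u\<close> and \<open>v\<close> by \<open>n\<close>-th roots of the values of \<open>u\<^sup>n\<close> and \<open>v\<^sup>n\<close> changes neither the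
  commutation relation nor the operator system, and reduces everything to the values \<open>1\<close>.\<close>

lemma rescaled_pair:
 assumes "cmod l = 1" "cmod m = 1"
 shows "rotation_pair (scaleC (cnj l) u) (scaleC (cnj m) v) q n"
  "generated_operator_system {scaleC (cnj l) u, scaleC (cnj m) v} = S"
proof -
 have l: "cnj l * l = 1" "l * cnj l = 1" and m: "cnj m * m = 1" "m * cnj m = 1"
  using assms by (simp_all add: complex_norm_square[symmetric] mult.commute[of "cnj _"])
 show "rotation_pair (scaleC (cnj l) u) (scaleC (cnj m) v) q n"
  by (unfold_locales)
   (simp_all add: q star_scaleC mult_scaleC_left mult_scaleC_right scaleC_scaleC u v l m uv mult_ac)
 let ?S' = "generated_operator_system {scaleC (cnj l) u, scaleC (cnj m) v}"
 have S': "operator_system ?S'" by (rule operator_system_generated)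
 have "?S' <= S" by (rule generated_operator_system_least[OF S_os]) (use uv_S S_props(5) in auto)
 moreover have in': "scaleC (cnj l) u : ?S'" "scaleC (cnj m) v : ?S'"
  using generated_operator_system_incl[of "{scaleC (cnj l) u, scaleC (cnj m) v}"] by auto
 then have "u : ?S'" "v : ?S'"
  using operator_systemD(5)[OF S' in'(1), of l] operator_systemD(5)[OF S' in'(2), of m]
  by (simp_all add: scaleC_scaleC l m)
 then have "S <= ?S'" by (rule S_least[OF S'])
 ultimately show "?S' = S" by blast
qed

theorem kraus_standard:
 assumes \<Phi>: "cp_map d \<Phi>" "\<Phi> 1 = 1\<^sub>m d" "0 < d" and l: "cmod l = 1" "cmod \<mu> = 1"
  and z: "!!p. p < d ==> \<Phi> (gp l \<mu>) $$ (p, p) = 0"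
 obtains \<pi> and r :: nat and \<gamma> where "standard_rep \<pi>" "!!t. t < r ==> \<gamma> t : carrier_mat n d"
  "!!b. b : B ==> \<Phi> b = mat_sum d r (%t. adj (\<gamma> t) * \<pi> b * \<gamma> t)"
proof -
 obtain l0 where l0: "l0 ^ n = l" "cmod l0 = 1" by (rule unimodular_root[OF l(1) q_simps(1)])
 obtain m0 where m0: "m0 ^ n = \<mu>" "cmod m0 = 1" by (rule unimodular_root[OF l(2) q_simps(1)])
 let ?u = "scaleC (cnj l0) u" and ?v = "scaleC (cnj m0) v"
 interpret r: rotation_pair ?u ?v q n by (rule rescaled_pair(1)[OF l0(2) m0(2)])
 have un: "l0 * cnj l0 = 1" "m0 * cnj m0 = 1" "cnj l * l = 1" "cnj \<mu> * \<mu> = 1" "l * cnj l = 1" "\<mu> * cnj \<mu> = 1"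
  using l0(2) m0(2) l by (simp_all add: complex_norm_square[symmetric] mult.commute[of "cnj _"])
 have pw: "scaleC t w ^ k = scaleC (t ^ k) (w ^ k)" for t k and w :: 'a
  by (induction k) (simp_all add: mult_scaleC_left mult_scaleC_right scaleC_scaleC mult.commute)
 have "cnj l0 ^ n = cnj l" "cnj m0 ^ n = cnj \<mu>" using l0(1) m0(1) by (simp_all flip: complex_cnj_power)
 then have "c * (?u ^ n - 1) = scaleC (cnj l) c * (u ^ n - scaleC l 1)" "c * (?v ^ n - 1) = scaleC (cnj \<mu>) c * (v ^ n - scaleC \<mu> 1)" for c
  by (simp_all add: pw mult_scaleC_left mult_scaleC_right right_diff_distrib scaleC_diff_right scaleC_scaleC un)
 then have van: "\<Phi> (c * (?u ^ n - 1)) = 0\<^sub>m d d" "\<Phi> (c * (?v ^ n - 1)) = 0\<^sub>m d d" for c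
  using vanishing_gap[OF \<Phi>(1) z] by simp_all
 obtain \<pi> where \<pi>: "cp_map n \<pi>" "\<pi> 1 = 1\<^sub>m n" "\<pi> ?u = r.clock_mat" "\<pi> ?v = r.shift_mat"
  by (rule r.standard_representation_exists[OF \<Phi> van])
 obtain r :: nat and \<gamma> where \<gamma>: "!!t. t < r ==> \<gamma> t : carrier_mat n d"
  "!!b. b : r.B ==> \<Phi> b = mat_sum d r (%t. adj (\<gamma> t) * \<pi> b * \<gamma> t)"
  by (rule r.kraus_decomposition[OF \<Phi>(1,2) van \<pi>]; (assumption | (rule that; (assumption | simp))))
 have "u = scaleC l0 ?u" "v = scaleC m0 ?v" by (simp_all add: scaleC_scaleC un)
 then have "\<pi> u = l0 \<cdot>\<^sub>m r.clock_mat" "\<pi> v = m0 \<cdot>\<^sub>m r.shift_mat" using cp_scaleC[OF \<pi>(1)] \<pi>(3,4) by metis+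
 moreover have "r.clock_mat = clock_mat" "r.shift_mat = shift_mat" by (simp_all only: r.clock_mat_def r.shift_mat_def clock_mat_def shift_mat_def)
 ultimately have "standard_rep \<pi>" unfolding standard_rep_def using \<pi>(1,2) l0(2) m0(2) by metis
 then show ?thesis by (rule that[OF _ \<gamma>]) (simp_all add: rescaled_pair(2)[OF l0(2) m0(2)])
qed

text \<open>By extremality each nonzero Kraus summand is already the whole map, up to an invertible
  conjugation.\<close>

theorem extreme_point_is_compression:
 assumes \<phi>: "\<phi> : matrix_extreme_points S d"
 obtains \<pi> \<delta> where "standard_rep \<pi>" "\<delta> : carrier_mat n d" "adj \<delta> * \<delta> = 1\<^sub>m d"
  "!!x. x : S ==> \<phi> x = adj \<delta> * \<pi> x * \<delta>"
proof -
 have ucp: "\<phi> : ucp S d" using \<phi> by (simp add: matrix_extreme_points_def)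
 note d = ucpD(1)[OF ucp]
 obtain l \<mu> \<Phi> where l: "cmod l = 1" "cmod \<mu> = 1" and \<Phi>: "cp_map d \<Phi>" "!!x. x : S ==> \<Phi> x = \<phi> x"
  and z: "!!p. p < d ==> \<Phi> (gp l \<mu>) $$ (p, p) = 0"
  by (rule extreme_point_extension[OF S_os S_B \<phi>]; (assumption | (rule that; (assumption | simp))))
 have \<Phi>1: "\<Phi> 1 = 1\<^sub>m d" using \<Phi>(2)[OF S_props(1)] ucpD(6)[OF ucp] by simp
 obtain \<pi> and r :: nat and \<gamma> where \<pi>: "standard_rep \<pi>" and \<gamma>: "!!t. t < r ==> \<gamma> t : carrier_mat n d"
  and kr: "!!b. b : B ==> \<Phi> b = mat_sum d r (%t. adj (\<gamma> t) * \<pi> b * \<gamma> t)"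
  by (rule kraus_standard[OF \<Phi>(1) \<Phi>1 d l z]; (assumption | (rule that; (assumption | simp))))
 have cp: "cp_map n \<pi>" and p1: "\<pi> 1 = 1\<^sub>m n" using \<pi> by (simp_all add: standard_rep_def)
 let ?F = "%t x. adj (\<gamma> t) * \<pi> x * \<gamma> t"
 have "EX t<r. ?F t 1 ~= 0\<^sub>m d d"
 proof (rule ccontr)
  assume "\<not> ?thesis"
  then have "(\<Sum>t<r. ?F t 1 $$ (0, 0)) = 0" using d by simp
  then have "\<Phi> 1 $$ (0, 0) = 0" using d by (simp add: kr[OF B_props(1)] mat_sum_def)
  then show False using d by (simp add: \<Phi>1)
 qed
 then obtain t0 where t0: "t0 < r" "?F t0 1 ~= 0\<^sub>m d d" by blast
 define \<gamma>' where "\<gamma>' t = (if t = t0 then 0\<^sub>m n d else \<gamma> t)" for t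
 have \<gamma>': "\<gamma>' t : carrier_mat n d" if "t < r" for t using \<gamma>[OF that] by (simp add: \<gamma>'_def)
 let ?F' = "%t x. adj (\<gamma>' t) * \<pi> x * \<gamma>' t"
 have c1: "cp_map d (?F t0)" by (rule cp_map_conj[OF cp \<gamma>[OF t0(1)]])
 have c2: "cp_map d (%x. mat_sum d r (%t. ?F' t x))" by (rule cp_map_mat_sum[OF cp_map_conj[OF cp \<gamma>']])
 have sum: "\<phi> x = ?F t0 x + mat_sum d r (%t. ?F' t x)" if x: "x : S" for x
 proof (rule eq_matI)
  fix i j assume "i < dim_row (?F t0 x + mat_sum d r (%t. ?F' t x))" "j < dim_col (?F t0 x + mat_sum d r (%t. ?F' t x))"
  then have ij: "i < d" "j < d" by (simp_all add: mat_sum_def)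
  have z0: "?F' t0 x $$ (i, j) = 0"
   using ij by (simp add: conj_index[OF cp_carrier[OF cp] \<gamma>'[OF t0(1)]]) (simp add: \<gamma>'_def)
  have "\<phi> x $$ (i, j) = (\<Sum>t<r. ?F t x $$ (i, j))"
   using kr[of x] \<Phi>(2)[OF x] S_B x ij by (auto simp: mat_sum_def)
  also have "... = ?F t0 x $$ (i, j) + (\<Sum>t\<in>{..<r} - {t0}. ?F t x $$ (i, j))"
   by (rule sum.remove) (use t0 in auto)
  also have "(\<Sum>t\<in>{..<r} - {t0}. ?F t x $$ (i, j)) = (\<Sum>t\<in>{..<r} - {t0}. ?F' t x $$ (i, j))"
   by (rule sum.cong[OF refl]) (simp add: \<gamma>'_def)
  also have "... = (\<Sum>t<r. ?F' t x $$ (i, j))" using t0(1) z0 by (simp add: sum.remove[of "{..<r}" t0])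
  finally show "\<phi> x $$ (i, j) = (?F t0 x + mat_sum d r (%t. ?F' t x)) $$ (i, j)"
   using ij by (simp add: mat_sum_def)
 qed (use ucpD(3)[OF ucp x] in \<open>auto simp: mat_sum_def\<close>)
 obtain g h where g: "g : carrier_mat d d" and h: "h : carrier_mat d d" and gh: "g * h = 1\<^sub>m d" "h * g = 1\<^sub>m d"
  and gp: "!!x. x : S ==> ?F t0 x = adj g * \<phi> x * g"
  by (rule matrix_extreme_summand[OF S_os \<phi> c1 c2 sum t0(2)]; (assumption | (rule that; (assumption | simp))))
 define \<delta> where "\<delta> = \<gamma> t0 * h"
 have \<gamma>0: "\<gamma> t0 : carrier_mat n d" by (rule \<gamma>[OF t0(1)])
 have \<delta>: "\<delta> : carrier_mat n d" unfolding \<delta>_def by (rule mult_carrier_mat[OF \<gamma>0 h])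
 have eq: "\<phi> x = adj \<delta> * \<pi> x * \<delta>" if x: "x : S" for x
 proof (rule mat_eq_formI)
  note px = ucpD(3)[OF ucp x]
  show "\<phi> x : carrier_mat d d" by (rule px)
  show "adj \<delta> * \<pi> x * \<delta> : carrier_mat d d" by (rule conj_carrier[OF cp_carrier[OF cp] \<delta>])
  fix a b :: "complex vec" assume a: "a : carrier_vec d" and b: "b : carrier_vec d"
  have ha: "h *\<^sub>v a : carrier_vec d" "h *\<^sub>v b : carrier_vec d" using h a b by auto
  have gha: "g *\<^sub>v (h *\<^sub>v c) = c" if "c : carrier_vec d" for c
   using assoc_mult_mat_vec[OF g h that] gh(1) that by simp
  have "((adj \<delta> * \<pi> x * \<delta>) *\<^sub>v a) \<bullet>c b = (\<pi> x *\<^sub>v (\<delta> *\<^sub>v a)) \<bullet>c (\<delta> *\<^sub>v b)"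
   by (rule conj_form[OF \<delta> cp_carrier[OF cp] a b])
  also have "... = (\<pi> x *\<^sub>v (\<gamma> t0 *\<^sub>v (h *\<^sub>v a))) \<bullet>c (\<gamma> t0 *\<^sub>v (h *\<^sub>v b))"
   unfolding \<delta>_def using assoc_mult_mat_vec[OF \<gamma>0 h a] assoc_mult_mat_vec[OF \<gamma>0 h b] by simp
  also have "... = (?F t0 x *\<^sub>v (h *\<^sub>v a)) \<bullet>c (h *\<^sub>v b)"
   by (rule conj_form[symmetric, OF \<gamma>0 cp_carrier[OF cp] ha])
  also have "... = (\<phi> x *\<^sub>v (g *\<^sub>v (h *\<^sub>v a))) \<bullet>c (g *\<^sub>v (h *\<^sub>v b))"
   unfolding gp[OF x] by (rule conj_form[OF g px ha])
  finally show "(\<phi> x *\<^sub>v a) \<bullet>c b = ((adj \<delta> * \<pi> x * \<delta>) *\<^sub>v a) \<bullet>c b" by (simp add: gha a b)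
 qed
 have "adj \<delta> * \<delta> = 1\<^sub>m d"
  using eq[OF S_props(1)] ucpD(6)[OF ucp] right_mult_one_mat[OF adjoint_carrier[OF \<delta>]] by (simp add: p1)
 then show ?thesis by (rule that[OF \<pi> \<delta> _ eq])
qed

lemma matrix_extreme_level: "\<phi> : matrix_extreme_points S d ==> d <= n"
 by (rule extreme_point_is_compression, assumption) (rule isometry_dim)

end

section \<open>Irreducible representations give absolute extreme points\<close>

text \<open>Padding a surjection with zero columns and a right inverse with zero rows would give mutually
  inverse square matrices, one of which has a zero row.\<close>

lemma surjective_mat_dim:
 fixes \<gamma> :: "complex mat"
 assumes \<gamma>: "\<gamma> : carrier_mat m n" and s: "surjective_mat \<gamma>"
 shows "m <= n"
proof (rule ccontr)
 assume "\<not> m <= n"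
 then have nm: "n < m" by simp
 have "EX w. w : carrier_vec n & \<gamma> *\<^sub>v w = unit_vec m j" for j
 proof -
  have "unit_vec m j : (%v. \<gamma> *\<^sub>v v) ` carrier_vec n" using s \<gamma> by (simp add: surjective_mat_def)
  then show ?thesis by auto
 qed
 then obtain w where w: "!!j. w j : carrier_vec n" "!!j. \<gamma> *\<^sub>v w j = unit_vec m j" by metis
 define e where "e = mat m m (%(i, j). if i < n then w j $ i else 0)"
 define g where "g = mat m m (%(i, j). if j < n then \<gamma> $$ (i, j) else 0)"
 have car: "e : carrier_mat m m" "g : carrier_mat m m" by (simp_all add: e_def g_def)
 have "g * e = 1\<^sub>m m"
 proof (rule eq_matI)
  fix i j assume "i < dim_row (1\<^sub>m m :: complex mat)" "j < dim_col (1\<^sub>m m :: complex mat)"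
  then have ij: "i < m" "j < m" by auto
  have "(g * e) $$ (i, j) = (\<Sum>k<m. (if k < n then \<gamma> $$ (i, k) else 0) * (if k < n then w j $ k else 0))"
   using ij by (simp add: e_def g_def scalar_prod_def atLeast0LessThan)
  also have "... = (\<Sum>k<n. \<gamma> $$ (i, k) * w j $ k)" by (rule sum.mono_neutral_cong_right) (use nm in auto)
  also have "... = (\<gamma> *\<^sub>v w j) $ i" using \<gamma> w(1)[of j] ij by (simp add: scalar_prod_def atLeast0LessThan)
  finally show "(g * e) $$ (i, j) = 1\<^sub>m m $$ (i, j)" using ij by (simp add: w(2))
 qed (simp_all add: e_def g_def)
 then have "e * g = 1\<^sub>m m" by (rule mat_mult_left_right_inverse[OF car(2,1)])
 then have "(e * g) $$ (m - 1, m - 1) = 1" using nm by simp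
 moreover have "(e * g) $$ (m - 1, m - 1) = 0" using nm by (auto simp: e_def g_def scalar_prod_def intro!: sum.neutral)
 ultimately show False by simp
qed

lemma mat_mult_zero_vec: "A : carrier_mat n m ==> A *\<^sub>v 0\<^sub>v m = (0\<^sub>v n :: complex vec)"
 by (intro eq_vecI) auto

lemma unitary_of_isometry: "V : carrier_mat d d ==> adj V * V = 1\<^sub>m d ==> unitary_mat d V"
 using mat_mult_left_right_inverse[OF adjoint_carrier, of V d V] by (simp add: unitary_mat_def)

lemma smult_conj:
 fixes A g :: "complex mat"
 assumes A: "A : carrier_mat m m" and g: "g : carrier_mat m n"
 shows "adj (c \<cdot>\<^sub>m g) * A * (c \<cdot>\<^sub>m g) = (cnj c * c) \<cdot>\<^sub>m (adj g * A * g)"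
proof (rule eq_matI)
 have g': "c \<cdot>\<^sub>m g : carrier_mat m n" using g by simp
 fix i j assume "i < dim_row ((cnj c * c) \<cdot>\<^sub>m (adj g * A * g))" "j < dim_col ((cnj c * c) \<cdot>\<^sub>m (adj g * A * g))"
 then have ij: "i < n" "j < n" using g by auto
 have "(adj (c \<cdot>\<^sub>m g) * A * (c \<cdot>\<^sub>m g)) $$ (i, j) = (\<Sum>a<m. \<Sum>b<m. cnj ((c \<cdot>\<^sub>m g) $$ (a, i)) * A $$ (a, b) * (c \<cdot>\<^sub>m g) $$ (b, j))"
  by (rule conj_index[OF A g' ij])
 also have "... = (\<Sum>a<m. \<Sum>b<m. (cnj c * c) * (cnj (g $$ (a, i)) * A $$ (a, b) * g $$ (b, j)))"
  using g ij by (intro sum.cong refl) (simp add: mult_ac)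
 also have "... = (cnj c * c) * (adj g * A * g) $$ (i, j)"
  by (simp only: conj_index[OF A g ij] sum_distrib_left)
 finally show "(adj (c \<cdot>\<^sub>m g) * A * (c \<cdot>\<^sub>m g)) $$ (i, j) = ((cnj c * c) \<cdot>\<^sub>m (adj g * A * g)) $$ (i, j)"
  using ij g by simp
qed (use g in auto)

lemma smult_inverse_mat:
 assumes "k * t = (1::complex)"
 shows "k \<cdot>\<^sub>m (t \<cdot>\<^sub>m A) = A"
proof -
 have "k * (t * z) = z" for z using assms by (simp only: mult.assoc[symmetric] mult_1_left)
 then show ?thesis by (intro eq_matI) auto
qed

lemma gram_isometry:
 fixes \<gamma> :: "complex mat"
 assumes \<gamma>: "\<gamma> : carrier_mat m d" and t: "adj \<gamma> * \<gamma> = t \<cdot>\<^sub>m 1\<^sub>m d" and nz: "\<gamma> ~= 0\<^sub>m m d"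
 obtains c where "cnj c * c * t = 1" "adj (c \<cdot>\<^sub>m \<gamma>) * (c \<cdot>\<^sub>m \<gamma>) = 1\<^sub>m d"
proof -
 obtain i j where ij: "i < m" "j < d" "\<gamma> $$ (i, j) ~= 0"
 proof (rule ccontr)
  assume "\<not> thesis"
  then have "\<gamma> = 0\<^sub>m m d" using \<gamma> that by (intro eq_matI) auto
  then show False using nz by simp
 qed
 let ?y = "\<gamma> *\<^sub>v unit_vec d j"
 have y: "?y : carrier_vec m" using \<gamma> by auto
 have "t = ((t \<cdot>\<^sub>m 1\<^sub>m d) *\<^sub>v unit_vec d j) \<bullet>c unit_vec d j" using form_unit[of "t \<cdot>\<^sub>m 1\<^sub>m d" d d j j] ij by simp
 also have "... = ?y \<bullet>c ?y" unfolding t[symmetric] by (rule gram_form[OF \<gamma>]) simp_all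
 also have "... = complex_of_real (\<Sum>i<m. (cmod (?y $ i))\<^sup>2)" by (simp only: cscalar_self carrier_vecD[OF y])
 finally have tr: "t = complex_of_real (\<Sum>i<m. (cmod (?y $ i))\<^sup>2)" .
 have "?y $ i = \<gamma> $$ (i, j)" using \<gamma> ij by simp
 then have "0 < (\<Sum>i<m. (cmod (?y $ i))\<^sup>2)"
  using ij by (intro sum_pos2[of _ i]) auto
 then obtain s where s: "0 < s" "t = complex_of_real s" using tr by blast
 define c where "c = complex_of_real (1 / sqrt s)"
 have "cnj c * c * t = complex_of_real (1 / sqrt s * (1 / sqrt s) * s)" by (simp only: c_def s(2) complex_cnj_complex_of_real of_real_mult)
 also have "1 / sqrt s * (1 / sqrt s) * s = 1" using s(1) by simp
 finally have c: "cnj c * c * t = 1" by simp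
 have "adj (c \<cdot>\<^sub>m \<gamma>) * (c \<cdot>\<^sub>m \<gamma>) = adj (c \<cdot>\<^sub>m \<gamma>) * 1\<^sub>m m * (c \<cdot>\<^sub>m \<gamma>)"
  using right_mult_one_mat[of "adj (c \<cdot>\<^sub>m \<gamma>)" d m] \<gamma> by simp
 also have "... = (cnj c * c) \<cdot>\<^sub>m (adj \<gamma> * 1\<^sub>m m * \<gamma>)" by (rule smult_conj[OF one_carrier_mat \<gamma>])
 also have "adj \<gamma> * 1\<^sub>m m * \<gamma> = t \<cdot>\<^sub>m 1\<^sub>m d" using right_mult_one_mat[of "adj \<gamma>" d m] \<gamma> t by simp
 finally have "adj (c \<cdot>\<^sub>m \<gamma>) * (c \<cdot>\<^sub>m \<gamma>) = 1\<^sub>m d" by (simp only: smult_inverse_mat[OF c])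
 with c show ?thesis by (rule that)
qed

lemma scalar_gram_equivalence:
 assumes \<psi>: "!!x. x : S ==> \<psi> x : carrier_mat m m" and \<gamma>: "\<gamma> : carrier_mat m d" and nz: "\<gamma> ~= 0\<^sub>m m d"
  and m: "m <= d" and t: "adj \<gamma> * \<gamma> = t \<cdot>\<^sub>m 1\<^sub>m d"
  and c: "!!x. x : S ==> adj \<gamma> * \<psi> x * \<gamma> = t \<cdot>\<^sub>m \<phi> x"
 shows "m = d & unitarily_equivalent S d \<phi> \<psi>"
proof -
 obtain c where c': "cnj c * c * t = 1" and V: "adj (c \<cdot>\<^sub>m \<gamma>) * (c \<cdot>\<^sub>m \<gamma>) = 1\<^sub>m d"
  by (rule gram_isometry[OF \<gamma> t nz])
 have cg: "c \<cdot>\<^sub>m \<gamma> : carrier_mat m d" using \<gamma> by simp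
 have md: "m = d" using isometry_dim[OF cg V] m by simp
 have "adj (c \<cdot>\<^sub>m \<gamma>) * \<psi> x * (c \<cdot>\<^sub>m \<gamma>) = \<phi> x" if "x : S" for x
 proof -
  have "adj (c \<cdot>\<^sub>m \<gamma>) * \<psi> x * (c \<cdot>\<^sub>m \<gamma>) = (cnj c * c) \<cdot>\<^sub>m (t \<cdot>\<^sub>m \<phi> x)"
   by (simp only: smult_conj[OF \<psi>[OF that] \<gamma>] c[OF that])
  then show ?thesis by (simp only: smult_inverse_mat[OF c'])
 qed
 then show ?thesis unfolding unitarily_equivalent_def using unitary_of_isometry[of "c \<cdot>\<^sub>m \<gamma>" d] cg V md by metis
qed

text \<open>If \<open>\<phi>(a)\<close> preserves the norm of \<open>\<xi>\<close> for an isometry \<open>a\<close>, then equality holds in the Schwarz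
  inequality of every summand, and each of them carries \<open>\<gamma>\<^sub>i \<xi>\<close> to \<open>\<gamma>\<^sub>i \<phi>(a) \<xi>\<close>.\<close>

lemma combination_exchange:
 assumes cc: "matrix_convex_combination S d \<phi> r m \<psi> \<gamma>" and one: "1 : S" and \<phi>: "\<phi> a : carrier_mat d d"
  and \<Psi>: "!!i. i < r ==> cp_map (m i) (\<Psi> i)" "!!i x. i < r ==> x : S ==> \<Psi> i x = \<psi> i x"
  and a: "a : S" "star a * a = 1" and \<xi>: "\<xi> : carrier_vec d" and \<zeta>: "\<phi> a *\<^sub>v \<xi> = \<zeta>" "\<zeta> \<bullet>c \<zeta> = \<xi> \<bullet>c \<xi>"
  and i: "i < r"
 shows "\<Psi> i (c * a) *\<^sub>v (\<gamma> i *\<^sub>v \<xi>) = \<Psi> i c *\<^sub>v (\<gamma> i *\<^sub>v \<zeta>)"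
proof -
 have z: "\<zeta> : carrier_vec d" using mult_mat_vec_carrier[OF \<phi> \<xi>] \<zeta>(1) by simp
 have g: "\<gamma> i : carrier_mat (m i) d" and u: "\<psi> i : ucp S (m i)" if "i < r" for i
  using cc that by (auto simp: matrix_convex_combination_def)
 have P1: "\<Psi> i 1 = 1\<^sub>m (m i)" if "i < r" for i using \<Psi>(2)[OF that one] ucpD(6)[OF u[OF that]] by simp
 have gv: "\<gamma> i *\<^sub>v x : carrier_vec (m i)" if "i < r" for i x using g[OF that] by auto
 have gram: "(\<Sum>i<r. (\<gamma> i *\<^sub>v x) \<bullet>c (\<gamma> i *\<^sub>v y)) = x \<bullet>c y" if x: "x : carrier_vec d" and y: "y : carrier_vec d" for x y
 proof -
  have "(\<Sum>i<r. (\<gamma> i *\<^sub>v x) \<bullet>c (\<gamma> i *\<^sub>v y)) = (\<Sum>i<r. ((adj (\<gamma> i) * \<gamma> i) *\<^sub>v x) \<bullet>c y)"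
   by (rule sum.cong[OF refl]) (simp add: gram_form[OF g x y])
  also have "... = (mat_sum d r (%i. adj (\<gamma> i) * \<gamma> i) *\<^sub>v x) \<bullet>c y"
   by (rule mat_sum_form[symmetric]) (use g x y in \<open>auto intro: mult_carrier_mat[OF adjoint_carrier]\<close>)
  also have "mat_sum d r (%i. adj (\<gamma> i) * \<gamma> i) = 1\<^sub>m d" using cc by (simp add: matrix_convex_combination_def)
  finally show ?thesis using x by simp
 qed
 have mid: "(\<Sum>i<r. (\<Psi> i a *\<^sub>v (\<gamma> i *\<^sub>v \<xi>)) \<bullet>c (\<gamma> i *\<^sub>v \<zeta>)) = \<zeta> \<bullet>c \<zeta>"
 proof -
  have "(\<Sum>i<r. (\<Psi> i a *\<^sub>v (\<gamma> i *\<^sub>v \<xi>)) \<bullet>c (\<gamma> i *\<^sub>v \<zeta>)) = (\<Sum>i<r. ((adj (\<gamma> i) * \<psi> i a * \<gamma> i) *\<^sub>v \<xi>) \<bullet>c \<zeta>)"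
   by (rule sum.cong[OF refl]) (simp add: conj_form[OF g ucpD(3)[OF u a(1)] \<xi> z] \<Psi>(2) a)
  also have "... = (mat_sum d r (%i. adj (\<gamma> i) * \<psi> i a * \<gamma> i) *\<^sub>v \<xi>) \<bullet>c \<zeta>"
   by (rule mat_sum_form[symmetric]) (use \<xi> z conj_carrier[OF ucpD(3)[OF u a(1)] g] in auto)
  also have "mat_sum d r (%i. adj (\<gamma> i) * \<psi> i a * \<gamma> i) = \<phi> a" using cc a(1) by (simp add: matrix_convex_combination_def)
  finally show ?thesis using \<zeta>(1) by simp
 qed
 define D where "D i = (\<Psi> i (star a * a) *\<^sub>v (\<gamma> i *\<^sub>v \<xi>)) \<bullet>c (\<gamma> i *\<^sub>v \<xi>) - (\<Psi> i a *\<^sub>v (\<gamma> i *\<^sub>v \<xi>)) \<bullet>c (\<gamma> i *\<^sub>v \<zeta>)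
   - cnj ((\<Psi> i a *\<^sub>v (\<gamma> i *\<^sub>v \<xi>)) \<bullet>c (\<gamma> i *\<^sub>v \<zeta>)) + (\<Psi> i 1 *\<^sub>v (\<gamma> i *\<^sub>v \<zeta>)) \<bullet>c (\<gamma> i *\<^sub>v \<zeta>)" for i
 have D0: "0 <= D i" if "i < r" for i unfolding D_def by (rule cp_distance_nonneg[OF \<Psi>(1)[OF that] gv[OF that] gv[OF that]])
 have "(\<Sum>i<r. D i) = (\<Sum>i<r. (\<gamma> i *\<^sub>v \<xi>) \<bullet>c (\<gamma> i *\<^sub>v \<xi>) - (\<Psi> i a *\<^sub>v (\<gamma> i *\<^sub>v \<xi>)) \<bullet>c (\<gamma> i *\<^sub>v \<zeta>)
   - cnj ((\<Psi> i a *\<^sub>v (\<gamma> i *\<^sub>v \<xi>)) \<bullet>c (\<gamma> i *\<^sub>v \<zeta>)) + (\<gamma> i *\<^sub>v \<zeta>) \<bullet>c (\<gamma> i *\<^sub>v \<zeta>))"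
  by (rule sum.cong[OF refl]) (simp add: D_def a(2) P1 gv)
 also have "... = \<xi> \<bullet>c \<xi> - \<zeta> \<bullet>c \<zeta> - cnj (\<zeta> \<bullet>c \<zeta>) + \<zeta> \<bullet>c \<zeta>"
  using mid[symmetric] by (simp add: sum.distrib sum_subtractf gram \<xi> z)
 also have "... = 0" using \<zeta>(2) cscalar_commute[OF z z] by simp
 finally have "(\<Sum>i<r. D i) = 0" .
 then have "D i = 0" using sum_nonneg_eq_0_iff[of "{..<r}" D] D0 i by auto
 then show ?thesis unfolding D_def by (rule cp_exchange[OF \<Psi>(1)[OF i] gv[OF i] gv[OF i]])
qed

lemma surjective_mat_nonzero:
 fixes \<gamma> :: "complex mat"
 assumes s: "surjective_mat \<gamma>" and m: "0 < m"
 shows "\<gamma> ~= 0\<^sub>m m d"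
proof
 assume "\<gamma> = 0\<^sub>m m d"
 then have "unit_vec m 0 : (%v. 0\<^sub>m m d *\<^sub>v v :: complex vec) ` carrier_vec d"
  using s by (auto simp: surjective_mat_def)
 then obtain w :: "complex vec" where w: "w : carrier_vec d" "unit_vec m 0 = 0\<^sub>m m d *\<^sub>v w" by auto
 then have "unit_vec m 0 $ 0 = (0\<^sub>v m :: complex vec) $ 0" by (simp add: zero_mat_mult_vec)
 then show False using m by simp
qed

lemma absolute_extreme_is_extreme: "absolute_matrix_extreme_points S d <= matrix_extreme_points S d"
proof
 fix \<phi> assume \<phi>: "\<phi> : absolute_matrix_extreme_points S d"
 then have ucp: "\<phi> : ucp S d" by (simp add: absolute_matrix_extreme_points_def)
 have "m i = d & unitarily_equivalent S d \<phi> (\<psi> i)"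
  if cc: "matrix_convex_combination S d \<phi> r m \<psi> \<gamma>" and s: "ALL i<r. surjective_mat (\<gamma> i)" and i: "i < r" for r m \<psi> \<gamma> i
 proof -
  have c: "\<gamma> i : carrier_mat (m i) d" "0 < m i" if "i < r" for i
   using cc that ucpD(1) by (auto simp: matrix_convex_combination_def)
  have nz: "\<gamma> i ~= 0\<^sub>m (m i) d" if "i < r" for i
   by (rule surjective_mat_nonzero) (use s c(2) that in auto)
  have "m i <= d" using surjective_mat_dim[OF c(1)[OF i]] s i by blast
  then show ?thesis using \<phi> cc nz i unfolding absolute_matrix_extreme_points_def by blast
 qed
 then show "\<phi> : matrix_extreme_points S d" using ucp unfolding matrix_extreme_points_def by blast
qed

context rotation_pair
begin

text \<open>Irreducibility enters only through Schur's lemma for selfadjoint matrices.\<close>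

definition irrep :: "nat => ('a => complex mat) => bool" where
 "irrep d \<theta> \<longleftrightarrow> 0 < d & cp_map d \<theta> & \<theta> 1 = 1\<^sub>m d & unitary_mat d (\<theta> u) & unitary_mat d (\<theta> v) \<and>
   (\<forall>A\<in>carrier_mat d d. adj A = A --> A * \<theta> u = \<theta> u * A --> A * \<theta> v = \<theta> v * A -->
    (EX c. A = c \<cdot>\<^sub>m 1\<^sub>m d))"

lemma irrepD:
 assumes "irrep d \<theta>"
 shows "0 < d" "cp_map d \<theta>" "\<theta> 1 = 1\<^sub>m d" "unitary_mat d (\<theta> u)" "unitary_mat d (\<theta> v)"
  "!!A. A : carrier_mat d d ==> adj A = A ==> A * \<theta> u = \<theta> u * A ==> A * \<theta> v = \<theta> v * A ==>
    EX c. A = c \<cdot>\<^sub>m 1\<^sub>m d"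
 using assms unfolding irrep_def by blast+

lemma S_induct [consumes 1, case_names one u v add scale star]:
 assumes x: "x : S" and base: "P 1" "P u" "P v"
  and add: "!!x y. x : S ==> y : S ==> P x ==> P y ==> P (x + y)"
  and sc: "!!c x. x : S ==> P x ==> P (scaleC c x)" and st: "!!x. x : S ==> P x ==> P (star x)"
 shows "P x"
proof -
 have "operator_system {x : S. P x}"
  unfolding operator_system_def using base(1) add sc st S_props(1,3,5,7) by simp
 from S_least[OF this] uv_S base x show ?thesis by blast
qed

theorem irrep_intertwines:
 assumes \<theta>: "irrep d \<theta>" and cc: "matrix_convex_combination S d (restrict \<theta> S) r m \<psi> \<gamma>" and i: "i < r"
 obtains t where "adj (\<gamma> i) * \<gamma> i = t \<cdot>\<^sub>m 1\<^sub>m d" "!!x. x : S ==> \<psi> i x * \<gamma> i = \<gamma> i * \<theta> x"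
proof -
 note P = irrepD[OF \<theta>] and C = cp_carrier[OF irrepD(2)[OF \<theta>]]
 have g: "\<gamma> i : carrier_mat (m i) d" and uc: "\<psi> i : ucp S (m i)" if "i < r" for i
  using cc that by (auto simp: matrix_convex_combination_def)
 have "EX \<Psi>. cp_map (m i) \<Psi> & (\<forall>x\<in>S. \<Psi> x = \<psi> i x)" if "i < r" for i
  by (rule ucp_extension[OF S_os uc[OF that]]) blast
 then obtain \<Psi> where \<Psi>: "!!i. i < r ==> cp_map (m i) (\<Psi> i)" "!!i x. i < r ==> x : S ==> \<Psi> i x = \<psi> i x" by metis
 note g = g[OF i]
 note us = ucp_star[OF S_os uc[OF i]]
 note uc = ucpD[OF uc[OF i]]
 have ex: "\<psi> i w * \<gamma> i = \<gamma> i * \<theta> w" if w: "w : S" "star w * w = 1" and W: "unitary_mat d (\<theta> w)" for w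
 proof (rule mat_eq_vecI[of _ "m i" d])
  show "\<psi> i w * \<gamma> i : carrier_mat (m i) d" by (rule mult_carrier_mat[OF uc(3)[OF w(1)] g])
  show "\<gamma> i * \<theta> w : carrier_mat (m i) d" by (rule mult_carrier_mat[OF g C])
  fix x :: "complex vec" assume x: "x : carrier_vec d"
  have z: "\<theta> w *\<^sub>v x : carrier_vec d" by (rule cp_vec[OF P(2)])
  have zz: "(\<theta> w *\<^sub>v x) \<bullet>c (\<theta> w *\<^sub>v x) = x \<bullet>c x"
   using gram_form[OF C[of w] x x] W x by (simp add: unitary_mat_def)
  have "\<Psi> i (1 * w) *\<^sub>v (\<gamma> i *\<^sub>v x) = \<Psi> i 1 *\<^sub>v (\<gamma> i *\<^sub>v (\<theta> w *\<^sub>v x))"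
   by (rule combination_exchange[OF cc S_props(1) _ \<Psi> w x _ zz i]) (use w C in simp_all)
  then have "\<psi> i w *\<^sub>v (\<gamma> i *\<^sub>v x) = \<gamma> i *\<^sub>v (\<theta> w *\<^sub>v x)"
   using \<Psi>(2)[OF i] w(1) S_props(1) uc(6) mult_mat_vec_carrier[OF g z] by simp
  then show "(\<psi> i w * \<gamma> i) *\<^sub>v x = (\<gamma> i * \<theta> w) *\<^sub>v x"
   using assoc_mult_mat_vec[OF uc(3)[OF w(1)] g x] assoc_mult_mat_vec[OF g C x] by simp
 qed
 have us_adj: "unitary_mat d (\<theta> (star w))" if "unitary_mat d (\<theta> w)" for w
  using that by (simp add: unitary_mat_def cp_star[OF P(2)] C)
 have eu: "\<psi> i u * \<gamma> i = \<gamma> i * \<theta> u" "\<psi> i (star u) * \<gamma> i = \<gamma> i * \<theta> (star u)"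
  by (rule ex; simp add: uv_S S_props(7) u star_star P us_adj)+
 have ev: "\<psi> i v * \<gamma> i = \<gamma> i * \<theta> v" "\<psi> i (star v) * \<gamma> i = \<gamma> i * \<theta> (star v)"
  by (rule ex; simp add: uv_S S_props(7) v star_star P us_adj)+
 let ?G = "adj (\<gamma> i) * \<gamma> i"
 have ga: "adj (\<gamma> i) : carrier_mat d (m i)" using g by simp
 have G: "?G : carrier_mat d d" by (rule mult_carrier_mat[OF ga g])
 have Gs: "adj ?G = ?G" using adjoint_mult[OF ga g] by simp
 have comm: "?G * \<theta> w = \<theta> w * ?G"
  if w: "w : S" and e: "\<psi> i w * \<gamma> i = \<gamma> i * \<theta> w" "\<psi> i (star w) * \<gamma> i = \<gamma> i * \<theta> (star w)" for w
 proof -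
  note pw = uc(3)[OF w]
  have "adj (\<psi> i (star w) * \<gamma> i) = adj (\<gamma> i) * \<psi> i w"
   using adjoint_mult[OF uc(3)[OF S_props(7)[OF w]] g] us[OF w] by simp
  moreover have "adj (\<gamma> i * \<theta> (star w)) = \<theta> w * adj (\<gamma> i)"
   using adjoint_mult[OF g C[of "star w"]] cp_star[OF P(2), of w] by simp
  ultimately have e': "adj (\<gamma> i) * \<psi> i w = \<theta> w * adj (\<gamma> i)" using e(2) by simp
  have "?G * \<theta> w = adj (\<gamma> i) * (\<gamma> i * \<theta> w)" by (rule assoc_mult_mat[OF ga g C])
  also have "... = adj (\<gamma> i) * (\<psi> i w * \<gamma> i)" by (simp only: e(1))
  also have "... = adj (\<gamma> i) * \<psi> i w * \<gamma> i" by (rule assoc_mult_mat[symmetric, OF ga pw g])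
  also have "... = \<theta> w * ?G" unfolding e' by (rule assoc_mult_mat[OF C ga g])
  finally show ?thesis .
 qed
 obtain t where t: "?G = t \<cdot>\<^sub>m 1\<^sub>m d" using P(6)[OF G Gs comm[OF uv_S(1) eu] comm[OF uv_S(2) ev]] by blast
 have "\<psi> i x * \<gamma> i = \<gamma> i * \<theta> x & \<psi> i (star x) * \<gamma> i = \<gamma> i * \<theta> (star x)" if "x : S" for x
  using that
 proof (induction x rule: S_induct)
  case one
  then show ?case using left_mult_one_mat[OF g] right_mult_one_mat[OF g] by (simp add: uc(6) P(3))
 next
  case (add x y)
  then show ?case
   using add_mult_distrib_mat[OF uc(3) uc(3) g] mult_add_distrib_mat[OF g C C]
   by (simp add: uc(4) star_add S_props(7) cp_add[OF P(2)])
 next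
  case (scale c x)
  then show ?case
   using mult_smult_assoc_mat[OF uc(3) g] mult_smult_distrib[OF g C]
   by (simp add: uc(5) star_scaleC S_props(7) cp_scaleC[OF P(2)])
 qed (use eu ev in \<open>simp_all add: star_star\<close>)
 then show ?thesis using that[OF t] by blast
qed

text \<open>In a decomposition of an irreducible representation every summand intertwines it, so by Schur's
  lemma every coefficient is a multiple of an isometry onto a subspace that reduces the summand.\<close>

theorem irrep_absolute_extreme:
 assumes \<theta>: "irrep d \<theta>"
 shows "restrict \<theta> S : absolute_matrix_extreme_points S d"
proof -
 note P = irrepD[OF \<theta>] and C = cp_carrier[OF irrepD(2)[OF \<theta>]]
 have le: "m i = d & unitarily_equivalent S d (restrict \<theta> S) (\<psi> i)"
  if cc: "matrix_convex_combination S d (restrict \<theta> S) r m \<psi> \<gamma>" and nz: "\<gamma> i ~= 0\<^sub>m (m i) d" and i: "i < r"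
   and mi: "m i <= d" for r m \<psi> \<gamma> i
 proof -
  obtain t where t: "adj (\<gamma> i) * \<gamma> i = t \<cdot>\<^sub>m 1\<^sub>m d" and e: "!!x. x : S ==> \<psi> i x * \<gamma> i = \<gamma> i * \<theta> x"
   by (rule irrep_intertwines[OF \<theta> cc i]; (assumption | (rule that; (assumption | simp))))
  have g: "\<gamma> i : carrier_mat (m i) d" and uc: "\<psi> i : ucp S (m i)"
   using cc i by (auto simp: matrix_convex_combination_def)
  have ga: "adj (\<gamma> i) : carrier_mat d (m i)" using g by simp
  show ?thesis
  proof (rule scalar_gram_equivalence[OF ucpD(3)[OF uc] g nz mi t])
   fix x assume x: "x : S"
   have "adj (\<gamma> i) * \<psi> i x * \<gamma> i = adj (\<gamma> i) * (\<gamma> i * \<theta> x)"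
    by (simp only: assoc_mult_mat[OF ga ucpD(3)[OF uc x] g] e[OF x])
   also have "... = (t \<cdot>\<^sub>m 1\<^sub>m d) * \<theta> x" by (simp only: assoc_mult_mat[symmetric, OF ga g C] t)
   also have "... = t \<cdot>\<^sub>m restrict \<theta> S x"
    using mult_smult_assoc_mat[OF one_carrier_mat C] left_mult_one_mat[OF C] x by simp
   finally show "adj (\<gamma> i) * \<psi> i x * \<gamma> i = t \<cdot>\<^sub>m restrict \<theta> S x" .
  qed
 qed
 have gt: "\<exists>\<rho>\<in>ucp S (m i - d). unitarily_equivalent S (m i) (\<psi> i) (%x. diag_block_mat [restrict \<theta> S x, \<rho> x])"
  if cc: "matrix_convex_combination S d (restrict \<theta> S) r m \<psi> \<gamma>" and nz: "\<gamma> i ~= 0\<^sub>m (m i) d" and i: "i < r"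
   and mi: "d < m i" for r m \<psi> \<gamma> i
 proof -
  obtain t where t: "adj (\<gamma> i) * \<gamma> i = t \<cdot>\<^sub>m 1\<^sub>m d" and e: "!!x. x : S ==> \<psi> i x * \<gamma> i = \<gamma> i * \<theta> x"
   by (rule irrep_intertwines[OF \<theta> cc i]; (assumption | (rule that; (assumption | simp))))
  have g: "\<gamma> i : carrier_mat (m i) d" and uc: "\<psi> i : ucp S (m i)"
   using cc i by (auto simp: matrix_convex_combination_def)
  note ucd = ucpD[OF uc]
  obtain s where s: "cnj s * s * t = 1" and iso: "adj (s \<cdot>\<^sub>m \<gamma> i) * (s \<cdot>\<^sub>m \<gamma> i) = 1\<^sub>m d"
   by (rule gram_isometry[OF g t nz])
  define V where "V = s \<cdot>\<^sub>m \<gamma> i"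
  have V: "V : carrier_mat (m i) d" using g by (simp add: V_def)
  have eV: "\<psi> i x * V = V * \<theta> x" if "x : S" for x
   using mult_smult_distrib[OF ucd(3)[OF that] g] mult_smult_assoc_mat[OF g C] e[OF that] by (simp add: V_def)
  obtain k c where c: "c : carrier_mat k (m i)" and k: "m i = d + k" and cc1: "c * adj c = 1\<^sub>m k"
   and cV: "c * V = 0\<^sub>m k d" and dec: "adj c * c + V * adj V = 1\<^sub>m (m i)"
   using isometry_completion[OF V iso[folded V_def]] by blast
  have k0: "0 < k" using k mi by simp
  have ca: "adj c : carrier_mat (m i) k" and Va: "adj V : carrier_mat d (m i)" using c V by simp_all
  obtain \<Psi> where \<Psi>: "cp_map (m i) \<Psi>" "!!x. x : S ==> \<Psi> x = \<psi> i x" by (rule ucp_extension[OF S_os uc]; (assumption | (rule that; (assumption | simp))))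
  define R where "R x = c * \<Psi> x * adj c" for x
  have Rcp: "cp_map k R" unfolding R_def using cp_map_conj[OF \<Psi>(1) ca] by simp
  have R1: "R 1 = 1\<^sub>m k"
   using \<Psi>(2)[OF S_props(1)] ucd(6) right_mult_one_mat[OF c] cc1 by (simp add: R_def)
  define W where "W = adj V @\<^sub>r c"
  have W: "W : carrier_mat (m i) (m i)" using carrier_append_rows[OF Va c] k by (simp add: W_def)
  have Wx: "W *\<^sub>v x = (adj V *\<^sub>v x) @\<^sub>v (c *\<^sub>v x)" if "x : carrier_vec (m i)" for x
   unfolding W_def by (rule mat_mult_append[OF Va c that])
  have app: "(x1 @\<^sub>v x2) \<bullet>c (y1 @\<^sub>v y2) = x1 \<bullet>c y1 + x2 \<bullet>c y2"
   if "x1 : carrier_vec d" "y1 : carrier_vec d" "x2 : carrier_vec k" "y2 : carrier_vec k" for x1 x2 y1 y2 :: "complex vec"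
  proof -
   have "conjugate (y1 @\<^sub>v y2) = conjugate y1 @\<^sub>v conjugate y2" using that by (intro eq_vecI) auto
   then show ?thesis using scalar_prod_append[of x1 d x2 k "conjugate y1" "conjugate y2"] that by simp
  qed
  have vd: "x = V *\<^sub>v (adj V *\<^sub>v x) + adj c *\<^sub>v (c *\<^sub>v x)" if x: "x : carrier_vec (m i)" for x
  proof -
   have "x = (adj c * c + V * adj V) *\<^sub>v x" using x by (simp add: dec)
   also have "... = (adj c * c) *\<^sub>v x + (V * adj V) *\<^sub>v x"
    by (rule add_mult_distrib_mat_vec[OF mult_carrier_mat[OF ca c] mult_carrier_mat[OF V Va] x])
   also have "... = adj c *\<^sub>v (c *\<^sub>v x) + V *\<^sub>v (adj V *\<^sub>v x)"
    by (simp only: assoc_mult_mat_vec[OF ca c x] assoc_mult_mat_vec[OF V Va x])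
   also have "... = V *\<^sub>v (adj V *\<^sub>v x) + adj c *\<^sub>v (c *\<^sub>v x)"
    by (rule comm_add_vec) (use ca V in auto)
   finally show ?thesis .
  qed
  have Vv: "V *\<^sub>v y : carrier_vec (m i)" and cv: "adj c *\<^sub>v y : carrier_vec (m i)"
   and Vav: "adj V *\<^sub>v y : carrier_vec d" and cav: "c *\<^sub>v y : carrier_vec k" for y
   by (rule mult_mat_vec_carrier'[OF V] mult_mat_vec_carrier'[OF ca] mult_mat_vec_carrier'[OF Va] mult_mat_vec_carrier'[OF c])+
  have "adj W * W = 1\<^sub>m (m i)"
  proof (rule mat_eq_formI)
   fix x y :: "complex vec" assume x: "x : carrier_vec (m i)" and y: "y : carrier_vec (m i)"
   have "((adj W * W) *\<^sub>v x) \<bullet>c y = (W *\<^sub>v x) \<bullet>c (W *\<^sub>v y)" by (rule gram_form[OF W x y])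
   also have "... = (adj V *\<^sub>v x) \<bullet>c (adj V *\<^sub>v y) + (c *\<^sub>v x) \<bullet>c (c *\<^sub>v y)"
    unfolding Wx[OF x] Wx[OF y] by (rule app[OF Vav Vav cav cav])
   also have "... = (V *\<^sub>v (adj V *\<^sub>v x)) \<bullet>c y + (adj c *\<^sub>v (c *\<^sub>v x)) \<bullet>c y"
    using form_adjoint[OF V Vav[of x] y] form_adjoint'[OF c y cav[of x]] by simp
   also have "... = x \<bullet>c y" using vd[OF x] cscalar_simps(1)[OF Vv cv y] by metis
   finally show "((adj W * W) *\<^sub>v x) \<bullet>c y = (1\<^sub>m (m i) *\<^sub>v x) \<bullet>c y" using x by simp
  qed (use W in \<open>auto intro: mult_carrier_mat[OF adjoint_carrier]\<close>)
  then have uW: "unitary_mat (m i) W" by (rule unitary_of_isometry[OF W])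
  have main: "\<psi> i x = adj W * diag_block_mat [restrict \<theta> S x, restrict R S x] * W" if x: "x : S" for x
  proof (rule mat_eq_formI)
   note px = ucd(3)[OF x] and sx = S_props(7)[OF x]
   have D: "diag_block_mat [restrict \<theta> S x, restrict R S x] = four_block_mat (\<theta> x) (0\<^sub>m d k) (0\<^sub>m k d) (R x)"
    using x by (simp add: diag_block_mat.simps(2)[of "\<theta> x" "[R x]"] Let_def cp_dim[OF P(2)] cp_dim[OF Rcp]
      del: diag_block_mat.simps)
   have Dc: "four_block_mat (\<theta> x) (0\<^sub>m d k) (0\<^sub>m k d) (R x) : carrier_mat (m i) (m i)"
    unfolding k by (rule four_block_carrier_mat[OF C cp_carrier[OF Rcp]])
   show "\<psi> i x : carrier_mat (m i) (m i)" by (rule px)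
   show "adj W * diag_block_mat [restrict \<theta> S x, restrict R S x] * W : carrier_mat (m i) (m i)"
    unfolding D by (rule conj_carrier[OF Dc W])
   fix a b :: "complex vec" assume a: "a : carrier_vec (m i)" and b: "b : carrier_vec (m i)"
   have off: "adj V *\<^sub>v (\<psi> i x *\<^sub>v (adj c *\<^sub>v y)) = 0\<^sub>v d" if y: "y : carrier_vec k" for y
   proof (rule cscalar_ext[OF Vav zero_carrier_vec])
    fix z :: "complex vec" assume z: "z : carrier_vec d"
    have cy: "adj c *\<^sub>v y : carrier_vec (m i)" by (rule cv)
    have pz: "\<theta> (star x) *\<^sub>v z : carrier_vec d" by (rule cp_vec[OF P(2)])
    have Vz: "V *\<^sub>v z : carrier_vec (m i)" by (rule Vv)
    have "(adj V *\<^sub>v (\<psi> i x *\<^sub>v (adj c *\<^sub>v y))) \<bullet>c z = (\<psi> i x *\<^sub>v (adj c *\<^sub>v y)) \<bullet>c (V *\<^sub>v z)"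
     by (rule form_adjoint'[OF V z mult_mat_vec_carrier[OF px cy]])
    also have "... = (adj c *\<^sub>v y) \<bullet>c (\<psi> i (star x) *\<^sub>v (V *\<^sub>v z))"
     using form_adjoint[OF px cy Vz] ucp_star[OF S_os uc x] by simp
    also have "\<psi> i (star x) *\<^sub>v (V *\<^sub>v z) = V *\<^sub>v (\<theta> (star x) *\<^sub>v z)"
     using assoc_mult_mat_vec[OF ucd(3)[OF sx] V z] assoc_mult_mat_vec[OF V C z] eV[OF sx] by metis
    also have "(adj c *\<^sub>v y) \<bullet>c (V *\<^sub>v (\<theta> (star x) *\<^sub>v z)) = y \<bullet>c (c *\<^sub>v (V *\<^sub>v (\<theta> (star x) *\<^sub>v z)))"
     by (rule form_adjoint'[OF c Vv y])
    also have "c *\<^sub>v (V *\<^sub>v (\<theta> (star x) *\<^sub>v z)) = 0\<^sub>v k"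
     using assoc_mult_mat_vec[OF c V pz] cV zero_mat_mult_vec[OF pz] by metis
    finally show "(adj V *\<^sub>v (\<psi> i x *\<^sub>v (adj c *\<^sub>v y))) \<bullet>c z = 0\<^sub>v d \<bullet>c z" using y z by simp
   qed
   let ?Va = "adj V *\<^sub>v a" and ?ca = "c *\<^sub>v a"
   have 1: "(\<psi> i x *\<^sub>v (V *\<^sub>v ?Va)) \<bullet>c b = (\<theta> x *\<^sub>v ?Va) \<bullet>c (adj V *\<^sub>v b)"
   proof -
    have "\<psi> i x *\<^sub>v (V *\<^sub>v ?Va) = V *\<^sub>v (\<theta> x *\<^sub>v ?Va)"
     using assoc_mult_mat_vec[OF px V Vav] assoc_mult_mat_vec[OF V C Vav] eV[OF x] by metis
    then show ?thesis using form_adjoint[OF V cp_vec[OF P(2)] b, of x ?Va] by simp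
   qed
   have 2: "(\<psi> i x *\<^sub>v (adj c *\<^sub>v ?ca)) \<bullet>c b = (R x *\<^sub>v ?ca) \<bullet>c (c *\<^sub>v b)"
   proof -
    let ?w = "\<psi> i x *\<^sub>v (adj c *\<^sub>v ?ca)"
    have w: "?w : carrier_vec (m i)" by (rule mult_mat_vec_carrier[OF px cv])
    have "?w = V *\<^sub>v (adj V *\<^sub>v ?w) + adj c *\<^sub>v (c *\<^sub>v ?w)" by (rule vd[OF w])
    also have "V *\<^sub>v (adj V *\<^sub>v ?w) = 0\<^sub>v (m i)" by (simp only: off[OF cav] mat_mult_zero_vec[OF V])
    also have "0\<^sub>v (m i) + adj c *\<^sub>v (c *\<^sub>v ?w) = adj c *\<^sub>v (c *\<^sub>v ?w)" using cv by simp
    also have "c *\<^sub>v ?w = R x *\<^sub>v ?ca"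
    proof -
     have "R x *\<^sub>v ?ca = (c * \<psi> i x) *\<^sub>v (adj c *\<^sub>v ?ca)"
      unfolding R_def \<Psi>(2)[OF x] by (rule assoc_mult_mat_vec[OF mult_carrier_mat[OF c px] ca cav])
     also have "... = c *\<^sub>v ?w" by (rule assoc_mult_mat_vec[OF c px cv])
     finally show ?thesis by simp
    qed
    finally have "?w = adj c *\<^sub>v (R x *\<^sub>v ?ca)" .
    then show ?thesis using form_adjoint'[OF c b cp_vec[OF Rcp], of x ?ca] by simp
   qed
   have "(\<psi> i x *\<^sub>v a) \<bullet>c b = (\<psi> i x *\<^sub>v (V *\<^sub>v ?Va) + \<psi> i x *\<^sub>v (adj c *\<^sub>v ?ca)) \<bullet>c b"
    using vd[OF a] mult_add_distrib_mat_vec[OF px Vv cv] by metis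
   also have "... = (\<theta> x *\<^sub>v ?Va) \<bullet>c (adj V *\<^sub>v b) + (R x *\<^sub>v ?ca) \<bullet>c (c *\<^sub>v b)"
    using cscalar_simps(1)[OF mult_mat_vec_carrier[OF px Vv] mult_mat_vec_carrier[OF px cv] b] by (simp only: 1 2)
   also have "... = ((\<theta> x *\<^sub>v ?Va) @\<^sub>v (R x *\<^sub>v ?ca)) \<bullet>c (W *\<^sub>v b)"
    unfolding Wx[OF b] by (rule app[symmetric, OF cp_vec[OF P(2)] Vav cp_vec[OF Rcp] cav])
   also have "(\<theta> x *\<^sub>v ?Va) @\<^sub>v (R x *\<^sub>v ?ca) = four_block_mat (\<theta> x) (0\<^sub>m d k) (0\<^sub>m k d) (R x) *\<^sub>v (W *\<^sub>v a)"
    unfolding Wx[OF a] by (rule mult_mat_vec_split[symmetric, OF C cp_carrier[OF Rcp] Vav cav])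
   also have "(four_block_mat (\<theta> x) (0\<^sub>m d k) (0\<^sub>m k d) (R x) *\<^sub>v (W *\<^sub>v a)) \<bullet>c (W *\<^sub>v b) =
     ((adj W * diag_block_mat [restrict \<theta> S x, restrict R S x] * W) *\<^sub>v a) \<bullet>c b"
    unfolding D by (rule conj_form[symmetric, OF W Dc a b])
   finally show "(\<psi> i x *\<^sub>v a) \<bullet>c b = ((adj W * diag_block_mat [restrict \<theta> S x, restrict R S x] * W) *\<^sub>v a) \<bullet>c b" .
  qed
  have "restrict R S : ucp S (m i - d)" using cp_map_restrict_ucp[OF Rcp R1 k0 S_os] k by simp
  then show ?thesis unfolding unitarily_equivalent_def using uW main by blast
 qed
 show ?thesis
  unfolding absolute_matrix_extreme_points_def
  using cp_map_restrict_ucp[OF P(2,3,1) S_os] le gt by blast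
qed

text \<open>The compression to the first \<open>d < n\<close> basis vectors is still extreme: \<open>u\<close> acts diagonally with
  distinct eigenvalues and \<open>v\<close> carries each basis vector isometrically to the next, apart from the last,
  whose image is controlled by \<open>u v = q v u\<close>.\<close>

theorem compression_extreme:
 assumes \<pi>: "standard_rep \<pi>" and d: "0 < d" "d < n"
 shows "matrix_extreme_points S d ~= {}"
proof -
 have cp: "cp_map n \<pi>" and p1: "\<pi> 1 = 1\<^sub>m n" using \<pi> by (simp_all add: standard_rep_def)
 obtain l \<mu> where l: "cmod l = 1" "cmod \<mu> = 1" and pu: "\<pi> u = l \<cdot>\<^sub>m clock_mat" and pv: "\<pi> v = \<mu> \<cdot>\<^sub>m shift_mat"
  using \<pi> by (auto simp: standard_rep_def)
 have ll: "l * cnj l = 1" "\<mu> * cnj \<mu> = 1" using l by (simp_all add: complex_norm_square[symmetric])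
 define E where "E = mat n d (%(i, j). if i = j then 1 else (0::complex))"
 have E: "E : carrier_mat n d" by (simp add: E_def)
 define \<Phi> where "\<Phi> x = adj E * \<pi> x * E" for x
 have \<Phi>: "cp_map d \<Phi>" unfolding \<Phi>_def by (rule cp_map_conj[OF cp E])
 have ent: "\<Phi> x $$ (i, j) = \<pi> x $$ (i, j)" if "i < d" "j < d" for x i j
 proof -
  have "\<Phi> x $$ (i, j) = (\<Sum>a<n. \<Sum>b<n. cnj (E $$ (a, i)) * \<pi> x $$ (a, b) * E $$ (b, j))"
   unfolding \<Phi>_def by (rule conj_index[OF cp_carrier[OF cp] E that])
  also have "... = (\<Sum>a<n. \<Sum>b<n. if b = j then if a = i then \<pi> x $$ (i, j) else 0 else 0)"
   by (intro sum.cong refl) (use that in \<open>simp add: E_def\<close>)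
  also have "... = \<pi> x $$ (i, j)" using that d by simp
  finally show ?thesis .
 qed
 note dim = cp_dim[OF \<Phi>] and C = cp_carrier[OF \<Phi>]
 have \<Phi>1: "\<Phi> 1 = 1\<^sub>m d" by (rule eq_matI) (use d in \<open>simp_all add: ent p1 dim\<close>)
 have Eu: "\<Phi> u *\<^sub>v unit_vec d k = (l * q ^ k) \<cdot>\<^sub>v unit_vec d k" if "k < d" for k
  by (rule eq_vecI) (use that d in \<open>simp_all add: dim scalar_prod_right_unit[of _ d] ent pu clock_mat_def row_def\<close>)
 have Ev: "\<Phi> v *\<^sub>v unit_vec d k = \<mu> \<cdot>\<^sub>v unit_vec d (Suc k)" if "Suc k < d" for k
  by (rule eq_vecI) (use that d in \<open>simp_all add: dim scalar_prod_right_unit[of _ d] ent pv shift_mat_def row_def\<close>)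
 have ev0: "\<Phi> v $$ (j, k) = (if j = Suc k then \<mu> else 0)" if "j < d" "k < d" for j k
  using that d by (simp add: ent pv shift_mat_def)
 have eu0: "\<Phi> u $$ (j, k) = (if j = k then l * q ^ k else 0)" if "j < d" "k < d" for j k
  using that d by (simp add: ent pu clock_mat_def)
 have "m i = d & unitarily_equivalent S d (restrict \<Phi> S) (\<psi> i)"
  if cc: "matrix_convex_combination S d (restrict \<Phi> S) r m \<psi> \<gamma>" and s: "surjective_mat (\<gamma> i)" and i: "i < r"
  for r m \<psi> \<gamma> i
 proof -
  have g: "\<gamma> i : carrier_mat (m i) d" and uc: "\<psi> i : ucp S (m i)" if "i < r" for i
   using cc that by (auto simp: matrix_convex_combination_def)
  have "EX \<Psi>. cp_map (m i) \<Psi> & (\<forall>x\<in>S. \<Psi> x = \<psi> i x)" if "i < r" for i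
   by (rule ucp_extension[OF S_os uc[OF that]]) blast
  then obtain \<Psi> where \<Psi>: "!!i. i < r ==> cp_map (m i) (\<Psi> i)" "!!i x. i < r ==> x : S ==> \<Psi> i x = \<psi> i x" by metis
  note g = g[OF i] and uc = uc[OF i] and \<Psi>i = \<Psi>(1)[OF i]
  let ?e = "%k. \<gamma> i *\<^sub>v unit_vec d k"
  have e: "?e k : carrier_vec (m i)" for k using g by auto
  define F where "F x j k = (\<Psi> i x *\<^sub>v ?e k) \<bullet>c ?e j" for x j k
  have exch: "F (c * a) j k = z * F c j k'"
   if a: "a : S" "star a * a = 1" and jk: "j < d" "k < d" "k' < d" and z: "\<Phi> a *\<^sub>v unit_vec d k = z \<cdot>\<^sub>v unit_vec d k'" "z * cnj z = 1"
   for a c j k k' z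
  proof -
   have u1: "unit_vec d b \<bullet>c unit_vec d b = (1::complex)" if "b < d" for b using cscalar_unit[OF that, of "unit_vec d b"] that by simp
   have zz: "(z \<cdot>\<^sub>v unit_vec d k') \<bullet>c (z \<cdot>\<^sub>v unit_vec d k') = (unit_vec d k :: complex vec) \<bullet>c unit_vec d k"
    using jk z(2) by (simp add: cscalar_simps(3,4)[of _ d] u1 mult.commute[of "cnj z"])
   have "\<Psi> i (c * a) *\<^sub>v ?e k = \<Psi> i c *\<^sub>v (\<gamma> i *\<^sub>v (z \<cdot>\<^sub>v unit_vec d k'))"
    by (rule combination_exchange[OF cc S_props(1) _ \<Psi> a _ _ zz i]) (use a z C in simp_all)
   also have "... = z \<cdot>\<^sub>v (\<Psi> i c *\<^sub>v ?e k')"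
    using mult_mat_vec[OF g unit_vec_carrier] mult_mat_vec[OF cp_carrier[OF \<Psi>i] e] by simp
   finally show ?thesis unfolding F_def using cscalar_simps(3)[OF cp_vec[OF \<Psi>i] e] by simp
  qed
  have lq: "l * q ^ k * cnj (l * q ^ k) = 1" for k
  proof -
   have "l * q ^ k * cnj (l * q ^ k) = (l * cnj l) * (q ^ k * cnj q ^ k)" by simp
   then show ?thesis by (simp only: ll qq mult_1_left)
  qed
  have Fu: "F (c * u) j k = l * q ^ k * F c j k" if "j < d" "k < d" for c j k
   by (rule exch[OF uv_S(1) u(1) that(1,2,2) Eu[OF that(2)] lq])
  have Fv: "F (c * v) j k = \<mu> * F c j (Suc k)" if "j < d" "Suc k < d" for c j k
   by (rule exch[OF uv_S(2) v(1) that(1) Suc_lessD[OF that(2)] that(2) Ev[OF that(2)] ll(2)])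
  have Fs: "F (star x) j k = cnj (F x k j)" for x j k unfolding F_def by (rule cp_form_star[OF \<Psi>i e e])
  have Fu': "F (u * c) j k = l * q ^ j * F c j k" if "j < d" "k < d" for c j k
  proof -
   have "F (star u * (u * c)) j k = cnj (F (star (u * c) * u) k j)" using Fs[of "star (u * c) * u" j k] by (simp add: star_mult star_star)
   also have "... = cnj (l * q ^ j) * cnj (F (star (u * c)) k j)" using Fu[OF that(2,1)] by simp
   also have "cnj (F (star (u * c)) k j) = F (u * c) j k" using Fs[of "star (u * c)" j k] by (simp add: star_star)
   finally have "F c j k = cnj (l * q ^ j) * F (u * c) j k" by (simp only: mult.assoc[symmetric] u(1) mult_1_left)
   then have "l * q ^ j * F c j k = (l * q ^ j * cnj (l * q ^ j)) * F (u * c) j k" by (simp only: mult.assoc)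
   then show ?thesis by (simp only: lq mult_1_left)
  qed
  have nz: "l ~= 0" using l(1) by auto
  have off: "F 1 j k = 0" if jk: "j < d" "k < d" "j ~= k" for j k
  proof -
   have "l * q ^ k * F 1 j k = l * q ^ j * F 1 j k" using Fu[OF jk(1,2), of 1] Fu'[OF jk(1,2), of 1] by simp
   then have "q ^ k = q ^ j | F 1 j k = 0" using nz by auto
   then show ?thesis using qpow_inj[of k j] jk d by auto
  qed
  define t where "t = F 1 0 0"
  have diag: "F 1 k k = t" if "k < d" for k
   using that
  proof (induction k)
   case (Suc k)
   have "F 1 k k = F (star v * v) k k" by (simp add: v)
   also have "... = \<mu> * F (star v) k (Suc k)" by (rule Fv) (use Suc.prems in simp_all)
   also have "F (star v) k (Suc k) = cnj (F (1 * v) (Suc k) k)" by (simp add: Fs)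
   also have "F (1 * v) (Suc k) k = \<mu> * F 1 (Suc k) (Suc k)" by (rule Fv[OF Suc.prems Suc.prems])
   also have "\<mu> * cnj (\<mu> * F 1 (Suc k) (Suc k)) = (\<mu> * cnj \<mu>) * cnj (F 1 (Suc k) (Suc k))" by simp
   also have "... = F (star 1) (Suc k) (Suc k)" by (simp only: ll mult_1_left Fs)
   finally show ?case using Suc by simp
  qed (simp add: t_def)
  have tr: "cnj t = t" using Fs[of 1 0 0] by (simp add: t_def)
  have Fx: "ALL j<d. ALL k<d. F x j k = t * \<Phi> x $$ (j, k)" if "x : S" for x
   using that
  proof (induction x rule: S_induct)
   case one
   then show ?case by (auto simp: \<Phi>1 off diag)
  next
   case u
   have "F u j k = t * \<Phi> u $$ (j, k)" if jk: "j < d" "k < d" for j k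
    using Fu[OF jk, of 1] off[OF jk] diag[OF jk(2)] by (cases "j = k") (simp_all add: eu0 jk)
   then show ?case by blast
  next
   case v
   have "F v j k = t * \<Phi> v $$ (j, k)" if jk: "j < d" "k < d" for j k
   proof (cases "Suc k < d")
    case True
    then show ?thesis using Fv[OF jk(1) True, of 1] off[OF jk(1) True] diag[OF True]
     by (cases "j = Suc k") (simp_all add: ev0 jk True)
   next
    case False
    then have k: "Suc k = d" using jk by simp
    have "l * q ^ j * F v j k = F (u * v) j k" by (rule Fu'[OF jk, symmetric])
    also have "... = q * F (v * u) j k"
     unfolding uv F_def by (rule cp_form_scaleC[OF \<Psi>i e e])
    also have "... = q * (l * q ^ k * F v j k)" by (simp only: Fu[OF jk])
    finally have "l * ((q ^ j - q ^ Suc k) * F v j k) = 0" by (simp add: algebra_simps)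
    then have "q ^ j = q ^ Suc k | F v j k = 0" using nz by auto
    then have "F v j k = 0" using qpow_inj[of j "Suc k"] jk d k by auto
    then show ?thesis using k jk by (simp add: ev0[OF jk])
   qed
   then show ?case by blast
  next
   case (add x y)
   then show ?case by (simp add: F_def cp_form_add[OF \<Psi>i e e] cp_add[OF \<Phi>] dim distrib_left)
  next
   case (scale c x)
   then show ?case by (simp add: F_def cp_form_scaleC[OF \<Psi>i e e] cp_scaleC[OF \<Phi>] dim)
  next
   case (star x)
   then show ?case by (simp add: Fs cp_star[OF \<Phi>] dim tr)
  qed
  have K: "adj (\<gamma> i) * \<psi> i x * \<gamma> i = t \<cdot>\<^sub>m \<Phi> x" if x: "x : S" for x
  proof (rule eq_matI)
   have Kc: "adj (\<gamma> i) * \<psi> i x * \<gamma> i : carrier_mat d d" by (rule conj_carrier[OF ucpD(3)[OF uc x] g])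
   fix j k assume "j < dim_row (t \<cdot>\<^sub>m \<Phi> x)" "k < dim_col (t \<cdot>\<^sub>m \<Phi> x)"
   then have jk: "j < d" "k < d" by (simp_all add: dim)
   have "(adj (\<gamma> i) * \<psi> i x * \<gamma> i) $$ (j, k) = F x j k"
    using form_unit[OF Kc jk] conj_form[OF g ucpD(3)[OF uc x] unit_vec_carrier unit_vec_carrier] by (simp add: F_def \<Psi>(2)[OF i x])
   then show "(adj (\<gamma> i) * \<psi> i x * \<gamma> i) $$ (j, k) = (t \<cdot>\<^sub>m \<Phi> x) $$ (j, k)"
    using Fx[OF x] jk by (simp add: dim)
  qed (use g in \<open>simp_all add: dim\<close>)
  have G: "adj (\<gamma> i) * \<gamma> i = t \<cdot>\<^sub>m 1\<^sub>m d"
   using K[OF S_props(1)] ucpD(6)[OF uc] right_mult_one_mat[OF adjoint_carrier[OF g]] by (simp add: \<Phi>1)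
  show ?thesis
   by (rule scalar_gram_equivalence[OF ucpD(3)[OF uc] g surjective_mat_nonzero[OF s ucpD(1)[OF uc]] surjective_mat_dim[OF g s] G])
    (simp_all add: K)
 qed
 then have "restrict \<Phi> S : matrix_extreme_points S d"
  unfolding matrix_extreme_points_def using cp_map_restrict_ucp[OF \<Phi> \<Phi>1 d(1) S_os] by blast
 then show ?thesis by blast
qed

end

section \<open>Existence of irreducible representations\<close>

lemma unitary_mult: "unitary_mat d A ==> unitary_mat d U ==> unitary_mat d (A * U)"
proof -
 assume "unitary_mat d A" "unitary_mat d U"
 then have A: "A : carrier_mat d d" "adj A * A = 1\<^sub>m d" and U: "U : carrier_mat d d" "adj U * U = 1\<^sub>m d"
  by (simp_all add: unitary_mat_def)
 have Ua: "adj U : carrier_mat d d" and Aa: "adj A : carrier_mat d d" using A U by simp_all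
 have "adj (A * U) * (A * U) = adj U * (adj A * (A * U))"
  unfolding adjoint_mult[OF A(1) U(1)] by (rule assoc_mult_mat[OF Ua Aa mult_carrier_mat[OF A(1) U(1)]])
 also have "adj A * (A * U) = U"
  using assoc_mult_mat[OF Aa A(1) U(1)] left_mult_one_mat[OF U(1)] by (simp add: A(2))
 finally show ?thesis using U(2) by (intro unitary_of_isometry mult_carrier_mat[OF A(1) U(1)]) simp
qed

lemma unitary_adjoint: "unitary_mat d U ==> unitary_mat d (adj U)"
 by (simp add: unitary_mat_def)

lemma unitary_smult: "cmod l = 1 ==> unitary_mat d U ==> unitary_mat d (l \<cdot>\<^sub>m U)"
proof -
 assume l: "cmod l = 1" and "unitary_mat d U"
 then have U: "U : carrier_mat d d" "adj U * U = 1\<^sub>m d" by (simp_all add: unitary_mat_def)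
 have "cnj l * l = 1" using l by (simp add: complex_norm_square[symmetric] mult.commute[of "cnj _"])
 then have "adj (l \<cdot>\<^sub>m U) * (l \<cdot>\<^sub>m U) = 1\<^sub>m d"
  using smult_conj[OF one_carrier_mat U(1), of l] U right_mult_one_mat[of "adj U" d d] right_mult_one_mat[of "adj (l \<cdot>\<^sub>m U)" d d]
  by (auto intro!: eq_matI)
 then show ?thesis by (intro unitary_of_isometry) (use U in simp_all)
qed

lemma conj_commute:
 fixes U P A :: "complex mat"
 assumes U: "unitary_mat d U" and P: "P : carrier_mat d d" and A: "A : carrier_mat d d"
  and c: "A * (adj U * P * U) = adj U * P * U * A"
 shows "(U * A * adj U) * P = P * (U * A * adj U)"
proof -
 let ?V = "adj U"
 define Q where "Q = ?V * P * U"
 have u: "U : carrier_mat d d" "?V : carrier_mat d d" "U * ?V = 1\<^sub>m d" using U by (simp_all add: unitary_mat_def)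
 note as = assoc_mult_mat[of _ d d _ d _ d] and cr = mult_carrier_mat[of _ d d _ d]
 have Q: "Q : carrier_mat d d" unfolding Q_def by (intro cr u P)
 have VP: "?V * P = Q * ?V"
  using as[OF cr[OF u(2) P] u(1,2)] right_mult_one_mat[OF cr[OF u(2) P]] by (simp add: Q_def u(3))
 have UQ: "U * Q = P * U"
  using as[OF u(1,2) P] as[OF u(1) cr[OF u(2) P] u(1)] u(3) left_mult_one_mat[OF P] by (simp add: Q_def)
 have "(U * A * ?V) * P = U * A * (?V * P)" by (rule as[OF cr[OF u(1) A] u(2) P])
 also have "... = U * A * Q * ?V" unfolding VP by (rule as[symmetric, OF cr[OF u(1) A] Q u(2)])
 also have "U * A * Q = U * Q * A"
  unfolding as[OF u(1) A Q] as[OF u(1) Q A] using c by (simp only: Q_def)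
 also have "U * Q * A * ?V = P * (U * A * ?V)"
  unfolding UQ by (simp only: as[OF P u(1) A] as[OF P cr[OF u(1) A] u(2)])
 finally show ?thesis .
qed

lemma irreducible_matD:
 assumes irr: "irreducible_mat A d \<theta>"
  and W: "W <= carrier_vec d" "0\<^sub>v d : W" "!!x y. x : W ==> y : W ==> x + y : W" "!!c x. x : W ==> c \<cdot>\<^sub>v x : W"
   "!!a x. a : A ==> x : W ==> \<theta> a *\<^sub>v x : W"
 shows "W = {0\<^sub>v d} | W = carrier_vec d"
 by (rule irr[unfolded irreducible_mat_def, THEN conjunct2, THEN spec, THEN mp, THEN mp, THEN mp, THEN mp, THEN mp])
  (simp_all add: W)

lemma scalar_cpos:
 assumes "cpos (scaleC s (1::'a::unital_cstar_algebra))"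
 shows "0 <= s"
proof -
 have inj: "a = b" if "scaleC a (1::'a) = scaleC b 1" for a b
 proof -
  have "norm (scaleC (a - b) (1::'a)) = 0" using that by (simp add: scaleC_diff_left)
  then show ?thesis by (simp add: norm_scaleC)
 qed
 have "scaleC (cnj s) (1::'a) = scaleC s 1" using cpos_selfadjoint[OF assms] by (simp add: star_scaleC)
 then have "cnj s = s" by (rule inj)
 then obtain r where r: "s = of_real r" by (metis Reals_cnj_iff Reals_cases)
 have "0 <= r"
 proof (rule ccontr)
  assume n: "\<not> 0 <= r"
  have "cpos ((- r) *\<^sub>R (1::'a))" by (rule cpos_scaleR) (use n in auto)
  moreover have "cpos (- ((- r) *\<^sub>R (1::'a)))" using assms by (simp add: r scaleR_scaleC)
  ultimately have "(- r) *\<^sub>R (1::'a) = 0" by (rule cpos_antisym)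
  then show False using n by simp
 qed
 then show ?thesis by (simp add: r less_eq_complex_def)
qed

context rotation_pair
begin

text \<open>The unique state of \<open>\<complex> 1\<close> is trivially extreme, so it extends to a state on which \<open>u\<^sup>n\<close> and
  \<open>v\<^sup>n\<close> are scalars.\<close>

theorem standard_rep_exists: obtains \<pi> where "standard_rep \<pi>"
proof -
 define T where "T = range (%c. scaleC c (1::'a))"
 have T: "operator_system T"
  unfolding operator_system_def
 proof (intro conjI ballI allI)
  have Tc: "scaleC c 1 : T" for c by (simp add: T_def)
  show "1 : T" using Tc[of 1] by simp
  fix x assume "x : T"
  then obtain a where a: "x = scaleC a 1" by (auto simp: T_def)
  show "scaleC c x : T" for c by (simp add: a scaleC_scaleC Tc)
  show "star x : T" by (simp add: a star_scaleC Tc)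
  fix y assume "y : T"
  then obtain b where b: "y = scaleC b 1" by (auto simp: T_def)
  show "x + y : T" unfolding a b scaleC_add_left[symmetric] by (rule Tc)
 qed
 have TB: "T <= B" unfolding T_def using B_props(1,6) by blast
 have inj: "scaleC a (1::'a) = scaleC b 1 \<longleftrightarrow> a = b" for a b
 proof
  assume "scaleC a (1::'a) = scaleC b 1"
  then have "norm (scaleC (a - b) (1::'a)) = 0" by (simp add: scaleC_diff_left)
  then show "a = b" by (simp add: norm_scaleC)
 qed simp
 define \<phi> where "\<phi> = restrict (%x. mat 1 1 (%_. THE c. x = scaleC c (1::'a))) T"
 have \<phi>: "\<phi> (scaleC c 1) = c \<cdot>\<^sub>m 1\<^sub>m 1" for c
  by (rule eq_matI) (auto simp: \<phi>_def T_def inj)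
 have \<phi>1: "\<phi> 1 = 1\<^sub>m 1" using \<phi>[of 1] by (auto intro!: eq_matI)
 have ucp: "\<phi> : ucp T 1"
  unfolding ucp_def
 proof (intro CollectI conjI allI impI ballI)
  show "\<phi> : T \<rightarrow>\<^sub>E carrier_mat 1 1" by (auto simp: \<phi>_def)
  show "\<phi> (x + y) = \<phi> x + \<phi> y" if xy: "x : T" "y : T" for x y
  proof -
   obtain a b where "x = scaleC a 1" "y = scaleC b 1" using xy by (auto simp: T_def)
   then have "\<phi> (x + y) = (a + b) \<cdot>\<^sub>m 1\<^sub>m 1" "\<phi> x = a \<cdot>\<^sub>m 1\<^sub>m 1" "\<phi> y = b \<cdot>\<^sub>m 1\<^sub>m 1"
    by (simp_all add: \<phi> scaleC_add_left[symmetric])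
   then show ?thesis by (auto intro!: eq_matI)
  qed
  show "\<phi> (scaleC c x) = c \<cdot>\<^sub>m \<phi> x" if "x : T" for c x
   using that by (auto simp: T_def \<phi> scaleC_scaleC intro!: eq_matI)
  show "\<phi> 1 = 1\<^sub>m 1" by (rule \<phi>1)
  fix k :: nat and X and \<xi> :: "nat => complex vec"
  assume X: "ALL i<k. ALL j<k. X i j : T" "positive_matrix k X" and \<xi>: "ALL i<k. \<xi> i : carrier_vec 1"
  obtain Y where Y: "!!i j. i < k ==> j < k ==> X i j = (\<Sum>l<k. star (Y l i) * Y l j)"
   using X(2) by (auto simp: positive_matrix_def)
  have "ALL i j. EX a. i < k --> j < k --> X i j = scaleC a 1" using X(1) by (auto simp: T_def)
  then obtain a where a: "!!i j. i < k ==> j < k ==> X i j = scaleC (a i j) 1" by metis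
  define s where "s = (\<Sum>i<k. \<Sum>j<k. a i j * \<xi> j $ 0 * cnj (\<xi> i $ 0))"
  have "(\<Sum>l<k. star (\<Sum>i<k. scaleC (\<xi> i $ 0) (Y l i)) * (\<Sum>j<k. scaleC (\<xi> j $ 0) (Y l j))) =
    (\<Sum>l<k. \<Sum>i<k. \<Sum>j<k. scaleC (\<xi> j $ 0 * cnj (\<xi> i $ 0)) (star (Y l i) * Y l j))"
   by (simp add: star_sum star_scaleC sum_product mult_scaleC_left mult_scaleC_right scaleC_scaleC mult.commute)
  also have "... = (\<Sum>i<k. \<Sum>l<k. \<Sum>j<k. scaleC (\<xi> j $ 0 * cnj (\<xi> i $ 0)) (star (Y l i) * Y l j))" by (rule sum.swap)
  also have "... = (\<Sum>i<k. \<Sum>j<k. \<Sum>l<k. scaleC (\<xi> j $ 0 * cnj (\<xi> i $ 0)) (star (Y l i) * Y l j))"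
   by (rule sum.cong[OF refl], rule sum.swap)
  also have "... = (\<Sum>i<k. \<Sum>j<k. scaleC (\<xi> j $ 0 * cnj (\<xi> i $ 0)) (X i j))"
   by (intro sum.cong refl) (simp add: Y scaleC_sum_right)
  also have "... = (\<Sum>i<k. \<Sum>j<k. scaleC (a i j * \<xi> j $ 0 * cnj (\<xi> i $ 0)) 1)"
   by (intro sum.cong refl) (simp add: a scaleC_scaleC mult_ac)
  also have "... = scaleC s 1" by (simp add: s_def scaleC_sum_left)
  finally have eq: "(\<Sum>l<k. star (\<Sum>i<k. scaleC (\<xi> i $ 0) (Y l i)) * (\<Sum>j<k. scaleC (\<xi> j $ 0) (Y l j))) = scaleC s 1" .
  have "cpos (scaleC s (1::'a))" unfolding eq[symmetric] by (intro cpos_sum cpos_star_mult)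
  then have "0 <= s" by (rule scalar_cpos)
  also have "s = (\<Sum>i<k. \<Sum>j<k. (\<phi> (X i j) *\<^sub>v \<xi> j) \<bullet>c \<xi> i)"
   unfolding s_def
  proof (intro sum.cong refl)
   fix i j assume "i : {..<k}" "j : {..<k}"
   then have ij: "i < k" "j < k" by auto
   show "a i j * \<xi> j $ 0 * cnj (\<xi> i $ 0) = (\<phi> (X i j) *\<^sub>v \<xi> j) \<bullet>c \<xi> i"
    using form_expand[of "a i j \<cdot>\<^sub>m 1\<^sub>m 1" 1 1 "\<xi> j" "\<xi> i"] \<xi> ij by (simp add: a \<phi>)
  qed
  finally show "0 <= (\<Sum>i<k. \<Sum>j<k. (\<phi> (X i j) *\<^sub>v \<xi> j) \<bullet>c \<xi> i)" .
 qed simp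
 have "m i = 1 & unitarily_equivalent T 1 \<phi> (\<psi> i)"
  if cc: "matrix_convex_combination T 1 \<phi> r m \<psi> \<gamma>" and s: "surjective_mat (\<gamma> i)" and i: "i < r" for r m \<psi> \<gamma> i
 proof -
  have g: "\<gamma> i : carrier_mat (m i) 1" and uc: "\<psi> i : ucp T (m i)"
   using cc i by (auto simp: matrix_convex_combination_def)
  have m: "m i = 1" using surjective_mat_dim[OF g s] ucpD(1)[OF uc] by simp
  have T1: "1 : T" using operator_systemD(1)[OF T] .
  have "\<phi> x = adj (1\<^sub>m 1) * \<psi> i x * 1\<^sub>m 1" if x: "x : T" for x
  proof -
   obtain a where a: "x = scaleC a 1" using x by (auto simp: T_def)
   have "\<psi> i x = a \<cdot>\<^sub>m 1\<^sub>m 1" using ucpD(5)[OF uc T1, of a] ucpD(6)[OF uc] by (simp add: a m)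
   then show ?thesis by (simp add: a \<phi>)
  qed
  moreover have "unitary_mat 1 (1\<^sub>m 1)" by (simp add: unitary_mat_def)
  ultimately show ?thesis unfolding unitarily_equivalent_def using m by blast
 qed
 then have ext: "\<phi> : matrix_extreme_points T 1" unfolding matrix_extreme_points_def using ucp by blast
 obtain l \<mu> \<Phi> where l: "cmod l = 1" "cmod \<mu> = 1" and \<Phi>: "cp_map 1 \<Phi>" "!!x. x : T ==> \<Phi> x = \<phi> x"
  and z: "!!p. p < 1 ==> \<Phi> (gp l \<mu>) $$ (p, p) = 0"
  by (rule extreme_point_extension[OF T TB ext]; (assumption | (rule that; (assumption | simp))))
 have \<Phi>1: "\<Phi> 1 = 1\<^sub>m 1" using \<Phi>(2)[OF operator_systemD(1)[OF T]] \<phi>1 by simp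
 show ?thesis by (rule kraus_standard[OF \<Phi>(1) \<Phi>1 _ l z]; (assumption | (rule that; assumption) | simp))
qed

lemma standard_irrep:
 assumes \<pi>: "standard_rep \<pi>"
 shows "irrep n \<pi>"
proof -
 obtain l m where l: "cmod l = 1" and m: "cmod m = 1" and p: "\<pi> u = l \<cdot>\<^sub>m clock_mat" "\<pi> v = m \<cdot>\<^sub>m shift_mat"
  using \<pi> by (auto simp: standard_rep_def)
 have canc: "A * C = C * A" if lC: "A * (l \<cdot>\<^sub>m C) = l \<cdot>\<^sub>m C * A" and l: "cmod l = 1" and A: "A : carrier_mat n n" and C: "C : carrier_mat n n" for A C l
 proof -
  have c: "cnj l * l = 1" using l by (simp add: complex_norm_square[symmetric] mult.commute[of "cnj _"])
  have "l \<cdot>\<^sub>m (A * C) = l \<cdot>\<^sub>m (C * A)" using lC mult_smult_distrib[OF A C] mult_smult_assoc_mat[OF C A] by simp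
  then have "cnj l \<cdot>\<^sub>m (l \<cdot>\<^sub>m (A * C)) = cnj l \<cdot>\<^sub>m (l \<cdot>\<^sub>m (C * A))" by simp
  then show ?thesis by (simp only: smult_inverse_mat[OF c])
 qed
 have "EX c. A = c \<cdot>\<^sub>m 1\<^sub>m n" if A: "A : carrier_mat n n" and c: "A * \<pi> u = \<pi> u * A" "A * \<pi> v = \<pi> v * A" for A
  using clock_shift_commutant[OF A canc[OF c(1)[unfolded p] l A clock_carrier(1)] canc[OF c(2)[unfolded p] m A shift_carrier(1)]] by auto
 then show ?thesis
  unfolding irrep_def using \<pi> q_simps(1) unitary_smult[OF l clock_unitary] unitary_smult[OF m shift_unitary]
  by (simp add: standard_rep_def p)
qed

lemma irrep_conj:
 assumes \<theta>: "irrep d \<theta>" and U: "unitary_mat d U"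
 shows "irrep d (%x. adj U * \<theta> x * U)"
proof -
 note P = irrepD[OF \<theta>] and C = cp_carrier[OF irrepD(2)[OF \<theta>]]
 have u: "U : carrier_mat d d" "adj U : carrier_mat d d" "adj U * U = 1\<^sub>m d" "U * adj U = 1\<^sub>m d"
  using U by (simp_all add: unitary_mat_def)
 note as = assoc_mult_mat[of _ d d _ d _ d] and cr = mult_carrier_mat[of _ d d _ d]
 have "EX c. A = c \<cdot>\<^sub>m 1\<^sub>m d"
  if A: "A : carrier_mat d d" "adj A = A"
   and c: "A * (adj U * \<theta> u * U) = adj U * \<theta> u * U * A" "A * (adj U * \<theta> v * U) = adj U * \<theta> v * U * A" for A
 proof -
  let ?A = "U * A * adj U"
  have Ac: "?A : carrier_mat d d" by (intro cr u A)
  have "adj ?A = ?A"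
   using adjoint_mult[OF cr[OF u(1) A(1)] u(2)] adjoint_mult[OF u(1) A(1)] as[OF u(1) A(1) u(2)] A(2) by simp
  then obtain c where "?A = c \<cdot>\<^sub>m 1\<^sub>m d" using P(6)[OF Ac _ conj_commute[OF U C A(1) c(1)] conj_commute[OF U C A(1) c(2)]] by blast
  then have "adj U * ?A * U = adj U * (c \<cdot>\<^sub>m 1\<^sub>m d) * U" by simp
  also have "... = c \<cdot>\<^sub>m 1\<^sub>m d"
   using mult_smult_distrib[OF u(2) one_carrier_mat] mult_smult_assoc_mat[OF u(2,1)] right_mult_one_mat[OF u(2)] u(3) by simp
  also have "adj U * ?A * U = (adj U * U) * A * (adj U * U)"
  proof -
   have "adj U * ?A * U = adj U * (?A * U)" by (rule as[OF u(2) Ac u(1)])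
   also have "?A * U = U * A * (adj U * U)" by (rule as[OF cr[OF u(1) A(1)] u(2,1)])
   also have "adj U * (U * A * (adj U * U)) = adj U * (U * A) * (adj U * U)"
    by (rule as[symmetric, OF u(2) cr[OF u(1) A(1)] cr[OF u(2,1)]])
   also have "adj U * (U * A) = adj U * U * A" by (rule as[symmetric, OF u(2,1) A(1)])
   finally show ?thesis .
  qed
  also have "... = A" using A(1) by (simp add: u(3))
  finally show ?thesis by blast
 qed
 then show ?thesis
  unfolding irrep_def using P(1) cp_map_conj[OF P(2) u(1)] u(3) right_mult_one_mat[OF u(2)]
   unitary_mult[OF unitary_mult[OF unitary_adjoint[OF U] P(4)] U] unitary_mult[OF unitary_mult[OF unitary_adjoint[OF U] P(5)] U]
  by (simp add: P(3))
qed

lemma irreducible_conj: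
 assumes \<theta>: "!!b. \<theta> b : carrier_mat d d" "irreducible_mat B d \<theta>" and U: "unitary_mat d U"
 shows "irreducible_mat B d (%x. adj U * \<theta> x * U)"
proof -
 have u: "U : carrier_mat d d" "adj U : carrier_mat d d" "adj U * U = 1\<^sub>m d" "U * adj U = 1\<^sub>m d"
  using U by (simp_all add: unitary_mat_def)
 have UU: "adj U *\<^sub>v (U *\<^sub>v x) = x" "U *\<^sub>v (adj U *\<^sub>v x) = x" if "x : carrier_vec d" for x
  using assoc_mult_mat_vec[OF u(2,1) that] assoc_mult_mat_vec[OF u(1,2) that] u(3,4) that by simp_all
 have cv: "U *\<^sub>v x : carrier_vec d" for x using u(1) by auto
 have main: "W = {0\<^sub>v d} | W = carrier_vec d"
  if W: "W <= carrier_vec d" "0\<^sub>v d : W" "\<forall>x\<in>W. \<forall>y\<in>W. x + y : W" "ALL c. \<forall>x\<in>W. c \<cdot>\<^sub>v x : W"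
   and inv: "\<forall>a\<in>B. \<forall>x\<in>W. (adj U * \<theta> a * U) *\<^sub>v x : W" for W
 proof -
  let ?W = "(%x. U *\<^sub>v x) ` W"
  have "?W = {0\<^sub>v d} | ?W = carrier_vec d"
  proof (rule irreducible_matD[OF \<theta>(2)])
   show "?W <= carrier_vec d" by (rule image_subsetI) (rule cv)
   show "0\<^sub>v d : ?W" by (rule image_eqI[where f = "%x. U *\<^sub>v x", OF mat_mult_zero_vec[OF u(1), symmetric] W(2)])
   show "x + y : ?W" if xy: "x : ?W" "y : ?W" for x y
   proof -
    obtain a where a: "a : W" "x = U *\<^sub>v a" using xy(1) by (rule imageE) (rule that)
    obtain b where b: "b : W" "y = U *\<^sub>v b" using xy(2) by (rule imageE) (rule that)
    note ab = a(1) b(1) a(2) b(2)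
    have "x + y = U *\<^sub>v (a + b)" using mult_add_distrib_mat_vec[OF u(1) subsetD[OF W(1) ab(1)] subsetD[OF W(1) ab(2)]] ab by simp
    moreover have "a + b : W" using W(3) ab by blast
    ultimately show ?thesis by (simp only: imageI)
   qed
   show "c \<cdot>\<^sub>v x : ?W" if x: "x : ?W" for c x
   proof -
    obtain a where a: "a : W" "x = U *\<^sub>v a" using x by (rule imageE) (rule that)
    have "c \<cdot>\<^sub>v x = U *\<^sub>v (c \<cdot>\<^sub>v a)" using mult_mat_vec[OF u(1) subsetD[OF W(1) a(1)], of c] a by simp
    moreover have "c \<cdot>\<^sub>v a : W" using W(4) a by blast
    ultimately show ?thesis by (simp only: imageI)
   qed
   show "\<theta> a *\<^sub>v x : ?W" if a: "a : B" and x: "x : ?W" for a x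
   proof -
    obtain w where w: "w : W" "x = U *\<^sub>v w" using x by (rule imageE) (rule that)
    have wc: "w : carrier_vec d" by (rule subsetD[OF W(1) w(1)])
    have t: "\<theta> a *\<^sub>v x : carrier_vec d" by (rule mult_mat_vec_carrier'[OF \<theta>(1)])
    have eq: "(adj U * \<theta> a * U) *\<^sub>v w = adj U *\<^sub>v (\<theta> a *\<^sub>v x)"
     using assoc_mult_mat_vec[OF mult_carrier_mat[OF u(2) \<theta>(1)] u(1) wc] assoc_mult_mat_vec[OF u(2) \<theta>(1) cv] w(2) by simp
    have "(adj U * \<theta> a * U) *\<^sub>v w : W" using inv a w(1) by blast
    then have "U *\<^sub>v ((adj U * \<theta> a * U) *\<^sub>v w) : ?W" by (rule imageI)
    then show ?thesis by (simp only: eq UU(2)[OF t])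
   qed
  qed
  then show ?thesis
  proof
   assume 0: "?W = {0\<^sub>v d}"
   have z: "x = 0\<^sub>v d" if "x : W" for x
   proof -
    have "U *\<^sub>v x : ?W" using that by (rule imageI)
    then have "U *\<^sub>v x = 0\<^sub>v d" unfolding 0 by simp
    then have "adj U *\<^sub>v (U *\<^sub>v x) = 0\<^sub>v d" by (simp only: mat_mult_zero_vec[OF u(2)])
    then show ?thesis using UU(1)[OF subsetD[OF W(1) that]] by simp
   qed
   have "W <= {0\<^sub>v d}" using z by blast
   then have "W = {0\<^sub>v d}" using W(2) by blast
   then show ?thesis by (rule disjI1)
  next
   assume all: "?W = carrier_vec d"
   have "x : W" if x: "x : carrier_vec d" for x
   proof -
    have "U *\<^sub>v x : ?W" unfolding all by (rule cv)
    then obtain w where w: "w : W" "U *\<^sub>v x = U *\<^sub>v w" by (rule imageE) (rule that)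
    have "x = adj U *\<^sub>v (U *\<^sub>v x)" by (rule UU(1)[OF x, symmetric])
    also have "... = w" unfolding w(2) by (rule UU(1)[OF subsetD[OF W(1) w(1)]])
    finally show ?thesis using w by simp
   qed
   then have "carrier_vec d <= W" by (rule subsetI)
   then have "W = carrier_vec d" by (rule equalityI[OF W(1)])
   then show ?thesis by (rule disjI2)
  qed
 qed
 have d: "0 < d" using \<theta>(2) by (simp add: irreducible_mat_def)
 show ?thesis unfolding irreducible_mat_def by (intro conjI d allI impI) (rule main)
qed

text \<open>Averaging over the powers of the clock isolates a basis vector in a nonzero invariant subspace, and the
  shift moves it to all the others.\<close>

lemma standard_irreducible:
 assumes \<pi>: "standard_rep \<pi>"
 shows "irreducible_mat B n \<pi>"
 unfolding irreducible_mat_def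
proof (intro conjI allI impI)
 show "0 < n" by (rule q_simps(1))
 fix W assume W: "W <= carrier_vec n" "0\<^sub>v n : W" "\<forall>x\<in>W. \<forall>y\<in>W. x + y : W" "ALL c. \<forall>x\<in>W. c \<cdot>\<^sub>v x : W"
  and inv: "\<forall>a\<in>B. \<forall>x\<in>W. \<pi> a *\<^sub>v x : W"
 obtain l m where l: "cmod l = 1" and m: "cmod m = 1" and p: "\<pi> u = l \<cdot>\<^sub>m clock_mat" "\<pi> v = m \<cdot>\<^sub>m shift_mat"
  using \<pi> by (auto simp: standard_rep_def)
 have c: "cnj l * l = 1" "cnj m * m = 1" using l m by (simp_all add: complex_norm_square[symmetric] mult.commute[of "cnj _"])
 show "W = {0\<^sub>v n} | W = carrier_vec n"
 proof (cases "W = {0\<^sub>v n}")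
  case False
  then obtain x where x: "x : W" "x ~= 0\<^sub>v n" using W(2) by blast
  have xc: "x : carrier_vec n" using x W by auto
  obtain j where j: "j < n" "x $ j ~= 0"
  proof (rule ccontr)
   assume "\<not> thesis"
   then have "x = 0\<^sub>v n" using xc that by (intro eq_vecI) auto
   then show False using x by simp
  qed
  have clock: "vec n (%i. q ^ i * y $ i) : W" if y: "y : W" for y
  proof -
   have yc: "y : carrier_vec n" using y W by auto
   have "cnj l \<cdot>\<^sub>v (\<pi> u *\<^sub>v y) : W" using inv uv_B y W(4) by blast
   also have "cnj l \<cdot>\<^sub>v (\<pi> u *\<^sub>v y) = vec n (%i. q ^ i * y $ i)"
   proof (rule eq_vecI)
    fix i assume "i < dim_vec (vec n (%i. q ^ i * y $ i))"
    then have i: "i < n" by simp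
    have "(\<pi> u *\<^sub>v y) $ i = (\<Sum>k<n. l * (if i = k then q ^ k else 0) * y $ k)"
     using i yc by (simp add: p scalar_prod_def atLeast0LessThan clock_mat_def)
    also have "... = (\<Sum>k<n. if k = i then l * q ^ i * y $ i else 0)" by (rule sum.cong[OF refl]) auto
    also have "... = l * q ^ i * y $ i" using i by simp
    finally have "(\<pi> u *\<^sub>v y) $ i = l * (q ^ i * y $ i)" by simp
    then have "cnj l * (\<pi> u *\<^sub>v y) $ i = (cnj l * l) * (q ^ i * y $ i)" by (simp only: mult.assoc)
    then show "(cnj l \<cdot>\<^sub>v (\<pi> u *\<^sub>v y)) $ i = vec n (%i. q ^ i * y $ i) $ i" using i by (simp add: c p)
   qed (simp add: p)
   finally show ?thesis .
  qed
  have iter: "vec n (%i. (q ^ i) ^ a * x $ i) : W" for a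
  proof (induction a)
   case 0
   have "vec n (%i. (q ^ i) ^ 0 * x $ i) = x" using xc by (intro eq_vecI) auto
   then show ?case using x by simp
  next
   case (Suc a)
   have "vec n (%i. q ^ i * vec n (%i. (q ^ i) ^ a * x $ i) $ i) = vec n (%i. (q ^ i) ^ Suc a * x $ i)"
    by (intro eq_vecI) auto
   then show ?case using clock[OF Suc] by simp
  qed
  have avg: "vec n (%i. (\<Sum>a<k. (q ^ i) ^ a * cnj (q ^ j) ^ a) * x $ i) : W" for k
  proof (induction k)
   case 0
   have "vec n (%i. (\<Sum>a<0::nat. (q ^ i) ^ a * cnj (q ^ j) ^ a) * x $ i) = 0\<^sub>v n" by (intro eq_vecI) auto
   then show ?case using W(2) by simp
  next
   case (Suc k)
   have "vec n (%i. (\<Sum>a<k. (q ^ i) ^ a * cnj (q ^ j) ^ a) * x $ i) + cnj (q ^ j) ^ k \<cdot>\<^sub>v vec n (%i. (q ^ i) ^ k * x $ i) =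
     vec n (%i. (\<Sum>a<Suc k. (q ^ i) ^ a * cnj (q ^ j) ^ a) * x $ i)"
    by (intro eq_vecI) (auto simp: distrib_right)
   moreover have "vec n (%i. (\<Sum>a<k. (q ^ i) ^ a * cnj (q ^ j) ^ a) * x $ i) + cnj (q ^ j) ^ k \<cdot>\<^sub>v vec n (%i. (q ^ i) ^ k * x $ i) : W"
    using Suc iter[of k] W(3,4) by blast
   ultimately show ?case by (simp only:)
  qed
  have orth: "(\<Sum>a<n. (q ^ i) ^ a * cnj (q ^ j) ^ a) = (if i = j then of_nat n else 0)" if i: "i < n" for i
  proof -
   have "(\<Sum>a<n. (q ^ i) ^ a * cnj (q ^ j) ^ a) = (\<Sum>a<n. (q ^ a) ^ i * (cnj (q ^ a)) ^ j)"
    by (simp only: complex_cnj_power power_mult[symmetric] mult.commute)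
   then show ?thesis using primitive_root_orthogonality[OF q i j(1)] by simp
  qed
  define s where "s i = (\<Sum>a<n. (q ^ i) ^ a * cnj (q ^ j) ^ a)" for i
  have s: "s i = (if i = j then of_nat n else 0)" if "i < n" for i unfolding s_def by (rule orth[OF that])
  have "(1 / (of_nat n * x $ j)) \<cdot>\<^sub>v vec n (%i. s i * x $ i) = unit_vec n j"
   by (rule eq_vecI) (use j q_simps(1) in \<open>auto simp: s\<close>)
  moreover have "(1 / (of_nat n * x $ j)) \<cdot>\<^sub>v vec n (%i. s i * x $ i) : W"
   using avg[of n, folded s_def] W(4) by blast
  ultimately have ej: "unit_vec n j : W" by (simp only:)
  have shift: "unit_vec n (Suc k mod n) : W" if k: "k < n" "unit_vec n k : W" for k
  proof -
   have "cnj m \<cdot>\<^sub>v (\<pi> v *\<^sub>v unit_vec n k) : W" using inv uv_B k W(4) by blast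
   also have "cnj m \<cdot>\<^sub>v (\<pi> v *\<^sub>v unit_vec n k) = unit_vec n (Suc k mod n)"
   proof (rule eq_vecI)
    fix i assume "i < dim_vec (unit_vec n (Suc k mod n) :: complex vec)"
    then have i: "i < n" by simp
    have pc: "\<pi> v : carrier_mat n n" by (simp add: p)
    note vc = mult_mat_vec_carrier'[OF pc, of "unit_vec n k"]
    have "(\<pi> v *\<^sub>v unit_vec n k) $ i = \<pi> v $$ (i, k)"
     by (rule trans[OF cscalar_unit[OF i vc, symmetric] form_unit[OF pc i k(1)]])
    also have "... = m * (if i = Suc k mod n then 1 else 0)" using i k by (simp add: p shift_mat_def)
    finally have e: "cnj m * (\<pi> v *\<^sub>v unit_vec n k) $ i = (if i = Suc k mod n then 1 else 0)"
     by (simp only: mult.assoc[symmetric] c mult_1_left)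
    have iy: "i < dim_vec (\<pi> v *\<^sub>v unit_vec n k)" by (simp only: carrier_vecD[OF vc] i)
    show "(cnj m \<cdot>\<^sub>v (\<pi> v *\<^sub>v unit_vec n k)) $ i = unit_vec n (Suc k mod n) $ i"
     unfolding index_smult_vec(1)[OF iy] e using i q_simps(1) by simp
   qed (simp add: p)
   finally show ?thesis .
  qed
  have orbit: "unit_vec n ((j + k) mod n) : W" for k
  proof (induction k)
   case (Suc k)
   have "Suc ((j + k) mod n) mod n = (j + Suc k) mod n" by (simp add: mod_Suc_eq)
   then show ?case using shift[OF _ Suc] q_simps(1) by simp
  qed (use ej j in simp)
  have ek: "unit_vec n k : W" if "k < n" for k
  proof -
   have "(j + (n - j + k)) mod n = k" using that j(1) by simp
   then show ?thesis using orbit[of "n - j + k"] by (simp only:)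
  qed
  have "y : W" if y: "y : carrier_vec n" for y
  proof -
   have "vec n (%i. if i < k then y $ i else 0) : W" if "k <= n" for k
    using that
   proof (induction k)
    case 0
    have "vec n (%i. if i < (0::nat) then y $ i else 0) = 0\<^sub>v n" by (intro eq_vecI) auto
    then show ?case using W(2) by simp
   next
    case (Suc k)
    have "vec n (%i. if i < k then y $ i else 0) + y $ k \<cdot>\<^sub>v unit_vec n k = vec n (%i. if i < Suc k then y $ i else 0)"
     by (intro eq_vecI) (use Suc.prems in \<open>auto simp: less_Suc_eq\<close>)
    moreover have "vec n (%i. if i < k then y $ i else 0) : W" by (rule Suc.IH) (use Suc.prems in simp)
    moreover have "y $ k \<cdot>\<^sub>v unit_vec n k : W" using ek[of k] Suc.prems W(4) by simp
    ultimately show ?case using W(3) by (metis (no_types, lifting))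
   qed
   from this[of n] have "vec n (%i. if i < n then y $ i else 0) : W" by simp
   also have "vec n (%i. if i < n then y $ i else 0) = y" using y by (intro eq_vecI) auto
   finally show ?thesis .
  qed
  then show ?thesis using W(1) by auto
 qed simp
qed

text \<open>The unique extension property: an extension of \<open>\<theta>|\<^sub>S\<close> is unitary on the generators, hence
  multiplicative, hence agrees with \<open>\<theta>\<close> on the generated algebra.\<close>

theorem irreducible_boundary:
 assumes \<theta>: "cp_map d \<theta>" "\<theta> 1 = 1\<^sub>m d" "0 < d" "unitary_mat d (\<theta> u)" "unitary_mat d (\<theta> v)" and irr: "irreducible_mat B d \<theta>"
 shows "boundary_representation_mat S d (restrict \<theta> B)"
proof -
 note C = cp_carrier[OF \<theta>(1)]
 note md = multiplicative_domain[OF \<theta>(1,2,4,5)]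
 have rs: "restrict (restrict \<theta> B) S = restrict \<theta> S" using S_B by (simp add: Int_absorb1)
 have star: "star_representation_mat B d (restrict \<theta> B)"
  unfolding star_representation_mat_def
  using B_props(1,3,5,6,8) C by (auto simp: \<theta>(2) cp_add[OF \<theta>(1)] cp_scaleC[OF \<theta>(1)] md(1) cp_star[OF \<theta>(1)])
 have "irreducible_mat B d (restrict \<theta> B)"
  unfolding irreducible_mat_def
 proof (intro conjI \<theta>(3) allI impI)
  fix W assume "W <= carrier_vec d" "0\<^sub>v d : W" "\<forall>x\<in>W. \<forall>y\<in>W. x + y : W" "ALL c. \<forall>x\<in>W. c \<cdot>\<^sub>v x : W"
   "\<forall>a\<in>B. \<forall>x\<in>W. restrict \<theta> B a *\<^sub>v x : W"
  then show "W = {0\<^sub>v d} | W = carrier_vec d" by (intro irreducible_matD[OF irr]) simp_all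
 qed
 moreover have uniq: "\<Psi> = restrict \<theta> B" if \<Psi>: "\<Psi> : ucp B d" "restrict \<Psi> S = restrict \<theta> S" for \<Psi>
 proof -
  obtain X where X: "cp_map d X" "!!x. x : B ==> X x = \<Psi> x"
   by (rule ucp_extension[OF B_os \<Psi>(1)]; (assumption | (rule that; (assumption | simp))))
  have XS: "X x = \<theta> x" if "x : S" for x
   using X(2)[of x] S_B that fun_cong[OF \<Psi>(2), of x] by auto
  have X1: "X 1 = 1\<^sub>m d" using XS[OF S_props(1)] \<theta>(2) by simp
  have mdX: "X (c * b) = X c * X b" if "b : B" for b c
   by (rule multiplicative_domain(1)[OF X(1) X1 _ _ that]) (simp_all add: XS uv_S \<theta>)
  have ent: "continuous_on UNIV (%b. Y b $$ (i, j))" if "cp_map d Y" "Y 1 = 1\<^sub>m d" "i < d" "j < d" for Y :: "'a => complex mat" and i j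
   using bounded_linear.continuous_on[OF cp_entry_continuous[OF that] continuous_on_id] by simp
  have "closed {b. X b = \<theta> b}"
   by (rule closed_mat_eq[OF cp_carrier[OF X(1)] C ent[OF X(1) X1] ent[OF \<theta>(1,2)]])
  then have "closed (B \<inter> {b. X b = \<theta> b})" using B_props(11) by (rule closed_Int[rotated])
  then have "cstar_subalgebra (B \<inter> {b. X b = \<theta> b})"
   unfolding cstar_subalgebra_def operator_system_def
   using B_props(1,3,5,6,8) by (simp add: X1 \<theta>(2) mdX md(1) cp_add[OF X(1)] cp_add[OF \<theta>(1)]
     cp_scaleC[OF X(1)] cp_scaleC[OF \<theta>(1)] cp_star[OF X(1)] cp_star[OF \<theta>(1)])
  then have "B <= B \<inter> {b. X b = \<theta> b}" by (rule B_least) (simp_all add: uv_B uv_S XS)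
  then have "\<Psi> b = \<theta> b" if "b : B" for b using X(2)[OF that] that by auto
  then show ?thesis using ucpD(2)[OF \<Psi>(1)] by (intro extensionalityI[of _ B]) auto
 qed
 moreover have "unique_extension_property (%T. ucp T d) (*) S (restrict (restrict \<theta> B) S)"
  unfolding unique_extension_property_def rs
 proof (intro conjI exI)
  show "restrict \<theta> S : ucp S d" by (rule cp_map_restrict_ucp[OF \<theta>(1,2,3) S_os])
  have "restrict \<theta> B : ucp B d" by (rule cp_map_restrict_ucp[OF \<theta>(1,2,3) B_os])
  then show "{\<Psi> : ucp B d. restrict \<Psi> S = restrict \<theta> S} = {restrict \<theta> B}" using rs uniq by blast
  show "\<forall>a\<in>B. \<forall>b\<in>B. restrict \<theta> B (a * b) = restrict \<theta> B a * restrict \<theta> B b"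
   using star unfolding star_representation_mat_def by blast
 qed
 ultimately show ?thesis unfolding boundary_representation_mat_def using star by blast
qed

text \<open>With a cyclic vector \<open>\<xi>\<^sub>0\<close> the positivity of a quadratic form in the vectors \<open>\<pi>(b\<^sub>i) \<xi>\<^sub>0\<close> reduces to that
  of the vector state at \<open>\<xi>\<^sub>0\<close>, which follows by taking square roots inside the algebra.\<close>

theorem irrep_of_star_rep:
 assumes \<pi>: "star_representation_mat B d \<pi>" and d: "0 < d" and x0: "\<xi>0 : carrier_vec d"
  and cyc: "!!\<xi>. \<xi> : carrier_vec d ==> \<exists>b\<in>B. \<xi> = \<pi> b *\<^sub>v \<xi>0"
  and schur: "!!A. A : carrier_mat d d ==> (!!b. b : B ==> A * \<pi> b = \<pi> b * A) ==> EX c. A = c \<cdot>\<^sub>m 1\<^sub>m d"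
 obtains \<theta> where "irrep d \<theta>" "!!b. b : B ==> \<theta> b = \<pi> b"
proof -
 have C: "\<pi> b : carrier_mat d d" if "b : B" for b using \<pi> that by (auto simp: star_representation_mat_def)
 have add: "\<pi> (a + b) = \<pi> a + \<pi> b" and mul: "\<pi> (a * b) = \<pi> a * \<pi> b" if "a : B" "b : B" for a b
  using \<pi> that by (simp_all add: star_representation_mat_def)
 have sc: "\<pi> (scaleC c b) = c \<cdot>\<^sub>m \<pi> b" and st: "\<pi> (star b) = adj (\<pi> b)" if "b : B" for b c
  using \<pi> that by (simp_all add: star_representation_mat_def)
 have one: "\<pi> 1 = 1\<^sub>m d" using \<pi> by (simp add: star_representation_mat_def)
 define f where "f b = (\<pi> b *\<^sub>v \<xi>0) \<bullet>c \<xi>0" for b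
 have f_add: "f (a + b) = f a + f b" if "a : B" "b : B" for a b
  unfolding f_def add[OF that] by (rule add_mat_vec_form[OF C[OF that(1)] C[OF that(2)] x0 x0])
 have f_0: "f 0 = 0" using f_add[of 0 0] B_props(2) by simp
 have f_sum: "f (sum g I) = (\<Sum>i\<in>I. f (g i))" if "!!i. i : I ==> g i : B" for g :: "nat => 'a" and I
  using that
 proof (induction I rule: infinite_finite_induct)
  case (insert i I)
  have "g i : B" "sum g I : B" using insert.prems by (auto intro!: B_sum)
  then show ?case using insert by (simp add: f_add)
 qed (simp_all add: f_0)
 have vec: "\<pi> b *\<^sub>v \<xi>0 : carrier_vec d" if "b : B" for b using C[OF that] by auto
 have f_form: "(\<pi> x *\<^sub>v (\<pi> b *\<^sub>v \<xi>0)) \<bullet>c (\<pi> a *\<^sub>v \<xi>0) = f (star a * x * b)" if "a : B" "b : B" "x : B" for a b x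
 proof -
  have m: "star a * x : B" by (rule B_props(5)[OF B_props(8)[OF that(1)] that(3)])
  have "f (star a * x * b) = ((\<pi> (star a) * \<pi> x) *\<^sub>v (\<pi> b *\<^sub>v \<xi>0)) \<bullet>c \<xi>0"
   unfolding f_def mul[OF m that(2)] mul[OF B_props(8)[OF that(1)] that(3)]
   using assoc_mult_mat_vec[OF mult_carrier_mat[OF C[OF B_props(8)[OF that(1)]] C[OF that(3)]] C[OF that(2)] x0] by simp
  also have "(\<pi> (star a) * \<pi> x) *\<^sub>v (\<pi> b *\<^sub>v \<xi>0) = adj (\<pi> a) *\<^sub>v (\<pi> x *\<^sub>v (\<pi> b *\<^sub>v \<xi>0))"
   using assoc_mult_mat_vec[OF C[OF B_props(8)[OF that(1)]] C[OF that(3)] vec[OF that(2)]] st[OF that(1)] by simp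
  also have "(adj (\<pi> a) *\<^sub>v (\<pi> x *\<^sub>v (\<pi> b *\<^sub>v \<xi>0))) \<bullet>c \<xi>0 = (\<pi> x *\<^sub>v (\<pi> b *\<^sub>v \<xi>0)) \<bullet>c (\<pi> a *\<^sub>v \<xi>0)"
   by (rule form_adjoint'[OF C[OF that(1)] x0 mult_mat_vec_carrier[OF C[OF that(3)] vec[OF that(2)]]])
  finally show ?thesis by simp
 qed
 have f_pos: "0 <= f a" if a: "a : B" "cpos a" for a
 proof -
  obtain e where e: "star e = e" "a = e * e" "calculus_of a e" by (rule cpos_sqrt[OF a(2)])
  have eB: "e : B" by (rule calculus_of_mem[OF e(3) B_alg a(1)])
  have "f a = (\<pi> 1 *\<^sub>v (\<pi> e *\<^sub>v \<xi>0)) \<bullet>c (\<pi> e *\<^sub>v \<xi>0)" using f_form[OF eB eB B_props(1)] e by simp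
  also have "... = (\<pi> e *\<^sub>v \<xi>0) \<bullet>c (\<pi> e *\<^sub>v \<xi>0)" using vec[OF eB] by (simp add: one)
  also have "0 <= ..." by (simp add: cscalar_self less_eq_complex_def sum_nonneg)
  finally show ?thesis .
 qed
 have ucp: "restrict \<pi> B : ucp B d"
  unfolding ucp_def
 proof (intro CollectI conjI allI impI ballI)
  fix k :: nat and X and \<xi> :: "nat => complex vec"
  assume X: "ALL i<k. ALL j<k. X i j : B" "positive_matrix k X" and \<xi>: "ALL i<k. \<xi> i : carrier_vec d"
  obtain Y where Y: "!!i j. i < k ==> j < k ==> X i j = (\<Sum>l<k. star (Y l i) * Y l j)"
   using X(2) by (auto simp: positive_matrix_def)
  have "ALL i. EX b. i < k --> b : B & \<xi> i = \<pi> b *\<^sub>v \<xi>0" using cyc \<xi> by blast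
  then obtain b where b: "!!i. i < k ==> b i : B" "!!i. i < k ==> \<xi> i = \<pi> (b i) *\<^sub>v \<xi>0" by metis
  have mem: "star (b i) * X i j * b j : B" if "i < k" "j < k" for i j
   using b(1)[OF that(1)] b(1)[OF that(2)] X(1) that by (intro B_props(5) B_props(8)) auto
  let ?Z = "\<Sum>l<k. star (\<Sum>i<k. Y l i * b i) * (\<Sum>j<k. Y l j * b j)"
  have "(\<Sum>i<k. \<Sum>j<k. star (b i) * X i j * b j) = (\<Sum>i<k. \<Sum>j<k. \<Sum>l<k. star (Y l i * b i) * (Y l j * b j))"
   by (intro sum.cong refl) (simp add: Y star_mult sum_distrib_left sum_distrib_right mult.assoc)
  also have "... = (\<Sum>i<k. \<Sum>l<k. \<Sum>j<k. star (Y l i * b i) * (Y l j * b j))"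
   by (rule sum.cong[OF refl], rule sum.swap)
  also have "... = (\<Sum>l<k. \<Sum>i<k. \<Sum>j<k. star (Y l i * b i) * (Y l j * b j))" by (rule sum.swap)
  also have "... = ?Z" by (simp only: star_sum sum_product)
  finally have Z: "(\<Sum>i<k. \<Sum>j<k. star (b i) * X i j * b j) = ?Z" .
  have row: "(\<Sum>j<k. star (b i) * X i j * b j) : B" if "i < k" for i by (rule B_sum) (use mem that in simp)
  have ZB: "?Z : B" unfolding Z[symmetric] by (rule B_sum) (use row in simp)
  have "(\<Sum>i<k. \<Sum>j<k. (restrict \<pi> B (X i j) *\<^sub>v \<xi> j) \<bullet>c \<xi> i) = (\<Sum>i<k. \<Sum>j<k. f (star (b i) * X i j * b j))"
   by (intro sum.cong refl) (use X(1) b in \<open>simp add: f_form\<close>)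
  also have "... = (\<Sum>i<k. f (\<Sum>j<k. star (b i) * X i j * b j))"
   by (intro sum.cong refl f_sum[symmetric]) (use mem in simp)
  also have "... = f (\<Sum>i<k. \<Sum>j<k. star (b i) * X i j * b j)"
   by (rule f_sum[symmetric]) (use row in simp)
  finally have eq: "(\<Sum>i<k. \<Sum>j<k. (restrict \<pi> B (X i j) *\<^sub>v \<xi> j) \<bullet>c \<xi> i) = f ?Z" by (simp only: Z)
  show "0 <= (\<Sum>i<k. \<Sum>j<k. (restrict \<pi> B (X i j) *\<^sub>v \<xi> j) \<bullet>c \<xi> i)"
   unfolding eq by (rule f_pos[OF ZB]) (intro cpos_sum cpos_star_mult)
 next
  show "restrict \<pi> B : B \<rightarrow>\<^sub>E carrier_mat d d" using C by auto
  show "0 < d" by (rule d)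
  show "restrict \<pi> B 1 = 1\<^sub>m d" by (simp add: B_props(1) one)
  show "restrict \<pi> B (x + y) = restrict \<pi> B x + restrict \<pi> B y" if "x : B" "y : B" for x y
   using that B_props(3)[OF that] by (simp add: add)
  show "restrict \<pi> B (scaleC c x) = c \<cdot>\<^sub>m restrict \<pi> B x" if "x : B" for c x
   using that B_props(6)[OF that] by (simp add: sc)
 qed
 obtain \<theta> where \<theta>: "cp_map d \<theta>" "!!b. b : B ==> \<theta> b = restrict \<pi> B b"
  by (rule ucp_extension[OF B_os ucp]; (assumption | (rule that; (assumption | simp))))
 have \<theta>B: "\<theta> b = \<pi> b" if "b : B" for b using \<theta>(2)[OF that] that by simp
 have t1: "\<theta> 1 = 1\<^sub>m d" using \<theta>B[OF B_props(1)] one by simp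
 have un: "unitary_mat d (\<theta> w)" if w: "w : B" "star w * w = 1" for w
  by (rule unitary_of_isometry) (use C[OF w(1)] mul[OF B_props(8)[OF w(1)] w(1)] st[OF w(1)] w one in \<open>simp_all add: \<theta>B\<close>)
 have "EX c. A = c \<cdot>\<^sub>m 1\<^sub>m d"
  if A: "A : carrier_mat d d" "adj A = A" and c: "A * \<theta> u = \<theta> u * A" "A * \<theta> v = \<theta> v * A" for A
 proof (rule schur[OF A(1)])
  note Ct = cp_carrier[OF \<theta>(1)]
  note md = multiplicative_domain(1)[OF \<theta>(1) t1 un[OF uv_B(1) u(1)] un[OF uv_B(2) v(1)]]
  have ent: "continuous_on UNIV (%b. \<theta> b $$ (i, j))" if "i < d" "j < d" for i j
   using bounded_linear.continuous_on[OF cp_entry_continuous[OF \<theta>(1) t1 that] continuous_on_id] by simp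
  let ?T = "B \<inter> {b. A * \<theta> b = \<theta> b * A}"
  have "closed {b. A * \<theta> b = \<theta> b * A}"
  proof (rule closed_mat_eq[OF mult_carrier_mat[OF A(1) Ct] mult_carrier_mat[OF Ct A(1)]])
   fix i j assume ij: "i < d" "j < d"
   show "continuous_on UNIV (%b. (A * \<theta> b) $$ (i, j))"
    by (rule continuous_mult_entry[where F = "%_. A" and G = \<theta>, OF A(1) Ct continuous_on_const ent ij])
   show "continuous_on UNIV (%b. (\<theta> b * A) $$ (i, j))"
    by (rule continuous_mult_entry[where F = \<theta> and G = "%_. A", OF Ct A(1) ent continuous_on_const ij])
  qed
  then have cl: "closed ?T" using B_props(11) by (rule closed_Int[rotated])
  have st': "A * \<theta> (star b) = \<theta> (star b) * A" if "A * \<theta> b = \<theta> b * A" for b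
   using arg_cong[OF that, of adj] unfolding adjoint_mult[OF A(1) Ct] adjoint_mult[OF Ct A(1)] A(2) cp_star[OF \<theta>(1)] by (rule sym)
  have mu': "A * \<theta> (a * b) = \<theta> (a * b) * A" if "b : B" "A * \<theta> a = \<theta> a * A" "A * \<theta> b = \<theta> b * A" for a b
  proof -
   have "A * (\<theta> a * \<theta> b) = A * \<theta> a * \<theta> b" by (rule assoc_mult_mat[symmetric, OF A(1) Ct Ct])
   also have "... = \<theta> a * (A * \<theta> b)" unfolding that(2) by (rule assoc_mult_mat[OF Ct A(1) Ct])
   also have "... = \<theta> a * \<theta> b * A" unfolding that(3) by (rule assoc_mult_mat[symmetric, OF Ct Ct A(1)])
   finally show ?thesis unfolding md[OF that(1)] .
  qed
  have "cstar_subalgebra ?T"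
   unfolding cstar_subalgebra_def operator_system_def
  proof (intro conjI ballI allI)
   show "1 : ?T" using B_props(1) A(1) by (simp add: t1)
   show "closed ?T" by (rule cl)
   fix x assume "x : ?T"
   then have x: "x : B" "A * \<theta> x = \<theta> x * A" by blast+
   have "A * \<theta> (scaleC c x) = \<theta> (scaleC c x) * A" for c
    unfolding cp_scaleC[OF \<theta>(1)] mult_smult_distrib[OF A(1) Ct] mult_smult_assoc_mat[OF Ct A(1)] x(2) ..
   then show "scaleC c x : ?T" for c using B_props(6)[OF x(1)] by blast
   show "star x : ?T" using B_props(8)[OF x(1)] st'[OF x(2)] by blast
   fix y assume "y : ?T"
   then have y: "y : B" "A * \<theta> y = \<theta> y * A" by blast+
   have "A * \<theta> (x + y) = \<theta> (x + y) * A"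
    unfolding cp_add[OF \<theta>(1)] mult_add_distrib_mat[OF A(1) Ct Ct] add_mult_distrib_mat[OF Ct Ct A(1)] x(2) y(2) ..
   then show "x + y : ?T" using B_props(3)[OF x(1) y(1)] by blast
   show "x * y : ?T" using B_props(5)[OF x(1) y(1)] mu'[OF y(1) x(2) y(2)] by blast
  qed
  then have "B <= ?T" by (rule B_least) (simp_all add: uv_B c)
  then show "A * \<pi> b = \<pi> b * A" if "b : B" for b using that \<theta>B by auto
 qed
 then have "irrep d \<theta>" unfolding irrep_def using d \<theta>(1) t1 un[OF uv_B(1) u(1)] un[OF uv_B(2) v(1)] by blast
 then show ?thesis by (rule that) (rule \<theta>B)
qed

lemma boundary_absolute_extreme:
 assumes "boundary_representation_mat S d \<pi>"
 shows "restrict \<pi> S : absolute_matrix_extreme_points S d"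
proof -
 have \<pi>: "star_representation_mat B d \<pi>" and irr: "irreducible_mat B d \<pi>"
  using assms by (simp_all add: boundary_representation_mat_def)
 have d: "0 < d" using irr by (simp add: irreducible_mat_def)
 have C: "\<pi> b : carrier_mat d d" if "b : B" for b using \<pi> that by (auto simp: star_representation_mat_def)
 have add: "\<pi> (a + b) = \<pi> a + \<pi> b" and mul: "\<pi> (a * b) = \<pi> a * \<pi> b" if "a : B" "b : B" for a b
  using \<pi> that by (simp_all add: star_representation_mat_def)
 have sc: "\<pi> (scaleC c b) = c \<cdot>\<^sub>m \<pi> b" if "b : B" for b c
  using \<pi> that by (simp_all add: star_representation_mat_def)
 have one: "\<pi> 1 = 1\<^sub>m d" using \<pi> by (simp add: star_representation_mat_def)
 let ?x = "unit_vec d 0 :: complex vec"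
 have x: "?x : carrier_vec d" by simp
 let ?W = "(%b. \<pi> b *\<^sub>v ?x) ` B"
 have "?W = {0\<^sub>v d} | ?W = carrier_vec d"
 proof (rule irreducible_matD[OF irr])
  show "?W <= carrier_vec d" using C by auto
  have "\<pi> (scaleC 0 1) *\<^sub>v ?x = 0\<^sub>v d" unfolding sc[OF B_props(1)] one by (intro eq_vecI) auto
  then show "0\<^sub>v d : ?W" using B_props(2) by (intro image_eqI[of _ _ 0]) simp_all
  show "a + b : ?W" if m: "a : ?W" "b : ?W" for a b
  proof -
   obtain a' b' where ab: "a' : B" "b' : B" "a = \<pi> a' *\<^sub>v ?x" "b = \<pi> b' *\<^sub>v ?x" using m by auto
   have "a + b = \<pi> (a' + b') *\<^sub>v ?x"
    unfolding ab(3,4) add[OF ab(1,2)] by (rule add_mult_distrib_mat_vec[symmetric, OF C[OF ab(1)] C[OF ab(2)] x])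
   then show ?thesis using B_props(3)[OF ab(1,2)] by blast
  qed
  show "c \<cdot>\<^sub>v a : ?W" if m: "a : ?W" for a c
  proof -
   obtain a' where a: "a' : B" "a = \<pi> a' *\<^sub>v ?x" using m by auto
   have "c \<cdot>\<^sub>v a = \<pi> (scaleC c a') *\<^sub>v ?x"
    unfolding a(2) sc[OF a(1)] using C[OF a(1)] by (intro eq_vecI) auto
   then show ?thesis using B_props(6)[OF a(1)] by blast
  qed
  show "\<pi> a *\<^sub>v y : ?W" if a: "a : B" and y: "y : ?W" for a y
  proof -
   obtain b where b: "b : B" "y = \<pi> b *\<^sub>v ?x" using y by auto
   have "\<pi> a *\<^sub>v y = \<pi> (a * b) *\<^sub>v ?x"
    unfolding b(2) mul[OF a b(1)] by (rule assoc_mult_mat_vec[symmetric, OF C[OF a] C[OF b(1)] x])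
   then show ?thesis using B_props(5)[OF a b(1)] by blast
  qed
 qed
 moreover have "?x : ?W" using B_props(1) by (intro image_eqI[of _ _ 1]) (simp_all add: one)
 moreover have "?x ~= 0\<^sub>v d"
 proof
  assume "?x = 0\<^sub>v d"
  then have "?x $ 0 = 0\<^sub>v d $ 0" by simp
  then show False using d by simp
 qed
 ultimately have W: "?W = carrier_vec d" by auto
 have schur: "EX c. A = c \<cdot>\<^sub>m 1\<^sub>m d" if A: "A : carrier_mat d d" and comm: "!!b. b : B ==> A * \<pi> b = \<pi> b * A" for A
 proof -
  obtain c where "eigenvalue A c" using spectrum_non_empty[OF A d] by (auto simp: spectrum_def)
  then obtain y where y: "y : carrier_vec d" "y ~= 0\<^sub>v d" "A *\<^sub>v y = c \<cdot>\<^sub>v y"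
   using A by (auto simp: eigenvalue_def eigenvector_def)
  let ?E = "{y : carrier_vec d. A *\<^sub>v y = c \<cdot>\<^sub>v y}"
  have "?E = {0\<^sub>v d} | ?E = carrier_vec d"
  proof (rule irreducible_matD[OF irr])
   show "0\<^sub>v d : ?E" using A by auto
   show "a + b : ?E" if "a : ?E" "b : ?E" for a b
    using that mult_add_distrib_mat_vec[OF A, of a b] smult_add_distrib_vec[of a d b c] by auto
   show "k \<cdot>\<^sub>v a : ?E" if "a : ?E" for a k
    using that mult_mat_vec[OF A, of a k] by (auto simp: smult_smult_assoc mult.commute)
   show "\<pi> b *\<^sub>v a : ?E" if b: "b : B" and a: "a : ?E" for a b
   proof -
    have "A *\<^sub>v (\<pi> b *\<^sub>v a) = \<pi> b *\<^sub>v (A *\<^sub>v a)"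
     using assoc_mult_mat_vec[OF A C[OF b], of a] assoc_mult_mat_vec[OF C[OF b] A, of a] comm[OF b] a by auto
    then show ?thesis using a mult_mat_vec[OF C[OF b], of a c] C[OF b] by auto
   qed
  qed auto
  then have E: "?E = carrier_vec d" using y by auto
  have "A = c \<cdot>\<^sub>m 1\<^sub>m d"
  proof (rule mat_eq_vecI[OF A])
   fix z :: "complex vec" assume z: "z : carrier_vec d"
   then have "A *\<^sub>v z = c \<cdot>\<^sub>v z" using E by blast
   then show "A *\<^sub>v z = (c \<cdot>\<^sub>m 1\<^sub>m d) *\<^sub>v z" using z by (auto intro!: eq_vecI)
  qed simp
  then show ?thesis by blast
 qed
 have "EX \<theta>. irrep d \<theta> & (\<forall>b\<in>B. \<theta> b = \<pi> b)"
 proof (rule irrep_of_star_rep[OF \<pi> d x])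
  show "\<exists>b\<in>B. \<xi> = \<pi> b *\<^sub>v ?x" if "\<xi> : carrier_vec d" for \<xi> using W that by blast
  show "EX c. A = c \<cdot>\<^sub>m 1\<^sub>m d" if "A : carrier_mat d d" "!!b. b : B ==> A * \<pi> b = \<pi> b * A" for A
   by (rule schur[OF that])
  show "EX \<theta>. irrep d \<theta> & (\<forall>b\<in>B. \<theta> b = \<pi> b)" if "irrep d \<theta>" "!!b. b : B ==> \<theta> b = \<pi> b" for \<theta>
   using that by blast
 qed
 then obtain \<theta> where \<theta>: "irrep d \<theta>" "!!b. b : B ==> \<theta> b = \<pi> b" by blast
 have "restrict \<pi> S = restrict \<theta> S" using \<theta>(2) S_B by (intro restrict_ext) auto
 then show ?thesis using irrep_absolute_extreme[OF \<theta>(1)] by simp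
qed

end

section \<open>Irreducible representations on Hilbert spaces\<close>

lemma cinner_add_right: "cinner x (y + z :: 'h::complex_hilbert_space) = cinner x y + cinner x z"
 by (metis cinner_add_left cinner_commute complex_cnj_add)

lemma cinner_scaleC_right: "cinner x (scaleC c y :: 'h::complex_hilbert_space) = cnj c * cinner x y"
 by (metis cinner_scaleC_left cinner_commute complex_cnj_mult)

lemma cinner_zero [simp]: "cinner 0 (y::'h::complex_hilbert_space) = 0" "cinner y 0 = 0"
 using cinner_add_left[of 0 0 y] cinner_add_right[of y 0 0] by auto

lemma cinner_diff_left: "cinner (x - y) (z :: 'h::complex_hilbert_space) = cinner x z - cinner y z"
 using cinner_add_left[of "x - y" y z] by simp

lemma cinner_diff_right: "cinner z (x - y :: 'h::complex_hilbert_space) = cinner z x - cinner z y"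
 using cinner_add_right[of z "x - y" y] by simp

lemma cinner_sum_left: "cinner (sum f I) (y :: 'h::complex_hilbert_space) = (\<Sum>i\<in>I. cinner (f i) y)"
 by (induction I rule: infinite_finite_induct) (auto simp: cinner_add_left)

lemma norm_cinner: "(norm (x :: 'h::complex_hilbert_space))\<^sup>2 = Re (cinner x x)"
 by (simp add: cinner_norm)

lemma cinner_unit_bounded:
 fixes e :: "'h::complex_hilbert_space"
 assumes e: "cinner e e = 1"
 shows "bounded_linear (%x. cinner x e)"
proof (rule bounded_linear_intro[of _ 1])
 show "cinner (x + y) e = cinner x e + cinner y e" for x y by (rule cinner_add_left)
 show "cinner (r *\<^sub>R x) e = r *\<^sub>R cinner x e" for r x
  by (simp add: scaleR_scaleC cinner_scaleC_left scaleR_conv_of_real)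
 show "norm (cinner x e) <= norm x * 1" for x
 proof -
  let ?t = "cinner x e"
  have "cinner (x - scaleC ?t e) (x - scaleC ?t e) = cinner x x - ?t * cnj ?t"
   using cinner_commute[of e x]
   by (simp add: cinner_diff_left cinner_diff_right cinner_scaleC_left cinner_scaleC_right e)
  then have "(norm (x - scaleC ?t e))\<^sup>2 = (norm x)\<^sup>2 - (cmod ?t)\<^sup>2"
   by (simp add: norm_cinner complex_norm_square[symmetric])
  then have "(cmod ?t)\<^sup>2 <= (norm x)\<^sup>2" using zero_le_power2[of "norm (x - scaleC ?t e)"] by linarith
  then show ?thesis by (simp add: power2_le_iff_abs_le)
 qed
qed

context rotation_pair
begin

lemma limit_scalar:
 fixes w :: "'h::complex_hilbert_space => 'h"
 assumes "!!c. 0 < c ==> EX l. cmod l = 1 & (ALL \<xi>. (norm (w \<xi> - scaleC l \<xi>))\<^sup>2 <= c * (norm \<xi>)\<^sup>2)"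
 obtains l where "cmod l = 1" "!!\<xi>. w \<xi> = scaleC l \<xi>"
proof -
 have "ALL k. EX l. cmod l = 1 & (ALL \<xi>. (norm (w \<xi> - scaleC l \<xi>))\<^sup>2 <= inverse (real (Suc k)) * (norm \<xi>)\<^sup>2)"
  using assms by simp
 then obtain z where z: "!!k. cmod (z k) = 1" "!!k \<xi>. (norm (w \<xi> - scaleC (z k) \<xi>))\<^sup>2 <= inverse (real (Suc k)) * (norm \<xi>)\<^sup>2"
  by metis
 obtain r :: "nat => nat" and l where r: "strict_mono r" and lim: "(%k. z (r k)) \<longlonglongrightarrow> l" and l: "cmod l = 1"
  by (rule unit_circle_subseq[of z, OF z(1)])
 have "w \<xi> = scaleC l \<xi>" for \<xi>
 proof -
  have "norm (w \<xi> - scaleC l \<xi>) <= sqrt (inverse (real (Suc (r k)))) * norm \<xi> + cmod (z (r k) - l) * norm \<xi>" for k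
  proof -
   have "norm (w \<xi> - scaleC (z (r k)) \<xi>) <= sqrt (inverse (real (Suc (r k))) * (norm \<xi>)\<^sup>2)"
    by (rule real_le_rsqrt[OF z(2)])
   also have "... = sqrt (inverse (real (Suc (r k)))) * norm \<xi>" by (simp only: real_sqrt_mult real_sqrt_abs abs_norm_cancel)
   finally have 1: "norm (w \<xi> - scaleC (z (r k)) \<xi>) <= sqrt (inverse (real (Suc (r k)))) * norm \<xi>" .
   have "w \<xi> - scaleC l \<xi> = (w \<xi> - scaleC (z (r k)) \<xi>) + scaleC (z (r k) - l) \<xi>" by (simp add: scaleC_diff_left)
   then have "norm (w \<xi> - scaleC l \<xi>) <= norm (w \<xi> - scaleC (z (r k)) \<xi>) + norm (scaleC (z (r k) - l) \<xi>)"
    by (simp only: norm_triangle_ineq)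
   then show ?thesis using 1 by (simp add: norm_scaleC)
  qed
  moreover have "(%k. sqrt (inverse (real (Suc (r k)))) * norm \<xi> + cmod (z (r k) - l) * norm \<xi>) \<longlonglongrightarrow> sqrt 0 * norm \<xi> + cmod (l - l) * norm \<xi>"
   using LIMSEQ_subseq_LIMSEQ[OF LIMSEQ_inverse_real_of_nat r] lim
   by (intro tendsto_intros) (simp_all add: o_def)
  ultimately have "norm (w \<xi> - scaleC l \<xi>) <= sqrt 0 * norm \<xi> + cmod (l - l) * norm \<xi>"
   by (intro LIMSEQ_le_const[of _ _ "norm (w \<xi> - scaleC l \<xi>)"]) auto
  then show ?thesis by simp
 qed
 with l show ?thesis by (rule that)
qed

end

locale irreducible_operator_rep = rotation_pair u v q n
 for u v :: "'a::unital_cstar_algebra" and q n +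
 fixes \<pi> :: "'a => 'h::complex_hilbert_space => 'h"
 assumes rep: "star_representation_op (generated_cstar (generated_operator_system {u, v})) \<pi>"
  and irr: "irreducible_op (generated_cstar (generated_operator_system {u, v})) \<pi>"
begin

lemma bl: "b : B ==> bounded_linear (\<pi> b)"
 and \<pi>_scaleC: "b : B ==> \<pi> b (scaleC c x) = scaleC c (\<pi> b x)"
 using rep by (auto simp: star_representation_op_def bounded_operator_def)

lemma \<pi>_add: "a : B ==> b : B ==> \<pi> (a + b) x = \<pi> a x + \<pi> b x"
 and \<pi>_sc: "b : B ==> \<pi> (scaleC c b) x = scaleC c (\<pi> b x)"
 and \<pi>_mult: "a : B ==> b : B ==> \<pi> (a * b) x = \<pi> a (\<pi> b x)"
 and \<pi>_star: "b : B ==> cinner (\<pi> (star b) x) y = cinner x (\<pi> b y)"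
 and \<pi>_1: "\<pi> 1 x = x"
 using rep by (auto simp: star_representation_op_def)

lemma \<pi>_star': "b : B ==> cinner (\<pi> b x) y = cinner x (\<pi> (star b) y)"
 using \<pi>_star[of "star b" x y] B_props(8) by (simp add: star_star)

lemma \<pi>_diff: "a : B ==> b : B ==> \<pi> (a - b) x = \<pi> a x - \<pi> b x"
 using \<pi>_add[of "a - b" b x] B_props(4)[of a b] by simp

lemma \<pi>_0: "\<pi> 0 x = 0" using \<pi>_diff[of 1 1 x] B_props(1) by simp

lemma \<pi>_sum: "(!!i. i : I ==> f i : B) ==> \<pi> (sum f I) x = (\<Sum>i\<in>I. \<pi> (f i) x)"
proof (induction I rule: infinite_finite_induct)
 case (insert i I)
 have "f i : B" "sum f I : B" using insert.prems by (auto intro!: B_sum)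
 then show ?case using insert by (simp add: \<pi>_add)
qed (simp_all add: \<pi>_0)

lemma \<pi>_scaleR: "b : B ==> \<pi> (r *\<^sub>R b) x = scaleC (of_real r) (\<pi> b x)"
 by (simp add: scaleR_scaleC \<pi>_sc)

lemma \<pi>_norm: "b : B ==> cinner (\<pi> (star b * b) x) x = of_real ((norm (\<pi> b x))\<^sup>2)"
 using \<pi>_mult[of "star b" b x] \<pi>_star[of b "\<pi> b x" x] B_props(8) by (simp add: cinner_norm)

lemma \<pi>_pos:
 assumes a: "cpos a" "a : B"
 shows "0 <= Re (cinner (\<pi> a x) x)"
proof -
 obtain d where d: "star d = d" "a = d * d" "calculus_of a d" by (rule cpos_sqrt[OF a(1)])
 have "d : B" by (rule calculus_of_mem[OF d(3) B_alg a(2)])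
 then show ?thesis using \<pi>_norm[of d x] d by simp
qed

lemma \<pi>_contractive:
 assumes b: "b : B"
 shows "norm (\<pi> b x) <= norm b * norm x"
proof -
 have bb: "star b * b : B" "1 : B" using B_props(1,5,8) b by auto
 have "cpos ((norm b)\<^sup>2 *\<^sub>R 1 - star b * b)"
  by (rule cpos_scalar_minus) (simp_all add: star_mult star_star cstar_identity)
 then have "0 <= Re (cinner (\<pi> ((norm b)\<^sup>2 *\<^sub>R 1 - star b * b) x) x)" by (rule \<pi>_pos) (use bb B_props(4,7) in auto)
 also have "\<pi> ((norm b)\<^sup>2 *\<^sub>R 1 - star b * b) x = scaleC (of_real ((norm b)\<^sup>2)) x - \<pi> (star b * b) x"
  using bb B_props(7) by (simp only: \<pi>_diff \<pi>_scaleR \<pi>_1)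
 finally have "(norm (\<pi> b x))\<^sup>2 <= (norm b * norm x)\<^sup>2"
  by (simp add: cinner_diff_left cinner_scaleC_left \<pi>_norm[OF b] cinner_norm power_mult_distrib)
 then show ?thesis by (simp add: power2_le_iff_abs_le)
qed

lemma nontrivial: obtains x :: 'h where "x ~= 0"
 using irr by (auto simp: irreducible_op_def)

lemma invariant_subspace:
 assumes "closed W" "0 : W" "!!x y. x : W ==> y : W ==> x + y : W" "!!c x. x : W ==> scaleC c x : W"
  "!!a x. a : B ==> x : W ==> \<pi> a x : W" "z : W" "z ~= 0"
 shows "x : W"
proof -
 have "W = {0} | W = UNIV"
  by (rule irr[unfolded irreducible_op_def, THEN conjunct2, THEN spec, THEN mp, THEN mp, THEN mp, THEN mp, THEN mp])
   (simp_all add: assms(1-5))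
 then show ?thesis using assms(6,7) by auto
qed

text \<open>Of the positive parts \<open>p\<close> which cover \<open>1\<close> one acts nontrivially; the corresponding negative part
  \<open>m\<close> is central with \<open>m p = 0\<close>, so its kernel is a nonzero invariant subspace and \<open>m\<close> acts as \<open>0\<close>.\<close>

lemma nearly_scalar:
 assumes c: "0 < c"
 obtains l \<mu> where "cmod l = 1" "cmod \<mu> = 1"
  "!!\<xi>. (norm (\<pi> (u ^ n) \<xi> - scaleC l \<xi>))\<^sup>2 + (norm (\<pi> (v ^ n) \<xi> - scaleC \<mu> \<xi>))\<^sup>2 <= c * (norm \<xi>)\<^sup>2"
proof -
 obtain X :: "(complex \<times> complex) set" and p m :: "complex \<times> complex => 'a" and \<delta> :: real
  where X: "finite X" "0 < \<delta>" "!!l \<mu>. (l, \<mu>) : X ==> cmod l = 1 & cmod \<mu> = 1"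
  and p: "!!x. cpos (p x)" "!!x. cpos (m x)" "!!l \<mu>. c *\<^sub>R 1 - gp l \<mu> = p (l, \<mu>) - m (l, \<mu>)"
  "!!x. p x * m x = 0"
  "!!l \<mu>. calculus_of (gp l \<mu>) (p (l, \<mu>))"  "!!l \<mu>. calculus_of (gp l \<mu>) (m (l, \<mu>))"
  "cpos ((\<Sum>x\<in>X. p x) - \<delta> *\<^sub>R 1)"
  by (rule cover[OF c], rule that)
 have pB: "p x : B" for x using calculus_of_mem[OF p(5) B_alg gap_in_B, of "fst x" "snd x"] by (simp only: prod.collapse)
 have mB: "m x : B" for x using calculus_of_mem[OF p(6) B_alg gap_in_B, of "fst x" "snd x"] by (simp only: prod.collapse)
 have "\<exists>x\<in>X. EX \<xi>. \<pi> (p x) \<xi> ~= 0"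
 proof (rule ccontr)
  assume "\<not> ?thesis"
  then have z: "\<pi> (p x) \<xi> = 0" if "x : X" for x \<xi> using that by blast
  obtain x :: 'h where x: "x ~= 0" by (rule nontrivial)
  have sB: "(\<Sum>x\<in>X. p x) : B" by (rule B_sum) (rule pB)
  have "\<pi> ((\<Sum>x\<in>X. p x) - \<delta> *\<^sub>R 1) x = - scaleC (of_real \<delta>) x"
   using \<pi>_diff[OF sB B_props(7)[OF B_props(1)]] \<pi>_scaleR[OF B_props(1)] \<pi>_sum[of X p] pB z by (simp add: \<pi>_1)
  moreover have "0 <= Re (cinner (\<pi> ((\<Sum>x\<in>X. p x) - \<delta> *\<^sub>R 1) x) x)"
   by (rule \<pi>_pos[OF p(7)]) (intro B_props(4) sB B_props(7) B_props(1))
  ultimately have "\<delta> * (norm x)\<^sup>2 <= 0"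
   by (simp del: scaleC_minus_left add: scaleC_minus_left[symmetric] cinner_scaleC_left cinner_norm)
  then show False using X(2) x by (simp add: mult_le_0_iff)
 qed
 then obtain y z where y: "y : X" "\<pi> (p y) z ~= 0" by blast
 obtain l \<mu> where "y = (l, \<mu>)" by (rule prod.exhaust)
 with y have x: "(l, \<mu>) : X" and z: "\<pi> (p (l, \<mu>)) z ~= 0" by (simp_all only: not_False_eq_True)
 let ?p = "p (l, \<mu>)" and ?m = "m (l, \<mu>)"
 have mp: "?m * ?p = 0"
  using arg_cong[OF p(4)[of "(l, \<mu>)"], of star] cpos_selfadjoint[OF p(1)] cpos_selfadjoint[OF p(2)] by (simp add: star_mult)
 have mb: "b * ?m = ?m * b" if "b : B" for b by (rule calculus_of_comm[OF p(6) gap_commutes_B[OF that, symmetric]])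
 have m0: "\<pi> ?m \<xi> = 0" for \<xi>
 proof -
  let ?W = "{\<xi>. \<pi> ?m \<xi> = 0}"
  have "\<xi> : ?W"
  proof (rule invariant_subspace[of ?W "\<pi> ?p z"])
   show "closed ?W"
    by (rule closed_Collect_eq[OF bounded_linear.continuous_on[OF bl[OF mB] continuous_on_id] continuous_on_const])
   show "0 : ?W" using linear_0[OF bounded_linear.linear[OF bl[OF mB]]] by simp
   show "x + y : ?W" if "x : ?W" "y : ?W" for x y
    using that linear_add[OF bounded_linear.linear[OF bl[OF mB]]] by simp
   show "scaleC c x : ?W" if "x : ?W" for c x using that by (simp add: \<pi>_scaleC[OF mB])
   show "\<pi> a x : ?W" if a: "a : B" and x: "x : ?W" for a x
   proof -
    have "\<pi> ?m (\<pi> a x) = \<pi> a (\<pi> ?m x)" by (simp only: \<pi>_mult[OF mB a, symmetric] \<pi>_mult[OF a mB, symmetric] mb[OF a])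
    also have "\<pi> ?m x = 0" using x by simp
    also have "\<pi> a 0 = 0" by (rule linear_0[OF bounded_linear.linear[OF bl[OF a]]])
    finally show ?thesis by simp
   qed
   show "\<pi> ?p z : ?W" unfolding mem_Collect_eq \<pi>_mult[OF mB pB, symmetric] mp by (rule \<pi>_0)
  qed (rule z)
  then show ?thesis by simp
 qed
 have un: "u ^ n : B" "v ^ n : B" by (intro B_props(10) uv_B)+
 have "(norm (\<pi> (u ^ n) \<xi> - scaleC l \<xi>))\<^sup>2 + (norm (\<pi> (v ^ n) \<xi> - scaleC \<mu> \<xi>))\<^sup>2 <= c * (norm \<xi>)\<^sup>2" for \<xi>
 proof -
  let ?U = "u ^ n - scaleC l 1" and ?V = "v ^ n - scaleC \<mu> 1"
  have U: "?U : B" "?V : B"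
   by (rule B_props(4)[OF un(1) B_props(6)[OF B_props(1)]], rule B_props(4)[OF un(2) B_props(6)[OF B_props(1)]])
  note UB = U B_props(5)[OF B_props(8)[OF U(1)] U(1)] B_props(5)[OF B_props(8)[OF U(2)] U(2)]
  have g: "gp l \<mu> = star ?U * ?U + star ?V * ?V" by (simp add: gap_def)
  have "\<pi> (c *\<^sub>R 1 - gp l \<mu>) \<xi> = scaleC (of_real c) \<xi> - (\<pi> (star ?U * ?U) \<xi> + \<pi> (star ?V * ?V) \<xi>)"
   using UB B_props(1,3,7) unfolding g by (simp only: \<pi>_diff \<pi>_scaleR \<pi>_add \<pi>_1)
  moreover have "\<pi> (c *\<^sub>R 1 - gp l \<mu>) \<xi> = \<pi> ?p \<xi>"
   unfolding p(3) using \<pi>_diff[OF pB mB] m0 by simp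
  moreover have "0 <= Re (cinner (\<pi> ?p \<xi>) \<xi>)" by (rule \<pi>_pos[OF p(1) pB])
  ultimately have "0 <= Re (cinner (scaleC (of_real c) \<xi> - (\<pi> (star ?U * ?U) \<xi> + \<pi> (star ?V * ?V) \<xi>)) \<xi>)" by simp
  then have "(norm (\<pi> ?U \<xi>))\<^sup>2 + (norm (\<pi> ?V \<xi>))\<^sup>2 <= c * (norm \<xi>)\<^sup>2"
   by (simp del: star_diff add: cinner_diff_left cinner_add_left cinner_scaleC_left \<pi>_norm[OF UB(1)] \<pi>_norm[OF UB(2)] cinner_norm)
  moreover have "\<pi> ?U \<xi> = \<pi> (u ^ n) \<xi> - scaleC l \<xi>" "\<pi> ?V \<xi> = \<pi> (v ^ n) \<xi> - scaleC \<mu> \<xi>"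
   using un B_props(1,6) by (simp_all only: \<pi>_diff \<pi>_sc \<pi>_1)
  ultimately show ?thesis by simp
 qed
 then show ?thesis by (rule that[OF conjunct1[OF X(3)[OF x]] conjunct2[OF X(3)[OF x]]])
qed

lemma central_scalars:
 obtains l \<mu> where "cmod l = 1" "cmod \<mu> = 1" "!!\<xi>. \<pi> (u ^ n) \<xi> = scaleC l \<xi>" "!!\<xi>. \<pi> (v ^ n) \<xi> = scaleC \<mu> \<xi>"
proof -
 have 1: "EX l. cmod l = 1 & (ALL \<xi>. (norm (\<pi> (u ^ n) \<xi> - scaleC l \<xi>))\<^sup>2 <= c * (norm \<xi>)\<^sup>2)" if c: "0 < c" for c
 proof (rule nearly_scalar[OF c])
  fix l \<mu> :: complex
  assume l: "cmod l = 1" and le: "!!\<xi>. (norm (\<pi> (u ^ n) \<xi> - scaleC l \<xi>))\<^sup>2 + (norm (\<pi> (v ^ n) \<xi> - scaleC \<mu> \<xi>))\<^sup>2 <= c * (norm \<xi>)\<^sup>2"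
  have "(norm (\<pi> (u ^ n) \<xi> - scaleC l \<xi>))\<^sup>2 <= c * (norm \<xi>)\<^sup>2" for \<xi>
   using le[of \<xi>] zero_le_power2[of "norm (\<pi> (v ^ n) \<xi> - scaleC \<mu> \<xi>)"] by linarith
  then show ?thesis using l by blast
 qed
 have 2: "EX l. cmod l = 1 & (ALL \<xi>. (norm (\<pi> (v ^ n) \<xi> - scaleC l \<xi>))\<^sup>2 <= c * (norm \<xi>)\<^sup>2)" if c: "0 < c" for c
 proof (rule nearly_scalar[OF c])
  fix l \<mu> :: complex
  assume l: "cmod \<mu> = 1" and le: "!!\<xi>. (norm (\<pi> (u ^ n) \<xi> - scaleC l \<xi>))\<^sup>2 + (norm (\<pi> (v ^ n) \<xi> - scaleC \<mu> \<xi>))\<^sup>2 <= c * (norm \<xi>)\<^sup>2"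
  have "(norm (\<pi> (v ^ n) \<xi> - scaleC \<mu> \<xi>))\<^sup>2 <= c * (norm \<xi>)\<^sup>2" for \<xi>
   using le[of \<xi>] zero_le_power2[of "norm (\<pi> (u ^ n) \<xi> - scaleC l \<xi>)"] by linarith
  then show ?thesis using l by blast
 qed
 obtain l where l: "cmod l = 1" "!!\<xi>. \<pi> (u ^ n) \<xi> = scaleC l \<xi>" by (rule limit_scalar[OF 1], assumption, rule that)
 obtain \<mu> where \<mu>: "cmod \<mu> = 1" "!!\<xi>. \<pi> (v ^ n) \<xi> = scaleC \<mu> \<xi>" by (rule limit_scalar[OF 2], assumption, rule that)
 show ?thesis by (rule that[OF l(1) \<mu>(1) l(2) \<mu>(2)])
qed

lemma eigenvector_exists:
 obtains e z where "cinner e e = 1" "cmod z = 1" "\<pi> u e = scaleC z e"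
proof -
 obtain l \<mu> where l: "cmod l = 1" "!!\<xi>. \<pi> (u ^ n) \<xi> = scaleC l \<xi>" by (rule central_scalars, rule that)
 obtain l0 where l0: "l0 ^ n = l" "cmod l0 = 1" by (rule unimodular_root[OF l(1) q_simps(1)])
 let ?u = "scaleC (cnj l0) u"
 have uB: "?u : B" by (rule B_props(6)[OF uv_B(1)])
 have ll: "l0 * cnj l0 = 1" "cnj l0 * l0 = 1" using l0(2) by (simp_all add: complex_norm_square[symmetric] mult.commute[of "cnj _"])
 have pw: "?u ^ k = scaleC (cnj l0 ^ k) (u ^ k)" for k
  by (induction k) (simp_all add: mult_scaleC_left mult_scaleC_right scaleC_scaleC mult.commute)
 have u1: "\<pi> (?u ^ n) \<xi> = \<xi>" for \<xi>
 proof -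
  have "\<pi> (?u ^ n) \<xi> = scaleC (cnj l0 ^ n * l0 ^ n) \<xi>"
   unfolding pw using \<pi>_sc[OF B_props(10)[OF uv_B(1)]] l(2) by (simp add: scaleC_scaleC l0(1))
  also have "cnj l0 ^ n * l0 ^ n = 1" by (simp only: power_mult_distrib[symmetric] ll power_one)
  finally show ?thesis by simp
 qed
 let ?P = "%j. root_average n ?u (q ^ j)"
 have PB: "?P j : B" for j by (rule root_average_B[OF uB])
 obtain x :: 'h where x: "x ~= 0" by (rule nontrivial)
 have "(\<Sum>j<n. \<pi> (?P j) x) = x"
  using \<pi>_sum[of "{..<n}" ?P x] PB root_average_sum[OF q, of ?u] by (simp add: \<pi>_1)
 then obtain j where y: "\<pi> (?P j) x ~= 0" using x sum.neutral[of "{..<n}" "%j. \<pi> (?P j) x"] by metis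
 let ?y = "\<pi> (?P j) x"
 have "(q ^ j) ^ n = (q ^ n) ^ j" by (simp only: power_mult[symmetric] mult.commute)
 then have qj: "cnj (q ^ j) * q ^ j = 1" "(q ^ j) ^ n = 1" by (simp_all add: qq q_simps(2))
 have "\<pi> (?u * ?P j - scaleC (q ^ j) (?P j)) x = \<pi> (scaleC (q ^ j / of_nat n) (?u ^ n - 1)) x"
  by (simp only: root_average_eigen[OF qj])
 also have "... = scaleC (q ^ j / of_nat n) (\<pi> (?u ^ n) x - \<pi> 1 x)"
  using B_props(1) B_props(4)[OF B_props(10)[OF uB] B_props(1)] B_props(10)[OF uB] by (simp only: \<pi>_sc \<pi>_diff)
 also have "... = 0" by (simp add: u1 \<pi>_1)
 finally have "\<pi> ?u ?y - scaleC (q ^ j) ?y = 0"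
  using B_props(5)[OF uB PB] B_props(6)[OF PB] PB uB by (simp only: \<pi>_diff \<pi>_mult \<pi>_sc)
 then have uy: "scaleC (cnj l0) (\<pi> u ?y) = scaleC (q ^ j) ?y" by (simp add: \<pi>_sc[OF uv_B(1)])
 have "\<pi> u ?y = scaleC l0 (scaleC (cnj l0) (\<pi> u ?y))" by (simp add: scaleC_scaleC ll)
 also have "... = scaleC (l0 * q ^ j) ?y" by (simp add: uy scaleC_scaleC)
 finally have eig: "\<pi> u ?y = scaleC (l0 * q ^ j) ?y" .
 define e where "e = scaleC (of_real (1 / norm ?y)) ?y"
 show ?thesis
 proof (rule that)
  have "norm e = 1" using y by (simp add: e_def norm_scaleC norm_divide)
  then show "cinner e e = 1" by (simp add: cinner_norm)
  show "cmod (l0 * q ^ j) = 1" by (simp add: norm_mult norm_power l0(2) q_simps(4))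
  show "\<pi> u e = scaleC (l0 * q ^ j) e" by (simp add: e_def \<pi>_scaleC[OF uv_B(1)] eig scaleC_scaleC mult.commute)
 qed
qed

text \<open>The orbit of an eigenvector of \<open>u\<close> under the powers of \<open>v\<close> is orthonormal, because the eigenvalues
  are distinct, and it spans a closed invariant subspace.\<close>

theorem orbit_basis:
 obtains e where "cinner e e = 1" "orthonormal_basis (map (%k. \<pi> (v ^ k) e) [0..<n])"
proof -
 obtain l \<mu> where \<mu>: "cmod \<mu> = 1" "!!\<xi>. \<pi> (v ^ n) \<xi> = scaleC \<mu> \<xi>" by (rule central_scalars, rule that)
 obtain e0 z where e0: "cinner e0 e0 = 1" and z: "cmod z = 1" and eig: "\<pi> u e0 = scaleC z e0" by (rule eigenvector_exists)
 define e where "e k = \<pi> (v ^ k) e0" for k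
 have vB: "v ^ k : B" for k by (rule B_props(10)[OF uv_B(2)])
 have sB: "star u : B" "star v : B" by (rule B_props(8)[OF uv_B(1)], rule B_props(8)[OF uv_B(2)])
 have zz: "z * cnj z = 1" using z by (simp add: complex_norm_square[symmetric])
 have ue: "\<pi> u (e k) = scaleC (z * q ^ k) (e k)" for k
 proof -
  have "\<pi> u (e k) = \<pi> (u * v ^ k) e0" by (simp add: e_def \<pi>_mult uv_B vB)
  also have "... = scaleC (q ^ k) (\<pi> (v ^ k) (\<pi> u e0))"
   unfolding u_vpow using \<pi>_sc[OF B_props(5)[OF vB uv_B(1)]] \<pi>_mult[OF vB uv_B(1)] by simp
  also have "... = scaleC (z * q ^ k) (e k)" by (simp add: eig \<pi>_scaleC[OF vB] scaleC_scaleC e_def mult.commute)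
  finally show ?thesis .
 qed
 have iso: "cinner (\<pi> w x) (\<pi> w y) = cinner x y" if "w : B" "star w * w = 1" for w x y
  using \<pi>_star[OF that(1), of "\<pi> w x" y] \<pi>_mult[OF B_props(8)[OF that(1)] that(1), of x] that(2) by (simp add: \<pi>_1)
 have on: "cinner (e j) (e k) = (if j = k then 1 else 0)" if jk: "j < n" "k < n" for j k
 proof (cases "j = k")
  case True
  then show ?thesis using iso[OF vB unitary_power[OF v(1)]] e0 by (simp add: e_def)
 next
  case False
  have "cinner (e j) (e k) = cinner (\<pi> u (e j)) (\<pi> u (e k))" by (rule iso[OF uv_B(1) u(1), symmetric])
  also have "... = (z * q ^ j) * cnj (z * q ^ k) * cinner (e j) (e k)"
   by (simp add: ue cinner_scaleC_left cinner_scaleC_right)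
  also have "(z * q ^ j) * cnj (z * q ^ k) = (z * cnj z) * (q ^ j * cnj q ^ k)" by simp
  finally have "(q ^ j * cnj q ^ k - 1) * cinner (e j) (e k) = 0" by (simp add: zz left_diff_distrib)
  moreover have "q ^ j * cnj q ^ k ~= 1"
  proof
   assume a: "q ^ j * cnj q ^ k = 1"
   have "q ^ j = q ^ j * (cnj q ^ k * q ^ k)" by (simp add: qq)
   also have "... = q ^ k" by (simp only: mult.assoc[symmetric] a mult_1_left)
   finally show False using qpow_inj[OF jk] False by simp
  qed
  ultimately show ?thesis using False by simp
 qed
 define M where "M = {x. x = (\<Sum>k<n. scaleC (cinner x (e k)) (e k))}"
 have M_add: "x + y : M" if "x : M" "y : M" for x y
  using that by (simp add: M_def cinner_add_left scaleC_add_left sum.distrib)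
 have M_sc: "scaleC c x : M" if "x : M" for c x
 proof -
  have "scaleC c x = scaleC c (\<Sum>k<n. scaleC (cinner x (e k)) (e k))" using that by (simp add: M_def)
  also have "... = (\<Sum>k<n. scaleC (cinner (scaleC c x) (e k)) (e k))"
   by (simp add: cinner_scaleC_left scaleC_sum_right scaleC_scaleC)
  finally show ?thesis unfolding M_def by (rule CollectI)
 qed
 have M_0: "0 : M" by (simp add: M_def)
 have M_sum: "sum f I : M" if "!!i. i : I ==> f i : M" for f :: "nat => 'h" and I
  using that
 proof (induction I rule: infinite_finite_induct)
  case (insert i I)
  have "f i + sum f I : M" by (rule M_add) (use insert in blast)+
  then show ?case by (simp only: sum.insert[OF insert(1,2)])
 qed (simp_all add: M_0)
 have eM: "e j : M" if "j < n" for j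
 proof -
  have "(\<Sum>k<n. scaleC (cinner (e j) (e k)) (e k)) = (\<Sum>k<n. if k = j then e j else 0)"
   by (rule sum.cong[OF refl]) (use that in \<open>auto simp: on\<close>)
  then show ?thesis using that by (simp add: M_def)
 qed
 have clM: "closed M"
 proof -
  have "continuous_on UNIV (%x. scaleC (cinner x (e k)) (e k))" if "k < n" for k
  proof -
   have "bounded_linear (%t. scaleC t (e k))"
    by (rule bounded_linear_intro[of _ "norm (e k)"])
     (simp_all add: scaleC_add_left norm_scaleC scaleR_scaleC scaleC_scaleC scaleR_conv_of_real)
   then show ?thesis
    using bounded_linear.continuous_on[OF bounded_linear_compose[OF _ cinner_unit_bounded] continuous_on_id] on[OF that that] by simp
  qed
  then show ?thesis unfolding M_def by (intro closed_Collect_eq continuous_on_id continuous_on_sum) auto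
 qed
 have M_inv: "\<pi> a x : M" if a: "a : B" "!!k. k < n ==> \<pi> a (e k) : M" and x: "x : M" for a x
 proof -
  have "\<pi> a x = \<pi> a (\<Sum>k<n. scaleC (cinner x (e k)) (e k))" using x by (simp add: M_def)
  also have "... = (\<Sum>k<n. scaleC (cinner x (e k)) (\<pi> a (e k)))"
   by (simp add: linear_sum[OF bounded_linear.linear[OF bl[OF a(1)]]] \<pi>_scaleC[OF a(1)])
  also have "... : M" by (intro M_sum M_sc a(2)) simp
  finally show ?thesis .
 qed
 define T where "T = {b : B. ALL k<n. \<pi> b (e k) : M & \<pi> (star b) (e k) : M}"
 have near: "EX r>0. \<forall>y\<in>B. norm (y - b) < r --> \<pi> y x \<notin> M" if b: "b : B" "\<pi> b x \<notin> M" for b x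
 proof -
  have "open (- M)" using clM by (simp add: closed_def)
  then obtain r where r: "0 < r" "!!y. dist y (\<pi> b x) < r ==> y : - M" using b(2) unfolding open_dist by blast
  have "\<pi> y x \<notin> M" if y: "y : B" "norm (y - b) < r / (norm x + 1)" for y
  proof -
   have "norm (\<pi> y x - \<pi> b x) <= norm (y - b) * norm x"
    using \<pi>_contractive[OF B_props(4)[OF y(1) b(1)], of x] \<pi>_diff[OF y(1) b(1)] by simp
   also have "... <= norm (y - b) * (norm x + 1)" by (intro mult_left_mono) auto
   also have "... < r" using y(2) by (simp add: pos_less_divide_eq add_nonneg_pos)
   finally show ?thesis using r(2)[of "\<pi> y x"] by (auto simp: dist_norm)
  qed
  moreover have "0 < r / (norm x + 1)" using r(1) by (intro divide_pos_pos add_nonneg_pos) auto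
  ultimately show ?thesis by blast
 qed
 have "open (- T)"
  unfolding open_dist
 proof
  fix b assume b: "b : - T"
  show "EX r>0. ALL y. dist y b < r --> y : - T"
  proof (cases "b : B")
   case False
   have "open (- B)" using B_props(11) by (simp add: closed_def)
   then obtain r where "0 < r" "!!y. dist y b < r ==> y : - B" using False unfolding open_dist by blast
   then show ?thesis by (auto simp: T_def)
  next
   case True
   then obtain k where k: "k < n" "\<pi> b (e k) \<notin> M | \<pi> (star b) (e k) \<notin> M" using b by (auto simp: T_def)
   show ?thesis
   proof (cases "\<pi> b (e k) : M")
    case False
    then obtain r where r: "0 < r" "\<forall>y\<in>B. norm (y - b) < r --> \<pi> y (e k) \<notin> M" using near[OF True] by blast
    then show ?thesis using k(1) by (intro exI[of _ r]) (auto simp: T_def dist_norm)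
   next
    case 2: True
    then obtain r where r: "0 < r" "\<forall>y\<in>B. norm (y - star b) < r --> \<pi> y (e k) \<notin> M"
     using near[OF B_props(8)[OF True]] k(2) by blast
    have "y : - T" if y: "dist y b < r" for y
    proof -
     have "norm (star y - star b) < r" using y norm_star[of "y - b"] by (simp add: dist_norm)
     then show ?thesis using r(2) B_props(8)[of y] k(1) by (auto simp: T_def)
    qed
    then show ?thesis using r(1) by blast
   qed
  qed
 qed
 then have "closed T" by (simp add: closed_def)
 moreover have "a * b : T" if ab: "a : T" "b : T" for a b
 proof -
  have m: "a : B" "b : B" "star a : B" "star b : B" using ab B_props(8) by (auto simp: T_def)
  have "\<pi> (a * b) (e k) : M" if "k < n" for k
   unfolding \<pi>_mult[OF m(1,2)] by (rule M_inv[OF m(1)]) (use ab that in \<open>auto simp: T_def\<close>)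
  moreover have "\<pi> (star (a * b)) (e k) : M" if "k < n" for k
   unfolding star_mult \<pi>_mult[OF m(4,3)] by (rule M_inv[OF m(4)]) (use ab that in \<open>auto simp: T_def\<close>)
  ultimately show ?thesis using B_props(5)[OF m(1,2)] by (simp add: T_def)
 qed
 moreover have "1 : T" using eM by (simp add: T_def \<pi>_1 B_props(1))
 moreover have "a + b : T" if "a : T" "b : T" for a b
  using that B_props(3)[of a b] B_props(8) by (simp add: T_def \<pi>_add star_add M_add)
 moreover have "scaleC c a : T" if "a : T" for c a
  using that B_props(6)[of a c] B_props(8)[of a] by (simp add: T_def \<pi>_sc star_scaleC M_sc)
 moreover have "star a : T" if "a : T" for a
  using that B_props(8)[of a] by (simp add: T_def star_star)
 ultimately have T: "cstar_subalgebra T" by (simp add: cstar_subalgebra_def operator_system_def)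
 have "u : T"
 proof -
  have "\<pi> (star u) (e k) = scaleC (cnj (z * q ^ k)) (e k)" for k
  proof -
   have "cnj (z * q ^ k) * (z * q ^ k) = (z * cnj z) * (cnj q ^ k * q ^ k)" by simp
   then have c: "cnj (z * q ^ k) * (z * q ^ k) = 1" by (simp only: zz qq mult_1_left)
   have "e k = \<pi> (star u) (\<pi> u (e k))" using \<pi>_mult[OF sB(1) uv_B(1), of "e k"] by (simp add: u \<pi>_1)
   also have "... = scaleC (z * q ^ k) (\<pi> (star u) (e k))" by (simp only: ue \<pi>_scaleC[OF sB(1)])
   finally have "scaleC (cnj (z * q ^ k)) (e k) = scaleC (cnj (z * q ^ k)) (scaleC (z * q ^ k) (\<pi> (star u) (e k)))" by simp
   then show ?thesis by (simp only: scaleC_scaleC c scaleC_one)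
  qed
  then show ?thesis by (simp add: T_def uv_B ue M_sc eM)
 qed
 moreover have "v : T"
 proof -
  have en: "e n = scaleC \<mu> (e 0)" by (simp add: e_def \<mu>(2) \<pi>_1)
  have ve: "\<pi> v (e k) = e (Suc k)" for k by (simp add: e_def \<pi>_mult[OF uv_B(2) vB])
  have se: "\<pi> (star v) (e (Suc k)) = e k" for k
   unfolding ve[symmetric] using \<pi>_mult[OF sB(2) uv_B(2), of "e k"] by (simp add: v \<pi>_1)
  have "e (Suc k) : M" if "k < n" for k
   using that eM[of "Suc k"] en M_sc[OF eM[OF q_simps(1)]] by (cases "Suc k = n") auto
  moreover have "\<pi> (star v) (e k) : M" if k: "k < n" for k
  proof (cases k)
   case 0
   have "scaleC (cnj \<mu> * \<mu>) (\<pi> (star v) (e 0)) = scaleC (cnj \<mu>) (\<pi> (star v) (e n))"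
    unfolding en \<pi>_scaleC[OF sB(2)] scaleC_scaleC ..
   moreover have "\<pi> (star v) (e n) = e (n - 1)" using se[of "n - 1"] q_simps(1) by simp
   moreover have "cnj \<mu> * \<mu> = 1" using \<mu>(1) by (simp add: complex_norm_square[symmetric] mult.commute[of "cnj _"])
   ultimately have "\<pi> (star v) (e 0) = scaleC (cnj \<mu>) (e (n - 1))" by simp
   then show ?thesis using M_sc[OF eM[of "n - 1"]] q_simps(1) 0 by simp
  next
   case (Suc j)
   then show ?thesis using se[of j] eM[of j] k by simp
  qed
  ultimately show ?thesis by (simp add: T_def uv_B ve)
 qed
 ultimately have BT: "B <= T" by (rule B_least[OF T])
 have ne: "e 0 ~= 0" using on[OF q_simps(1) q_simps(1)] by auto
 have "x : M" for x
 proof (rule invariant_subspace[OF clM M_0 M_add M_sc _ eM[OF q_simps(1)] ne])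
  show "\<pi> a x : M" if "a : B" "x : M" for a x by (rule M_inv[OF that(1) _ that(2)]) (use BT that in \<open>auto simp: T_def\<close>)
 qed
 then have "x = (\<Sum>k<n. scaleC (cinner x (e k)) (e k))" for x by (simp add: M_def)
 then have "orthonormal_basis (map (%k. \<pi> (v ^ k) e0) [0..<n])"
  unfolding orthonormal_basis_def using on by (simp add: e_def)
 with e0 show ?thesis by (rule that)
qed

end

context irreducible_operator_rep
begin

text \<open>The orbit of the eigenvector of \<open>u\<close> provides the cyclic vector, and the eigenspaces of matrices in the
  commutant are closed invariant subspaces, which gives Schur's lemma.\<close>

theorem matrix_form_absolute_extreme:
 assumes es: "orthonormal_basis (es :: 'h list)"
 shows "restrict (%a. mat_of_op es (\<pi> a)) S : absolute_matrix_extreme_points S (length es)"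
proof -
 define d where "d = length es"
 define \<rho> where "\<rho> b = mat_of_op es (\<pi> b)" for b
 define \<kappa> where "\<kappa> h = vec d (%i. cinner h (es ! i))" for h
 define H where "H x = (\<Sum>i<d. scaleC (x $ i) (es ! i))" for x :: "complex vec"
 have on: "cinner (es ! i) (es ! j) = (if i = j then 1 else 0)" if "i < d" "j < d" for i j
  using es that by (auto simp: orthonormal_basis_def d_def)
 have ex: "x = (\<Sum>i<d. scaleC (cinner x (es ! i)) (es ! i))" for x using es unfolding orthonormal_basis_def d_def by blast
 have d: "0 < d"
 proof (rule ccontr)
  assume "\<not> 0 < d"
  then have "x = 0" for x :: 'h using ex[of x] by simp
  then show False using nontrivial by metis
 qed
 have \<kappa>c: "\<kappa> h : carrier_vec d" for h by (simp add: \<kappa>_def)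
 have \<rho>c: "\<rho> b : carrier_mat d d" for b by (simp add: \<rho>_def mat_of_op_def d_def)
 have \<rho>i: "\<rho> b $$ (i, j) = cinner (\<pi> b (es ! j)) (es ! i)" if "i < d" "j < d" for b i j
  using that by (simp add: \<rho>_def mat_of_op_def d_def)
 have \<kappa>H: "\<kappa> (H x) = x" if x: "x : carrier_vec d" for x
 proof (rule eq_vecI)
  fix i assume "i < dim_vec x"
  then have i: "i < d" using x by simp
  have "cinner (H x) (es ! i) = (\<Sum>j<d. if j = i then x $ i else 0)"
   unfolding H_def cinner_sum_left by (rule sum.cong[OF refl]) (use i in \<open>simp add: cinner_scaleC_left on\<close>)
  then show "\<kappa> (H x) $ i = x $ i" using i by (simp add: \<kappa>_def)
 qed (use x in \<open>simp add: \<kappa>_def\<close>)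
 have act: "\<rho> b *\<^sub>v \<kappa> h = \<kappa> (\<pi> b h)" if b: "b : B" for b h
 proof (rule eq_vecI)
  fix i assume "i < dim_vec (\<kappa> (\<pi> b h))"
  then have i: "i < d" by (simp add: \<kappa>_def)
  have "\<pi> b h = \<pi> b (\<Sum>j<d. scaleC (cinner h (es ! j)) (es ! j))" by (simp only: ex[symmetric])
  also have "... = (\<Sum>j<d. scaleC (cinner h (es ! j)) (\<pi> b (es ! j)))"
   by (simp add: linear_sum[OF bounded_linear.linear[OF bl[OF b]]] \<pi>_scaleC[OF b])
  finally have "cinner (\<pi> b h) (es ! i) = (\<Sum>j<d. cinner h (es ! j) * cinner (\<pi> b (es ! j)) (es ! i))"
   by (simp add: cinner_sum_left cinner_scaleC_left)
  moreover have "(\<rho> b *\<^sub>v \<kappa> h) $ i = (\<Sum>j<d. \<rho> b $$ (i, j) * cinner h (es ! j))"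
   using i \<rho>c[of b] by (simp add: scalar_prod_def atLeast0LessThan \<kappa>_def)
  ultimately show "(\<rho> b *\<^sub>v \<kappa> h) $ i = \<kappa> (\<pi> b h) $ i"
   using i by (simp add: \<rho>i \<kappa>_def mult.commute)
 qed (use \<rho>c[of b] in \<open>simp add: \<kappa>_def\<close>)
 have star: "star_representation_mat B d (restrict \<rho> B)"
  unfolding star_representation_mat_def
 proof (intro conjI ballI allI)
  show "restrict \<rho> B : B \<rightarrow>\<^sub>E carrier_mat d d" using \<rho>c by auto
  show "restrict \<rho> B 1 = 1\<^sub>m d" using B_props(1) \<rho>c[of 1] by (auto intro!: eq_matI simp: \<rho>i \<pi>_1 on)
  fix a assume a: "a : B"
  show "restrict \<rho> B (scaleC c a) = c \<cdot>\<^sub>m restrict \<rho> B a" for c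
   using a B_props(6)[OF a, of c] \<rho>c[of a] \<rho>c[of "scaleC c a"] by (auto intro!: eq_matI simp: \<rho>i \<pi>_sc cinner_scaleC_left)
  show "restrict \<rho> B (star a) = adj (restrict \<rho> B a)"
  proof (rule eq_matI)
   fix i j assume "i < dim_row (adj (restrict \<rho> B a))" "j < dim_col (adj (restrict \<rho> B a))"
   then have ij: "i < d" "j < d" using a \<rho>c[of a] by auto
   have "cinner (\<pi> (star a) (es ! j)) (es ! i) = cnj (cinner (\<pi> a (es ! i)) (es ! j))"
    by (simp only: \<pi>_star[OF a] cinner_commute[of "es ! j"])
   then show "restrict \<rho> B (star a) $$ (i, j) = adj (restrict \<rho> B a) $$ (i, j)"
    using ij a B_props(8)[OF a] \<rho>c[of a] by (simp add: \<rho>i)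
  qed (use a B_props(8)[OF a] \<rho>c[of a] \<rho>c[of "star a"] in auto)
  fix b assume b: "b : B"
  show "restrict \<rho> B (a + b) = restrict \<rho> B a + restrict \<rho> B b"
   using a b B_props(3)[OF a b] \<rho>c[of a] \<rho>c[of b] \<rho>c[of "a + b"] by (auto intro!: eq_matI simp: \<rho>i \<pi>_add cinner_add_left)
  have "\<rho> (a * b) = \<rho> a * \<rho> b"
  proof (rule mat_eq_vecI[OF \<rho>c mult_carrier_mat[OF \<rho>c \<rho>c]])
   fix x :: "complex vec" assume x: "x : carrier_vec d"
   have "\<rho> (a * b) *\<^sub>v \<kappa> (H x) = \<rho> a *\<^sub>v (\<rho> b *\<^sub>v \<kappa> (H x))"
    by (simp only: act a b B_props(5)[OF a b] \<pi>_mult)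
   then show "\<rho> (a * b) *\<^sub>v x = (\<rho> a * \<rho> b) *\<^sub>v x" using assoc_mult_mat_vec[OF \<rho>c \<rho>c x] by (simp only: \<kappa>H[OF x])
  qed
  then show "restrict \<rho> B (a * b) = restrict \<rho> B a * restrict \<rho> B b" using a b B_props(5)[OF a b] by simp
 qed
 obtain e where "cinner e e = 1" and ob: "orthonormal_basis (map (%k. \<pi> (v ^ k) e) [0..<n])" by (rule orbit_basis)
 have cyc: "\<exists>b\<in>B. \<xi> = restrict \<rho> B b *\<^sub>v \<kappa> e" if \<xi>: "\<xi> : carrier_vec d" for \<xi>
 proof -
  let ?L = "map (%k. \<pi> (v ^ k) e) [0..<n]" and ?h = "H \<xi>"
  have vB: "v ^ k : B" for k by (rule B_props(10)[OF uv_B(2)])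
  have "?h = (\<Sum>k<length ?L. scaleC (cinner ?h (?L ! k)) (?L ! k))" using ob unfolding orthonormal_basis_def by blast
  also have "... = (\<Sum>k<n. scaleC (cinner ?h (\<pi> (v ^ k) e)) (\<pi> (v ^ k) e))" by simp
  also have "... = \<pi> (\<Sum>k<n. scaleC (cinner ?h (\<pi> (v ^ k) e)) (v ^ k)) e"
   using \<pi>_sum[of "{..<n}" "%k. scaleC (cinner ?h (\<pi> (v ^ k) e)) (v ^ k)" e] B_props(6)[OF vB] by (simp add: \<pi>_sc[OF vB])
  finally have "\<exists>b\<in>B. ?h = \<pi> b e" using B_sum[of "{..<n}" "%k. scaleC (cinner ?h (\<pi> (v ^ k) e)) (v ^ k)"] B_props(6)[OF vB] by blast
  then obtain b where b: "b : B" "?h = \<pi> b e" by blast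
  have "\<xi> = \<rho> b *\<^sub>v \<kappa> e" unfolding act[OF b(1)] b(2)[symmetric] by (rule \<kappa>H[OF \<xi>, symmetric])
  then show ?thesis using b(1) by auto
 qed
 have schur: "EX c. A = c \<cdot>\<^sub>m 1\<^sub>m d" if A: "A : carrier_mat d d" and comm: "!!b. b : B ==> A * restrict \<rho> B b = restrict \<rho> B b * A" for A
 proof -
  obtain c where "eigenvalue A c" using spectrum_non_empty[OF A d] by (auto simp: spectrum_def)
  then obtain y where y: "y : carrier_vec d" "y ~= 0\<^sub>v d" "A *\<^sub>v y = c \<cdot>\<^sub>v y"
   using A by (auto simp: eigenvalue_def eigenvector_def)
  let ?E = "{h. A *\<^sub>v \<kappa> h = c \<cdot>\<^sub>v \<kappa> h}"
  have \<kappa>_add: "\<kappa> (g + h) = \<kappa> g + \<kappa> h" for g h by (intro eq_vecI) (auto simp: \<kappa>_def cinner_add_left)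
  have \<kappa>_sc: "\<kappa> (scaleC k h) = k \<cdot>\<^sub>v \<kappa> h" for k h by (intro eq_vecI) (auto simp: \<kappa>_def cinner_scaleC_left)
  have \<kappa>0: "\<kappa> 0 = 0\<^sub>v d" by (intro eq_vecI) (auto simp: \<kappa>_def)
  have E: "h : ?E" for h
  proof (rule invariant_subspace[of ?E "H y"])
   have "closed {h. (\<Sum>j<d. A $$ (i, j) * cinner h (es ! j)) = c * cinner h (es ! i)}" if i: "i < d" for i
   proof -
    have cont: "continuous_on UNIV (%h. cinner h (es ! j))" if "j < d" for j
     using bounded_linear.continuous_on[OF cinner_unit_bounded continuous_on_id] on[OF that that] by simp
    show ?thesis
     by (rule closed_Collect_eq) (use cont i in \<open>auto intro!: continuous_on_sum continuous_on_mult continuous_on_const\<close>)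
   qed
   then have "closed (\<Inter>i\<in>{..<d}. {h. (\<Sum>j<d. A $$ (i, j) * cinner h (es ! j)) = c * cinner h (es ! i)})"
    by (auto intro!: closed_INT)
   also have "(\<Inter>i\<in>{..<d}. {h. (\<Sum>j<d. A $$ (i, j) * cinner h (es ! j)) = c * cinner h (es ! i)}) = ?E"
   proof -
    have Ai: "(A *\<^sub>v \<kappa> h) $ i = (\<Sum>j<d. A $$ (i, j) * cinner h (es ! j))" if "i < d" for h i
     using that A by (simp add: scalar_prod_def atLeast0LessThan \<kappa>_def)
    have "A *\<^sub>v \<kappa> h = c \<cdot>\<^sub>v \<kappa> h \<longleftrightarrow> (ALL i<d. (A *\<^sub>v \<kappa> h) $ i = (c \<cdot>\<^sub>v \<kappa> h) $ i)" for h
     using A \<kappa>c[of h] by (intro iffI eq_vecI) auto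
    then show ?thesis using Ai by (auto simp: \<kappa>_def)
   qed
   finally show "closed ?E" .
   have "c \<cdot>\<^sub>v 0\<^sub>v d = (0\<^sub>v d :: complex vec)" by (intro eq_vecI) auto
   then show "0 : ?E" using mat_mult_zero_vec[OF A] by (simp add: \<kappa>0)
   show "g + h : ?E" if "g : ?E" "h : ?E" for g h
    using that mult_add_distrib_mat_vec[OF A \<kappa>c \<kappa>c, of g h] smult_add_distrib_vec[OF \<kappa>c \<kappa>c, of c g h] by (simp add: \<kappa>_add)
   show "scaleC k h : ?E" if "h : ?E" for k h
    using that mult_mat_vec[OF A \<kappa>c, of k h] by (simp add: \<kappa>_sc smult_smult_assoc mult.commute)
   show "\<pi> b h : ?E" if b: "b : B" and h: "h : ?E" for b h
   proof -
    have comm': "A * \<rho> b = \<rho> b * A" using comm[OF b] b by simp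
    have "A *\<^sub>v \<kappa> (\<pi> b h) = (A * \<rho> b) *\<^sub>v \<kappa> h"
     unfolding act[OF b, symmetric] by (rule assoc_mult_mat_vec[symmetric, OF A \<rho>c \<kappa>c])
    also have "... = \<rho> b *\<^sub>v (A *\<^sub>v \<kappa> h)" unfolding comm' by (rule assoc_mult_mat_vec[OF \<rho>c A \<kappa>c])
    also have "... = c \<cdot>\<^sub>v \<kappa> (\<pi> b h)" using h mult_mat_vec[OF \<rho>c \<kappa>c] by (simp add: act[OF b])
    finally show ?thesis by simp
   qed
   show "H y : ?E" using y by (simp add: \<kappa>H)
   show "H y ~= 0" using y \<kappa>H[OF y(1)] \<kappa>0 by auto
  qed
  have "A = c \<cdot>\<^sub>m 1\<^sub>m d"
  proof (rule mat_eq_vecI[OF A])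
   fix x :: "complex vec" assume x: "x : carrier_vec d"
   have "A *\<^sub>v x = c \<cdot>\<^sub>v x" using E[of "H x"] by (simp add: \<kappa>H[OF x])
   then show "A *\<^sub>v x = (c \<cdot>\<^sub>m 1\<^sub>m d) *\<^sub>v x" using x by (auto intro!: eq_vecI)
  qed simp
  then show ?thesis by blast
 qed
 have "EX \<theta>. irrep d \<theta> & (\<forall>b\<in>B. \<theta> b = restrict \<rho> B b)"
 proof (rule irrep_of_star_rep[OF star d \<kappa>c[of e]])
  show "\<exists>b\<in>B. \<xi> = restrict \<rho> B b *\<^sub>v \<kappa> e" if "\<xi> : carrier_vec d" for \<xi> by (rule cyc[OF that])
  show "EX c. A = c \<cdot>\<^sub>m 1\<^sub>m d" if "A : carrier_mat d d" "!!b. b : B ==> A * restrict \<rho> B b = restrict \<rho> B b * A" for A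
   by (rule schur[OF that])
  show "EX \<theta>. irrep d \<theta> & (\<forall>b\<in>B. \<theta> b = restrict \<rho> B b)" if "irrep d \<theta>" "!!b. b : B ==> \<theta> b = restrict \<rho> B b" for \<theta>
   using that by blast
 qed
 then obtain \<theta> where \<theta>: "irrep d \<theta>" "!!b. b : B ==> \<theta> b = restrict \<rho> B b" by blast
 have "restrict (%a. mat_of_op es (\<pi> a)) S = restrict \<theta> S"
  by (rule restrict_ext) (use \<theta>(2) S_B in \<open>auto simp: \<rho>_def\<close>)
 then show ?thesis using irrep_absolute_extreme[OF \<theta>(1)] by (simp add: d_def)
qed

end

section \<open>The classification\<close>

lemma conj_cancel:
 fixes U X :: "complex mat"
 assumes U: "unitary_mat d U" and X: "X : carrier_mat d d"
 shows "U * (adj U * X * U) * adj U = X"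
proof -
 let ?V = "adj U"
 have u: "U : carrier_mat d d" "?V : carrier_mat d d" "U * ?V = 1\<^sub>m d" using U by (simp_all add: unitary_mat_def)
 note as = assoc_mult_mat[of _ d d _ d _ d] and cr = mult_carrier_mat[of _ d d _ d]
 have "U * (?V * X * U) = U * (?V * X) * U" by (rule as[symmetric, OF u(1) cr[OF u(2) X] u(1)])
 also have "U * (?V * X) = U * ?V * X" by (rule as[symmetric, OF u(1,2) X])
 also have "... = X" using X by (simp add: u(3))
 finally have "U * (?V * X * U) * ?V = X * U * ?V" by simp
 also have "... = X * (U * ?V)" by (rule as[OF X u(1,2)])
 finally show ?thesis using X by (simp add: u(3))
qed

context rotation_pair
begin

text \<open>A direct sum of two maps is never irreducible: the projection onto the first summand commutes with
  it.\<close>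

lemma irrep_indecomposable:
 assumes \<theta>: "irrep (d + k) \<theta>" and W: "unitary_mat (d + k) W" and d: "0 < d" "0 < k"
  and \<phi>: "!!x. x : S ==> \<phi> x : carrier_mat d d" "!!x. x : S ==> \<rho> x : carrier_mat k k"
  and eq: "!!x. x : S ==> \<theta> x = adj W * diag_block_mat [\<phi> x, \<rho> x] * W"
 shows False
proof -
 note P = irrepD[OF \<theta>] and C = cp_carrier[OF irrepD(2)[OF \<theta>]]
 let ?P = "four_block_mat (1\<^sub>m d) (0\<^sub>m d k) (0\<^sub>m k d) (0\<^sub>m k k) :: complex mat"
 let ?A = "adj W * ?P * W"
 have w: "W : carrier_mat (d + k) (d + k)" "adj W : carrier_mat (d + k) (d + k)" using W by (simp_all add: unitary_mat_def)
 have Pc: "?P : carrier_mat (d + k) (d + k)" by (rule four_block_carrier_mat) simp_all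
 have Ps: "adj ?P = ?P" by (rule eq_matI) auto
 have Ac: "?A : carrier_mat (d + k) (d + k)" by (rule conj_carrier[OF Pc w(1)])
 have As: "adj ?A = ?A"
  using adjoint_mult[OF mult_carrier_mat[OF w(2) Pc] w(1)] adjoint_mult[OF w(2) Pc] assoc_mult_mat[OF w(2) Pc w(1)] Ps by simp
 have comm: "?A * \<theta> x = \<theta> x * ?A" if x: "x : S" for x
 proof -
  note c = \<phi>(1)[OF x] \<phi>(2)[OF x]
  let ?D = "four_block_mat (\<phi> x) (0\<^sub>m d k) (0\<^sub>m k d) (\<rho> x)"
  have D: "diag_block_mat [\<phi> x, \<rho> x] = ?D"
   using c carrier_matD[OF c(1)] carrier_matD[OF c(2)]
   by (simp add: diag_block_mat.simps(2)[of "\<phi> x" "[\<rho> x]"] Let_def del: diag_block_mat.simps)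
  have Dc: "?D : carrier_mat (d + k) (d + k)" by (rule four_block_carrier_mat[OF c])
  have "?P * ?D = four_block_mat (\<phi> x) (0\<^sub>m d k) (0\<^sub>m k d) (0\<^sub>m k k)"
   by (subst mult_four_block_mat[of _ d d _ k _ k _ _ d _ k]) (use c in \<open>simp_all\<close>)
  moreover have "?D * ?P = four_block_mat (\<phi> x) (0\<^sub>m d k) (0\<^sub>m k d) (0\<^sub>m k k)"
   by (subst mult_four_block_mat[of _ d d _ k _ k _ _ d _ k]) (use c in \<open>simp_all\<close>)
  ultimately have PD: "?P * ?D = ?D * ?P" by simp
  have D': "W * \<theta> x * adj W = ?D" unfolding eq[OF x] D by (rule conj_cancel[OF W Dc])
  show ?thesis
   using conj_commute[OF unitary_adjoint[OF W] C Pc, of x] PD by (simp add: D')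
 qed
 obtain c where c: "?A = c \<cdot>\<^sub>m 1\<^sub>m (d + k)" using P(6)[OF Ac As comm[OF uv_S(1)] comm[OF uv_S(2)]] by blast
 have "?P = W * (c \<cdot>\<^sub>m 1\<^sub>m (d + k)) * adj W" unfolding c[symmetric] by (rule conj_cancel[OF W Pc, symmetric])
 also have "... = c \<cdot>\<^sub>m 1\<^sub>m (d + k)"
  using mult_smult_distrib[OF w(1) one_carrier_mat] mult_smult_assoc_mat[OF w] right_mult_one_mat[OF w(1)] W
  by (simp add: unitary_mat_def)
 finally have P': "?P = c \<cdot>\<^sub>m 1\<^sub>m (d + k)" .
 have "c = 1" using arg_cong[OF P', of "%A. A $$ (0, 0)"] d by simp
 moreover have "c = 0" using arg_cong[OF P', of "%A. A $$ (d, d)"] d by simp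
 ultimately show False by simp
qed

text \<open>At a lower level, absolute extremality would make a standard representation a direct sum.\<close>

lemma absolute_extreme_level:
 assumes \<phi>: "\<phi> : absolute_matrix_extreme_points S d"
 shows "d = n"
proof (rule ccontr)
 assume dn: "d ~= n"
 have ext: "\<phi> : matrix_extreme_points S d" using \<phi> absolute_extreme_is_extreme by blast
 have ucp: "\<phi> : ucp S d" using ext by (simp add: matrix_extreme_points_def)
 have less: "d < n" using matrix_extreme_level[OF ext] dn by simp
 obtain \<pi> \<delta> where \<pi>: "standard_rep \<pi>" and \<delta>: "\<delta> : carrier_mat n d" "adj \<delta> * \<delta> = 1\<^sub>m d"
  and eq: "!!x. x : S ==> \<phi> x = adj \<delta> * \<pi> x * \<delta>"
  by (rule extreme_point_is_compression[OF ext]; (assumption | (rule that; (assumption | simp))))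
 note irr = standard_irrep[OF \<pi>]
 note P = irrepD[OF irr] and C = cp_carrier[OF irrepD(2)[OF irr]]
 have cc: "matrix_convex_combination S d \<phi> (Suc 0) (%_. n) (%_. restrict \<pi> S) (%_. \<delta>)"
  unfolding matrix_convex_combination_def
  using cp_map_restrict_ucp[OF P(2,3,1) S_os] \<delta> eq mat_sum_one[OF mult_carrier_mat[OF adjoint_carrier[OF \<delta>(1)] \<delta>(1)]]
   mat_sum_one[OF conj_carrier[OF C \<delta>(1)]] by simp
 have "\<delta> ~= 0\<^sub>m n d"
 proof
  assume "\<delta> = 0\<^sub>m n d"
  then have "adj \<delta> * \<delta> = 0\<^sub>m d d" using right_mult_zero_mat[OF adjoint_carrier[OF \<delta>(1)]] by simp
  then have "(0\<^sub>m d d :: complex mat) $$ (0, 0) = 1\<^sub>m d $$ (0, 0)" using \<delta>(2) by simp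
  then show False using ucpD(1)[OF ucp] by simp
 qed
 then obtain \<rho> where \<rho>: "\<rho> : ucp S (n - d)" "unitarily_equivalent S n (restrict \<pi> S) (%x. diag_block_mat [\<phi> x, \<rho> x])"
  using \<phi> cc less unfolding absolute_matrix_extreme_points_def by blast
 then obtain W where W: "unitary_mat n W" "!!x. x : S ==> \<pi> x = adj W * diag_block_mat [\<phi> x, \<rho> x] * W"
  by (auto simp: unitarily_equivalent_def)
 have dk: "d + (n - d) = n" using less by simp
 show False
  by (rule irrep_indecomposable[of d "n - d" \<pi> W \<phi> \<rho>])
   (use irr W dk ucpD(1,3)[OF ucp] ucpD(3)[OF \<rho>(1)] less in simp_all)
qed

lemma extreme_point_is_boundary:
 assumes \<phi>: "\<phi> : matrix_extreme_points S n"
 shows "\<phi> : absolute_matrix_extreme_points S n & (EX \<pi>. boundary_representation_mat S n \<pi> & \<phi> = restrict \<pi> S)"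
proof -
 have ucp: "\<phi> : ucp S n" using \<phi> by (simp add: matrix_extreme_points_def)
 obtain \<pi> \<delta> where \<pi>: "standard_rep \<pi>" and \<delta>: "\<delta> : carrier_mat n n" "adj \<delta> * \<delta> = 1\<^sub>m n"
  and eq: "!!x. x : S ==> \<phi> x = adj \<delta> * \<pi> x * \<delta>"
  by (rule extreme_point_is_compression[OF \<phi>]; (assumption | (rule that; (assumption | simp))))
 have U: "unitary_mat n \<delta>" by (rule unitary_of_isometry[OF \<delta>])
 let ?\<theta> = "%x. adj \<delta> * \<pi> x * \<delta>"
 have irr: "irrep n ?\<theta>" by (rule irrep_conj[OF standard_irrep[OF \<pi>] U])
 note P = irrepD[OF irr]
 have "irreducible_mat B n ?\<theta>"
  by (rule irreducible_conj[OF cp_carrier[OF irrepD(2)[OF standard_irrep[OF \<pi>]]] standard_irreducible[OF \<pi>] U])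
 then have b: "boundary_representation_mat S n (restrict ?\<theta> B)" by (rule irreducible_boundary[OF P(2,3,1,4,5)])
 have "\<phi> = restrict ?\<theta> S" by (rule extensionalityI[of _ S]) (use ucpD(2)[OF ucp] eq in auto)
 moreover have "restrict (restrict ?\<theta> B) S = restrict ?\<theta> S" using S_B by (simp add: Int_absorb1)
 ultimately show ?thesis using b irrep_absolute_extreme[OF irr] by metis
qed

end

theorem theorem5p3:
  fixes k n :: nat and q :: complex
    and u v :: "'a::unital_cstar_algebra" and S :: "'a set"
  assumes "0 < n" and "coprime k n"
    and "q = exp (2 * complex_of_real pi * \<i> * of_nat k / of_nat n)"
    and "unitary_element u" and "unitary_element v"
    and "u * v = scaleC q (v * u)"
    and "S = generated_operator_system {u, v}"
  shows "subhomogeneous S n \<and>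
      (matrix_extreme_points S n = Abex S \<and>
       Abex S = {restrict \<pi> S | \<pi> d. boundary_representation_mat S d \<pi>} \<and>
       (\<forall>\<pi> :: 'a \<Rightarrow> 'h::complex_hilbert_space \<Rightarrow> 'h. boundary_representation_op S \<pi> \<longrightarrow>
           (\<exists>es :: 'h list. orthonormal_basis es) \<and>
           (\<forall>es :: 'h list. orthonormal_basis es \<longrightarrow>
              restrict (\<lambda>a. mat_of_op es (\<pi> a)) S \<in> Abex S))) \<and>
      (\<forall>m. 1 \<le> m \<and> m < n \<longrightarrow>
           matrix_extreme_points S m \<noteq> {} \<and>
           (\<forall>\<phi> \<in> matrix_extreme_points S m.
              (\<exists>\<psi> \<in> matrix_extreme_points S (m + 1). \<exists>\<gamma> \<in> carrier_mat (m + 1) m.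
                 \<forall>x\<in>S. \<phi> x = mat_adjoint \<gamma> * \<psi> x * \<gamma>) \<or>
              (\<exists>d. \<exists>\<psi> \<in> absolute_matrix_extreme_points S d. \<exists>\<gamma> \<in> carrier_mat d m.
                 \<forall>x\<in>S. \<phi> x = mat_adjoint \<gamma> * \<psi> x * \<gamma>)))"
proof -
 have prim: "primitive_root n q" unfolding assms(3) by (rule primitive_root_exists[OF assms(1,2)])
 interpret rotation_pair u v q n
  by unfold_locales (use assms(4-6) prim in \<open>simp_all add: unitary_element_def\<close>)
 note S = assms(7)
 obtain \<pi>0 where \<pi>0: "standard_rep \<pi>0" by (rule standard_rep_exists)
 have abs: "Abex S = absolute_matrix_extreme_points S n"
  unfolding Abex_def S using absolute_extreme_level by blast
 have extr: "matrix_extreme_points S n = Abex S"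
  unfolding abs using absolute_extreme_is_extreme extreme_point_is_boundary by (auto simp: S)
 have "Abex S <= {restrict \<pi> S | \<pi> d. boundary_representation_mat S d \<pi>}"
  unfolding extr[symmetric] using extreme_point_is_boundary by (force simp: S)
 moreover have "{restrict \<pi> S | \<pi> d. boundary_representation_mat S d \<pi>} <= Abex S"
  unfolding Abex_def using boundary_absolute_extreme by (auto simp: S)
 ultimately have bd: "Abex S = {restrict \<pi> S | \<pi> d. boundary_representation_mat S d \<pi>}" by (rule equalityI)
 have op: "(EX es :: 'h list. orthonormal_basis es) \<and>
   (ALL es :: 'h list. orthonormal_basis es --> restrict (%a. mat_of_op es (\<pi> a)) S : Abex S)"
  if "boundary_representation_op S \<pi>" for \<pi> :: "'a => 'h => 'h"
 proof -
  interpret irreducible_operator_rep u v q n \<pi>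
   by unfold_locales (use that in \<open>simp_all add: boundary_representation_op_def S\<close>)
  have "EX es :: 'h list. orthonormal_basis es" by (rule orbit_basis, rule exI)
  then show ?thesis using matrix_form_absolute_extreme unfolding Abex_def S by blast
 qed
 have "restrict \<pi>0 S : absolute_matrix_extreme_points S n"
  unfolding S by (rule irrep_absolute_extreme[OF standard_irrep[OF \<pi>0]])
 then have "matrix_extreme_points S n ~= {}" unfolding extr abs by blast
 moreover have "matrix_extreme_points S m = {}" if "n < m" for m
  using matrix_extreme_level[of _ m] that by (fastforce simp: S)
 ultimately have sub: "subhomogeneous S n"
  unfolding subhomogeneous_def using assms(1) by (meson not_le)
 have low: "matrix_extreme_points S m ~= {} & (\<forall>\<phi> \<in> matrix_extreme_points S m.
   EX d. \<exists>\<psi> \<in> absolute_matrix_extreme_points S d. \<exists>\<gamma> \<in> carrier_mat d m. \<forall>x\<in>S. \<phi> x = adj \<gamma> * \<psi> x * \<gamma>)"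
  if m: "1 <= m" "m < n" for m
 proof (intro conjI ballI)
  show "matrix_extreme_points S m ~= {}" unfolding S by (rule compression_extreme[OF \<pi>0]) (use m in simp_all)
  fix \<phi> assume \<phi>: "\<phi> : matrix_extreme_points S m"
  show "EX d. \<exists>\<psi> \<in> absolute_matrix_extreme_points S d. \<exists>\<gamma> \<in> carrier_mat d m. \<forall>x\<in>S. \<phi> x = adj \<gamma> * \<psi> x * \<gamma>"
  proof (rule extreme_point_is_compression[OF \<phi>[unfolded S]])
   fix \<pi> \<delta> assume \<pi>: "standard_rep \<pi>" and \<delta>: "\<delta> : carrier_mat n m"
    and eq: "!!x. x : generated_operator_system {u, v} ==> \<phi> x = adj \<delta> * \<pi> x * \<delta>"
   have "restrict \<pi> S : absolute_matrix_extreme_points S n"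
    unfolding S by (rule irrep_absolute_extreme[OF standard_irrep[OF \<pi>]])
   moreover have "\<forall>x\<in>S. \<phi> x = adj \<delta> * restrict \<pi> S x * \<delta>" using eq by (simp add: S)
   ultimately show ?thesis using \<delta> by blast
  qed
 qed
 show ?thesis using sub extr bd op low by blast
qed

end
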